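(* Let $R=Q/I$ be a standard graded $k$-algebra presented as in the context. If $R$ is Koszul and $\operatorname{rank}_k R_1\leq 3$, then \[ \beta_i^Q(R)\leq\binom{\beta_1^Q(R)}{i}\quad\text{for each } i . \]
   Context: $k$ is a field and $R=\bigoplus_{i\geq 0}R_i$ is a commutative standard graded finitely generated $k$-algebra (generated by $R_1$, with $\operatorname{rank}_kR_1<\infty$). $Q$ is the symmetric $k$-algebra on $R_1$, $Q\to R$ the canonical surjection, and $I=\operatorname{Ker}(Q\to R)\subseteq Q_{\geq 2}$. The Betti numbers are $\beta_i^Q(R)=\operatorname{rank}_k\operatorname{Tor}_i^Q(k,R)$; $\beta_1^Q(R)$ is the minimal number of generators of $I$. The algebra $R$ is Koszul if $\operatorname{Tor}_i^R(k,k)_j=0$ whenever $i\neq j$. *)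

theory Defs
  imports Complex_Main "HOL-Library.Poly_Mapping" "HOL-Library.Countable_Set"
    "HOL-Library.Function_Algebras"
begin

section \<open>Standard graded algebras and graded modules\<close>

text \<open>
  Graded objects are internal: an algebra lives in an ambient commutative ring, a module in an
  ambient abelian group, and the family \<open>gr\<close> (resp. \<open>mgr\<close>) of homogeneous components determines
  the underlying set, namely the sum of the components.
\<close>

record ('k, 'a) galgebra =
  smul :: "'k \<Rightarrow> 'a \<Rightarrow> 'a"
  gr :: "nat \<Rightarrow> 'a set"

record ('a, 'm) gmodule =
  act :: "'a \<Rightarrow> 'm \<Rightarrow> 'm"
  mgr :: "nat \<Rightarrow> 'm set"

definition gsum :: "(nat \<Rightarrow> 'a::comm_monoid_add set) \<Rightarrow> 'a set"
  where "gsum G = {\<Sum>i\<le>n. f i | n f. \<forall>i. f i \<in> G i}"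

locale standard_graded_algebra = vector_space "smul A"
  for A :: "('k::field, 'a::comm_ring_1) galgebra" +
  assumes smul_mult: "smul A c (x * y) = smul A c x * y"
    and subspace_gr: "subspace (gr A d)"
    and gr_direct: "\<lbrakk>\<forall>i. f i \<in> gr A i; (\<Sum>i\<le>n. f i) = 0; i \<le> n\<rbrakk> \<Longrightarrow> f i = 0"
    and gr_0: "gr A 0 = range (\<lambda>c. smul A c 1)"
    and gr_mult: "\<lbrakk>x \<in> gr A d; y \<in> gr A e\<rbrakk> \<Longrightarrow> x * y \<in> gr A (d + e)"
    and gr_1_finite: "\<exists>B. finite B \<and> gr A 1 = span B"
    and generated: "\<lbrakk>subspace S; 1 \<in> S; \<And>x y. \<lbrakk>x \<in> S; y \<in> S\<rbrakk> \<Longrightarrow> x * y \<in> S; gr A 1 \<subseteq> S\<rbrakk>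
                      \<Longrightarrow> gr A d \<subseteq> S"

text \<open>The augmentation \<open>A \<rightarrow> A / A\<^sub>+ = k\<close>, where \<open>A\<^sub>+\<close> is the sum of the components of
  positive degree, and the graded \<open>A\<close>-module \<open>k\<close> it defines.\<close>

definition residue :: "('k, 'a::comm_ring_1) galgebra \<Rightarrow> 'a \<Rightarrow> 'k"
  where "residue A a = (THE c. a - smul A c 1 \<in> gsum (\<lambda>d. if d = 0 then {0} else gr A d))"

definition residue_field :: "('k::field, 'a::comm_ring_1) galgebra \<Rightarrow> ('a, 'k) gmodule"
  where "residue_field A =
    \<lparr>act = (\<lambda>a c. residue A a * c), mgr = (\<lambda>d. if d = 0 then UNIV else {0})\<rparr>"

section \<open>Graded free resolutions and Tor\<close>

text \<open>
  A complex of graded free modules is given by homogeneous bases, indexed by sets of natural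
  numbers (so the modules have countable rank), the degrees of the basis elements, and the images
  of the basis elements: \<open>bd i b\<close> is the coordinate vector of the image of the basis element \<open>b\<close>
  of the module in position \<open>i + 1\<close>, and \<open>aug b\<close> the image in the resolved module of the basis
  element \<open>b\<close> of the module in position \<open>0\<close>.
\<close>

record ('a, 'm) gcomplex =
  gens :: "nat \<Rightarrow> nat set"
  gdeg :: "nat \<Rightarrow> nat \<Rightarrow> nat"
  bd :: "nat \<Rightarrow> nat \<Rightarrow> nat \<Rightarrow> 'a"
  aug :: "nat \<Rightarrow> 'm"

definition finfam :: "'m::zero set \<Rightarrow> nat set \<Rightarrow> (nat \<Rightarrow> 'm) set"
  where "finfam M B = {f. finite {b. f b \<noteq> 0} \<and> (\<forall>b. f b \<noteq> 0 \<longrightarrow> b \<in> B) \<and> (\<forall>b. f b \<in> M)}"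

text \<open>For a matrix \<open>D\<close> over \<open>A\<close>, the map it induces from \<open>N \<otimes> A\<^bsup>(B)\<^esup> = N\<^bsup>(B)\<^esup>\<close> to
  \<open>N \<otimes> A\<^bsup>(B')\<^esup> = N\<^bsup>(B')\<^esup>\<close>.\<close>

definition matmap ::
  "('a \<Rightarrow> 'm \<Rightarrow> 'm::comm_monoid_add) \<Rightarrow> (nat \<Rightarrow> nat \<Rightarrow> 'a) \<Rightarrow> (nat \<Rightarrow> 'm) \<Rightarrow> nat \<Rightarrow> 'm"
  where "matmap a D f = (\<lambda>b'. \<Sum>b | f b \<noteq> 0. a (D b b') (f b))"

definition augmap ::
  "('a::zero \<Rightarrow> 'm \<Rightarrow> 'm::comm_monoid_add) \<Rightarrow> (nat \<Rightarrow> 'm) \<Rightarrow> (nat \<Rightarrow> 'a) \<Rightarrow> 'm"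
  where "augmap a e f = (\<Sum>b | f b \<noteq> 0. a (f b) (e b))"

definition shift :: "(nat \<Rightarrow> 'm::zero set) \<Rightarrow> nat \<Rightarrow> nat \<Rightarrow> 'm set"
  where "shift G d j = (if d \<le> j then G (j - d) else {0})"

definition graded_free_resolution ::
  "('k, 'a::comm_ring_1) galgebra \<Rightarrow> ('a, 'm::ab_group_add) gmodule \<Rightarrow> ('a, 'm) gcomplex \<Rightarrow> bool"
  where "graded_free_resolution A M F \<longleftrightarrow>
    (\<forall>b \<in> gens F 0. aug F b \<in> mgr M (gdeg F 0 b)) \<and>
    (\<forall>i. \<forall>b \<in> gens F (Suc i). bd F i b \<in> finfam (gsum (gr A)) (gens F i) \<and>
       (\<forall>b'. bd F i b b' \<in> shift (gr A) (gdeg F i b') (gdeg F (Suc i) b))) \<and>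
    augmap (act M) (aug F) ` finfam (gsum (gr A)) (gens F 0) = gsum (mgr M) \<and>
    matmap (*) (bd F 0) ` finfam (gsum (gr A)) (gens F 1) =
      {f \<in> finfam (gsum (gr A)) (gens F 0). augmap (act M) (aug F) f = 0} \<and>
    (\<forall>i. matmap (*) (bd F (Suc i)) ` finfam (gsum (gr A)) (gens F (Suc (Suc i))) =
      {f \<in> finfam (gsum (gr A)) (gens F (Suc i)). matmap (*) (bd F i) f = 0})"

definition resolution ::
  "('k, 'a::comm_ring_1) galgebra \<Rightarrow> ('a, 'm::ab_group_add) gmodule \<Rightarrow> ('a, 'm) gcomplex"
  where "resolution A M = (SOME F. graded_free_resolution A M F)"

text \<open>\<open>Tor\<^sub>i(M, N)\<close> is the quotient of \<open>tor_cycles A M N i\<close> by \<open>tor_boundaries A M N i\<close>, the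
  homology of \<open>F \<otimes> N\<close> for a graded free resolution \<open>F\<close> of \<open>M\<close>. Existence of a resolution is proved
  below for the case \<open>M = k\<close>, the only one that is used.\<close>

definition tor_chains ::
  "('k, 'a::comm_ring_1) galgebra \<Rightarrow> ('a, 'm::ab_group_add) gmodule \<Rightarrow>
   ('a, 'n::ab_group_add) gmodule \<Rightarrow> nat \<Rightarrow> (nat \<Rightarrow> 'n) set"
  where "tor_chains A M N i = finfam (gsum (mgr N)) (gens (resolution A M) i)"

definition tor_boundaries ::
  "('k, 'a::comm_ring_1) galgebra \<Rightarrow> ('a, 'm::ab_group_add) gmodule \<Rightarrow>
   ('a, 'n::ab_group_add) gmodule \<Rightarrow> nat \<Rightarrow> (nat \<Rightarrow> 'n) set"
  where "tor_boundaries A M N i =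
    matmap (act N) (bd (resolution A M) i) ` tor_chains A M N (Suc i)"

fun tor_cycles ::
  "('k, 'a::comm_ring_1) galgebra \<Rightarrow> ('a, 'm::ab_group_add) gmodule \<Rightarrow>
   ('a, 'n::ab_group_add) gmodule \<Rightarrow> nat \<Rightarrow> (nat \<Rightarrow> 'n) set"
  where
    "tor_cycles A M N 0 = tor_chains A M N 0"
  | "tor_cycles A M N (Suc i) =
      {f \<in> tor_chains A M N (Suc i). matmap (act N) (bd (resolution A M) i) f = 0}"

definition tor_degree ::
  "('k, 'a::comm_ring_1) galgebra \<Rightarrow> ('a, 'm::ab_group_add) gmodule \<Rightarrow>
   ('a, 'n::ab_group_add) gmodule \<Rightarrow> nat \<Rightarrow> nat \<Rightarrow> (nat \<Rightarrow> 'n) set"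
  where "tor_degree A M N i j =
    {f \<in> tor_chains A M N i. \<forall>b. f b \<in> shift (mgr N) (gdeg (resolution A M) i b) j}"

definition tor_component_zero ::
  "('k, 'a::comm_ring_1) galgebra \<Rightarrow> ('a, 'm::ab_group_add) gmodule \<Rightarrow>
   ('a, 'n::ab_group_add) gmodule \<Rightarrow> nat \<Rightarrow> nat \<Rightarrow> bool"
  where "tor_component_zero A M N i j \<longleftrightarrow>
    tor_cycles A M N i \<inter> tor_degree A M N i j \<subseteq> tor_boundaries A M N i"

text \<open>The dimension of \<open>V / W\<close>: the size of a set of representatives of a basis. The library's
  \<open>dim V - dim W\<close> would not do, as \<open>V\<close> and \<open>W\<close> may have infinite dimension.\<close>

definition quotient_dim ::
  "('k::field \<Rightarrow> 'v::ab_group_add \<Rightarrow> 'v) \<Rightarrow> 'v set \<Rightarrow> 'v set \<Rightarrow> nat"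
  where "quotient_dim s V W = (THE n. \<exists>S \<subseteq> V. finite S \<and> card S = n \<and>
    \<not> module.dependent s S \<and> module.span s S \<inter> module.span s W = {0} \<and>
    V \<subseteq> module.span s (S \<union> W))"

definition tor_rank ::
  "('k::field, 'a::comm_ring_1) galgebra \<Rightarrow> ('a, 'm::ab_group_add) gmodule \<Rightarrow>
   ('a, 'n::ab_group_add) gmodule \<Rightarrow> nat \<Rightarrow> nat"
  where "tor_rank A M N i =
    quotient_dim (\<lambda>c f b. act N (smul A c 1) (f b)) (tor_cycles A M N i) (tor_boundaries A M N i)"

definition koszul :: "('k::field, 'a::comm_ring_1) galgebra \<Rightarrow> bool"
  where "koszul A \<longleftrightarrow>
    (\<forall>i j. i \<noteq> j \<longrightarrow> tor_component_zero A (residue_field A) (residue_field A) i j)"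

section \<open>The symmetric algebra and Betti numbers\<close>

text \<open>If \<open>X\<close> is a basis of \<open>R\<^sub>1\<close>, the symmetric algebra of \<open>R\<^sub>1\<close> is the polynomial ring whose
  variables are the elements of \<open>X\<close>; it lives in the ring of polynomials with variables indexed by
  the whole type. Its canonical surjection to \<open>R\<close> sends each variable to itself.\<close>

definition sym_algebra :: "'r set \<Rightarrow> ('k::field, ('r \<Rightarrow>\<^sub>0 nat) \<Rightarrow>\<^sub>0 'k) galgebra"
  where "sym_algebra X =
    \<lparr>smul = (\<lambda>c p. Poly_Mapping.single 0 c * p),
     gr = (\<lambda>d. {p. \<forall>m \<in> Poly_Mapping.keys p. Poly_Mapping.keys m \<subseteq> X \<and>
                   (\<Sum>x \<in> Poly_Mapping.keys m. Poly_Mapping.lookup m x) = d})\<rparr>"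

definition sym_map ::
  "('k::field, 'r::comm_ring_1) galgebra \<Rightarrow> (('r \<Rightarrow>\<^sub>0 nat) \<Rightarrow>\<^sub>0 'k) \<Rightarrow> 'r"
  where "sym_map R p = (\<Sum>m \<in> Poly_Mapping.keys p.
    smul R (Poly_Mapping.lookup p m)
      (\<Prod>x \<in> Poly_Mapping.keys m. x ^ Poly_Mapping.lookup m x))"

definition sym_module ::
  "('k::field, 'r::comm_ring_1) galgebra \<Rightarrow> (('r \<Rightarrow>\<^sub>0 nat) \<Rightarrow>\<^sub>0 'k, 'r) gmodule"
  where "sym_module R = \<lparr>act = (\<lambda>p r. sym_map R p * r), mgr = gr R\<rparr>"

definition betti :: "('k::field, 'r::comm_ring_1) galgebra \<Rightarrow> 'r set \<Rightarrow> nat \<Rightarrow> nat"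
  where "betti R X i = tor_rank (sym_algebra X) (residue_field (sym_algebra X)) (sym_module R) i"

section \<open>Well-definedness\<close>

subsection \<open>Dimensions of quotients\<close>

context vector_space
begin

lemma independent_Un_direct:
  assumes "independent S" "independent T" "span S \<inter> span T = {0}"
  shows "independent (S \<union> T)"
proof -
  have 1: "a \<notin> span (S \<union> T - {a})"
    if S: "independent S" and ST: "span S \<inter> span T = {0}" and a: "a \<in> S" for S T a
  proof
    assume "a \<in> span (S \<union> T - {a})"
    also have "\<dots> \<subseteq> span ((S - {a}) \<union> T)" by (rule span_mono) blast
    finally obtain u v where uv: "a = u + v" "u \<in> span (S - {a})" "v \<in> span T"
      unfolding span_Un by blast
    have "u \<in> span S" using uv(2) span_mono[of "S - {a}" S] by blast
    then have "v \<in> span S" using span_diff[OF span_base[OF a], of u] uv(1) by simp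
    then have "a = u" using uv ST by auto
    then show False using S a uv(2) unfolding dependent_def by blast
  qed
  show ?thesis
    unfolding dependent_def
    using 1[OF assms(1,3)] 1[of T S] assms by (auto simp: Un_commute Int_commute)
qed

lemma quotient_basis_card_le:
  assumes S: "finite S" "V \<subseteq> span (S \<union> W)"
    and S': "S' \<subseteq> V" "finite S'" "independent S'" "span S' \<inter> span W = {0}"
  shows "card S' \<le> card S"
proof -
  have "\<exists>F. finite F \<and> F \<subseteq> W \<and> x \<in> span (S \<union> F)" if x: "x \<in> S'" for x
  proof -
    have "x \<in> span (S \<union> W)" using x S' S by blast
    then obtain F r where F: "finite F" "F \<subseteq> S \<union> W" "x = (\<Sum>a\<in>F. r a *s a)"
      unfolding span_explicit by blast
    have "x \<in> span F" unfolding F(3) by (auto intro: span_sum span_scale span_base)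
    then have "x \<in> span (S \<union> (F \<inter> W))" using F(2) span_mono[of F "S \<union> (F \<inter> W)"] by blast
    with F(1) show ?thesis by (intro exI[of _ "F \<inter> W"]) auto
  qed
  then obtain F where F: "\<And>x. x \<in> S' \<Longrightarrow> finite (F x) \<and> F x \<subseteq> W \<and> x \<in> span (S \<union> F x)" by metis
  define U where "U = (\<Union>x\<in>S'. F x)"
  have U: "finite U" "U \<subseteq> W" using F S'(2) unfolding U_def by blast+
  have "S' \<subseteq> span (S \<union> U)"
  proof
    fix x assume x: "x \<in> S'"
    then have "S \<union> F x \<subseteq> S \<union> U" unfolding U_def by blast
    then show "x \<in> span (S \<union> U)" using F[OF x] span_mono by blast
  qed
  obtain T where T: "T \<subseteq> U" "independent T" "U \<subseteq> span T"
    using maximal_independent_subset[of U] by blast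
  have fT: "finite T" using T U finite_subset by blast
  have "S \<union> U \<subseteq> span (S \<union> T)"
    using T(3) span_mono[of T "S \<union> T"] span_superset[of "S \<union> T"] by blast
  then have "S' \<subseteq> span (S \<union> T)"
    using \<open>S' \<subseteq> span (S \<union> U)\<close> span_minimal[OF _ subspace_span] by blast
  then have sub: "S' \<union> T \<subseteq> span (S \<union> T)" using span_superset[of "S \<union> T"] by blast
  have "span T \<subseteq> span W" using T U span_mono by blast
  then have int: "span S' \<inter> span T = {0}" using S'(4) span_zero by blast
  have ind: "independent (S' \<union> T)" using independent_Un_direct[OF S'(3) T(2) int] .
  have "x = 0" if "x \<in> S'" "x \<in> T" for x
    using that int span_base by blast
  then have "S' \<inter> T = {}" using T(2) dependent_zero by blast
  then have "card S' + card T = card (S' \<union> T)" using S'(2) fT by (simp add: card_Un_disjoint)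
  also have "\<dots> \<le> card (S \<union> T)"
    using independent_span_bound[OF _ ind sub] S(1) fT by simp
  also have "\<dots> \<le> card S + card T" by (rule card_Un_le)
  finally show ?thesis by simp
qed

lemma quotient_dim_eq:
  assumes "S \<subseteq> V" "finite S" "independent S" "span S \<inter> span W = {0}" "V \<subseteq> span (S \<union> W)"
  shows "quotient_dim scale V W = card S"
  unfolding quotient_dim_def
proof (rule the_equality)
  show "\<exists>S'\<subseteq>V. finite S' \<and> card S' = card S \<and> independent S' \<and> span S' \<inter> span W = {0} \<and>
      V \<subseteq> span (S' \<union> W)"
    using assms by blast
next
  fix n assume "\<exists>S'\<subseteq>V. finite S' \<and> card S' = n \<and> independent S' \<and> span S' \<inter> span W = {0} \<and>
      V \<subseteq> span (S' \<union> W)"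
  then obtain S' where S': "S' \<subseteq> V" "finite S'" "card S' = n" "independent S'"
      "span S' \<inter> span W = {0}" "V \<subseteq> span (S' \<union> W)" by (elim exE conjE)
  show "n = card S"
    using quotient_basis_card_le[OF assms(2,5) S'(1,2,4,5)]
      quotient_basis_card_le[OF S'(2,6) assms(1-4)] S'(3) by simp
qed

end

subsection \<open>Existence of graded free resolutions of the residue field\<close>

lemma finfam_iff:
  "f \<in> finfam M B \<longleftrightarrow> finite {b. f b \<noteq> 0} \<and> (\<forall>b. f b \<noteq> 0 \<longrightarrow> b \<in> B) \<and> (\<forall>b. f b \<in> M)"
  by (simp add: finfam_def)

lemma finite_support_add:
  fixes f g :: "nat \<Rightarrow> 'm::ab_group_add"
  assumes "finite {b. f b \<noteq> 0}" "finite {b. g b \<noteq> 0}"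
  shows "finite {b. f b + g b \<noteq> 0}"
  by (rule finite_subset[OF _ finite_UnI[OF assms]]) auto

lemma matmap_superset:
  fixes f :: "nat \<Rightarrow> 'a::comm_ring_1"
  assumes "finite S" "{b. f b \<noteq> 0} \<subseteq> S"
  shows "matmap (*) D f b' = (\<Sum>b\<in>S. D b b' * f b)"
  unfolding matmap_def using assms by (intro sum.mono_neutral_left) auto

lemma matmap_add:
  fixes f g :: "nat \<Rightarrow> 'a::comm_ring_1"
  assumes "finite {b. f b \<noteq> 0}" "finite {b. g b \<noteq> 0}"
  shows "matmap (*) D (f + g) = matmap (*) D f + matmap (*) D g"
proof
  fix b'
  let ?S = "{b. f b \<noteq> 0} \<union> {b. g b \<noteq> 0}"
  have S: "finite ?S" using assms by simp
  have "{b. f b + g b \<noteq> 0} \<subseteq> ?S" by auto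
  then show "matmap (*) D (f + g) b' = (matmap (*) D f + matmap (*) D g) b'"
    using matmap_superset[OF S, of f D b'] matmap_superset[OF S, of g D b']
      matmap_superset[OF S, of "f + g" D b']
    by (auto simp: sum.distrib distrib_left)
qed

context standard_graded_algebra
begin

abbreviation "car \<equiv> gsum (gr A)"

lemma gr_zero: "0 \<in> gr A d"
  using subspace_gr subspace_0 by blast

lemma gr_sum: "(\<And>i. i \<in> I \<Longrightarrow> f i \<in> gr A d) \<Longrightarrow> sum f I \<in> gr A d"
  by (rule subspace_sum[OF subspace_gr])

text \<open>The homogeneous components of an element.\<close>

definition decomp :: "'a \<Rightarrow> (nat \<Rightarrow> 'a) \<Rightarrow> bool"
  where "decomp a f \<longleftrightarrow> (\<forall>i. f i \<in> gr A i) \<and> (\<exists>n. (\<forall>i>n. f i = 0) \<and> a = (\<Sum>i\<le>n. f i))"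

lemma decomp_ge:
  assumes "\<forall>i>n. f i = (0::'a)" "n \<le> (m::nat)" shows "(\<Sum>i\<le>n. f i) = (\<Sum>i\<le>m. f i)"
  using assms by (intro sum.mono_neutral_left) (auto simp: not_le)

lemma decomp_ex: "a \<in> car \<Longrightarrow> \<exists>f. decomp a f"
proof -
  assume "a \<in> car"
  then obtain n f where f: "a = (\<Sum>i\<le>n. f i)" "\<forall>i. f i \<in> gr A i" by (auto simp: gsum_def)
  have "decomp a (\<lambda>i. if i \<le> n then f i else 0)"
    unfolding decomp_def using f gr_zero by (auto intro!: exI[of _ n])
  then show ?thesis by blast
qed

lemma decomp_common:
  assumes "decomp a f" "decomp b g"
  obtains n where "\<forall>i>n. f i = 0" "\<forall>i>n. g i = 0" "a = (\<Sum>i\<le>n. f i)" "b = (\<Sum>i\<le>n. g i)"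
proof -
  obtain n where n: "\<forall>i>n. f i = 0" "a = (\<Sum>i\<le>n. f i)" using assms by (auto simp: decomp_def)
  obtain m where m: "\<forall>i>m. g i = 0" "b = (\<Sum>i\<le>m. g i)" using assms by (auto simp: decomp_def)
  show ?thesis
    by (rule that[of "max n m"]) (use n m decomp_ge[of n f "max n m"] decomp_ge[of m g "max n m"] in auto)
qed

lemma decomp_unique: assumes "decomp a f" "decomp a g" shows "f = g"
proof
  fix i
  obtain n where n: "\<forall>i>n. f i = 0" "\<forall>i>n. g i = 0" "a = (\<Sum>i\<le>n. f i)" "a = (\<Sum>i\<le>n. g i)"
    using decomp_common[OF assms] by metis
  have 1: "\<forall>i. f i - g i \<in> gr A i"
    using assms by (auto simp: decomp_def intro: subspace_diff subspace_gr)
  have 2: "(\<Sum>i\<le>n. f i - g i) = 0" using n by (simp add: sum_subtractf)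
  show "f i = g i"
    using gr_direct[OF 1 2, of i] n by (cases "i \<le> n") auto
qed

lemma decomp_add: assumes "decomp a f" "decomp b g" shows "decomp (a + b) (f + g)"
proof -
  obtain n where n: "\<forall>i>n. f i = 0" "\<forall>i>n. g i = 0" "a = (\<Sum>i\<le>n. f i)" "b = (\<Sum>i\<le>n. g i)"
    using decomp_common[OF assms] by metis
  then show ?thesis using assms
    unfolding decomp_def by (auto simp: sum.distrib intro!: subspace_add subspace_gr exI[of _ n])
qed

lemma decomp_scale: "decomp a f \<Longrightarrow> decomp (smul A c a) (\<lambda>i. smul A c (f i))"
  unfolding decomp_def
  by (auto simp: scale_sum_right intro!: subspace_scale subspace_gr)

lemma decomp_gr: "a \<in> gr A d \<Longrightarrow> decomp a (\<lambda>i. if i = d then a else 0)"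
  unfolding decomp_def using gr_zero by (auto intro!: exI[of _ d])

lemma decomp_mult:
  assumes "x \<in> gr A d" "decomp a f"
  shows "decomp (x * a) (\<lambda>j. if d \<le> j then x * f (j - d) else 0)"
proof -
  obtain n where n: "\<forall>i>n. f i = 0" "a = (\<Sum>i\<le>n. f i)" using assms by (auto simp: decomp_def)
  have "(\<Sum>j\<le>d + n. if d \<le> j then x * f (j - d) else 0) = (\<Sum>j=d..d + n. x * f (j - d))"
    by (rule sum.mono_neutral_cong_right) auto
  also have "\<dots> = (\<Sum>j=0..n. x * f j)"
    using sum.shift_bounds_cl_nat_ivl[of "\<lambda>j. x * f (j - d)" 0 d n] by (simp add: add.commute)
  also have "\<dots> = x * a" using n by (simp add: sum_distrib_left atLeast0AtMost)
  finally have "x * a = (\<Sum>j\<le>d + n. if d \<le> j then x * f (j - d) else 0)" ..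
  moreover have "(if d \<le> j then x * f (j - d) else 0) \<in> gr A j" for j
    using gr_mult[OF assms(1), of "f (j - d)" "j - d"] assms(2) gr_zero by (auto simp: decomp_def)
  ultimately show ?thesis
    unfolding decomp_def using n(1) by (auto intro!: exI[of _ "d + n"])
qed

definition hc :: "'a \<Rightarrow> nat \<Rightarrow> 'a"
  where "hc a = (THE f. decomp a f)"

lemma hc_eq: "decomp a f \<Longrightarrow> hc a = f"
  unfolding hc_def using decomp_unique by blast

lemma hc_decomp: "a \<in> car \<Longrightarrow> decomp a (hc a)"
  using decomp_ex hc_eq by metis

lemma hc_gr: "a \<in> car \<Longrightarrow> hc a i \<in> gr A i"
  using hc_decomp by (auto simp: decomp_def)

lemma decomp_C: "decomp a f \<Longrightarrow> a \<in> car"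
  by (auto simp: decomp_def gsum_def)

lemma hc_add: "a \<in> car \<Longrightarrow> b \<in> car \<Longrightarrow> hc (a + b) = hc a + hc b"
  by (intro hc_eq decomp_add hc_decomp)

lemma hc_mult:
  "x \<in> gr A d \<Longrightarrow> a \<in> car \<Longrightarrow> hc (x * a) j = (if d \<le> j then x * hc a (j - d) else 0)"
  using hc_eq[OF decomp_mult[OF _ hc_decomp]] by (auto simp: fun_eq_iff)

lemma gr_C: "a \<in> gr A d \<Longrightarrow> a \<in> car"
  using decomp_gr decomp_C by blast

lemma zero_C: "0 \<in> car"
  using gr_C gr_zero by blast

lemma hc_zero: "hc 0 = (\<lambda>_. 0)"
  using hc_eq[OF decomp_gr[OF gr_zero]] by (metis (no_types, lifting) ext)

lemma subspace_C: "subspace car"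
  by (rule subspaceI) (use zero_C decomp_add decomp_scale decomp_C decomp_ex in metis)+

lemma sum_C: "(\<And>i. i \<in> I \<Longrightarrow> f i \<in> car) \<Longrightarrow> sum f I \<in> car"
  by (rule subspace_sum[OF subspace_C])

lemma mult_C: assumes "a \<in> car" "b \<in> car" shows "a * b \<in> car"
proof -
  obtain n f where f: "a = (\<Sum>i\<le>n. f i)" "\<forall>i. f i \<in> gr A i"
    using assms(1) by (auto simp: gsum_def)
  have "f i * b \<in> car" for i
    using decomp_C[OF decomp_mult[OF _ hc_decomp[OF assms(2)]]] f by blast
  then show ?thesis using f by (simp add: sum_distrib_right sum_C)
qed

lemma hc_sum: "(\<And>i. i \<in> I \<Longrightarrow> f i \<in> car) \<Longrightarrow> hc (sum f I) j = (\<Sum>i\<in>I. hc (f i) j)"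
proof (induction I rule: infinite_finite_induct)
  case (insert x F)
  then show ?case by (simp add: hc_add sum_C)
qed (auto simp: hc_zero)

lemma one_gr: "1 \<in> gr A 0"
  using gr_0 scale_one by (metis rangeI)

lemma one_C: "1 \<in> car"
  using one_gr gr_C by blast

text \<open>The algebra has countable dimension.\<close>

lemma gr_countable: "\<exists>S. countable S \<and> S \<subseteq> car \<and> (\<forall>d. gr A d \<subseteq> span S)"
proof -
  obtain B where B: "finite B" "gr A 1 = span B" using gr_1_finite by blast
  let ?S = "prod_list ` lists B"
  have "countable ?S" using B(1) by (simp add: countable_finite)
  have BC: "B \<subseteq> car" using B span_superset gr_C by blast
  have S_C: "?S \<subseteq> car"
  proof
    fix x assume "x \<in> ?S"
    then obtain xs where "xs \<in> lists B" and x: "x = prod_list xs" by blast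
    from this(1) have "prod_list xs \<in> car"
      by (induction xs) (use one_C mult_C BC in auto)
    then show "x \<in> car" using x by simp
  qed
  have mult: "x * y \<in> span ?S" if "x \<in> span ?S" "y \<in> span ?S" for x y
  proof -
    have 1: "u * y \<in> span ?S" if u: "u \<in> ?S" for u
      using \<open>y \<in> span ?S\<close>
    proof (induction rule: span_induct_alt)
      case base
      then show ?case by (simp add: span_zero)
    next
      case (step c v w)
      obtain us vs where "us \<in> lists B" "u = prod_list us" "vs \<in> lists B" "v = prod_list vs"
        using u step by blast
      then have "u * v \<in> ?S"
        by (intro image_eqI[of _ _ "us @ vs"]) auto
      moreover have "u * (smul A c v + w) = smul A c (u * v) + u * w"
        using smul_mult[of c v u] by (simp add: algebra_simps)
      ultimately show ?case using step by (metis span_add span_base span_scale)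
    qed
    from \<open>x \<in> span ?S\<close> show ?thesis
    proof (induction rule: span_induct_alt)
      case base
      then show ?case by (simp add: span_zero)
    next
      case (step c v w)
      then show ?case using 1[of v]
        by (simp add: smul_mult[symmetric] span_add span_scale distrib_right)
    qed
  qed
  have "gr A d \<subseteq> span ?S" for d
  proof (rule generated)
    show "1 \<in> span ?S" by (rule span_base) (auto intro!: image_eqI[of _ _ "[]"])
    have "B \<subseteq> ?S" by (auto intro!: image_eqI[of _ _ "[x]" for x])
    then show "gr A 1 \<subseteq> span ?S" using B span_mono by blast
  qed (use mult in auto)
  with \<open>countable ?S\<close> S_C show ?thesis by blast
qed

end

lemma (in vector_space) countable_subspace:
  assumes "countable S" "W \<subseteq> span S"
  obtains T where "countable T" "T \<subseteq> W" "W \<subseteq> span T"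
proof -
  obtain B where B: "B \<subseteq> W" "independent B" "W \<subseteq> span B"
    using maximal_independent_subset[of W] by blast
  have "B \<subseteq> (\<Union>F\<in>{F. finite F \<and> F \<subseteq> S}. B \<inter> span F)"
  proof
    fix x assume "x \<in> B"
    then have "x \<in> span S" using B assms by blast
    then obtain F r where "finite F" "F \<subseteq> S" "x = (\<Sum>a\<in>F. r a *s a)"
      unfolding span_explicit by blast
    then have "x \<in> span F" by (auto intro: span_sum span_scale span_base)
    with \<open>x \<in> B\<close> \<open>finite F\<close> \<open>F \<subseteq> S\<close> show "x \<in> (\<Union>F\<in>{F. finite F \<and> F \<subseteq> S}. B \<inter> span F)" by blast
  qed
  moreover have "finite (B \<inter> span F)" if "finite F" for F
    using independent_span_bound[OF that, of "B \<inter> span F"] B(2) independent_mono by blast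
  then have "countable (\<Union>F\<in>{F. finite F \<and> F \<subseteq> S}. B \<inter> span F)"
    using countable_Collect_finite_subset[OF assms(1)]
    by (intro countable_UN) (auto intro: countable_finite)
  ultimately have "countable B" using countable_subset by blast
  with B show ?thesis using that by blast
qed

context standard_graded_algebra
begin

abbreviation "vscale \<equiv> \<lambda>c (f :: nat \<Rightarrow> 'a) b. smul A c (f b)"

interpretation V: vector_space vscale
  by unfold_locales (auto simp: fun_eq_iff algebra_simps)

lemma C_span: assumes "\<forall>d. gr A d \<subseteq> span S" shows "car \<subseteq> span S"
  using assms by (auto simp: gsum_def intro!: span_sum)

lemma sum_fun_apply: "(sum g I) x = (\<Sum>i\<in>I. g i x)"
  for g :: "'i \<Rightarrow> 'x \<Rightarrow> 'y::comm_monoid_add"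
  by (induction I rule: infinite_finite_induct) auto

lemma finfam_countable: "\<exists>T. countable T \<and> finfam car B \<subseteq> V.span T"
proof -
  obtain S where S: "countable S" "\<forall>d. gr A d \<subseteq> span S" using gr_countable by blast
  let ?e = "\<lambda>(b::nat) x i. if i = b then x else (0::'a)"
  let ?T = "(\<lambda>(b, x). ?e b x) ` (UNIV \<times> S)"
  have "countable ?T" using S(1) by (intro countable_image countable_SIGMA) auto
  have e: "?e b x \<in> V.span ?T" if "x \<in> span S" for b x
    using that
  proof (induction rule: span_induct_alt)
    case base
    have "?e b 0 = 0" by auto
    then show ?case using V.span_zero by metis
  next
    case (step c x y)
    have "?e b x \<in> ?T" using step(1) by (intro image_eqI[of _ _ "(b, x)"]) auto
    then have "vscale c (?e b x) + ?e b y \<in> V.span ?T"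
      by (intro V.span_add V.span_scale V.span_base step(2))
    moreover have "vscale c (?e b x) + ?e b y = ?e b (smul A c x + y)" by auto
    ultimately show ?case by metis
  qed
  have "finfam car B \<subseteq> V.span ?T"
  proof
    fix f assume f: "f \<in> finfam car B"
    have fin: "finite {b. f b \<noteq> 0}" using f by (auto simp: finfam_iff)
    have "f = (\<Sum>b | f b \<noteq> 0. ?e b (f b))"
      using fin by (auto simp: fun_eq_iff sum_fun_apply sum.delta)
    moreover have "\<dots> \<in> V.span ?T"
      using f C_span[OF S(2)] by (intro V.span_sum e) (auto simp: finfam_iff)
    ultimately show "f \<in> V.span ?T" by simp
  qed
  with \<open>countable ?T\<close> show ?thesis by blast
qed

text \<open>The homogeneous component of degree \<open>j\<close> of an element of a graded free module.\<close>

definition proj :: "(nat \<Rightarrow> nat) \<Rightarrow> nat \<Rightarrow> (nat \<Rightarrow> 'a) \<Rightarrow> nat \<Rightarrow> 'a"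
  where "proj deg j f = (\<lambda>b. if deg b \<le> j then hc (f b) (j - deg b) else 0)"

definition graded_submodule :: "nat set \<Rightarrow> (nat \<Rightarrow> nat) \<Rightarrow> (nat \<Rightarrow> 'a) set \<Rightarrow> bool"
  where "graded_submodule B deg K \<longleftrightarrow> K \<subseteq> finfam car B \<and> V.subspace K \<and>
    (\<forall>f\<in>K. \<forall>a\<in>car. (\<lambda>b. f b * a) \<in> K) \<and> (\<forall>f\<in>K. \<forall>j. proj deg j f \<in> K)"

definition hom_gens :: "nat set \<Rightarrow> (nat \<Rightarrow> nat) \<Rightarrow> nat set \<Rightarrow> (nat \<Rightarrow> nat) \<Rightarrow>
    (nat \<Rightarrow> nat \<Rightarrow> 'a) \<Rightarrow> bool"
  where "hom_gens B deg B' deg' D \<longleftrightarrow>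
    (\<forall>b\<in>B'. D b \<in> finfam car B \<and> (\<forall>b'. D b b' \<in> shift (gr A) (deg b') (deg' b)))"

lemma proj_finfam: assumes "f \<in> finfam car B" shows "proj deg j f \<in> finfam car B"
proof -
  have "{b. proj deg j f b \<noteq> 0} \<subseteq> {b. f b \<noteq> 0}"
    by (auto simp: proj_def hc_zero split: if_splits)
  moreover have "proj deg j f b \<in> car" for b
    using assms gr_C[OF hc_gr[of "f b" "j - deg b"]] by (auto simp: proj_def finfam_iff zero_C)
  ultimately show ?thesis
    using assms unfolding finfam_iff by (auto intro: finite_subset)
qed

lemma proj_hom: "f \<in> finfam car B \<Longrightarrow> proj deg j f b \<in> shift (gr A) (deg b) j"
  by (auto simp: proj_def shift_def finfam_iff intro: hc_gr)

lemma proj_sum: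
  assumes "f \<in> finfam car B"
  shows "\<exists>n. f = (\<Sum>j\<le>n. proj deg j f)"
proof -
  have "\<exists>n. (\<forall>i>n. hc (f b) i = 0) \<and> f b = (\<Sum>i\<le>n. hc (f b) i)" for b
    using assms hc_decomp[of "f b"] by (auto simp: decomp_def finfam_iff)
  then obtain n where n: "\<And>b i. i > n b \<Longrightarrow> hc (f b) i = 0" "\<And>b. f b = (\<Sum>i\<le>n b. hc (f b) i)"
    by metis
  define N where "N = (\<Sum>b | f b \<noteq> 0. deg b + n b)"
  have fin: "finite {b. f b \<noteq> 0}" using assms by (auto simp: finfam_iff)
  have "f b = (\<Sum>j\<le>N. proj deg j f b)" for b
  proof (cases "f b = 0")
    case True
    then show ?thesis by (simp add: proj_def hc_zero cong: if_cong)
  next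
    case False
    then have N: "deg b + n b \<le> N"
      unfolding N_def using fin member_le_sum[of b "{b. f b \<noteq> 0}" "\<lambda>b. deg b + n b"] by auto
    have "(\<Sum>j\<le>N. proj deg j f b) = (\<Sum>j=0 + deg b..(N - deg b) + deg b. hc (f b) (j - deg b))"
      using N by (intro sum.mono_neutral_cong_right) (auto simp: proj_def)
    also have "\<dots> = (\<Sum>j\<le>N - deg b. hc (f b) j)"
      unfolding sum.shift_bounds_cl_nat_ivl by (simp add: atLeast0AtMost)
    also have "\<dots> = f b"
      using n decomp_ge[of "n b" "hc (f b)" "N - deg b"] N by auto
    finally show ?thesis ..
  qed
  then have "f = (\<Sum>j\<le>N. proj deg j f)" by (simp add: fun_eq_iff sum_fun_apply)
  then show ?thesis ..
qed

lemma matmap_in: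
  assumes K: "graded_submodule B deg K" and D: "\<forall>b\<in>B'. D b \<in> K" and f: "f \<in> finfam car B'"
  shows "matmap (*) D f \<in> K"
proof -
  have "matmap (*) D f = (\<Sum>b | f b \<noteq> 0. (\<lambda>b'. D b b' * f b))"
    by (simp add: fun_eq_iff matmap_def sum_fun_apply)
  also have "\<dots> \<in> K"
    by (rule V.subspace_sum) (use K D f in \<open>auto simp: graded_submodule_def finfam_iff\<close>)
  finally show ?thesis .
qed

lemma subspace_finfam: "V.subspace (finfam car B)"
proof (rule V.subspaceI)
  show "0 \<in> finfam car B" by (simp add: finfam_iff zero_C)
next
  fix f g assume "f \<in> finfam car B" "g \<in> finfam car B"
  then show "f + g \<in> finfam car B"
    using finite_support_add[of f g] subspace_add[OF subspace_C]
    by (auto simp: finfam_iff) (metis add.right_neutral)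
next
  fix c f assume f: "f \<in> finfam car B"
  then have "{b. smul A c (f b) \<noteq> 0} \<subseteq> {b. f b \<noteq> 0}" by auto
  then show "vscale c f \<in> finfam car B"
    using f subspace_scale[OF subspace_C] by (auto simp: finfam_iff dest: finite_subset)
qed

lemma finfam_mult: assumes "f \<in> finfam car B" "a \<in> car" shows "(\<lambda>b. f b * a) \<in> finfam car B"
proof -
  have "{b. f b * a \<noteq> 0} \<subseteq> {b. f b \<noteq> 0}" by auto
  then show ?thesis using assms by (auto simp: finfam_iff mult_C dest: finite_subset)
qed

lemma graded_submodule_finfam: "graded_submodule B deg (finfam car B)"
  unfolding graded_submodule_def using subspace_finfam finfam_mult proj_finfam by blast

lemma smul_comm: "x * smul A c y = smul A c (x * y)"
  using smul_mult[of c y x] by (simp add: mult.commute)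

lemma matmap_vscale: "finite {b. f b \<noteq> 0} \<Longrightarrow> matmap (*) D (vscale c f) = vscale c (matmap (*) D f)"
  by (rule ext, subst matmap_superset[of "{b. f b \<noteq> 0}"])
    (auto simp: matmap_def smul_comm scale_sum_right)

lemma matmap_mult:
  "finite {b. f b \<noteq> (0::'a)} \<Longrightarrow> matmap (*) D (\<lambda>b. f b * a) = (\<lambda>b. matmap (*) D f b * a)"
  by (rule ext, subst matmap_superset[where f = "\<lambda>b. f b * a" and S = "{b. f b \<noteq> 0}"])
    (auto simp: matmap_def sum_distrib_right mult.assoc)

lemma generators:
  assumes K: "graded_submodule B deg K"
  obtains B' deg' D where "hom_gens B deg B' deg' D" "matmap (*) D ` finfam car B' = K"
proof -
  have KF: "K \<subseteq> finfam car B" and KV: "V.subspace K" using K by (auto simp: graded_submodule_def)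
  let ?h = "\<lambda>j. {f. \<forall>b. f b \<in> shift (gr A) (deg b) j}"
  obtain T where T: "countable T" "finfam car B \<subseteq> V.span T"
    using finfam_countable[of B] by (elim exE conjE)
  have "\<exists>S. countable S \<and> S \<subseteq> K \<inter> ?h j \<and> K \<inter> ?h j \<subseteq> V.span S" for j
  proof -
    have "K \<inter> ?h j \<subseteq> V.span T" using KF T(2) by blast
    then obtain S where "countable S" "S \<subseteq> K \<inter> ?h j" "K \<inter> ?h j \<subseteq> V.span S"
      by (rule V.countable_subspace[OF T(1)])
    then show ?thesis by (intro exI[of _ S] conjI)
  qed
  then have "\<exists>S. \<forall>j. countable (S j) \<and> S j \<subseteq> K \<inter> ?h j \<and> K \<inter> ?h j \<subseteq> V.span (S j)"
    by (intro choice allI)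
  then obtain S where S0: "\<forall>j. countable (S j) \<and> S j \<subseteq> K \<inter> ?h j \<and> K \<inter> ?h j \<subseteq> V.span (S j)"
    by (elim exE)
  have S: "countable (S j)" "S j \<subseteq> K \<inter> ?h j" "K \<inter> ?h j \<subseteq> V.span (S j)" for j
    using S0[rule_format, of j] by (iprover)+
  define G where "G = (SIGMA j:UNIV. S j)"
  have G: "countable G" unfolding G_def using S(1) by (intro countable_SIGMA) auto
  define B' where "B' = to_nat_on G ` G"
  define deg' where "deg' = fst \<circ> from_nat_into G"
  define D where "D = snd \<circ> from_nat_into G"
  have D1: "D b \<in> S (deg' b)" if "b \<in> B'" for b
  proof -
    have "from_nat_into G b \<in> G" using that G unfolding B'_def by auto
    then show ?thesis unfolding G_def D_def deg'_def by auto
  qed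
  have D2: "\<exists>b\<in>B'. D b = f" if "f \<in> S j" for f j
  proof -
    have "(j, f) \<in> G" using that unfolding G_def by simp
    then show ?thesis using from_nat_into_to_nat_on[OF G, of "(j, f)"]
      unfolding B'_def D_def by (intro bexI[of _ "to_nat_on G (j, f)"]) auto
  qed
  have DK: "\<forall>b\<in>B'. D b \<in> K" using D1 S(2) by blast
  have hom: "hom_gens B deg B' deg' D"
    unfolding hom_gens_def
  proof (intro ballI conjI)
    fix b assume "b \<in> B'"
    then have "D b \<in> K \<inter> ?h (deg' b)" using D1 S(2) by blast
    then show "D b \<in> finfam car B" "\<forall>b'. D b b' \<in> shift (gr A) (deg b') (deg' b)"
      using KF by auto
  qed
  let ?I = "matmap (*) D ` finfam car B'"
  have "?I \<subseteq> K" using matmap_in[OF K DK] by blast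
  moreover have I: "V.subspace ?I"
  proof (rule V.subspaceI)
    have "matmap (*) D 0 = 0" by (simp add: matmap_def fun_eq_iff)
    then show "0 \<in> ?I" using V.subspace_0[OF subspace_finfam]
      by (intro image_eqI[of _ _ 0]) auto
  next
    fix x y assume "x \<in> ?I" "y \<in> ?I"
    then obtain f g where fg: "f \<in> finfam car B'" "g \<in> finfam car B'"
        "x = matmap (*) D f" "y = matmap (*) D g" by blast
    then have "x + y = matmap (*) D (f + g)" by (simp add: matmap_add finfam_iff)
    then show "x + y \<in> ?I" using V.subspace_add[OF subspace_finfam fg(1,2)] by blast
  next
    fix c x assume "x \<in> ?I"
    then obtain f where f: "f \<in> finfam car B'" "x = matmap (*) D f" by blast
    then have "vscale c x = matmap (*) D (vscale c f)" by (simp add: matmap_vscale finfam_iff)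
    then show "vscale c x \<in> ?I" using V.subspace_scale[OF subspace_finfam f(1)] by blast
  qed
  have SI: "S j \<subseteq> ?I" for j
  proof
    fix f assume "f \<in> S j"
    then obtain b where b: "b \<in> B'" "D b = f" using D2 by blast
    let ?e = "\<lambda>i. if i = b then (1::'a) else 0"
    have "{i. ?e i \<noteq> 0} = {b}" by auto
    then have "?e \<in> finfam car B'" "matmap (*) D ?e = f"
      using b by (auto simp: finfam_iff one_C zero_C matmap_def)
    then show "f \<in> ?I" by blast
  qed
  have "K \<subseteq> ?I"
  proof
    fix f assume f: "f \<in> K"
    obtain n where n: "f = (\<Sum>j\<le>n. proj deg j f)" using proj_sum[OF subsetD[OF KF f], of deg] by (elim exE)
    have "proj deg j f \<in> K \<inter> ?h j" for j
    proof
      show "proj deg j f \<in> K" using K f unfolding graded_submodule_def by blast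
      show "proj deg j f \<in> ?h j" using proj_hom[OF subsetD[OF KF f]] by simp
    qed
    then have pI: "proj deg j f \<in> ?I" for j
      using S(3)[of j] V.span_minimal[OF SI[of j] I] by (meson subsetD)
    have "(\<Sum>j\<le>n. proj deg j f) \<in> ?I" by (rule V.subspace_sum[OF I pI])
    then show "f \<in> ?I" using n by simp
  qed
  ultimately have "?I = K" by blast
  with hom show ?thesis using that by blast
qed

lemma proj_matmap:
  assumes D: "hom_gens B deg B' deg' D" and f: "f \<in> finfam car B'"
  shows "matmap (*) D (proj deg' j f) = proj deg j (matmap (*) D f)"
proof
  fix b'
  let ?S = "{b. f b \<noteq> 0}"
  have fin: "finite ?S" and fC: "f b \<in> car" for b using f by (auto simp: finfam_iff)
  have DC: "D b b' * f b \<in> car" if "b \<in> ?S" for b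
    using that D f by (auto simp: hom_gens_def finfam_iff intro!: mult_C)
  have "matmap (*) D (proj deg' j f) b' = (\<Sum>b\<in>?S. D b b' * proj deg' j f b)"
    by (rule matmap_superset[OF fin]) (auto simp: proj_def hc_zero split: if_splits)
  also have "\<dots> = (\<Sum>b\<in>?S. if deg b' \<le> j then hc (D b b' * f b) (j - deg b') else 0)"
  proof (rule sum.cong[OF refl])
    fix b assume "b \<in> ?S"
    then have "D b b' \<in> shift (gr A) (deg b') (deg' b)"
      using D f by (auto simp: hom_gens_def finfam_iff)
    then consider "deg b' \<le> deg' b" "D b b' \<in> gr A (deg' b - deg b')" | "D b b' = 0"
      by (auto simp: shift_def split: if_splits)
    then show "D b b' * proj deg' j f b = (if deg b' \<le> j then hc (D b b' * f b) (j - deg b') else 0)"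
    proof cases
      case 1
      then show ?thesis by (auto simp: proj_def hc_mult[OF 1(2) fC])
    qed (auto simp: hc_zero)
  qed
  also have "\<dots> = proj deg j (matmap (*) D f) b'"
    using hc_sum[of ?S "\<lambda>b. D b b' * f b" "j - deg b'", OF DC]
    by (auto simp: proj_def matmap_def)
  finally show "matmap (*) D (proj deg' j f) b' = proj deg j (matmap (*) D f) b'" .
qed

lemma graded_submodule_kernel:
  assumes D: "hom_gens B deg B' deg' D"
  shows "graded_submodule B' deg' {f \<in> finfam car B'. matmap (*) D f = 0}"
proof -
  let ?K = "{f \<in> finfam car B'. matmap (*) D f = 0}"
  have fin: "finite {b. f b \<noteq> 0}" if "f \<in> ?K" for f
    using that by (auto simp: finfam_iff)
  have "V.subspace ?K"
  proof (rule V.subspaceI)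
    have "matmap (*) D 0 = 0" by (simp add: matmap_def fun_eq_iff)
    then show "0 \<in> ?K" using V.subspace_0[OF subspace_finfam] by simp
  next
    fix f g assume fg: "f \<in> ?K" "g \<in> ?K"
    have "matmap (*) D (f + g) = 0"
      using matmap_add[OF fin[OF fg(1)] fin[OF fg(2)]] fg by simp
    then show "f + g \<in> ?K" using V.subspace_add[OF subspace_finfam] fg by simp
  next
    fix c f assume f: "f \<in> ?K"
    have "matmap (*) D (vscale c f) = 0"
      using matmap_vscale[OF fin[OF f], of D c] f by (simp add: fun_eq_iff)
    then show "vscale c f \<in> ?K" using f V.subspace_scale[OF subspace_finfam] by simp
  qed
  moreover have "(\<lambda>b. f b * a) \<in> ?K" if f: "f \<in> ?K" and a: "a \<in> car" for f a
  proof -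
    have "matmap (*) D (\<lambda>b. f b * a) = 0"
      using matmap_mult[OF fin[OF f], of D a] f by (simp add: fun_eq_iff)
    then show ?thesis using finfam_mult[OF _ a] f by simp
  qed
  moreover have "proj deg' j f \<in> ?K" if f: "f \<in> ?K" for f j
  proof -
    have "matmap (*) D (proj deg' j f) = proj deg j 0"
      using proj_matmap[OF D, of f j] f by simp
    also have "\<dots> = 0" by (auto simp: proj_def fun_eq_iff hc_zero)
    finally show ?thesis using proj_finfam f by simp
  qed
  ultimately show ?thesis
    unfolding graded_submodule_def by blast
qed

text \<open>The residue is the degree zero component.\<close>

lemma residue_eq:
  assumes "a \<in> car" "hc a 0 = smul A c 1" shows "residue A a = c"
proof -
  have dec: "decomp a (hc a)" using assms hc_decomp by blast
  let ?P = "gsum (\<lambda>d. if d = 0 then {0} else gr A d)"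
  have P: "x \<in> car \<and> hc x 0 = 0" if x: "x \<in> ?P" for x
  proof -
    obtain n f where f0: "x = (\<Sum>i\<le>n. f i) \<and> (\<forall>i. f i \<in> (if i = 0 then {0} else gr A i))"
      using x unfolding gsum_def mem_Collect_eq by (elim exE)
    then have f: "x = (\<Sum>i\<le>n. f i)" "\<And>i. f i \<in> (if i = 0 then {0} else gr A i)"
      by iprover+
    have f': "f i \<in> gr A i" for i using f(2)[of i] gr_zero by (auto split: if_splits)
    have "hc (f i) 0 = 0" for i
      using f(2)[of i] hc_eq[OF decomp_gr[OF f'[of i]]] by (auto simp: hc_zero split: if_splits)
    then show ?thesis
      using f(1) hc_sum[of "{..n}" f 0, OF gr_C[OF f']] sum_C[of "{..n}" f, OF gr_C[OF f']]
      by simp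
  qed
  show ?thesis unfolding residue_def
  proof (rule the_equality)
    obtain n where n: "\<forall>i>n. hc a i = 0" "a = (\<Sum>i\<le>n. hc a i)" using dec by (auto simp: decomp_def)
    have "a - smul A c 1 = (\<Sum>i\<le>n. if i = 0 then 0 else hc a i)"
    proof -
      have "(\<Sum>i\<le>n. hc a i) = hc a 0 + (\<Sum>i\<in>{..n} - {0}. hc a i)"
        by (rule sum.remove) auto
      moreover have "(\<Sum>i\<in>{..n} - {0}. hc a i) = (\<Sum>i\<le>n. if i = 0 then 0 else hc a i)"
        by (rule sum.mono_neutral_cong_left) auto
      ultimately have "a = smul A c 1 + (\<Sum>i\<le>n. if i = 0 then 0 else hc a i)"
        using n(2) assms(2) by (metis (no_types, lifting))
      then show ?thesis by (metis (no_types, lifting) add_diff_cancel_left')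
    qed
    then show "a - smul A c 1 \<in> ?P"
      using hc_gr[OF assms(1)] unfolding gsum_def mem_Collect_eq
      by (intro exI[of _ n] exI[of _ "\<lambda>i. if i = 0 then 0 else hc a i"]) simp
  next
    fix c' assume "a - smul A c' 1 \<in> ?P"
    then have x: "a - smul A c' 1 \<in> car" "hc (a - smul A c' 1) 0 = 0" using P by blast+
    have c'1: "smul A c' 1 \<in> gr A 0" using gr_0 by blast
    have "hc (a - smul A c' 1 + smul A c' 1) 0 = hc (a - smul A c' 1) 0 + hc (smul A c' 1) 0"
      using hc_add[OF x(1) gr_C[OF c'1]] by simp
    then have "hc a 0 = smul A c' 1"
      using x hc_eq[OF decomp_gr[OF c'1]] by simp
    then have "smul A (c' - c) 1 = 0" using assms by (simp add: scale_left_diff_distrib)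
    then show "c' = c"
      by (metis eq_iff_diff_eq_0 scale_eq_0_iff zero_neq_one)
  qed
qed

lemma residue_C: assumes "a \<in> car" shows "hc a 0 = smul A (residue A a) 1"
proof -
  obtain c where "hc a 0 = smul A c 1" using hc_gr[OF assms, of 0] gr_0 by auto
  then show ?thesis using residue_eq[OF assms] by metis
qed

lemma residue_0_iff: "a \<in> car \<Longrightarrow> residue A a = 0 \<longleftrightarrow> hc a 0 = 0"
  using residue_C by (metis scale_eq_0_iff zero_neq_one)

lemma augmap_residue:
  "f \<in> finfam car {0} \<Longrightarrow> augmap (act (residue_field A)) (\<lambda>_. 1) f = residue A (f 0)"
proof -
  assume f: "f \<in> finfam car {0}"
  have r0: "residue A 0 = 0" using residue_0_iff[OF zero_C] hc_zero by simp
  have "augmap (act (residue_field A)) (\<lambda>_. 1) f = (\<Sum>b\<in>{0}. residue A (f b))"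
    unfolding augmap_def residue_field_def
    using f r0 by (intro sum.mono_neutral_cong_left) (auto simp: finfam_iff)
  then show ?thesis by simp
qed

lemma kernel_residue:
  "graded_submodule {0} (\<lambda>_. 0)
     {f \<in> finfam car {0}. augmap (act (residue_field A)) (\<lambda>_. 1) f = 0}"
proof -
  have "{f \<in> finfam car {0}. augmap (act (residue_field A)) (\<lambda>_. 1) f = 0} =
      {f \<in> finfam car {0}. hc (f 0) 0 = 0}" (is "_ = ?K")
    using augmap_residue residue_0_iff by (auto simp: finfam_iff)
  moreover have "V.subspace ?K"
  proof (rule V.subspaceI)
    show "0 \<in> ?K" using V.subspace_0[OF subspace_finfam] by (auto simp: hc_zero)
  next
    fix f g assume fg: "f \<in> ?K" "g \<in> ?K"
    have "hc (f 0 + g 0) 0 = 0"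
      using fg hc_add[of "f 0" "g 0"] by (simp add: finfam_iff)
    then show "f + g \<in> ?K" using V.subspace_add[OF subspace_finfam] fg by simp
  next
    fix c f assume f: "f \<in> ?K"
    then have "f 0 \<in> car" by (simp add: finfam_iff)
    then have "hc (smul A c (f 0)) 0 = 0"
      using hc_eq[OF decomp_scale[OF hc_decomp[of "f 0"]], of c] f by simp
    then show "vscale c f \<in> ?K" using f V.subspace_scale[OF subspace_finfam] by simp
  qed
  moreover
  have "hc (x * a) 0 = 0" if xa: "x \<in> car" "a \<in> car" "hc x 0 = 0" for x a
  proof -
    obtain n where n: "x = (\<Sum>i\<le>n. hc x i)" using hc_decomp[OF xa(1)] by (auto simp: decomp_def)
    have "hc (hc x i * a) 0 = 0" for i
      using hc_mult[OF hc_gr[OF that(1), of i] that(2), of 0] that(3) by auto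
    moreover have "x * a = (\<Sum>i\<le>n. hc x i * a)" using n by (metis sum_distrib_right)
    ultimately show ?thesis
      using that by (simp add: hc_sum mult_C gr_C[OF hc_gr])
  qed
  then have "(\<lambda>b. f b * a) \<in> ?K" if "f \<in> ?K" "a \<in> car" for f a
    using that finfam_mult[of f "{0}" a] by (simp add: finfam_iff)
  moreover have "proj (\<lambda>_. 0) j f \<in> ?K" if f: "f \<in> ?K" for f j
  proof -
    have "f 0 \<in> car" using f by (simp add: finfam_iff)
    then have "hc (hc (f 0) j) = (\<lambda>i. if i = j then hc (f 0) j else 0)"
      using hc_eq[OF decomp_gr[OF hc_gr]] by simp
    then have "hc (proj (\<lambda>_. 0) j f 0) 0 = 0" using f by (simp add: proj_def)
    then show ?thesis using f proj_finfam by simp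
  qed
  ultimately show ?thesis
    unfolding graded_submodule_def by (metis (no_types, lifting) mem_Collect_eq subsetI)
qed

text \<open>A state of the construction consists of the basis and degrees in one position, the submodule
  that the next differential has to cover, and the differential that starts there.\<close>

theorem ex_graded_free_resolution: "\<exists>F. graded_free_resolution A (residue_field A) F"
proof -
  define ok :: "nat set \<times> (nat \<Rightarrow> nat) \<times> (nat \<Rightarrow> 'a) set \<times> (nat \<Rightarrow> nat \<Rightarrow> 'a) \<Rightarrow> bool"
    where "ok = (\<lambda>(B, deg, K, D). graded_submodule B deg K)"
  define next_to :: "nat set \<times> (nat \<Rightarrow> nat) \<times> (nat \<Rightarrow> 'a) set \<times> (nat \<Rightarrow> nat \<Rightarrow> 'a) \<Rightarrow>
      nat set \<times> (nat \<Rightarrow> nat) \<times> (nat \<Rightarrow> 'a) set \<times> (nat \<Rightarrow> nat \<Rightarrow> 'a) \<Rightarrow> bool"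
    where "next_to = (\<lambda>(B, deg, K, D) (B', deg', K', D'). hom_gens B deg B' deg' D' \<and>
      matmap (*) D' ` finfam car B' = K \<and> K' = {f \<in> finfam car B'. matmap (*) D' f = 0})"
  define K0 where "K0 = {f \<in> finfam car {0}. augmap (act (residue_field A)) (\<lambda>_. 1) f = 0}"
  have step: "\<exists>y. ok y \<and> next_to x y" if okx: "ok x" for x
  proof -
    obtain B deg K D where x: "x = (B, deg, K, D)" by (metis prod.exhaust)
    have "graded_submodule B deg K" using okx by (simp add: ok_def x)
    then obtain B' deg' D' where *: "hom_gens B deg B' deg' D'" "matmap (*) D' ` finfam car B' = K"
      by (rule generators)
    show ?thesis
      by (rule exI[of _ "(B', deg', {f \<in> finfam car B'. matmap (*) D' f = 0}, D')"])
        (use * graded_submodule_kernel[OF *(1)] in \<open>auto simp: ok_def next_to_def x\<close>)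
  qed
  define x0 where "x0 = ({0::nat}, (\<lambda>_::nat. 0::nat), K0, \<lambda>(_::nat) (_::nat). 0::'a)"
  have "ok x0" using kernel_residue by (simp add: ok_def K0_def x0_def)
  have "\<exists>s. \<forall>n. (ok (s n) \<and> (n = 0 \<longrightarrow> s n = x0)) \<and> next_to (s n) (s (Suc n))"
  proof (rule dependent_nat_choice)
    show "\<exists>x. ok x \<and> ((0::nat) = 0 \<longrightarrow> x = x0)" using \<open>ok x0\<close> by blast
  next
    fix x and n :: nat assume "ok x \<and> (n = 0 \<longrightarrow> x = x0)"
    then show "\<exists>y. (ok y \<and> (Suc n = 0 \<longrightarrow> y = x0)) \<and> next_to x y" using step[of x] by blast
  qed
  then obtain s where s': "\<forall>n. (ok (s n) \<and> (n = 0 \<longrightarrow> s n = x0)) \<and> next_to (s n) (s (Suc n))"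
    by (elim exE)
  have s: "s 0 = ({0}, (\<lambda>_. 0), K0, \<lambda>_ _. 0)" "next_to (s n) (s (Suc n))" for n
    using s'[rule_format, of 0] s'[rule_format, of n] by (simp_all add: x0_def)
  define F where "F = \<lparr>gens = (\<lambda>n. fst (s n)), gdeg = (\<lambda>n. fst (snd (s n))),
    bd = (\<lambda>n. snd (snd (snd (s (Suc n))))), aug = (\<lambda>_. 1::'k)\<rparr>"
  have K: "fst (snd (snd (s (Suc n)))) =
      {f \<in> finfam car (gens F (Suc n)). matmap (*) (bd F n) f = 0}" for n
    using s(2)[of n] by (auto simp: next_to_def F_def split: prod.splits)
  have H: "hom_gens (gens F n) (gdeg F n) (gens F (Suc n)) (gdeg F (Suc n)) (bd F n)"
    and I: "matmap (*) (bd F n) ` finfam car (gens F (Suc n)) = fst (snd (snd (s n)))" for n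
    using s(2)[of n] by (auto simp: next_to_def F_def split: prod.splits)
  have g0: "gens F 0 = {0}" "gdeg F 0 = (\<lambda>_. 0)" "aug F = (\<lambda>_. 1)"
    using s(1) by (simp_all add: F_def)
  have "augmap (act (residue_field A)) (aug F) ` finfam car (gens F 0) = UNIV"
  proof -
    have "c \<in> augmap (act (residue_field A)) (aug F) ` finfam car (gens F 0)" for c
    proof -
      let ?f = "\<lambda>b::nat. if b = 0 then smul A c 1 else 0"
      have c: "smul A c 1 \<in> gr A 0" using gr_0 by blast
      have f: "?f \<in> finfam car {0}" using gr_C[OF c] zero_C by (auto simp: finfam_iff)
      have "residue A (smul A c 1) = c"
        using residue_eq[OF gr_C[OF c]] hc_eq[OF decomp_gr[OF c]] by simp
      then show ?thesis
        using augmap_residue[OF f] f g0 by (intro image_eqI[of _ _ ?f]) auto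
    qed
    then show ?thesis by blast
  qed
  moreover have "gsum (mgr (residue_field A)) = UNIV"
  proof -
    have "c \<in> gsum (mgr (residue_field A))" for c
      unfolding gsum_def residue_field_def
      by (auto intro!: exI[of _ 0] exI[of _ "\<lambda>i. if i = 0 then c else 0"])
    then show ?thesis by blast
  qed
  ultimately have "graded_free_resolution A (residue_field A) F"
    unfolding graded_free_resolution_def
  proof (intro conjI allI ballI)
    fix b show "aug F b \<in> mgr (residue_field A) (gdeg F 0 b)"
      by (simp add: g0 residue_field_def)
  next
    fix i b b' assume "b \<in> gens F (Suc i)"
    then show "bd F i b \<in> finfam car (gens F i)"
      "bd F i b b' \<in> shift (gr A) (gdeg F i b') (gdeg F (Suc i) b)"
      using H[of i] by (simp_all add: hom_gens_def)
  next
    show "matmap (*) (bd F 0) ` finfam car (gens F 1) =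
        {f \<in> finfam car (gens F 0). augmap (act (residue_field A)) (aug F) f = 0}"
      using I[of 0] s(1) g0 by (simp add: K0_def)
  next
    fix i show "matmap (*) (bd F (Suc i)) ` finfam car (gens F (Suc (Suc i))) =
        {f \<in> finfam car (gens F (Suc i)). matmap (*) (bd F i) f = 0}"
      using I[of "Suc i"] K[of i] by simp
  qed simp
  then show ?thesis ..
qed

lemma resolution_residue_field:
  "graded_free_resolution A (residue_field A) (resolution A (residue_field A))"
  unfolding resolution_def using ex_graded_free_resolution by (rule someI_ex)

end

subsection \<open>The symmetric algebra is a standard graded algebra\<close>

lemma sum_lookup_add:
  "(\<Sum>x \<in> Poly_Mapping.keys (m + m'). Poly_Mapping.lookup (m + m') x) =
   (\<Sum>x \<in> Poly_Mapping.keys m. Poly_Mapping.lookup m x) +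
   (\<Sum>x \<in> Poly_Mapping.keys m'. Poly_Mapping.lookup m' x)"
  for m m' :: "'r \<Rightarrow>\<^sub>0 nat"
  by (rule setsum_keys_plus_distrib) auto

lemma keys_add_nat:
  "Poly_Mapping.keys (m + m') = Poly_Mapping.keys m \<union> Poly_Mapping.keys m'"
  for m m' :: "'r \<Rightarrow>\<^sub>0 nat"
  by (auto simp: in_keys_iff lookup_add)

lemma poly_mapping_sum_single:
  "p = (\<Sum>m \<in> Poly_Mapping.keys p. Poly_Mapping.single m (Poly_Mapping.lookup p m))"
  for p :: "'m \<Rightarrow>\<^sub>0 'k::comm_monoid_add"
  by (rule poly_mapping_eqI)
    (auto simp: lookup_sum lookup_single when_def sum.delta in_keys_iff)

lemma lookup_single0_mult:
  "Poly_Mapping.lookup (Poly_Mapping.single 0 c * p) m = c * Poly_Mapping.lookup p m"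
  for p :: "('r \<Rightarrow>\<^sub>0 nat) \<Rightarrow>\<^sub>0 'k::field"
  unfolding mult_map_scale_conv_mult[symmetric] by (simp add: Poly_Mapping.map.rep_eq when_def)

theorem standard_graded_sym_algebra:
  fixes X :: "'r set"
  assumes "finite X"
  shows "standard_graded_algebra (sym_algebra X :: ('k::field, _) galgebra)"
proof -
  let ?A = "sym_algebra X :: ('k, ('r \<Rightarrow>\<^sub>0 nat) \<Rightarrow>\<^sub>0 'k) galgebra"
  let ?deg = "\<lambda>m. \<Sum>x \<in> Poly_Mapping.keys m. Poly_Mapping.lookup m x"
  have sm: "smul ?A c p = Poly_Mapping.single 0 c * p" for c p
    by (simp add: sym_algebra_def)
  have gr: "p \<in> gr ?A d \<longleftrightarrow> (\<forall>m \<in> Poly_Mapping.keys p. Poly_Mapping.keys m \<subseteq> X \<and> ?deg m = d)" for p d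
    by (simp add: sym_algebra_def)
  interpret V: vector_space "smul ?A"
    by unfold_locales
      (simp_all add: sm algebra_simps single_add mult_single mult.assoc[symmetric])
  have deg0: "m = 0" if "?deg m = 0" for m :: "'r \<Rightarrow>\<^sub>0 nat"
    using that by (intro poly_mapping_eqI) (metis finite_keys in_keys_iff lookup_zero sum_eq_0_iff)
  have sub: "V.subspace (gr ?A d)" for d
  proof (rule V.subspaceI)
    show "0 \<in> gr ?A d" by (simp add: gr)
  next
    fix p q assume "p \<in> gr ?A d" "q \<in> gr ?A d"
    then show "p + q \<in> gr ?A d" using keys_add[of p q] by (auto simp: gr)
  next
    fix c p assume "p \<in> gr ?A d"
    moreover have "Poly_Mapping.keys (smul ?A c p) \<subseteq> Poly_Mapping.keys p"
      by (auto simp: sm in_keys_iff lookup_single0_mult)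
    ultimately show "smul ?A c p \<in> gr ?A d" by (auto simp: gr)
  qed
  let ?v = "\<lambda>x. Poly_Mapping.single (Poly_Mapping.single x (1::nat)) (1::'k)"
  show ?thesis
  proof
    show "smul ?A c (x * y) = smul ?A c x * y" for c x y by (simp add: sm mult.assoc)
  next
    fix f n i assume f: "\<forall>i. f i \<in> gr ?A i" and s: "(\<Sum>i\<le>n. f i) = 0" and i: "i \<le> (n::nat)"
    show "f i = 0"
    proof (rule ccontr)
      assume "f i \<noteq> 0"
      then obtain m where m: "Poly_Mapping.lookup (f i) m \<noteq> 0"
        by (metis lookup_zero poly_mapping_eqI)
      then have d: "?deg m = i" using f by (auto simp: gr in_keys_iff)
      have "Poly_Mapping.lookup (f j) m = 0" if "j \<noteq> i" for j
        using that f d by (metis gr in_keys_iff)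
      then have "(\<Sum>j\<le>n. Poly_Mapping.lookup (f j) m) =
          (\<Sum>j\<le>n. if j = i then Poly_Mapping.lookup (f i) m else 0)"
        by (intro sum.cong) auto
      also have "\<dots> = Poly_Mapping.lookup (f i) m" using i by (simp add: sum.delta)
      finally show False using s m by (metis lookup_sum lookup_zero)
    qed
  next
    show "gr ?A 0 = range (\<lambda>c. smul ?A c 1)"
    proof (intro equalityI subsetI)
      fix p assume "p \<in> gr ?A 0"
      then have k: "Poly_Mapping.keys p \<subseteq> {0}" using deg0 by (auto simp: gr)
      have "p = Poly_Mapping.single 0 (Poly_Mapping.lookup p 0)"
        by (rule poly_mapping_eqI) (use k in \<open>auto simp: lookup_single when_def in_keys_iff\<close>)
      then show "p \<in> range (\<lambda>c. smul ?A c 1)" by (auto simp: sm)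
    qed (auto simp: gr sm split: if_splits)
  next
    fix p q d e assume pq: "p \<in> gr ?A d" "q \<in> gr ?A e"
    show "p * q \<in> gr ?A (d + e)"
      unfolding gr
    proof
      fix m assume "m \<in> Poly_Mapping.keys (p * q)"
      then obtain a b where m: "m = a + b" "a \<in> Poly_Mapping.keys p" "b \<in> Poly_Mapping.keys q"
        using keys_mult[of p q] by blast
      then have "?deg m = d + e" using pq by (simp add: sum_lookup_add gr)
      moreover have "Poly_Mapping.keys m \<subseteq> X"
        using pq m(2,3) unfolding m(1) keys_add_nat gr by blast
      ultimately show "Poly_Mapping.keys m \<subseteq> X \<and> ?deg m = d + e" by blast
    qed
  next
    have "gr ?A 1 = V.span (?v ` X)"
    proof (intro equalityI subsetI)
      fix p assume p: "p \<in> gr ?A 1"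
      have "Poly_Mapping.single m (Poly_Mapping.lookup p m) \<in> V.span (?v ` X)"
        if mp: "m \<in> Poly_Mapping.keys p" for m
      proof -
        have m: "Poly_Mapping.keys m \<subseteq> X" "?deg m = 1" using p mp unfolding gr by blast+
        then obtain x where x: "x \<in> Poly_Mapping.keys m" by fastforce
        have "?deg m = Poly_Mapping.lookup m x + (\<Sum>y \<in> Poly_Mapping.keys m - {x}. Poly_Mapping.lookup m y)"
          by (rule sum.remove) (use x in auto)
        moreover have "Poly_Mapping.lookup m x \<noteq> 0" using x by (simp only: in_keys_iff simp_thms)
        ultimately have 1: "Poly_Mapping.lookup m x = 1"
            "(\<Sum>y \<in> Poly_Mapping.keys m - {x}. Poly_Mapping.lookup m y) = 0"
          using m(2) by linarith+
        have 0: "Poly_Mapping.lookup m y = 0" if "y \<noteq> x" for y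
        proof (cases "y \<in> Poly_Mapping.keys m")
          case True
          then have "y \<in> Poly_Mapping.keys m - {x}" using that by blast
          moreover have "finite (Poly_Mapping.keys m - {x})" by (rule finite_Diff) (rule finite_keys)
          ultimately show ?thesis using 1(2) by (metis sum_eq_0_iff)
        next
          case False
          then show ?thesis by (simp only: in_keys_iff not_not)
        qed
        have "Poly_Mapping.lookup m y = Poly_Mapping.lookup (Poly_Mapping.single x 1) y" for y
          using 1(1) 0[of y] by (cases "y = x") (simp_all add: lookup_single when_def)
        then have "m = Poly_Mapping.single x 1" by (rule poly_mapping_eqI)
        then have "Poly_Mapping.single m (Poly_Mapping.lookup p m) =
            smul ?A (Poly_Mapping.lookup p m) (?v x)"
          by (simp add: sm mult_single)
        moreover have "?v x \<in> V.span (?v ` X)" using x m(1) by (intro V.span_base) blast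
        ultimately show ?thesis using V.span_scale by metis
      qed
      then have "(\<Sum>m \<in> Poly_Mapping.keys p. Poly_Mapping.single m (Poly_Mapping.lookup p m)) \<in> V.span (?v ` X)"
        by (rule V.span_sum)
      then show "p \<in> V.span (?v ` X)" using poly_mapping_sum_single[of p] by simp
    next
      have "?v ` X \<subseteq> gr ?A 1" by (auto simp: gr)
      then show "p \<in> gr ?A 1" if "p \<in> V.span (?v ` X)" for p
        using that V.span_minimal[OF _ sub] by blast
    qed
    then show "\<exists>B. finite B \<and> gr ?A 1 = V.span B" using assms by blast
  next
    fix S d
    assume S: "V.subspace S" "1 \<in> S" "\<And>x y. \<lbrakk>x \<in> S; y \<in> S\<rbrakk> \<Longrightarrow> x * y \<in> S" "gr ?A 1 \<subseteq> S"
    have mono: "Poly_Mapping.single m 1 \<in> S" if "Poly_Mapping.keys m \<subseteq> X" for m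
      using that
    proof (induction "?deg m" arbitrary: m)
      case 0
      then show ?case using deg0[of m] S(2) by simp
    next
      case (Suc n)
      then obtain x where x: "x \<in> Poly_Mapping.keys m" by fastforce
      define m' where "m' = m - Poly_Mapping.single x 1"
      have mm: "m = Poly_Mapping.single x 1 + m'"
        by (rule poly_mapping_eqI)
          (use x in \<open>auto simp: m'_def lookup_add lookup_minus lookup_single when_def in_keys_iff\<close>)
      have "?deg m = 1 + ?deg m'" 
        using sum_lookup_add[of "Poly_Mapping.single x 1" m'] unfolding mm[symmetric] by simp
      then have "n = ?deg m'" using Suc(2) by simp
      moreover have "Poly_Mapping.keys m' \<subseteq> Poly_Mapping.keys m"
        using keys_add_nat[of "Poly_Mapping.single x 1" m'] unfolding mm[symmetric] by blast
      ultimately have "Poly_Mapping.single m' 1 \<in> S"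
        using Suc(1)[of m'] Suc(3) by blast
      moreover have "?v x \<in> gr ?A 1" using x Suc(3) by (auto simp: gr)
      then have "?v x \<in> S" using S(4) by blast
      ultimately have "?v x * Poly_Mapping.single m' 1 \<in> S" by (rule S(3)[rotated])
      then show ?case
        using mm by (simp add: mult_single)
    qed
    show "gr ?A d \<subseteq> S"
    proof
      fix p assume p: "p \<in> gr ?A d"
      have "Poly_Mapping.single m (Poly_Mapping.lookup p m) \<in> S" if "m \<in> Poly_Mapping.keys p" for m
      proof -
        have "Poly_Mapping.single m (Poly_Mapping.lookup p m) =
            smul ?A (Poly_Mapping.lookup p m) (Poly_Mapping.single m 1)"
          by (simp add: sm mult_single)
        then show ?thesis using mono p that V.subspace_scale[OF S(1)] by (auto simp: gr)
      qed
      then have "(\<Sum>m \<in> Poly_Mapping.keys p. Poly_Mapping.single m (Poly_Mapping.lookup p m)) \<in> S"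
        by (rule V.subspace_sum[OF S(1)])
      then show "p \<in> S" using poly_mapping_sum_single[of p] by simp
    qed
  qed (rule sub)
qed

text \<open>The resolution entering the Betti numbers exists.\<close>

corollary betti_resolution:
  fixes R :: "('k::field, 'r::comm_ring_1) galgebra" and X :: "'r set"
  assumes "standard_graded_algebra R" "\<not> module.dependent (smul R) X"
    "module.span (smul R) X = gr R 1"
  defines "Q \<equiv> sym_algebra X :: ('k, _) galgebra"
  shows "graded_free_resolution Q (residue_field Q) (resolution Q (residue_field Q))"
proof -
  interpret R: standard_graded_algebra R by fact
  obtain B where B: "finite B" "gr R 1 = R.span B" using R.gr_1_finite by blast
  have "X \<subseteq> R.span B" using assms(3) B(2) R.span_superset[of X] by blast
  then have "finite X" using R.independent_span_bound[OF B(1) assms(2)] by blast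
  then interpret Q: standard_graded_algebra Q
    unfolding Q_def by (rule standard_graded_sym_algebra)
  show ?thesis by (rule Q.resolution_residue_field)
qed

end

theory Submission
  imports Defs
begin

text \<open>
  The Koszul complex \<open>K\<close> on a basis of \<open>R\<^sub>1\<close> resolves \<open>k\<close> over \<open>Q\<close>, so \<open>b\<^sub>i = \<beta>\<^sub>i(R)\<close> is the dimension of
  \<open>H\<^sub>i = H\<^sub>i(K \<otimes> R)\<close>. The first steps of the minimal resolution of \<open>k\<close> over \<open>R\<close> are those of Tate's
  construction. If \<open>R\<close> is Koszul, the second syzygies of \<open>k\<close> are generated in degree 2 and the third
  ones in degree 3; hence \<open>H\<^sub>1\<close> is concentrated in degree 2, and \<open>H\<^sub>2\<close> is the sum of its part of
  degree 3 and of the products of two elements of \<open>H\<^sub>1\<close>. So the part of \<open>H\<^sub>2\<close> of degree 4 has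
  dimension at most \<open>b\<^sub>1 choose 2\<close>. The Euler characteristics of the graded pieces of \<open>K \<otimes> R\<close> express
  the dimensions of both parts by the Hilbert function. If the part of degree 3 vanishes, this
  proves \<open>b\<^sub>2 \<le> (b\<^sub>1 choose 2)\<close>; otherwise the bound follows from Macaulay's bounds for the growth of the
  Hilbert function, obtained by counting standard monomials. Finally \<open>1 - b\<^sub>1 + b\<^sub>2 - b\<^sub>3\<close> is the
  eventual second difference of the Hilbert function for three variables. Were it negative, the
  Hilbert function would become negative, so \<open>b\<^sub>3 \<le> 1 - b\<^sub>1 + b\<^sub>2\<close>, which suffices if \<open>b\<^sub>1 > 0\<close>. If
  \<open>b\<^sub>1 = 0\<close>, then the variables form a regular sequence on \<open>R\<close> and \<open>b\<^sub>3 = 0\<close>.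
\<close>

section \<open>Linear algebra\<close>

context vector_space
begin

text \<open>Both kinds of Tor are computed from an arbitrarily chosen resolution, possibly infinite
  and not minimal, so neither the Betti numbers nor Koszulness can be read off it. Hence complexes
  are compared up to homotopy, and only up to a position \<open>q\<close>: the partial resolution of
  \<open>k\<close> over \<open>R\<close> that is built by hand stops at position 2. Koszulness
  enters through one statement: if a truncated resolution is minimal at its last syzygy module
  \<open>Z\<close>, then \<open>Z\<close> modulo its multiples with the augmentation ideal is Tor in
  the following position, so \<open>Z\<close> is generated in a single degree.

  The Euler characteristics relate the Hilbert function, the second homology and the cycles in top
  position. The term not governed by the Hilbert function is the socle of \<open>R\<close> in degree
  1, which enlarges the degree 4 part of the second homology. It is paid for by the degree 3 part,
  where every socle element yields three cycles; this trade-off is what makes the bound on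
  \<open>b\<^sub>2\<close> close for three variables.\<close>

lemma independent_finite_of_span:
  assumes "finite F" "V \<subseteq> span F" "S \<subseteq> V" "independent S"
  shows "finite S" "card S \<le> card F"
  using independent_span_bound[OF assms(1,4)] assms(2,3) by auto

text \<open>Extend a basis \<open>B\<close> of \<open>W\<close> to a basis \<open>C\<close> of
  \<open>V\<close> and keep \<open>C - B\<close>. The conclusions have the shape that
  \<open>quotient_dim_eq\<close> asks for, together with the dimension count.\<close>

lemma complement_exists:
  assumes "subspace V" "subspace W" "W \<subseteq> V" "finite F" "V \<subseteq> span F"
  obtains S where "S \<subseteq> V" "finite S" "independent S" "span S \<inter> W = {0}" "V \<subseteq> span (S \<union> W)"
    "dim V = card S + dim W"
proof -
  obtain B where B: "B \<subseteq> W" "independent B" "W \<subseteq> span B" "card B = dim W"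
    using basis_exists[of W] by blast
  obtain C where C: "B \<subseteq> C" "C \<subseteq> V" "independent C" "V \<subseteq> span C"
    using maximal_independent_subset_extend[of B V] B assms(3) by blast
  have fC: "finite C" using independent_finite_of_span[OF assms(4,5) C(2,3)] by blast
  have spB: "span B = W" using B(1,3) span_minimal[OF _ assms(2)] by blast
  have "dim V = card C" using C basis_card_eq_dim by auto
  also have "\<dots> = card (C - B) + dim W"
    using C(1) fC B(4) card_mono[OF fC C(1)] by (simp add: card_Diff_subset finite_subset)
  finally have 1: "dim V = card (C - B) + dim W" .
  \<comment> \<open>The coordinates of \<open>x\<close> with respect to \<open>C\<close> are
    supported both in \<open>C - B\<close> and in \<open>B\<close>.\<close>
  have "x = 0" if x: "x \<in> span (C - B)" "x \<in> span B" for x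
  proof (rule ccontr)
    assume "x \<noteq> 0"
    then have B0: "representation C x \<noteq> (\<lambda>_. 0)"
      using sum_nonzero_representation_eq[OF C(3), of x] x span_mono[of B C] C(1) by auto
    have "representation C x = representation (C - B) x" "representation C x = representation B x"
      using representation_extend[OF C(3)] x C(1) by blast+
    then have "representation C x b = 0" for b
      using representation_ne_zero[of "C - B" x b] representation_ne_zero[of B x b]
      by (metis Diff_iff)
    with B0 show False by blast
  qed
  then have "span (C - B) \<inter> W = {0}" using spB span_zero subspace_0[OF assms(2)] by blast
  moreover have "V \<subseteq> span ((C - B) \<union> W)"
  proof -
    have "C \<subseteq> (C - B) \<union> W" using B(1) by blast
    then show ?thesis using C(4) span_mono by blast
  qed
  ultimately show ?thesis
    using that[of "C - B"] 1 fC C independent_mono[OF C(3), of "C - B"] by blast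
qed

lemma dim_mono_finite:
  assumes "V \<subseteq> W" "finite F" "W \<subseteq> span F"
  shows "dim V \<le> dim W"
proof -
  obtain C where C: "C \<subseteq> W" "independent C" "W \<subseteq> span C" "card C = dim W"
    using basis_exists[of W] by blast
  have "finite C" using independent_finite_of_span[OF assms(2,3) C(1,2)] by blast
  then show ?thesis using dim_le_card[of V C] C assms(1) by auto
qed

text \<open>The quotients are compared through maps that are linear on the relevant subspaces only and
  mutually inverse modulo boundaries.\<close>

lemma quotient_dim_transfer:
  assumes Z: "subspace Z" and B: "subspace B" "B \<subseteq> Z"
    and lin: "\<And>x y. x \<in> Z' \<Longrightarrow> y \<in> Z' \<Longrightarrow> \<Psi> (x + y) = \<Psi> x + \<Psi> y"
      "\<And>c x. x \<in> Z' \<Longrightarrow> \<Psi> (s c x) = scale c (\<Psi> x)"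
    and V': "vector_space s" and Z': "module.subspace s Z'" and B': "module.subspace s B'" "B' \<subseteq> Z'"
    and \<Phi>: "\<And>x. x \<in> B \<Longrightarrow> \<Phi> x \<in> B'" "\<And>x. x \<in> Z \<Longrightarrow> \<Phi> x \<in> Z'"
    and \<Psi>: "\<And>x. x \<in> B' \<Longrightarrow> \<Psi> x \<in> B" "\<And>x. x \<in> Z' \<Longrightarrow> \<Psi> x \<in> Z"
    and inv: "\<And>x. x \<in> Z \<Longrightarrow> \<Psi> (\<Phi> x) - x \<in> B" "\<And>x. x \<in> Z' \<Longrightarrow> \<Phi> (\<Psi> x) - x \<in> B'"
    and S: "S \<subseteq> Z'" "finite S" "\<not> module.dependent s S" "module.span s S \<inter> B' = {0}"
      "Z' \<subseteq> module.span s (S \<union> B')"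
  shows "quotient_dim scale Z B = card S"
proof -
  interpret V': vector_space s by fact
  have spS: "V'.span S \<subseteq> Z'" using S(1) V'.span_minimal[OF _ Z'] by blast
  have lin0: "\<Psi> 0 = 0" using lin(2)[OF V'.subspace_0[OF Z'], of 0] by simp
  have lins: "\<Psi> (\<Sum>a\<in>S. s (r a) a) = (\<Sum>a\<in>S. scale (r a) (\<Psi> a))" for r
  proof -
    have "T \<subseteq> S \<Longrightarrow> \<Psi> (\<Sum>a\<in>T. s (r a) a) = (\<Sum>a\<in>T. scale (r a) (\<Psi> a)) \<and> (\<Sum>a\<in>T. s (r a) a) \<in> Z'"
      if "finite T" for T
      using that
    proof (induction T)
      case empty
      then show ?case using lin0 V'.subspace_0[OF Z'] by simp
    next
      case (insert x T)
      then have "x \<in> Z'" "s (r x) x \<in> Z'" using S(1) V'.subspace_scale[OF Z'] by auto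
      then show ?case using insert lin V'.subspace_add[OF Z'] by simp
    qed
    then show ?thesis using S(2) by blast
  qed
  \<comment> \<open>\<open>\<Psi> x\<close> in \<open>B\<close> puts
    \<open>\<Phi> (\<Psi> x)\<close> in \<open>B'\<close>, and this element differs from
    \<open>x\<close> by an element of \<open>B'\<close>. Injectivity of \<open>\<Psi>\<close> on the
    span of \<open>S\<close> thus follows without linearity of \<open>\<Phi>\<close>.\<close>
  have key: "x = 0" if x: "x \<in> V'.span S" "\<Psi> x \<in> B" for x
  proof -
    have xZ: "x \<in> Z'" using x spS by blast
    have "\<Phi> (\<Psi> x) - (\<Phi> (\<Psi> x) - x) \<in> B'"
      using V'.subspace_diff[OF B'(1) \<Phi>(1)[OF x(2)] inv(2)[OF xZ]] .
    then show "x = 0" using S(4) x by auto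
  qed
  have sp: "span (\<Psi> ` S) = \<Psi> ` V'.span S" and inj: "inj_on \<Psi> (V'.span S)"
  proof -
    show inj: "inj_on \<Psi> (V'.span S)"
    proof (rule inj_onI)
      fix x y assume xy: "x \<in> V'.span S" "y \<in> V'.span S" "\<Psi> x = \<Psi> y"
      have d: "x - y \<in> V'.span S" using xy V'.span_diff by blast
      have "\<Psi> x = \<Psi> (x - y) + \<Psi> y" using lin(1)[of "x - y" y] d xy spS by auto
      then have "\<Psi> (x - y) = 0" using xy by simp
      then have "x - y = 0" using key[OF d] subspace_0[OF B(1)] by simp
      then show "x = y" by simp
    qed
    then have injS: "inj_on \<Psi> S" using V'.span_superset inj_on_subset by metis
    have "span (\<Psi> ` S) = range (\<lambda>u. \<Sum>a\<in>\<Psi> ` S. scale (u a) a)"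
      using span_finite[of "\<Psi> ` S"] S(2) by simp
    also have "\<dots> = range (\<lambda>u. \<Sum>a\<in>S. scale (u (\<Psi> a)) (\<Psi> a))"
      by (simp add: sum.reindex[OF injS] o_def)
    also have "\<dots> = range (\<lambda>u. \<Sum>a\<in>S. scale (u a) (\<Psi> a))"
    proof (intro equalityI subsetI)
      fix x assume "x \<in> range (\<lambda>u. \<Sum>a\<in>S. scale (u a) (\<Psi> a))"
      then obtain u where "x = (\<Sum>a\<in>S. scale (u a) (\<Psi> a))" by blast
      also have "\<dots> = (\<Sum>a\<in>S. scale ((u \<circ> the_inv_into S \<Psi>) (\<Psi> a)) (\<Psi> a))"
        using the_inv_into_f_f[OF injS] by (intro sum.cong) auto
      finally show "x \<in> range (\<lambda>u. \<Sum>a\<in>S. scale (u (\<Psi> a)) (\<Psi> a))" by blast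
    qed auto
    also have "\<dots> = \<Psi> ` range (\<lambda>u. \<Sum>a\<in>S. s (u a) a)" by (simp add: image_image lins)
    finally show "span (\<Psi> ` S) = \<Psi> ` V'.span S" using V'.span_finite[OF S(2)] by simp
  qed
  have injS: "inj_on \<Psi> S" using inj V'.span_superset inj_on_subset by metis
  have indep: "independent (\<Psi> ` S)"
    unfolding dependent_finite[OF finite_imageI[OF S(2)]]
  proof (clarsimp simp: sum.reindex[OF injS])
    fix u x assume u: "(\<Sum>a\<in>S. scale (u (\<Psi> a)) (\<Psi> a)) = 0" and x: "x \<in> S" "u (\<Psi> x) \<noteq> 0"
    have "(\<Sum>a\<in>S. s (u (\<Psi> a)) a) \<in> V'.span S"
      by (auto intro: V'.span_sum V'.span_scale V'.span_base)
    then have "(\<Sum>a\<in>S. s (u (\<Psi> a)) a) = 0"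
      using key lins[of "u \<circ> \<Psi>"] u subspace_0[OF B(1)] by simp
    moreover have "\<exists>v\<in>S. (u \<circ> \<Psi>) v \<noteq> 0" using x by auto
    ultimately have "V'.dependent S"
      unfolding V'.dependent_finite[OF S(2)] by (intro exI[of _ "u \<circ> \<Psi>"]) auto
    then show False using S(3) by contradiction
  qed
  have spB: "span B = B" using B(1) span_eq_iff by blast
  have "quotient_dim scale Z B = card (\<Psi> ` S)"
  proof (rule quotient_dim_eq)
    show "\<Psi> ` S \<subseteq> Z" using S(1) \<Psi> by blast
    show "span (\<Psi> ` S) \<inter> span B = {0}"
      unfolding sp spB using key lin0 subspace_0[OF B(1)] V'.span_zero by (auto intro!: image_eqI[of _ _ 0])
    show "Z \<subseteq> span (\<Psi> ` S \<union> B)"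
    proof
      fix z assume z: "z \<in> Z"
      then have "\<Phi> z \<in> V'.span (S \<union> B')" using \<Phi> S(5) by blast
      then obtain u v where uv: "\<Phi> z = u + v" "u \<in> V'.span S" "v \<in> B'"
        unfolding V'.span_Un using V'.span_eq_iff B'(1) by blast
      have "\<Psi> (\<Phi> z) = \<Psi> u + \<Psi> v" using uv lin(1)[of u v] spS B'(2) by auto
      then have e: "z = \<Psi> u + (\<Psi> v - (\<Psi> (\<Phi> z) - z))" by simp
      have 1: "\<Psi> u \<in> span (\<Psi> ` S)" using sp uv(2) by blast
      have 2: "\<Psi> v - (\<Psi> (\<Phi> z) - z) \<in> span B"
        by (rule span_base[OF subspace_diff[OF B(1) \<Psi>(1)[OF uv(3)] inv(1)[OF z]]])
      show "z \<in> span (\<Psi> ` S \<union> B)"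
        unfolding span_Un using e 1 2 by blast
    qed
  qed (use indep S(2) in auto)
  then show ?thesis using card_image[OF injS] by simp
qed

text \<open>Representatives of homology chosen degree by degree remain independent modulo
  \<open>W\<close> when put together. Homogeneity of \<open>W\<close> enters as \<open>hom\<close>:
  a sum of elements of the \<open>G e\<close> lies in \<open>W\<close> only if every summand
  does.\<close>

lemma graded_union_independent:
  assumes "finite E"
    and S: "\<And>e. e \<in> E \<Longrightarrow> S e \<subseteq> G e \<and> finite (S e) \<and> independent (S e) \<and> span (S e) \<inter> W = {0}"
    and G: "\<And>e. e \<in> E \<Longrightarrow> subspace (G e)" and W: "subspace W"
    and hom: "\<And>u e. (\<And>e. e \<in> E \<Longrightarrow> u e \<in> G e) \<Longrightarrow> (\<Sum>e\<in>E. u e) \<in> W \<Longrightarrow> e \<in> E \<Longrightarrow> u e \<in> W"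
  shows "independent (\<Union>e\<in>E. S e) \<and> span (\<Union>e\<in>E. S e) \<inter> W = {0} \<and>
    card (\<Union>e\<in>E. S e) = (\<Sum>e\<in>E. card (S e))"
proof -
  have sG: "span (S e) \<subseteq> G e" if "e \<in> E" for e
    using S[OF that] G[OF that] span_minimal by blast
  have z: "u e = 0" if u: "\<And>e. e \<in> E \<Longrightarrow> u e \<in> span (S e)" and s: "(\<Sum>e\<in>E. u e) \<in> W" and e: "e \<in> E" for u e
    using hom[of u e] u s e S[OF e] sG by blast
  have "independent (\<Union>e\<in>F. S e) \<and>
    (\<forall>x\<in>span (\<Union>e\<in>F. S e). \<exists>u. (\<forall>e\<in>F. u e \<in> span (S e)) \<and> x = (\<Sum>e\<in>F. u e)) \<and>
    card (\<Union>e\<in>F. S e) = (\<Sum>e\<in>F. card (S e))" if "F \<subseteq> E" "finite F" for F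
    using that(2,1)
  proof (induction F)
    case empty
    then show ?case by (simp add: independent_empty)
  next
    case (insert a F)
    have int: "span (S a) \<inter> span (\<Union>e\<in>F. S e) = {0}"
    proof -
      have "x = 0" if x: "x \<in> span (S a)" "x \<in> span (\<Union>e\<in>F. S e)" for x
      proof -
        obtain u where u: "\<forall>e\<in>F. u e \<in> span (S e)" "x = (\<Sum>e\<in>F. u e)"
          using insert x by blast
        \<comment> \<open>A common element \<open>x\<close> of the two spans becomes a family with
          sum 0, with \<open>- x\<close> at \<open>a\<close>; the fact \<open>z\<close> then forces
          \<open>x = 0\<close>.\<close>
        define w where "w = (\<lambda>e. if e = a then - x else if e \<in> F then u e else 0)"
        have "(\<Sum>e\<in>E. w e) = (\<Sum>e\<in>insert a F. w e)"
          using insert \<open>finite E\<close> by (intro sum.mono_neutral_right) (auto simp: w_def)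
        also have "\<dots> = - x + (\<Sum>e\<in>F. u e)"
        proof -
          have "(\<Sum>e\<in>F. w e) = (\<Sum>e\<in>F. u e)" using insert by (intro sum.cong) (auto simp: w_def)
          then show ?thesis using insert by (simp add: w_def)
        qed
        finally have "(\<Sum>e\<in>E. w e) = 0" using u by simp
        then have "(\<Sum>e\<in>E. w e) \<in> W" using subspace_0[OF W] by simp
        moreover have "w e \<in> span (S e)" for e
          using u x by (simp add: w_def span_neg span_zero)
        ultimately have "w a = 0" using z[of w a] insert(4) by blast
        then show "x = 0" by (simp add: w_def)
      qed
      then show ?thesis using span_zero by blast
    qed
    have "independent (S a \<union> (\<Union>e\<in>F. S e))"
      using independent_Un_direct[OF _ _ int] insert S[of a] by blast
    moreover have "\<exists>u. (\<forall>e\<in>insert a F. u e \<in> span (S e)) \<and> x = (\<Sum>e\<in>insert a F. u e)"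
      if x: "x \<in> span (S a \<union> (\<Union>e\<in>F. S e))" for x
    proof -
      obtain y w where yw: "x = y + w" "y \<in> span (S a)" "w \<in> span (\<Union>e\<in>F. S e)"
        using x unfolding span_Un by blast
      obtain u where u: "\<forall>e\<in>F. u e \<in> span (S e)" "w = (\<Sum>e\<in>F. u e)"
        using insert yw by blast
      have "(\<Sum>e\<in>F. (u(a := y)) e) = w" using u(2) insert by (auto intro: sum.cong)
      then show ?thesis
        by (intro exI[of _ "u(a := y)"]) (use yw u insert in auto)
    qed
    moreover have "card (S a \<union> (\<Union>e\<in>F. S e)) = card (S a) + card (\<Union>e\<in>F. S e)"
    proof (rule card_Un_disjoint)
      show "finite (S a)" "finite (\<Union>e\<in>F. S e)" using S insert by blast+
      have "x = 0" if x: "x \<in> S a" "x \<in> (\<Union>e\<in>F. S e)" for x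
      proof -
        have "x \<in> span (S a) \<inter> span (\<Union>e\<in>F. S e)" using x by (intro IntI span_base)
        then show ?thesis using int by simp
      qed
      moreover have "independent (S a)" using S[of a] insert(4) by simp
      then have "0 \<notin> S a" using dependent_zero[of "S a"] by iprover
      ultimately show "S a \<inter> (\<Union>e\<in>F. S e) = {}" by blast
    qed
    ultimately show ?case using insert by simp
  qed
  note A = this[OF order_refl \<open>finite E\<close>]
  have *: "independent (\<Union>e\<in>E. S e)"
    "\<And>x. x\<in>span (\<Union>e\<in>E. S e) \<Longrightarrow> \<exists>u. (\<forall>e\<in>E. u e \<in> span (S e)) \<and> x = (\<Sum>e\<in>E. u e)"
    "card (\<Union>e\<in>E. S e) = (\<Sum>e\<in>E. card (S e))"
    by (rule conjunct1[OF A], rule bspec[OF conjunct1[OF conjunct2[OF A]]], assumption,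
        rule conjunct2[OF conjunct2[OF A]])
  have "x = 0" if x: "x \<in> span (\<Union>e\<in>E. S e)" "x \<in> W" for x
  proof -
    obtain u where u: "\<forall>e\<in>E. u e \<in> span (S e)" "x = (\<Sum>e\<in>E. u e)" using *(2)[OF x(1)] by blast
    have "(\<Sum>e\<in>E. u e) \<in> W" using u(2) x(2) by simp
    then have "\<forall>e\<in>E. u e = 0" by (intro ballI z[OF bspec[OF u(1)]])
    then show "x = 0" unfolding u(2) by (rule sum.neutral)
  qed
  then have "span (\<Union>e\<in>E. S e) \<inter> W = {0}" using span_zero subspace_0[OF W] by auto
  then show ?thesis using *(1,3) by (intro conjI)
qed

lemma standard_basis:
  fixes key :: "'t \<Rightarrow> nat" and g :: "'t \<Rightarrow> 'b"
  assumes "finite T" "inj_on key T"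
  defines "S \<equiv> {t \<in> T. g t \<notin> span (g ` {t' \<in> T. key t' < key t})}"
  shows "dim (span (g ` T)) = card S"
proof -
  have fin: "finite S" using assms by simp
  have 1: "g t \<in> span (g ` S)" if "t \<in> T" for t
    using that
  proof (induction "key t" arbitrary: t rule: less_induct)
    case less
    show ?case
    proof (cases "t \<in> S")
      case True
      then show ?thesis by (simp add: span_base)
    next
      case False
      then have "g t \<in> span (g ` {t' \<in> T. key t' < key t})" using less by (simp add: S_def)
      moreover have "g ` {t' \<in> T. key t' < key t} \<subseteq> span (g ` S)" using less by blast
      ultimately show ?thesis using span_minimal subspace_span by blast
    qed
  qed
  then have sp: "span (g ` T) = span (g ` S)"
    by (intro equalityI span_minimal) (auto simp: S_def intro: span_base subspace_span)
  have 2: "inj_on g {t \<in> S. key t < n} \<and> independent (g ` {t \<in> S. key t < n})" for n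
  proof (induction n)
    case 0
    then show ?case by (simp add: independent_empty)
  next
    case (Suc n)
    show ?case
    proof (cases "\<exists>t\<in>S. key t = n")
      case True
      then obtain t where t: "t \<in> S" "key t = n" by blast
      have "{t \<in> S. key t < Suc n} = insert t {t \<in> S. key t < n}"
        using t assms(2) by (auto simp: less_Suc_eq S_def inj_on_def)
      moreover have "g t \<notin> span (g ` {t \<in> S. key t < n})"
      proof -
        have "{t \<in> S. key t < n} \<subseteq> {t' \<in> T. key t' < key t}" using t by (auto simp: S_def)
        then show ?thesis using t(1) span_mono[OF image_mono] unfolding S_def by blast
      qed
      moreover from this have "g t \<notin> g ` {t \<in> S. key t < n}" using span_base[of "g t"] by metis
      ultimately show ?thesis using Suc t by (simp add: independent_insertI)
    next
      case False
      then have "{t \<in> S. key t < Suc n} = {t \<in> S. key t < n}" by (auto simp: less_Suc_eq)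
      then show ?thesis using Suc by simp
    qed
  qed
  obtain n where "\<forall>t\<in>S. key t < n"
    using fin by (metis finite_imageI finite_nat_set_iff_bounded image_eqI)
  then have "{t \<in> S. key t < n} = S" by blast
  with 2[of n] have "inj_on g S" "independent (g ` S)" by simp_all
  then show ?thesis using sp dim_span_eq_card_independent by (simp add: card_image)
qed

end

lemma (in vector_space_pair) dim_kernel_plus_image:
  assumes f: "Vector_Spaces.linear s1 s2 f" and V: "vs1.subspace V" "finite F" "V \<subseteq> vs1.span F"
  shows "vs1.dim V = vs1.dim {x \<in> V. f x = 0} + vs2.dim (f ` V)"
proof -
  interpret f: Vector_Spaces.linear s1 s2 f by fact
  let ?K = "{x \<in> V. f x = 0}"
  have K: "vs1.subspace ?K"
    using V(1) by (auto simp: vs1.subspace_def f.add f.scale f.zero)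
  obtain S where S: "S \<subseteq> V" "finite S" "vs1.independent S" "vs1.span S \<inter> ?K = {0}"
    "V \<subseteq> vs1.span (S \<union> ?K)" "vs1.dim V = card S + vs1.dim ?K"
    by (rule vs1.complement_exists[OF V(1) K _ V(2,3)]) auto
  have spS: "vs1.span S \<subseteq> V" using S(1) V(1) vs1.span_minimal by blast
  have inj: "inj_on f (vs1.span S)"
  proof (rule inj_onI)
    fix x y assume xy: "x \<in> vs1.span S" "y \<in> vs1.span S" "f x = f y"
    then have d: "x - y \<in> vs1.span S" "f (x - y) = 0" by (simp_all add: vs1.span_diff f.diff)
    then have "x - y \<in> vs1.span S \<inter> ?K" using spS by blast
    then have "x - y = 0" using S(4) by blast
    then show "x = y" by simp
  qed
  have indep: "vs2.independent (f ` S)"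
    using f.independent_injective_image[OF S(3) inj] .
  have "f ` V \<subseteq> vs2.span (f ` S)"
  proof
    fix y assume "y \<in> f ` V"
    then obtain x where x: "x \<in> V" "y = f x" by blast
    then obtain u v where uv: "x = u + v" "u \<in> vs1.span S" "v \<in> vs1.span ?K"
      using S(5) unfolding vs1.span_Un by auto
    have "vs1.span ?K = ?K" by (rule vs1.span_eq_iff[THEN iffD2, OF K])
    with uv(3) have "v \<in> ?K" by metis
    then have "y = f u" using x uv by (simp add: f.add)
    then show "y \<in> vs2.span (f ` S)" using uv(2) f.span_image[of S] by simp
  qed
  then have "vs2.dim (f ` V) = card (f ` S)"
    using vs2.basis_card_eq_dim[of "f ` S" "f ` V"] S(1) indep by (simp add: image_mono)
  also have "\<dots> = card S"
    using inj vs1.span_superset[of S] by (meson card_image inj_on_subset)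
  finally show ?thesis using S(6) by simp
qed

section \<open>Comparison of resolutions\<close>

text \<open>Tensoring complexes over \<open>A\<close> along \<open>\<rho>\<close>. The instances are
  \<open>self\<close> (the complex itself), \<open>res\<close> (tensoring with \<open>k\<close>) and
  \<open>B\<close> (tensoring with \<open>R\<close> over \<open>Q\<close>). The axioms on
  \<open>\<rho>\<close> are restricted to the carrier because the ambient ring may be larger, and
  \<open>residue\<close> is a definite description that is meaningful only there.\<close>

locale base_change = standard_graded_algebra A
  for A :: "('k::field, 'a::comm_ring_1) galgebra" +
  fixes \<rho> :: "'a \<Rightarrow> 's::comm_ring_1" and C :: "'s set"
  assumes rho_add: "a \<in> gsum (gr A) \<Longrightarrow> b \<in> gsum (gr A) \<Longrightarrow> \<rho> (a + b) = \<rho> a + \<rho> b"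
    and rho_mult: "a \<in> gsum (gr A) \<Longrightarrow> b \<in> gsum (gr A) \<Longrightarrow> \<rho> (a * b) = \<rho> a * \<rho> b"
    and rho_one: "\<rho> 1 = 1"
    and C_zero: "0 \<in> C" and C_add: "x \<in> C \<Longrightarrow> y \<in> C \<Longrightarrow> x + y \<in> C"
    and C_mult: "a \<in> gsum (gr A) \<Longrightarrow> x \<in> C \<Longrightarrow> \<rho> a * x \<in> C"

text \<open>The part of \<open>hom_gens\<close> that does not mention degrees; chain maps and
  homotopies are stated with it.\<close>

definition (in standard_graded_algebra) maps :: "nat set \<Rightarrow> nat set \<Rightarrow> (nat \<Rightarrow> nat \<Rightarrow> 'a) \<Rightarrow> bool"
  where "maps B B' M \<longleftrightarrow> (\<forall>b\<in>B. M b \<in> finfam car B')"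

definition unit_vec :: "nat \<Rightarrow> nat \<Rightarrow> 'a::zero_neq_one"
  where "unit_vec b = (\<lambda>b'. if b' = b then 1 else 0)"

lemma (in standard_graded_algebra) car_minus: "a \<in> car \<Longrightarrow> - a \<in> car"
  using subspace_neg[OF subspace_C] .

lemma (in standard_graded_algebra) unit_vec_finfam: "b \<in> B \<Longrightarrow> unit_vec b \<in> finfam car B"
  by (auto simp: unit_vec_def finfam_iff one_C zero_C)

section \<open>Matrix calculus after base change\<close>

context base_change
begin

definition tmap :: "(nat \<Rightarrow> nat \<Rightarrow> 'a) \<Rightarrow> (nat \<Rightarrow> 's) \<Rightarrow> nat \<Rightarrow> 's"
  where "tmap M f = matmap (\<lambda>a m. \<rho> a * m) M f"

lemma rho_zero: "\<rho> 0 = 0"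
  using rho_add[OF zero_C zero_C] by simp

lemma rho_minus: "a \<in> car \<Longrightarrow> \<rho> (- a) = - \<rho> a"
  using rho_add[of a "- a"] car_minus[of a] rho_zero by (simp add: eq_neg_iff_add_eq_0 add.commute)

lemma rho_sum: "(\<And>i. i \<in> I \<Longrightarrow> g i \<in> car) \<Longrightarrow> \<rho> (sum g I) = (\<Sum>i\<in>I. \<rho> (g i))"
  by (induction I rule: infinite_finite_induct) (simp_all add: rho_zero rho_add sum_C)

lemma C_minus: "x \<in> C \<Longrightarrow> - x \<in> C"
  using C_mult[OF car_minus[OF one_C], of x] rho_minus[OF one_C] rho_one by simp

lemma C_sum: "(\<And>i. i \<in> I \<Longrightarrow> g i \<in> C) \<Longrightarrow> sum g I \<in> C"
  by (induction I rule: infinite_finite_induct) (simp_all add: C_zero C_add)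

lemma finfam_add: "f \<in> finfam C B \<Longrightarrow> g \<in> finfam C B \<Longrightarrow> f + g \<in> finfam C B"
  using finite_support_add[of f g] C_add unfolding finfam_iff plus_fun_apply
  by (metis add.right_neutral)

lemma finfam_uminus: "f \<in> finfam C B \<Longrightarrow> - f \<in> finfam C B"
  by (auto simp: finfam_iff C_minus)

lemma finfam_diff: "f \<in> finfam C B \<Longrightarrow> g \<in> finfam C B \<Longrightarrow> f - g \<in> finfam C B"
  using finfam_add[OF _ finfam_uminus, of f B g] by simp

lemma finfam_zero: "0 \<in> finfam C B"
  by (simp add: finfam_iff C_zero)

lemma tmap_superset:
  assumes "finite S" "{b. f b \<noteq> 0} \<subseteq> S"
  shows "tmap M f b' = (\<Sum>b\<in>S. \<rho> (M b b') * f b)"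
  unfolding tmap_def matmap_def using assms by (intro sum.mono_neutral_left) auto

lemma tmap_eq:
  assumes "f \<in> finfam C B"
  shows "tmap M f b' = (\<Sum>b | f b \<noteq> 0. \<rho> (M b b') * f b)"
  using assms by (intro tmap_superset) (auto simp: finfam_iff)

lemma tmap_zero: "tmap M 0 = 0"
  by (simp add: tmap_def matmap_def fun_eq_iff)

lemma finfam_support: "f \<in> finfam C B \<Longrightarrow> f b \<noteq> 0 \<Longrightarrow> b \<in> B"
  by (auto simp: finfam_iff)

lemma maps_car: "maps B B' M \<Longrightarrow> b \<in> B \<Longrightarrow> M b b' \<in> car"
  by (auto simp: maps_def finfam_iff)

lemma maps_support:
  assumes "maps B B' M" "f \<in> finfam C B"
  obtains T where "finite T" "\<forall>b. f b \<noteq> 0 \<longrightarrow> {b'. M b b' \<noteq> 0} \<subseteq> T" "T \<subseteq> B'"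
proof
  let ?T = "\<Union>b\<in>{b. f b \<noteq> 0}. {b'. M b b' \<noteq> 0}"
  show "finite ?T" "?T \<subseteq> B'" using assms unfolding maps_def finfam_iff by auto
qed auto

lemma tmap_in:
  assumes M: "maps B B' M" and f: "f \<in> finfam C B"
  shows "tmap M f \<in> finfam C B'"
proof -
  obtain T where T: "finite T" "\<forall>b. f b \<noteq> 0 \<longrightarrow> {b'. M b b' \<noteq> 0} \<subseteq> T" "T \<subseteq> B'"
    using maps_support[OF assms] .
  have 0: "tmap M f b' = 0" if "b' \<notin> T" for b'
  proof -
    have "\<rho> (M b b') * f b = 0" if "f b \<noteq> 0" for b
      using T(2)[rule_format, OF that] \<open>b' \<notin> T\<close> rho_zero by (metis (mono_tags) mem_Collect_eq mult_zero_left subsetD)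
    then show ?thesis unfolding tmap_eq[OF f] by (intro sum.neutral) auto
  qed
  have "tmap M f b' \<in> C" for b'
    unfolding tmap_eq[OF f]
    by (intro C_sum C_mult) (use f maps_car[OF M] in \<open>auto simp: finfam_iff\<close>)
  moreover have "{b'. tmap M f b' \<noteq> 0} \<subseteq> T" using 0 by blast
  ultimately show ?thesis unfolding finfam_iff using T finite_subset by blast
qed

lemma tmap_add:
  assumes "f \<in> finfam C B" "g \<in> finfam C B"
  shows "tmap M (f + g) = tmap M f + tmap M g"
proof
  fix b'
  let ?S = "{b. f b \<noteq> 0} \<union> {b. g b \<noteq> 0}"
  have S: "finite ?S" using assms by (simp add: finfam_iff)
  have "{b. (f + g) b \<noteq> 0} \<subseteq> ?S" by auto
  then show "tmap M (f + g) b' = (tmap M f + tmap M g) b'"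
    using tmap_superset[OF S, of f M b'] tmap_superset[OF S, of g M b']
      tmap_superset[OF S, of "f + g" M b']
    by (auto simp: sum.distrib distrib_left)
qed

lemma tmap_uminus: "tmap M (- f) = - tmap M f"
  by (simp add: tmap_def matmap_def fun_eq_iff sum_negf)

lemma tmap_diff:
  assumes "f \<in> finfam C B" "g \<in> finfam C B"
  shows "tmap M (f - g) = tmap M f - tmap M g"
  using tmap_add[OF assms(1) finfam_uminus[OF assms(2)], of M] tmap_uminus[of M g] by simp

lemma tmap_mult: "tmap M (\<lambda>b. f b * c) = (\<lambda>b. tmap M f b * c)" if "f \<in> finfam C B"
proof
  fix b'
  have "tmap M (\<lambda>b. f b * c) b' = (\<Sum>b | f b \<noteq> 0. \<rho> (M b b') * (f b * c))"
    using that by (intro tmap_superset) (auto simp: finfam_iff)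
  then show "tmap M (\<lambda>b. f b * c) b' = tmap M f b' * c"
    unfolding tmap_eq[OF that] by (simp add: sum_distrib_right mult.assoc)
qed

lemma tmap_cong:
  assumes "f \<in> finfam C B" "\<And>b. b \<in> B \<Longrightarrow> M b = N b"
  shows "tmap M f = tmap N f"
  using assms by (intro ext) (auto simp: tmap_eq finfam_iff intro!: sum.cong)

lemma tmap_mat_add:
  assumes "maps B B' M" "maps B B' N" "f \<in> finfam C B"
  shows "tmap (\<lambda>b. M b + N b) f = tmap M f + tmap N f"
proof
  fix b'
  have "\<rho> (M b b' + N b b') = \<rho> (M b b') + \<rho> (N b b')" if "f b \<noteq> 0" for b
    using that maps_car[OF assms(1)] maps_car[OF assms(2)] assms(3)
    by (intro rho_add) (auto simp: finfam_iff)
  then show "tmap (\<lambda>b. M b + N b) f b' = (tmap M f + tmap N f) b'"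
    by (simp add: tmap_eq[OF assms(3)] sum.distrib[symmetric] distrib_right)
qed

lemma tmap_mat_uminus:
  assumes "maps B B' M" "f \<in> finfam C B"
  shows "tmap (\<lambda>b. - M b) f = - tmap M f"
proof
  fix b'
  have "\<rho> (- M b b') = - \<rho> (M b b')" if "f b \<noteq> 0" for b
    using that maps_car[OF assms(1)] assms(2) by (intro rho_minus) (auto simp: finfam_iff)
  then show "tmap (\<lambda>b. - M b) f b' = (- tmap M f) b'"
    by (simp add: tmap_eq[OF assms(2)] sum_negf)
qed

lemma tmap_mat_diff:
  assumes "maps B B' M" "maps B B' N" "f \<in> finfam C B"
  shows "tmap (\<lambda>b. M b - N b) f = tmap M f - tmap N f"
proof -
  have "maps B B' (\<lambda>b. - N b)"
    using assms(2) car_minus by (auto simp: maps_def finfam_iff)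
  then show ?thesis
    using tmap_mat_add[OF assms(1) _ assms(3), of "\<lambda>b. - N b"] tmap_mat_uminus[OF assms(2,3)]
    by simp
qed

lemma tmap_mat_zero: "f \<in> finfam C B \<Longrightarrow> (\<And>b. b \<in> B \<Longrightarrow> M b = 0) \<Longrightarrow> tmap M f = 0"
  using rho_zero by (intro ext) (auto simp: tmap_eq finfam_iff intro!: sum.neutral)

lemma tmap_unit_mat: "f \<in> finfam C B \<Longrightarrow> tmap unit_vec f = f"
proof
  fix b' assume f: "f \<in> finfam C B"
  have "tmap unit_vec f b' = (\<Sum>b\<in>insert b' {b. f b \<noteq> 0}. \<rho> (unit_vec b b') * f b)"
    using f by (intro tmap_superset) (auto simp: finfam_iff)
  also have "\<dots> = (\<Sum>b\<in>insert b' {b. f b \<noteq> 0}. if b = b' then f b else 0)"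
    by (intro sum.cong) (auto simp: unit_vec_def rho_one rho_zero)
  also have "\<dots> = f b'" using f by (simp add: finfam_iff)
  finally show "tmap unit_vec f b' = f b'" .
qed

lemma tmap_unit_vec: "tmap M (unit_vec b) = (\<lambda>b'. \<rho> (M b b'))"
proof
  fix b'
  have "tmap M (unit_vec b) b' = (\<Sum>c\<in>{b}. \<rho> (M c b') * unit_vec b c)"
    by (intro tmap_superset) (auto simp: unit_vec_def)
  then show "tmap M (unit_vec b) b' = \<rho> (M b b')" by (simp add: unit_vec_def)
qed

text \<open>A finite set \<open>T\<close> containing the supports of all rows of \<open>N\<close>
  that \<open>f\<close> meets turns both sides into finite double sums, whose order can be
  exchanged.\<close>

lemma tmap_comp:
  assumes N: "maps B B' N" and M: "maps B' B'' M" and f: "f \<in> finfam C B"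
  shows "tmap M (tmap N f) = tmap (\<lambda>b. matmap (*) M (N b)) f"
proof
  fix b''
  obtain T where T: "finite T" "\<forall>b. f b \<noteq> 0 \<longrightarrow> {b'. N b b' \<noteq> 0} \<subseteq> T" "T \<subseteq> B'"
    using maps_support[OF N f] .
  let ?S = "{b. f b \<noteq> 0}"
  have z: "tmap N f b' = 0" if "b' \<notin> T" for b'
  proof -
    have "\<rho> (N b b') * f b = 0" if "f b \<noteq> 0" for b
      using T(2)[rule_format, OF that] \<open>b' \<notin> T\<close> rho_zero by (metis (mono_tags) mem_Collect_eq mult_zero_left subsetD)
    then show ?thesis unfolding tmap_eq[OF f] by (intro sum.neutral) auto
  qed
  have "tmap M (tmap N f) b'' = (\<Sum>b'\<in>T. \<rho> (M b' b'') * tmap N f b')"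
    using T(1) z by (intro tmap_superset) auto
  also have "\<dots> = (\<Sum>b'\<in>T. \<Sum>b\<in>?S. \<rho> (M b' b'') * (\<rho> (N b b') * f b))"
    by (simp add: tmap_eq[OF f] sum_distrib_left)
  also have "\<dots> = (\<Sum>b\<in>?S. \<Sum>b'\<in>T. \<rho> (M b' b'') * (\<rho> (N b b') * f b))"
    by (rule sum.swap)
  also have "\<dots> = (\<Sum>b\<in>?S. \<rho> (matmap (*) M (N b) b'') * f b)"
  proof (rule sum.cong[OF refl])
    fix b assume b: "b \<in> ?S"
    then have bB: "b \<in> B" using f by (auto simp: finfam_iff)
    have MC: "M b' b'' \<in> car" if "b' \<in> T" for b' using that T(3) maps_car[OF M] by blast
    have NC: "N b b' \<in> car" for b' using maps_car[OF N bB] .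
    have "matmap (*) M (N b) b'' = (\<Sum>b'\<in>T. M b' b'' * N b b')"
      using T(1,2) b by (intro matmap_superset) auto
    then have "\<rho> (matmap (*) M (N b) b'') = (\<Sum>b'\<in>T. \<rho> (M b' b'') * \<rho> (N b b'))"
      using MC NC by (simp add: rho_sum mult_C rho_mult)
    then show "(\<Sum>b'\<in>T. \<rho> (M b' b'') * (\<rho> (N b b') * f b)) = \<rho> (matmap (*) M (N b) b'') * f b"
      by (simp add: sum_distrib_right mult.assoc)
  qed
  also have "\<dots> = tmap (\<lambda>b. matmap (*) M (N b)) f b''" by (simp add: tmap_eq[OF f])
  finally show "tmap M (tmap N f) b'' = tmap (\<lambda>b. matmap (*) M (N b)) f b''" .
qed

end

sublocale standard_graded_algebra \<subseteq> self: base_change A "\<lambda>a. a" "gsum (gr A)"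
  by unfold_locales (auto intro: zero_C mult_C subspace_add[OF subspace_C])

context standard_graded_algebra
begin

lemma self_tmap: "self.tmap = matmap (*)"
  by (simp add: fun_eq_iff self.tmap_def)

lemmas mat_in = self.tmap_in[unfolded self_tmap]
lemmas mat_diff = self.tmap_diff[unfolded self_tmap]
lemmas mat_cong = self.tmap_cong[unfolded self_tmap]
lemmas mat_comp = self.tmap_comp[unfolded self_tmap]
lemmas mat_mat_diff = self.tmap_mat_diff[unfolded self_tmap]
lemmas mat_mat_zero = self.tmap_mat_zero[unfolded self_tmap]
lemmas mat_unit_mat = self.tmap_unit_mat[unfolded self_tmap]
lemmas mat_unit_vec = self.tmap_unit_vec[unfolded self_tmap]
lemmas mat_zero = self.tmap_zero[unfolded self_tmap]

lemma maps_comp: "maps B B' N \<Longrightarrow> maps B' B'' M \<Longrightarrow> maps B B'' (\<lambda>b. matmap (*) M (N b))"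
  using mat_in by (auto simp: maps_def)

lemma maps_diff: "maps B B' N \<Longrightarrow> maps B B' M \<Longrightarrow> maps B B' (\<lambda>b. N b - M b)"
  using self.finfam_diff by (auto simp: maps_def)

lemma maps_unit: "maps B B unit_vec"
  by (auto simp: maps_def unit_vec_finfam)

lemma hom_gens_maps: "hom_gens B deg B' deg' D \<Longrightarrow> maps B' B D"
  by (auto simp: hom_gens_def maps_def)

lemma smul_one_mult: "smul A c 1 * a = smul A c a"
  using smul_mult[of c 1 a] by simp

lemma residue_add: assumes "a \<in> car" "b \<in> car" shows "residue A (a + b) = residue A a + residue A b"
proof (rule residue_eq)
  show "a + b \<in> car" using assms subspace_add[OF subspace_C] by blast
  show "hc (a + b) 0 = smul A (residue A a + residue A b) 1"
    using hc_add[OF assms] residue_C[OF assms(1)] residue_C[OF assms(2)]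
    by (simp add: scale_left_distrib)
qed

lemma hc_mult_0: assumes "a \<in> car" "b \<in> car" shows "hc (a * b) 0 = hc a 0 * hc b 0"
proof -
  obtain n where n: "a = (\<Sum>i\<le>n. hc a i)" using hc_decomp[OF assms(1)] by (auto simp: decomp_def)
  have "a * b = (\<Sum>i\<le>n. hc a i * b)" using n by (metis sum_distrib_right)
  then have "hc (a * b) 0 = (\<Sum>i\<le>n. hc (hc a i * b) 0)"
    using hc_sum[of "{..n}" "\<lambda>i. hc a i * b" 0] assms by (simp add: mult_C gr_C[OF hc_gr])
  also have "\<dots> = (\<Sum>i\<le>n. if i = 0 then hc a 0 * hc b 0 else 0)"
    using hc_mult[OF hc_gr[OF assms(1)] assms(2), of _ 0] by (intro sum.cong) auto
  finally show ?thesis by simp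
qed

lemma residue_mult: assumes "a \<in> car" "b \<in> car" shows "residue A (a * b) = residue A a * residue A b"
proof (rule residue_eq)
  show "a * b \<in> car" using assms by (rule mult_C)
  show "hc (a * b) 0 = smul A (residue A a * residue A b) 1"
    using hc_mult_0[OF assms] residue_C[OF assms(1)] residue_C[OF assms(2)]
    by (simp add: smul_one_mult)
qed

lemma gr_smul_one: "smul A c 1 \<in> gr A 0"
  using gr_0 by blast

lemma residue_smul_one: "residue A (smul A c 1) = c"
  using residue_eq[OF gr_C[OF gr_smul_one]] hc_eq[OF decomp_gr[OF gr_smul_one]] by simp

lemma residue_gr: "a \<in> gr A d \<Longrightarrow> 0 < d \<Longrightarrow> residue A a = 0"
  using residue_0_iff[OF gr_C] hc_eq[OF decomp_gr] by simp

end

sublocale standard_graded_algebra \<subseteq> res: base_change A "residue A" UNIV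
proof unfold_locales
  show "residue A 1 = 1" using residue_smul_one[of 1] by simp
qed (auto simp: residue_add residue_mult)

section \<open>Truncated complexes, lifting and homotopies\<close>

context standard_graded_algebra
begin

definition aug_map :: "('a, 'k) gcomplex \<Rightarrow> (nat \<Rightarrow> 'a) \<Rightarrow> 'k"
  where "aug_map F f = augmap (act (residue_field A)) (aug F) f"

lemma aug_map_superset:
  assumes "finite S" "{b. f b \<noteq> 0} \<subseteq> S"
  shows "aug_map F f = (\<Sum>b\<in>S. residue A (f b) * aug F b)"
  unfolding aug_map_def augmap_def residue_field_def
  using assms res.rho_zero by (simp, intro sum.mono_neutral_left) auto

lemma aug_map_eq: "f \<in> finfam car B \<Longrightarrow> aug_map F f = (\<Sum>b | f b \<noteq> 0. residue A (f b) * aug F b)"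
  by (intro aug_map_superset) (auto simp: finfam_iff)

lemma aug_map_unit: "aug_map F (unit_vec b) = aug F b"
proof -
  have "aug_map F (unit_vec b) = (\<Sum>c\<in>{b}. residue A (unit_vec b c) * aug F c)"
    by (intro aug_map_superset) (auto simp: unit_vec_def)
  then show ?thesis by (simp add: unit_vec_def res.rho_one)
qed

lemma aug_map_diff:
  assumes "f \<in> finfam car B" "g \<in> finfam car B"
  shows "aug_map F (f - g) = aug_map F f - aug_map F g"
proof -
  let ?S = "{b. f b \<noteq> 0} \<union> {b. g b \<noteq> 0}"
  have S: "finite ?S" using assms by (simp add: finfam_iff)
  have d: "residue A (f b - g b) = residue A (f b) - residue A (g b)" for b
    using residue_add[of "f b" "- g b"] res.rho_minus[of "g b"] assms car_minus by (simp add: finfam_iff)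
  have "{b. (f - g) b \<noteq> 0} \<subseteq> ?S" by auto
  then show ?thesis
    using aug_map_superset[OF S, of f F] aug_map_superset[OF S, of g F]
      aug_map_superset[OF S, of "f - g" F]
    by (auto simp: sum_subtractf left_diff_distrib d)
qed

lemma aug_map_comp:
  assumes N: "maps B B' N" and f: "f \<in> finfam car B"
  shows "aug_map F (matmap (*) N f) = (\<Sum>b | f b \<noteq> 0. residue A (f b) * aug_map F (N b))"
proof -
  obtain T where T: "finite T" "\<forall>b. f b \<noteq> 0 \<longrightarrow> {b'. N b b' \<noteq> 0} \<subseteq> T" "T \<subseteq> B'"
    using self.maps_support[OF N f] .
  let ?S = "{b. f b \<noteq> 0}"
  have fin: "finite ?S" using f by (simp add: finfam_iff)
  have NC: "N b b' \<in> car" if "b \<in> ?S" for b b'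
    using that f self.maps_car[OF N] by (auto simp: finfam_iff)
  have fC: "f b \<in> car" for b using f by (simp add: finfam_iff)
  have z: "matmap (*) N f b' = 0" if "b' \<notin> T" for b'
  proof -
    have "N b b' = 0" if "f b \<noteq> 0" for b using T(2)[rule_format, OF that] \<open>b' \<notin> T\<close> by auto
    then show ?thesis unfolding matmap_def by (intro sum.neutral) auto
  qed
  have "aug_map F (matmap (*) N f) = (\<Sum>b'\<in>T. residue A (matmap (*) N f b') * aug F b')"
    using T(1) z by (intro aug_map_superset) auto
  also have "\<dots> = (\<Sum>b'\<in>T. \<Sum>b\<in>?S. residue A (f b) * (residue A (N b b') * aug F b'))"
  proof (rule sum.cong[OF refl])
    fix b'
    have "residue A (matmap (*) N f b') = (\<Sum>b\<in>?S. residue A (N b b' * f b))"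
      unfolding matmap_def using NC fC by (intro res.rho_sum mult_C) auto
    also have "\<dots> = (\<Sum>b\<in>?S. residue A (N b b') * residue A (f b))"
      using NC fC by (intro sum.cong residue_mult) auto
    finally show "residue A (matmap (*) N f b') * aug F b' =
        (\<Sum>b\<in>?S. residue A (f b) * (residue A (N b b') * aug F b'))"
      by (simp add: sum_distrib_left sum_distrib_right mult_ac)
  qed
  also have "\<dots> = (\<Sum>b\<in>?S. \<Sum>b'\<in>T. residue A (f b) * (residue A (N b b') * aug F b'))"
    by (rule sum.swap)
  also have "\<dots> = (\<Sum>b\<in>?S. residue A (f b) * aug_map F (N b))"
    using aug_map_superset[OF T(1), of "N _" F] T(2) by (intro sum.cong) (auto simp: sum_distrib_left)
  finally show ?thesis .
qed

text \<open>\<open>q\<close> counts differentials, so positions \<open>0\<close> to \<open>q\<close>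
  are involved. The first clause says that the augmentation is homogeneous, \<open>k\<close> being
  concentrated in degree 0.\<close>

definition complex_upto :: "nat \<Rightarrow> ('a, 'k) gcomplex \<Rightarrow> bool"
  where "complex_upto q F \<longleftrightarrow>
    (\<forall>b\<in>gens F 0. gdeg F 0 b \<noteq> 0 \<longrightarrow> aug F b = 0) \<and>
    (\<forall>i<q. hom_gens (gens F i) (gdeg F i) (gens F (Suc i)) (gdeg F (Suc i)) (bd F i)) \<and>
    (0 < q \<longrightarrow> (\<forall>b\<in>gens F 1. aug_map F (bd F 0 b) = 0)) \<and>
    (\<forall>i. Suc i < q \<longrightarrow> (\<forall>b\<in>gens F (Suc (Suc i)). matmap (*) (bd F i) (bd F (Suc i) b) = 0))"

text \<open>Exactness is required in the positions below \<open>q\<close>; the kernel in position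
  \<open>q\<close> itself is left free. That kernel is the syzygy module studied in
  \<open>koszul_generation\<close>.\<close>

definition exact_upto :: "nat \<Rightarrow> ('a, 'k) gcomplex \<Rightarrow> bool"
  where "exact_upto q F \<longleftrightarrow> complex_upto q F \<and>
    aug_map F ` finfam car (gens F 0) = UNIV \<and>
    (0 < q \<longrightarrow> {f \<in> finfam car (gens F 0). aug_map F f = 0} \<subseteq>
      matmap (*) (bd F 0) ` finfam car (gens F 1)) \<and>
    (\<forall>i. Suc i < q \<longrightarrow> {f \<in> finfam car (gens F (Suc i)). matmap (*) (bd F i) f = 0} \<subseteq>
      matmap (*) (bd F (Suc i)) ` finfam car (gens F (Suc (Suc i))))"

lemma gsum_residue_field: "gsum (mgr (residue_field A)) = UNIV"
proof -
  have "c \<in> gsum (mgr (residue_field A))" for c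
    unfolding gsum_def residue_field_def
    by (auto intro!: exI[of _ 0] exI[of _ "\<lambda>i. if i = 0 then c else 0"])
  then show ?thesis by blast
qed

lemma resolution_exact_upto:
  assumes F: "graded_free_resolution A (residue_field A) F"
  shows "exact_upto q F"
proof -
  have bd: "bd F i b \<in> matmap (*) (bd F i) ` finfam car (gens F (Suc i))" if "b \<in> gens F (Suc i)" for i b
    using mat_unit_vec[of "bd F i" b] unit_vec_finfam[OF that] by (intro image_eqI[of _ _ "unit_vec b"]) auto
  have hom: "hom_gens (gens F i) (gdeg F i) (gens F (Suc i)) (gdeg F (Suc i)) (bd F i)" for i
  proof -
    have "\<forall>i. \<forall>b \<in> gens F (Suc i). bd F i b \<in> finfam car (gens F i) \<and>
        (\<forall>b'. bd F i b b' \<in> shift (gr A) (gdeg F i b') (gdeg F (Suc i) b))"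
      using F unfolding graded_free_resolution_def by (elim conjE)
    then show ?thesis by (simp add: hom_gens_def)
  qed
  have a: "aug F b = 0" if "b \<in> gens F 0" "gdeg F 0 b \<noteq> 0" for b
  proof -
    have "aug F b \<in> mgr (residue_field A) (gdeg F 0 b)"
      using F that(1) unfolding graded_free_resolution_def by simp
    then show ?thesis using that by (simp add: residue_field_def)
  qed
  have e0: "matmap (*) (bd F 0) ` finfam car (gens F 1) = {f \<in> finfam car (gens F 0). aug_map F f = 0}"
    and e1: "matmap (*) (bd F (Suc i)) ` finfam car (gens F (Suc (Suc i))) =
      {f \<in> finfam car (gens F (Suc i)). matmap (*) (bd F i) f = 0}"
    and s: "aug_map F ` finfam car (gens F 0) = UNIV" for i
    using F gsum_residue_field unfolding graded_free_resolution_def aug_map_def by auto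
  have "complex_upto q F"
    unfolding complex_upto_def using a hom bd[of _ 0] e0 bd[of _ "Suc _"] e1 by auto
  then show ?thesis unfolding exact_upto_def using e0 e1 s by auto
qed

definition chain_map :: "nat \<Rightarrow> ('a, 'k) gcomplex \<Rightarrow> ('a, 'k) gcomplex \<Rightarrow> (nat \<Rightarrow> nat \<Rightarrow> nat \<Rightarrow> 'a) \<Rightarrow> bool"
  where "chain_map q F F' \<phi> \<longleftrightarrow> (\<forall>i\<le>q. maps (gens F i) (gens F' i) (\<phi> i)) \<and>
    (\<forall>i<q. \<forall>b\<in>gens F (Suc i). matmap (*) (bd F' i) (\<phi> (Suc i) b) = matmap (*) (\<phi> i) (bd F i b))"

lemma proj_homogeneous:
  assumes "\<forall>b. f b \<in> shift (gr A) (deg b) j"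
  shows "proj deg j f = f"
proof
  fix b
  show "proj deg j f b = f b"
    using assms[rule_format, of b] hc_eq[OF decomp_gr, of "f b" "j - deg b"]
    by (auto simp: proj_def shift_def split: if_splits)
qed

lemma shift_mult: "a \<in> shift (gr A) p q \<Longrightarrow> b \<in> shift (gr A) q r \<Longrightarrow> a * b \<in> shift (gr A) p r"
  using gr_mult[of a "q - p" b "r - q"] gr_zero by (auto simp: shift_def split: if_splits)

lemma matmap_shift:
  assumes "hom_gens B deg B' deg' D" "f \<in> finfam car B'" "\<forall>b. f b \<in> shift (gr A) (deg' b) j"
  shows "matmap (*) D f b' \<in> shift (gr A) (deg b') j"
proof -
  have "D b b' * f b \<in> shift (gr A) (deg b') j" if "f b \<noteq> 0" for b
    using assms that by (intro shift_mult) (auto simp: hom_gens_def finfam_iff)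
  then show ?thesis
    unfolding matmap_def shift_def by (auto split: if_splits intro!: gr_sum sum.neutral)
qed

text \<open>The component of degree \<open>j\<close> of any preimage is again a preimage, since
  homogeneous matrices commute with \<open>proj\<close>.\<close>

lemma hom_gens_preimage:
  assumes D: "hom_gens B deg B' deg' D" and f: "f \<in> matmap (*) D ` finfam car B'"
    and h: "\<forall>b. f b \<in> shift (gr A) (deg b) j"
  obtains g where "g \<in> finfam car B'" "matmap (*) D g = f" "\<forall>b. g b \<in> shift (gr A) (deg' b) j"
proof -
  obtain g where g: "g \<in> finfam car B'" "matmap (*) D g = f" using f by blast
  have "matmap (*) D (proj deg' j g) = f"
    using proj_matmap[OF D g(1), of j] g(2) proj_homogeneous[OF h] by simp
  then show ?thesis using that[of "proj deg' j g"] proj_finfam[OF g(1)] proj_hom[OF g(1)] by blast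
qed

lemma aug_preimage:
  assumes F: "exact_upto q F" and c: "d \<noteq> 0 \<longrightarrow> c = 0"
  obtains g where "g \<in> finfam car (gens F 0)" "aug_map F g = c" "\<forall>b. g b \<in> shift (gr A) (gdeg F 0 b) d"
proof (cases "d = 0")
  case False
  then show ?thesis
    using that[of 0] c self.finfam_zero aug_map_superset[of "{}" 0 F] gr_zero by (auto simp: shift_def)
next
  case True
  obtain f where f: "f \<in> finfam car (gens F 0)" "aug_map F f = c"
  proof -
    have "c \<in> aug_map F ` finfam car (gens F 0)" using F by (simp add: exact_upto_def)
    then show ?thesis using that by blast
  qed
  let ?g = "proj (gdeg F 0) 0 f"
  have fC: "f b \<in> car" for b using f by (simp add: finfam_iff)
  have "aug_map F ?g = (\<Sum>b | f b \<noteq> 0. residue A (?g b) * aug F b)"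
    using f(1) by (intro aug_map_superset) (auto simp: finfam_iff proj_def hc_zero split: if_splits)
  \<comment> \<open>Basis elements of nonzero degree have augmentation 0, and at those of degree 0
    the component of degree 0 has the same residue as the whole coordinate.\<close>
  also have "\<dots> = (\<Sum>b | f b \<noteq> 0. residue A (f b) * aug F b)"
  proof (rule sum.cong[OF refl])
    fix b assume "b \<in> {b. f b \<noteq> 0}"
    then have b: "b \<in> gens F 0" using f by (auto simp: finfam_iff)
    show "residue A (?g b) * aug F b = residue A (f b) * aug F b"
    proof (cases "gdeg F 0 b = 0")
      case True
      then show ?thesis by (simp add: proj_def residue_C[OF fC] residue_smul_one)
    next
      case False
      then show ?thesis using F b unfolding exact_upto_def complex_upto_def by simp
    qed
  qed
  finally show ?thesis
    using that[of ?g] proj_finfam[OF f(1)] proj_hom[OF f(1)] f True aug_map_eq[OF f(1)] by simp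
qed

text \<open>The comparison theorem: basis elements of \<open>F\<close> are lifted one position at a
  time, which uses exactness of \<open>F'\<close> below position \<open>q\<close>. Homogeneous
  preimages are chosen throughout, which gives the degrees in the third conclusion.\<close>

lemma lift_exists:
  assumes F: "complex_upto q F" and F': "exact_upto q F'"
  obtains \<phi> where "chain_map q F F' \<phi>" "\<forall>b\<in>gens F 0. aug_map F' (\<phi> 0 b) = aug F b"
    "\<forall>i\<le>q. hom_gens (gens F' i) (gdeg F' i) (gens F i) (gdeg F i) (\<phi> i)"
proof -
  define good where "good = (\<lambda>\<phi> j. (\<forall>b\<in>gens F 0. aug_map F' (\<phi> 0 b) = aug F b) \<and>
    (\<forall>i\<le>j. hom_gens (gens F' i) (gdeg F' i) (gens F i) (gdeg F i) (\<phi> i)) \<and>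
    (\<forall>i<j. \<forall>b\<in>gens F (Suc i). matmap (*) (bd F' i) (\<phi> (Suc i) b) = matmap (*) (\<phi> i) (bd F i b)))"
  have "j \<le> q \<Longrightarrow> \<exists>\<phi>. good \<phi> j" for j
  proof (induction j)
    case 0
    have "\<forall>b\<in>gens F 0. \<exists>g. g \<in> finfam car (gens F' 0) \<and> aug_map F' g = aug F b \<and>
      (\<forall>b'. g b' \<in> shift (gr A) (gdeg F' 0 b') (gdeg F 0 b))"
    proof
      fix b assume "b \<in> gens F 0"
      then have "gdeg F 0 b \<noteq> 0 \<longrightarrow> aug F b = 0" using F by (simp add: complex_upto_def)
      then show "\<exists>g. g \<in> finfam car (gens F' 0) \<and> aug_map F' g = aug F b \<and>
        (\<forall>b'. g b' \<in> shift (gr A) (gdeg F' 0 b') (gdeg F 0 b))"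
        using aug_preimage[OF F'] by metis
    qed
    from bchoice[OF this] obtain g where "\<forall>b\<in>gens F 0. g b \<in> finfam car (gens F' 0) \<and> aug_map F' (g b) = aug F b \<and>
      (\<forall>b'. g b b' \<in> shift (gr A) (gdeg F' 0 b') (gdeg F 0 b))"
      by (elim exE)
    then have "good (\<lambda>_. g) 0" unfolding good_def hom_gens_def by simp
    then show ?case by (rule exI[of "\<lambda>\<phi>. good \<phi> 0"])
  next
    case (Suc j)
    then obtain \<phi> where \<phi>: "good \<phi> j" by auto
    have hom: "hom_gens (gens F i) (gdeg F i) (gens F (Suc i)) (gdeg F (Suc i)) (bd F i)" if "i < q" for i
      using F that by (simp add: complex_upto_def)
    have hom': "hom_gens (gens F' j) (gdeg F' j) (gens F' (Suc j)) (gdeg F' (Suc j)) (bd F' j)"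
      using F' Suc by (simp add: complex_upto_def exact_upto_def)
    have h\<phi>: "hom_gens (gens F' i) (gdeg F' i) (gens F i) (gdeg F i) (\<phi> i)" if "i \<le> j" for i
      using \<phi> that by (simp add: good_def)
    have "\<forall>b\<in>gens F (Suc j). \<exists>g. g \<in> finfam car (gens F' (Suc j)) \<and>
      matmap (*) (bd F' j) g = matmap (*) (\<phi> j) (bd F j b) \<and>
      (\<forall>b'. g b' \<in> shift (gr A) (gdeg F' (Suc j) b') (gdeg F (Suc j) b))"
    proof
      fix b assume b: "b \<in> gens F (Suc j)"
      let ?t = "matmap (*) (\<phi> j) (bd F j b)"
      have bdb: "bd F j b \<in> finfam car (gens F j)"
        "\<forall>b'. bd F j b b' \<in> shift (gr A) (gdeg F j b') (gdeg F (Suc j) b)"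
        using hom[of j] Suc b by (auto simp: hom_gens_def)
      have t: "?t \<in> finfam car (gens F' j)" using mat_in[OF hom_gens_maps[OF h\<phi>] bdb(1)] by simp
      have th: "\<forall>b'. ?t b' \<in> shift (gr A) (gdeg F' j b') (gdeg F (Suc j) b)"
        using matmap_shift[OF h\<phi> bdb] by simp
      have "?t \<in> matmap (*) (bd F' j) ` finfam car (gens F' (Suc j))"
      proof (cases j)
        case 0
        have "aug_map F' ?t = (\<Sum>c | bd F j b c \<noteq> 0. residue A (bd F j b c) * aug_map F' (\<phi> j c))"
          using aug_map_comp[OF hom_gens_maps[OF h\<phi>] bdb(1)] by simp
        also have "\<dots> = aug_map F (bd F j b)"
          unfolding aug_map_eq[OF bdb(1)]
          using \<phi> bdb(1) 0 by (intro sum.cong) (auto simp: good_def finfam_iff)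
        also have "\<dots> = 0" using F b Suc 0 by (simp add: complex_upto_def)
        finally show ?thesis using F' t Suc 0 unfolding exact_upto_def by auto
      next
        case (Suc i)
        have m: "maps (gens F' j) (gens F' i) (bd F' i)"
        proof (rule hom_gens_maps)
          have "i < q" using Suc.prems Suc by simp
          then show "hom_gens (gens F' i) (gdeg F' i) (gens F' j) (gdeg F' j) (bd F' i)"
            using F' Suc by (simp add: exact_upto_def complex_upto_def)
        qed
        have "matmap (*) (bd F' i) ?t = matmap (*) (\<lambda>c. matmap (*) (bd F' i) (\<phi> j c)) (bd F j b)"
          by (rule mat_comp[OF hom_gens_maps[OF h\<phi>] m bdb(1)]) simp
        also have "\<dots> = matmap (*) (\<lambda>c. matmap (*) (\<phi> i) (bd F i c)) (bd F j b)"
          by (rule mat_cong[OF bdb(1)]) (use \<phi> Suc in \<open>auto simp: good_def\<close>)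
        also have "\<dots> = matmap (*) (\<phi> i) (matmap (*) (bd F i) (bd F j b))"
        proof (rule mat_comp[OF _ _ bdb(1), symmetric])
          show "maps (gens F j) (gens F i) (bd F i)"
            using hom_gens_maps[OF hom, of i] Suc.prems Suc by auto
          show "maps (gens F i) (gens F' i) (\<phi> i)" using hom_gens_maps[OF h\<phi>, of i] Suc by auto
        qed
        also have "\<dots> = 0" using F b Suc.prems Suc mat_zero by (simp add: complex_upto_def)
        finally have "?t \<in> {f \<in> finfam car (gens F' (Suc i)). matmap (*) (bd F' i) f = 0}"
          using t Suc by simp
        moreover have "Suc i < q" using Suc.prems Suc by simp
        then have "{f \<in> finfam car (gens F' (Suc i)). matmap (*) (bd F' i) f = 0} \<subseteq>
            matmap (*) (bd F' (Suc i)) ` finfam car (gens F' (Suc (Suc i)))"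
          using F' by (simp add: exact_upto_def)
        ultimately have "?t \<in> matmap (*) (bd F' (Suc i)) ` finfam car (gens F' (Suc (Suc i)))"
          by (rule subsetD[rotated])
        then show ?thesis by (simp only: Suc)
      qed
      from hom_gens_preimage[OF hom' this th] show "\<exists>g. g \<in> finfam car (gens F' (Suc j)) \<and>
        matmap (*) (bd F' j) g = ?t \<and> (\<forall>b'. g b' \<in> shift (gr A) (gdeg F' (Suc j) b') (gdeg F (Suc j) b))"
        by metis
    qed
    from bchoice[OF this] obtain g where g: "\<forall>b\<in>gens F (Suc j). g b \<in> finfam car (gens F' (Suc j)) \<and>
      matmap (*) (bd F' j) (g b) = matmap (*) (\<phi> j) (bd F j b) \<and>
      (\<forall>b'. g b b' \<in> shift (gr A) (gdeg F' (Suc j) b') (gdeg F (Suc j) b))"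
      by (elim exE)
    have "good (\<phi>(Suc j := g)) (Suc j)"
      using \<phi> g unfolding good_def by (auto simp: hom_gens_def le_Suc_eq less_Suc_eq)
    then show ?case by (rule exI[of "\<lambda>\<phi>. good \<phi> (Suc j)"])
  qed
  then obtain \<phi> where \<phi>: "good \<phi> q" by blast
  note \<phi>' = \<phi>[unfolded good_def]
  have "maps (gens F i) (gens F' i) (\<phi> i)" if "i \<le> q" for i
    by (rule hom_gens_maps[where deg = "gdeg F' i" and deg' = "gdeg F i"]) (use \<phi>' that in simp)
  then have "chain_map q F F' \<phi>"
    unfolding chain_map_def using \<phi>' by simp
  then show ?thesis
    by (rule that[OF _ conjunct1[OF \<phi>'] conjunct1[OF conjunct2[OF \<phi>']]])
qed

text \<open>A chain map that induces 0 on \<open>k\<close> is null-homotopic below position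
  \<open>q\<close>. In position \<open>q\<close> there need not be a preimage; the last conclusion
  records that the defect left there is still a cycle, and this is what
  \<open>koszul_generation_step\<close> works with.\<close>

lemma homotopy_exists:
  assumes F: "complex_upto q F" and F': "exact_upto q F'" and \<chi>: "chain_map q F F' \<chi>"
    and aug: "\<forall>b\<in>gens F 0. aug_map F' (\<chi> 0 b) = 0"
  obtains \<sigma> where "\<forall>i<q. maps (gens F i) (gens F' (Suc i)) (\<sigma> i)"
    "0 < q \<longrightarrow> (\<forall>b\<in>gens F 0. matmap (*) (bd F' 0) (\<sigma> 0 b) = \<chi> 0 b)"
    "\<forall>i. Suc i < q \<longrightarrow> (\<forall>b\<in>gens F (Suc i).
      matmap (*) (bd F' (Suc i)) (\<sigma> (Suc i) b) = \<chi> (Suc i) b - matmap (*) (\<sigma> i) (bd F i b))"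
    "\<forall>i<q. \<forall>b\<in>gens F (Suc i). matmap (*) (bd F' i) (\<chi> (Suc i) b - matmap (*) (\<sigma> i) (bd F i b)) = 0"
proof -
  define good where "good = (\<lambda>\<sigma> j. (\<forall>i<j. maps (gens F i) (gens F' (Suc i)) (\<sigma> i)) \<and>
    (0 < j \<longrightarrow> (\<forall>b\<in>gens F 0. matmap (*) (bd F' 0) (\<sigma> 0 b) = \<chi> 0 b)) \<and>
    (\<forall>i. Suc i < j \<longrightarrow> (\<forall>b\<in>gens F (Suc i).
      matmap (*) (bd F' (Suc i)) (\<sigma> (Suc i) b) = \<chi> (Suc i) b - matmap (*) (\<sigma> i) (bd F i b))))"
  have hom: "maps (gens F (Suc i)) (gens F i) (bd F i)" if "i < q" for i
    using F that hom_gens_maps by (auto simp: complex_upto_def)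
  have hom': "maps (gens F' (Suc i)) (gens F' i) (bd F' i)" if "i < q" for i
    using F' that hom_gens_maps by (auto simp: complex_upto_def exact_upto_def)
  have m\<chi>: "maps (gens F i) (gens F' i) (\<chi> i)" if "i \<le> q" for i
    using \<chi> that by (simp add: chain_map_def)
  have cyc: "matmap (*) (bd F' i) (\<chi> (Suc i) b - matmap (*) (\<sigma> i) (bd F i b)) = 0"
    and fin: "\<chi> (Suc i) b - matmap (*) (\<sigma> i) (bd F i b) \<in> finfam car (gens F' (Suc i))"
    if g: "good \<sigma> j" and i: "i < j" "j \<le> q" and b: "b \<in> gens F (Suc i)" for \<sigma> i j b
  proof -
    have bdb: "bd F i b \<in> finfam car (gens F i)" using hom i b by (auto simp: maps_def)
    have m\<sigma>: "maps (gens F l) (gens F' (Suc l)) (\<sigma> l)" if "l \<le> i" for l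
      using g i that by (simp add: good_def)
    have c1: "\<chi> (Suc i) b \<in> finfam car (gens F' (Suc i))" using m\<chi>[of "Suc i"] i b by (auto simp: maps_def)
    have c2: "matmap (*) (\<sigma> i) (bd F i b) \<in> finfam car (gens F' (Suc i))"
      using mat_in[OF m\<sigma> bdb] by simp
    show "\<chi> (Suc i) b - matmap (*) (\<sigma> i) (bd F i b) \<in> finfam car (gens F' (Suc i))"
      by (rule self.finfam_diff[OF c1 c2])
    have "matmap (*) (bd F' i) (matmap (*) (\<sigma> i) (bd F i b)) =
        matmap (*) (\<lambda>c. matmap (*) (bd F' i) (\<sigma> i c)) (bd F i b)"
      by (rule mat_comp[OF m\<sigma> hom' bdb]) (use i in auto)
    also have "\<dots> = matmap (*) (\<chi> i) (bd F i b)"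
    proof (cases i)
      case 0
      then show ?thesis using g i by (intro mat_cong[OF bdb]) (simp add: good_def)
    next
      case (Suc l)
      have "matmap (*) (\<lambda>c. matmap (*) (bd F' i) (\<sigma> i c)) (bd F i b) =
          matmap (*) (\<lambda>c. \<chi> i c - matmap (*) (\<sigma> l) (bd F l c)) (bd F i b)"
        by (rule mat_cong[OF bdb]) (use g i Suc in \<open>simp add: good_def\<close>)
      also have "\<dots> = matmap (*) (\<chi> i) (bd F i b) - matmap (*) (\<lambda>c. matmap (*) (\<sigma> l) (bd F l c)) (bd F i b)"
        by (rule mat_mat_diff[OF m\<chi> maps_comp bdb]) (use m\<sigma>[of l] hom[of l] i Suc in auto)
      also have "matmap (*) (\<lambda>c. matmap (*) (\<sigma> l) (bd F l c)) (bd F i b) =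
          matmap (*) (\<sigma> l) (matmap (*) (bd F l) (bd F i b))"
        by (rule mat_comp[OF _ _ bdb, symmetric]) (use m\<sigma>[of l] hom[of l] i Suc in auto)
      also have "matmap (*) (bd F l) (bd F i b) = 0"
        using F b i Suc by (simp add: complex_upto_def)
      finally show ?thesis unfolding mat_zero by (simp only: diff_0_right)
    qed
    also have "\<dots> = matmap (*) (bd F' i) (\<chi> (Suc i) b)"
      using \<chi> i b by (simp add: chain_map_def)
    finally show "matmap (*) (bd F' i) (\<chi> (Suc i) b - matmap (*) (\<sigma> i) (bd F i b)) = 0"
      using mat_diff[OF c1 c2, of "bd F' i"] by simp
  qed
  have "j \<le> q \<Longrightarrow> \<exists>\<sigma>. good \<sigma> j" for j
  proof (induction j)
    case 0
    show ?case by (simp add: good_def)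
  next
    case (Suc j)
    then obtain \<sigma> where \<sigma>: "good \<sigma> j" by auto
    \<comment> \<open>The element whose preimage under the differential of \<open>F'\<close> becomes
      \<open>\<sigma> j b\<close>; in position 0 there is no earlier homotopy to subtract.\<close>
    define \<tau> where "\<tau> = (\<lambda>b. case j of 0 \<Rightarrow> \<chi> 0 b | Suc i \<Rightarrow> \<chi> (Suc i) b - matmap (*) (\<sigma> i) (bd F i b))"
    have "\<forall>b\<in>gens F j. \<exists>g. g \<in> finfam car (gens F' (Suc j)) \<and> matmap (*) (bd F' j) g = \<tau> b"
    proof
      fix b assume b: "b \<in> gens F j"
      have "\<tau> b \<in> matmap (*) (bd F' j) ` finfam car (gens F' (Suc j))"
      proof (cases j)
        case 0
        then have "\<chi> 0 b \<in> {f \<in> finfam car (gens F' 0). aug_map F' f = 0}"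
          using b aug m\<chi>[of 0] by (simp add: maps_def)
        then show ?thesis using F' Suc 0 unfolding exact_upto_def \<tau>_def by auto
      next
        case (Suc i)
        have "\<chi> (Suc i) b - matmap (*) (\<sigma> i) (bd F i b) \<in>
            {f \<in> finfam car (gens F' (Suc i)). matmap (*) (bd F' i) f = 0}"
          using cyc[OF \<sigma>, of i b] fin[OF \<sigma>, of i b] b Suc.prems Suc by simp
        moreover have "Suc i < q" using Suc.prems Suc by simp
        ultimately show ?thesis using F' Suc unfolding exact_upto_def \<tau>_def by auto
      qed
      then obtain g where "\<tau> b = matmap (*) (bd F' j) g" "g \<in> finfam car (gens F' (Suc j))"
        by (rule imageE)
      then show "\<exists>g. g \<in> finfam car (gens F' (Suc j)) \<and> matmap (*) (bd F' j) g = \<tau> b"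
        by (intro exI[of _ g] conjI) simp_all
    qed
    from bchoice[OF this] obtain g where g: "\<forall>b\<in>gens F j. g b \<in> finfam car (gens F' (Suc j)) \<and> matmap (*) (bd F' j) (g b) = \<tau> b"
      by (elim exE)
    have "good (\<sigma>(j := g)) (Suc j)"
      using \<sigma> g unfolding good_def \<tau>_def by (auto simp: maps_def less_Suc_eq)
    then show ?case by (rule exI[of "\<lambda>\<sigma>. good \<sigma> (Suc j)"])
  qed
  then obtain \<sigma> where \<sigma>: "good \<sigma> q" by blast
  note \<sigma>' = \<sigma>[unfolded good_def]
  show ?thesis
    by (rule that[OF conjunct1[OF \<sigma>'] conjunct1[OF conjunct2[OF \<sigma>']] conjunct2[OF conjunct2[OF \<sigma>']]])
      (use cyc[OF \<sigma>] in simp)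
qed

lemma chain_map_comp:
  assumes \<phi>: "chain_map q F F' \<phi>" and \<psi>: "chain_map q F' F'' \<psi>"
    and c: "complex_upto q F" "complex_upto q F'" "complex_upto q F''"
  shows "chain_map q F F'' (\<lambda>i b. matmap (*) (\<psi> i) (\<phi> i b))"
  unfolding chain_map_def
proof (intro conjI allI impI ballI)
  show "maps (gens F i) (gens F'' i) (\<lambda>b. matmap (*) (\<psi> i) (\<phi> i b))" if "i \<le> q" for i
    using \<phi> \<psi> that by (intro maps_comp) (auto simp: chain_map_def)
next
  fix i b assume i: "i < q" and b: "b \<in> gens F (Suc i)"
  have m: "maps (gens F j) (gens F' j) (\<phi> j)" "maps (gens F' j) (gens F'' j) (\<psi> j)" if "j \<le> q" for j
    using \<phi> \<psi> that by (auto simp: chain_map_def)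
  have d: "maps (gens F (Suc i)) (gens F i) (bd F i)" "maps (gens F' (Suc i)) (gens F' i) (bd F' i)"
    "maps (gens F'' (Suc i)) (gens F'' i) (bd F'' i)"
    using c i hom_gens_maps by (auto simp: complex_upto_def)
  have \<phi>b: "\<phi> (Suc i) b \<in> finfam car (gens F' (Suc i))" using m(1)[of "Suc i"] i b by (auto simp: maps_def)
  have bdb: "bd F i b \<in> finfam car (gens F i)" using d(1) b by (auto simp: maps_def)
  have "matmap (*) (bd F'' i) (matmap (*) (\<psi> (Suc i)) (\<phi> (Suc i) b)) =
      matmap (*) (\<lambda>c. matmap (*) (bd F'' i) (\<psi> (Suc i) c)) (\<phi> (Suc i) b)"
    by (rule mat_comp[OF m(2) d(3) \<phi>b]) (use i in simp)
  also have "\<dots> = matmap (*) (\<lambda>c. matmap (*) (\<psi> i) (bd F' i c)) (\<phi> (Suc i) b)"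
    by (rule mat_cong[OF \<phi>b]) (use \<psi> i in \<open>simp add: chain_map_def\<close>)
  also have "\<dots> = matmap (*) (\<psi> i) (matmap (*) (bd F' i) (\<phi> (Suc i) b))"
    by (rule mat_comp[OF d(2) m(2) \<phi>b, symmetric]) (use i in simp)
  also have "matmap (*) (bd F' i) (\<phi> (Suc i) b) = matmap (*) (\<phi> i) (bd F i b)"
    using \<phi> i b by (simp add: chain_map_def)
  also have "matmap (*) (\<psi> i) \<dots> = matmap (*) (\<lambda>c. matmap (*) (\<psi> i) (\<phi> i c)) (bd F i b)"
    by (rule mat_comp[OF m(1) m(2) bdb]) (use i in simp_all)
  finally show "matmap (*) (bd F'' i) (matmap (*) (\<psi> (Suc i)) (\<phi> (Suc i) b)) =
      matmap (*) (\<lambda>c. matmap (*) (\<psi> i) (\<phi> i c)) (bd F i b)" .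
qed

text \<open>Both maps preserve the augmentation, so their composition minus the identity induces 0
  on \<open>k\<close>. \<open>F'\<close> need not be exact: it serves only as an intermediate
  complex.\<close>

lemma homotopy_to_identity:
  assumes F: "exact_upto q F" and F': "complex_upto q F'"
    and \<phi>: "chain_map q F F' \<phi>" "\<forall>b\<in>gens F 0. aug_map F' (\<phi> 0 b) = aug F b"
    and \<psi>: "chain_map q F' F \<psi>" "\<forall>b\<in>gens F' 0. aug_map F (\<psi> 0 b) = aug F' b"
  defines "\<chi> \<equiv> \<lambda>i b. matmap (*) (\<psi> i) (\<phi> i b) - unit_vec b"
  obtains \<sigma> where "\<forall>i\<le>q. maps (gens F i) (gens F i) (\<chi> i)"
    "\<forall>i<q. maps (gens F i) (gens F (Suc i)) (\<sigma> i)"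
    "0 < q \<longrightarrow> (\<forall>b\<in>gens F 0. matmap (*) (bd F 0) (\<sigma> 0 b) = \<chi> 0 b)"
    "\<forall>i. Suc i < q \<longrightarrow> (\<forall>b\<in>gens F (Suc i).
      matmap (*) (bd F (Suc i)) (\<sigma> (Suc i) b) = \<chi> (Suc i) b - matmap (*) (\<sigma> i) (bd F i b))"
    "\<forall>i<q. \<forall>b\<in>gens F (Suc i). matmap (*) (bd F i) (\<chi> (Suc i) b - matmap (*) (\<sigma> i) (bd F i b)) = 0"
proof -
  have cF: "complex_upto q F" using F by (simp add: exact_upto_def)
  let ?\<theta> = "\<lambda>i b. matmap (*) (\<psi> i) (\<phi> i b)"
  have \<theta>: "chain_map q F F ?\<theta>" by (rule chain_map_comp[OF \<phi>(1) \<psi>(1) cF F' cF])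
  have m: "maps (gens F i) (gens F i) (?\<theta> i)" if "i \<le> q" for i
    using \<theta> that by (auto simp: chain_map_def)
  have m\<chi>: "\<forall>i\<le>q. maps (gens F i) (gens F i) (\<chi> i)"
    unfolding \<chi>_def using m by (auto intro!: maps_diff maps_unit)
  have "chain_map q F F \<chi>"
    unfolding chain_map_def
  proof (intro conjI allI impI ballI)
    fix i b assume i: "i < q" and b: "b \<in> gens F (Suc i)"
    have d: "maps (gens F (Suc i)) (gens F i) (bd F i)"
      using cF i hom_gens_maps by (auto simp: complex_upto_def)
    have bdb: "bd F i b \<in> finfam car (gens F i)" using d b by (auto simp: maps_def)
    have \<theta>b: "?\<theta> (Suc i) b \<in> finfam car (gens F (Suc i))" using m[of "Suc i"] i b by (auto simp: maps_def)
    have "matmap (*) (bd F i) (\<chi> (Suc i) b) = matmap (*) (?\<theta> i) (bd F i b) - bd F i b"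
      unfolding \<chi>_def using mat_diff[OF \<theta>b unit_vec_finfam[OF b]] mat_unit_vec[of "bd F i" b] \<theta> i b
      by (simp add: chain_map_def)
    also have "\<dots> = matmap (*) (\<chi> i) (bd F i b)"
      unfolding \<chi>_def using mat_mat_diff[OF m[of i] maps_unit bdb] mat_unit_mat[OF bdb] i by simp
    finally show "matmap (*) (bd F i) (\<chi> (Suc i) b) = matmap (*) (\<chi> i) (bd F i b)" .
  qed (use m\<chi> in blast)
  moreover have "\<forall>b\<in>gens F 0. aug_map F (\<chi> 0 b) = 0"
  proof
    fix b assume b: "b \<in> gens F 0"
    have m0: "maps (gens F 0) (gens F' 0) (\<phi> 0)" "maps (gens F' 0) (gens F 0) (\<psi> 0)"
      using \<phi> \<psi> by (auto simp: chain_map_def)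
    have \<phi>b: "\<phi> 0 b \<in> finfam car (gens F' 0)" using m0 b by (auto simp: maps_def)
    have "aug_map F (?\<theta> 0 b) = (\<Sum>c | \<phi> 0 b c \<noteq> 0. residue A (\<phi> 0 b c) * aug_map F (\<psi> 0 c))"
      by (rule aug_map_comp[OF m0(2) \<phi>b])
    also have "\<dots> = aug_map F' (\<phi> 0 b)"
      unfolding aug_map_eq[OF \<phi>b] using \<psi>(2) \<phi>b by (intro sum.cong) (auto simp: finfam_iff)
    finally have "aug_map F (?\<theta> 0 b) = aug F b" using \<phi>(2) b by simp
    then show "aug_map F (\<chi> 0 b) = 0"
      unfolding \<chi>_def using aug_map_diff[OF _ unit_vec_finfam[OF b]] m[of 0] b aug_map_unit
      by (auto simp: maps_def)
  qed
  ultimately show ?thesis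
    by (rule homotopy_exists[OF cF F]) (erule (3) that[OF m\<chi>])
qed

end

section \<open>Homology after base change and its independence of the resolution\<close>

context base_change
begin

definition vs :: "'k \<Rightarrow> (nat \<Rightarrow> 's) \<Rightarrow> nat \<Rightarrow> 's"
  where "vs c f = (\<lambda>b. \<rho> (smul A c 1) * f b)"

definition homology_cycles :: "('a, 'm) gcomplex \<Rightarrow> nat \<Rightarrow> (nat \<Rightarrow> 's) set"
  where "homology_cycles F i = {f \<in> finfam C (gens F i). i \<noteq> 0 \<longrightarrow> tmap (bd F (i - 1)) f = 0}"

definition homology_boundaries :: "('a, 'm) gcomplex \<Rightarrow> nat \<Rightarrow> (nat \<Rightarrow> 's) set"
  where "homology_boundaries F i = tmap (bd F i) ` finfam C (gens F (Suc i))"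

lemma smul_one_car: "smul A c 1 \<in> car"
  by (rule gr_C[OF gr_smul_one])

lemma vector_space_vs: "vector_space vs"
proof
  fix a b :: 'k and x y :: "nat \<Rightarrow> 's"
  show "vs a (x + y) = vs a x + vs a y" by (simp add: vs_def fun_eq_iff distrib_left)
  show "vs (a + b) x = vs a x + vs b x"
    by (simp add: vs_def fun_eq_iff scale_left_distrib rho_add smul_one_car distrib_right)
  show "vs a (vs b x) = vs (a * b) x"
    using rho_mult[OF smul_one_car[of a] smul_one_car[of b]]
    by (simp add: vs_def fun_eq_iff smul_one_mult mult.assoc[symmetric])
  show "vs 1 x = x" by (simp add: vs_def rho_one)
qed

lemma vs_eq_mult: "vs c f = (\<lambda>b. f b * \<rho> (smul A c 1))"
  by (simp add: vs_def mult.commute)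

lemma tmap_vs: "f \<in> finfam C B \<Longrightarrow> tmap M (vs c f) = vs c (tmap M f)"
  using tmap_mult[of f B M "\<rho> (smul A c 1)"] by (simp add: vs_eq_mult)

lemma finfam_vs: "f \<in> finfam C B \<Longrightarrow> vs c f \<in> finfam C B"
proof -
  assume f: "f \<in> finfam C B"
  have "{b. vs c f b \<noteq> 0} \<subseteq> {b. f b \<noteq> 0}" by (auto simp: vs_def)
  then show ?thesis
    using f C_mult[OF smul_one_car] unfolding finfam_iff
    by (auto simp: vs_def dest: finite_subset)
qed

lemma subspace_homology_cycles: "module.subspace vs (homology_cycles F i)"
proof -
  interpret V: vector_space vs by (rule vector_space_vs)
  show ?thesis
    by (rule V.subspaceI) (auto simp: homology_cycles_def finfam_zero finfam_add finfam_vs tmap_zero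
      tmap_add tmap_vs vs_def[of _ 0])
qed

lemma subspace_homology_boundaries: "module.subspace vs (homology_boundaries F i)"
proof -
  interpret V: vector_space vs by (rule vector_space_vs)
  show ?thesis
  proof (rule V.subspaceI)
    show "0 \<in> homology_boundaries F i"
      unfolding homology_boundaries_def using finfam_zero tmap_zero by (intro image_eqI[of _ _ 0]) auto
  next
    fix x y assume "x \<in> homology_boundaries F i" "y \<in> homology_boundaries F i"
    then obtain f g where fg: "f \<in> finfam C (gens F (Suc i))" "g \<in> finfam C (gens F (Suc i))"
      "x = tmap (bd F i) f" "y = tmap (bd F i) g" unfolding homology_boundaries_def by blast
    then have "x + y = tmap (bd F i) (f + g)" by (simp add: tmap_add)
    then show "x + y \<in> homology_boundaries F i"
      unfolding homology_boundaries_def using finfam_add fg by blast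
  next
    fix c x assume "x \<in> homology_boundaries F i"
    then obtain f where f: "f \<in> finfam C (gens F (Suc i))" "x = tmap (bd F i) f"
      unfolding homology_boundaries_def by blast
    then have "vs c x = tmap (bd F i) (vs c f)" by (simp add: tmap_vs)
    then show "vs c x \<in> homology_boundaries F i"
      unfolding homology_boundaries_def using finfam_vs f by blast
  qed
qed

lemma complex_upto_maps: "complex_upto q F \<Longrightarrow> i < q \<Longrightarrow> maps (gens F (Suc i)) (gens F i) (bd F i)"
  using hom_gens_maps by (auto simp: complex_upto_def)

lemma homology_boundaries_cycles:
  assumes F: "complex_upto (Suc i) F"
  shows "homology_boundaries F i \<subseteq> homology_cycles F i"
proof
  fix x assume "x \<in> homology_boundaries F i"
  then obtain f where f: "f \<in> finfam C (gens F (Suc i))" "x = tmap (bd F i) f"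
    unfolding homology_boundaries_def by blast
  have m: "maps (gens F (Suc j)) (gens F j) (bd F j)" if "j \<le> i" for j
    using complex_upto_maps[OF F] that by simp
  have "tmap (bd F j) x = 0" if "i = Suc j" for j
  proof -
    have "tmap (bd F j) x = tmap (\<lambda>b. matmap (*) (bd F j) (bd F i b)) f"
      unfolding f(2) by (rule tmap_comp[OF m _ f(1)]) (use m[of j] that in auto)
    also have "\<dots> = 0" by (rule tmap_mat_zero[OF f(1)]) (use F that in \<open>simp add: complex_upto_def\<close>)
    finally show ?thesis .
  qed
  moreover have "x \<in> finfam C (gens F i)" using tmap_in[OF m f(1)] f(2) by simp
  ultimately show "x \<in> homology_cycles F i"
    unfolding homology_cycles_def by (cases i) auto
qed

lemma tmap_chain_map:
  assumes \<phi>: "chain_map q F F' \<phi>" and c: "complex_upto q F" "complex_upto q F'"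
    and i: "i < q" and f: "f \<in> finfam C (gens F (Suc i))"
  shows "tmap (bd F' i) (tmap (\<phi> (Suc i)) f) = tmap (\<phi> i) (tmap (bd F i) f)"
proof -
  have m: "maps (gens F j) (gens F' j) (\<phi> j)" if "j \<le> q" for j
    using \<phi> that by (auto simp: chain_map_def)
  have "tmap (bd F' i) (tmap (\<phi> (Suc i)) f) = tmap (\<lambda>b. matmap (*) (bd F' i) (\<phi> (Suc i) b)) f"
    by (rule tmap_comp[OF m complex_upto_maps[OF c(2) i] f]) (use i in simp)
  also have "\<dots> = tmap (\<lambda>b. matmap (*) (\<phi> i) (bd F i b)) f"
    by (rule tmap_cong[OF f]) (use \<phi> i in \<open>simp add: chain_map_def\<close>)
  also have "\<dots> = tmap (\<phi> i) (tmap (bd F i) f)"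
    by (rule tmap_comp[OF complex_upto_maps[OF c(1) i] m f, symmetric]) (use i in simp)
  finally show ?thesis .
qed

lemma chain_map_homology:
  assumes \<phi>: "chain_map (Suc i) F F' \<phi>" and c: "complex_upto (Suc i) F" "complex_upto (Suc i) F'"
  shows "f \<in> homology_cycles F i \<Longrightarrow> tmap (\<phi> i) f \<in> homology_cycles F' i"
    and "f \<in> homology_boundaries F i \<Longrightarrow> tmap (\<phi> i) f \<in> homology_boundaries F' i"
proof -
  have m: "maps (gens F j) (gens F' j) (\<phi> j)" if "j \<le> Suc i" for j
    using \<phi> that by (auto simp: chain_map_def)
  show "tmap (\<phi> i) f \<in> homology_cycles F' i" if f: "f \<in> homology_cycles F i"
  proof -
    have ff: "f \<in> finfam C (gens F i)" using f by (simp add: homology_cycles_def)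
    have "tmap (bd F' j) (tmap (\<phi> i) f) = 0" if "i = Suc j" for j
      using tmap_chain_map[OF \<phi> c, of j f] f that by (simp add: homology_cycles_def tmap_zero)
    then show ?thesis
      using tmap_in[OF m ff] unfolding homology_cycles_def by (cases i) auto
  qed
  show "tmap (\<phi> i) f \<in> homology_boundaries F' i" if f: "f \<in> homology_boundaries F i"
  proof -
    obtain g where g: "g \<in> finfam C (gens F (Suc i))" "f = tmap (bd F i) g"
      using f unfolding homology_boundaries_def by blast
    then have "tmap (\<phi> i) f = tmap (bd F' i) (tmap (\<phi> (Suc i)) g)"
      using tmap_chain_map[OF \<phi> c _ g(1)] by simp
    then show ?thesis unfolding homology_boundaries_def using tmap_in[OF m g(1)] by simp
  qed
qed

text \<open>On a cycle the homotopy formula loses the term that starts with the differential, so the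
  composition minus the identity takes boundaries as values.\<close>

lemma homotopic_to_identity_homology:
  assumes F: "exact_upto (Suc i) F" and F': "complex_upto (Suc i) F'"
    and \<phi>: "chain_map (Suc i) F F' \<phi>" "\<forall>b\<in>gens F 0. aug_map F' (\<phi> 0 b) = aug F b"
    and \<psi>: "chain_map (Suc i) F' F \<psi>" "\<forall>b\<in>gens F' 0. aug_map F (\<psi> 0 b) = aug F' b"
    and f: "f \<in> homology_cycles F i"
  shows "tmap (\<psi> i) (tmap (\<phi> i) f) - f \<in> homology_boundaries F i"
proof -
  let ?\<chi> = "\<lambda>i b. matmap (*) (\<psi> i) (\<phi> i b) - unit_vec b"
  obtain \<sigma> where \<chi>: "\<forall>j\<le>Suc i. maps (gens F j) (gens F j) (?\<chi> j)"
    and \<sigma>: "\<forall>j<Suc i. maps (gens F j) (gens F (Suc j)) (\<sigma> j)"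
    and \<sigma>0: "0 < Suc i \<longrightarrow> (\<forall>b\<in>gens F 0. matmap (*) (bd F 0) (\<sigma> 0 b) = ?\<chi> 0 b)"
    and \<sigma>1: "\<forall>j. Suc j < Suc i \<longrightarrow> (\<forall>b\<in>gens F (Suc j).
      matmap (*) (bd F (Suc j)) (\<sigma> (Suc j) b) = ?\<chi> (Suc j) b - matmap (*) (\<sigma> j) (bd F j b))"
    by (rule homotopy_to_identity[OF F F' \<phi> \<psi>])
  have cF: "complex_upto (Suc i) F" using F by (simp add: exact_upto_def)
  have ff: "f \<in> finfam C (gens F i)" using f by (simp add: homology_cycles_def)
  have m\<phi>: "maps (gens F i) (gens F' i) (\<phi> i)" and m\<psi>: "maps (gens F' i) (gens F i) (\<psi> i)"
    using \<phi> \<psi> by (auto simp: chain_map_def)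
  have m\<sigma>: "maps (gens F i) (gens F (Suc i)) (\<sigma> i)" using \<sigma> by simp
  have md: "maps (gens F (Suc j)) (gens F j) (bd F j)" if "j \<le> i" for j
    using complex_upto_maps[OF cF] that by simp
  have "tmap (\<psi> i) (tmap (\<phi> i) f) - f = tmap (\<lambda>b. matmap (*) (\<psi> i) (\<phi> i b)) f - tmap unit_vec f"
    by (simp only: tmap_comp[OF m\<phi> m\<psi> ff] tmap_unit_mat[OF ff])
  also have "\<dots> = tmap (?\<chi> i) f"
    by (rule tmap_mat_diff[OF maps_comp[OF m\<phi> m\<psi>] maps_unit ff, symmetric])
  also have "\<dots> = tmap (\<lambda>b. matmap (*) (bd F i) (\<sigma> i b)) f"
  proof (cases i)
    case 0
    then show ?thesis using \<sigma>0 by (intro tmap_cong[OF ff]) simp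
  next
    case (Suc j)
    have mj: "maps (gens F j) (gens F i) (\<sigma> j)" using \<sigma> Suc by simp
    have dj: "maps (gens F i) (gens F j) (bd F j)" using md[of j] Suc by simp
    have "tmap (\<lambda>b. matmap (*) (bd F i) (\<sigma> i b)) f = tmap (\<lambda>b. ?\<chi> i b - matmap (*) (\<sigma> j) (bd F j b)) f"
      by (rule tmap_cong[OF ff]) (use \<sigma>1 Suc in simp)
    also have "\<dots> = tmap (?\<chi> i) f - tmap (\<lambda>b. matmap (*) (\<sigma> j) (bd F j b)) f"
      by (rule tmap_mat_diff[OF _ maps_comp[OF dj mj] ff]) (use \<chi> in simp)
    also have "tmap (\<lambda>b. matmap (*) (\<sigma> j) (bd F j b)) f = tmap (\<sigma> j) (tmap (bd F j) f)"
      by (rule tmap_comp[OF dj mj ff, symmetric])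
    also have "tmap (bd F j) f = 0" using f Suc by (simp add: homology_cycles_def)
    finally show ?thesis unfolding tmap_zero by (simp only: diff_0_right)
  qed
  also have "\<dots> = tmap (bd F i) (tmap (\<sigma> i) f)"
    by (rule tmap_comp[OF m\<sigma> md ff, symmetric]) simp
  finally show ?thesis
    unfolding homology_boundaries_def using tmap_in[OF m\<sigma> ff] by simp
qed

text \<open>This is how facts about the chosen resolution \<open>F\<close> are obtained: a homology
  basis \<open>S\<close> found on any convenient \<open>F'\<close> computes the dimension for
  \<open>F\<close>. Exactness below position \<open>Suc i\<close> is enough for homology in position
  \<open>i\<close>.\<close>

theorem homology_independent_of_resolution:
  fixes F F' :: "('a, 'k) gcomplex"
  assumes F: "exact_upto (Suc i) F" and F': "exact_upto (Suc i) F'"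
    and S: "S \<subseteq> homology_cycles F' i" "finite S" "\<not> module.dependent vs S"
      "module.span vs S \<inter> homology_boundaries F' i = {0}"
      "homology_cycles F' i \<subseteq> module.span vs (S \<union> homology_boundaries F' i)"
  shows "quotient_dim vs (homology_cycles F i) (homology_boundaries F i) = card S"
proof -
  interpret V: vector_space vs by (rule vector_space_vs)
  have c: "complex_upto (Suc i) F" "complex_upto (Suc i) F'" using F F' by (auto simp: exact_upto_def)
  obtain \<phi> where \<phi>: "chain_map (Suc i) F F' \<phi>" "\<forall>b\<in>gens F 0. aug_map F' (\<phi> 0 b) = aug F b"
    by (rule lift_exists[OF c(1) F'])
  obtain \<psi> where \<psi>: "chain_map (Suc i) F' F \<psi>" "\<forall>b\<in>gens F' 0. aug_map F (\<psi> 0 b) = aug F' b"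
    by (rule lift_exists[OF c(2) F])
  show ?thesis
  proof (rule V.quotient_dim_transfer[where \<Psi> = "tmap (\<psi> i)" and \<Phi> = "tmap (\<phi> i)" and s = vs
        and Z' = "homology_cycles F' i" and B' = "homology_boundaries F' i"])
    fix x y c assume "x \<in> homology_cycles F' i"
    then have x: "x \<in> finfam C (gens F' i)" by (simp add: homology_cycles_def)
    show "tmap (\<psi> i) (vs c x) = vs c (tmap (\<psi> i) x)" by (rule tmap_vs[OF x])
    assume "y \<in> homology_cycles F' i"
    then have y: "y \<in> finfam C (gens F' i)" by (simp add: homology_cycles_def)
    show "tmap (\<psi> i) (x + y) = tmap (\<psi> i) x + tmap (\<psi> i) y" by (rule tmap_add[OF x y])
  qed (fact S subspace_homology_cycles subspace_homology_boundaries vector_space_vs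
      homology_boundaries_cycles[OF c(1)] homology_boundaries_cycles[OF c(2)]
      chain_map_homology[OF \<phi>(1) c] chain_map_homology[OF \<psi>(1) c(2,1)]
      homotopic_to_identity_homology[OF F c(2) \<phi> \<psi>] homotopic_to_identity_homology[OF F' c(1) \<psi> \<phi>])+
qed

end

section \<open>Minimal resolutions over Koszul algebras\<close>

context standard_graded_algebra
begin

lemma mgr_residue_field: "mgr (residue_field A) d = (if d = 0 then UNIV else {0})"
  by (simp add: residue_field_def)

lemma act_residue_field: "matmap (act (residue_field A)) M f = res.tmap M f"
  by (simp add: res.tmap_def residue_field_def)

text \<open>A section of the reduction of free modules modulo the augmentation ideal; it lifts
  chains of the complex tensored with \<open>k\<close>.\<close>

definition const_vec :: "(nat \<Rightarrow> 'k) \<Rightarrow> nat \<Rightarrow> 'a"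
  where "const_vec c = (\<lambda>b. smul A (c b) 1)"

lemma const_vec_nonzero: "const_vec c b \<noteq> 0 \<longleftrightarrow> c b \<noteq> 0"
  by (simp add: const_vec_def)

lemma const_vec_finfam: "c \<in> finfam UNIV B \<Longrightarrow> const_vec c \<in> finfam car B"
  using gr_C[OF gr_smul_one] by (auto simp: finfam_iff const_vec_nonzero) (simp add: const_vec_def)

lemma residue_const_vec: "residue A (const_vec c b) = c b"
  by (simp add: const_vec_def residue_smul_one)

lemma residue_matmap:
  assumes "maps B B' M" "f \<in> finfam car B"
  shows "residue A (matmap (*) M f b') = res.tmap M (\<lambda>b. residue A (f b)) b'"
proof -
  have "residue A (matmap (*) M f b') = (\<Sum>b | f b \<noteq> 0. residue A (M b b' * f b))"
    unfolding matmap_def using assms self.maps_car[OF assms(1)]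
    by (intro res.rho_sum mult_C) (auto simp: finfam_iff)
  also have "\<dots> = (\<Sum>b | f b \<noteq> 0. residue A (M b b') * residue A (f b))"
    using assms self.maps_car[OF assms(1)]
    by (intro sum.cong residue_mult) (auto simp: finfam_iff)
  also have "\<dots> = res.tmap M (\<lambda>b. residue A (f b)) b'"
    using assms(2) by (intro res.tmap_superset[symmetric]) (auto simp: finfam_iff res.rho_zero)
  finally show ?thesis .
qed

text \<open>By \<open>min\<close> the module \<open>Z\<close>, modulo its multiples with the
  augmentation ideal, is Tor in position \<open>p + 2\<close>, which Koszulness places in degree
  \<open>p + 2\<close>. As Tor is given by another resolution \<open>G\<close>, the argument passes
  from \<open>P\<close> to \<open>G\<close> and back. \<open>U\<close> stands for anything that
  contains the part of \<open>Z\<close> of degree \<open>p + 2\<close> and these multiples.\<close>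

lemma koszul_generation_step:
  assumes K: "koszul A" and P: "exact_upto (Suc p) P"
  defines "Z \<equiv> {z \<in> finfam car (gens P (Suc p)). matmap (*) (bd P p) z = 0}"
  assumes min: "\<And>z b. z \<in> Z \<Longrightarrow> residue A (z b) = 0"
    and U: "0 \<in> U" "\<And>u v. u \<in> U \<Longrightarrow> v \<in> U \<Longrightarrow> u + v \<in> U"
    and base: "\<And>z. z \<in> Z \<Longrightarrow> \<forall>b. z b \<in> shift (gr A) (gdeg P (Suc p) b) (Suc (Suc p)) \<Longrightarrow> z \<in> U"
    and plus: "\<And>z a. z \<in> Z \<Longrightarrow> a \<in> car \<Longrightarrow> residue A a = 0 \<Longrightarrow> (\<lambda>b. z b * a) \<in> U"
    and z: "z \<in> Z"
  shows "z \<in> U"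
proof -
  define q where "q = Suc p"
  define G where "G = resolution A (residue_field A)"
  have G: "exact_upto n G" for n
    unfolding G_def by (rule resolution_exact_upto[OF resolution_residue_field])
  have cG: "complex_upto n G" for n using G[of n] by (simp add: exact_upto_def)
  have cP: "complex_upto q P" using P by (simp add: exact_upto_def q_def)
  have Pq: "exact_upto q P" using P by (simp add: q_def)
  obtain \<psi> where \<psi>: "chain_map q P G \<psi>" "\<forall>b\<in>gens P 0. aug_map G (\<psi> 0 b) = aug P b"
    by (rule lift_exists[OF cP G])
  obtain \<phi> where \<phi>: "chain_map q G P \<phi>" "\<forall>b\<in>gens G 0. aug_map P (\<phi> 0 b) = aug G b"
    "\<forall>i\<le>q. hom_gens (gens P i) (gdeg P i) (gens G i) (gdeg G i) (\<phi> i)"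
    by (rule lift_exists[OF cG Pq])
  let ?\<chi> = "\<lambda>i b. matmap (*) (\<phi> i) (\<psi> i b) - unit_vec b"
  obtain \<sigma> where \<chi>: "\<forall>i\<le>q. maps (gens P i) (gens P i) (?\<chi> i)"
    and \<sigma>: "\<forall>i<q. maps (gens P i) (gens P (Suc i)) (\<sigma> i)"
    and cyc: "\<forall>i<q. \<forall>b\<in>gens P (Suc i).
      matmap (*) (bd P i) (?\<chi> (Suc i) b - matmap (*) (\<sigma> i) (bd P i b)) = 0"
    by (rule homotopy_to_identity[OF Pq cG \<psi> \<phi>(1,2)])
  have mP: "maps (gens P q) (gens P p) (bd P p)"
    using res.complex_upto_maps[OF cP, of p] by (simp add: q_def)
  have mG: "maps (gens G (Suc i)) (gens G i) (bd G i)" for i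
    using res.complex_upto_maps[OF cG, of i "Suc i"] by simp
  have m\<phi>: "maps (gens G i) (gens P i) (\<phi> i)" and m\<psi>: "maps (gens P i) (gens G i) (\<psi> i)" if "i \<le> q" for i
    using \<phi> \<psi> that by (auto simp: chain_map_def)
  have m\<sigma>: "maps (gens P p) (gens P q) (\<sigma> p)" using \<sigma> by (simp add: q_def)
  have Zdef: "x \<in> Z \<longleftrightarrow> x \<in> finfam car (gens P q) \<and> matmap (*) (bd P p) x = 0" for x
    by (simp add: Z_def q_def)
  have Usum: "sum h I \<in> U" if "\<And>i. i \<in> I \<Longrightarrow> h i \<in> U" for I and h :: "'i \<Rightarrow> nat \<Rightarrow> 'a"
    using that by (induction I rule: infinite_finite_induct) (auto simp: U simp del: plus_fun_apply)
  have plus_sum: "matmap (*) N f \<in> U"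
    if f: "f \<in> finfam car B" "\<And>b. residue A (f b) = 0" and N: "\<And>b. b \<in> B \<Longrightarrow> N b \<in> Z" for f B N
  proof -
    have "matmap (*) N f = (\<Sum>b | f b \<noteq> 0. (\<lambda>b'. N b b' * f b))"
      by (simp add: fun_eq_iff matmap_def sum_fun_apply)
    moreover have "(\<lambda>b'. N b b' * f b) \<in> U" if "f b \<noteq> 0" for b
      using that f N by (intro plus) (auto simp: finfam_iff)
    ultimately show ?thesis using Usum[of "{b. f b \<noteq> 0}" "\<lambda>b b'. N b b' * f b"] by simp
  qed
  \<comment> \<open>\<open>\<tau>\<close> is the defect of the homotopy in position
    \<open>q\<close>, and \<open>\<theta>\<close> is a differential of \<open>G\<close> followed by
    the map back to \<open>P\<close>; both take values in \<open>Z\<close>. With \<open>y\<close>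
    the boundary of \<open>g\<close>, they give \<open>z = \<theta> g - \<tau> z\<close>. The
    coordinates of \<open>z\<close> lie in the augmentation ideal, so the term with
    \<open>\<tau>\<close> is in \<open>U\<close>.\<close>
  define \<tau> where "\<tau> = (\<lambda>b. ?\<chi> q b - matmap (*) (\<sigma> p) (bd P p b))"
  define \<theta> where "\<theta> = (\<lambda>b. matmap (*) (\<phi> q) (bd G q b))"
  define y where "y = matmap (*) (\<psi> q) z"
  have zf: "z \<in> finfam car (gens P q)" and zb: "matmap (*) (bd P p) z = 0" using z Zdef by auto
  have yf: "y \<in> finfam car (gens G q)" unfolding y_def by (rule mat_in[OF m\<psi> zf]) simp
  have "matmap (*) (bd G p) y = matmap (*) (\<psi> p) (matmap (*) (bd P p) z)"
    unfolding y_def using self.tmap_chain_map[OF \<psi>(1) cP cG, of p z] zf by (simp add: q_def self_tmap)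
  then have "y \<in> {f \<in> finfam car (gens G (Suc p)). matmap (*) (bd G p) f = 0}"
    using yf by (simp add: zb mat_zero q_def)
  then have "y \<in> matmap (*) (bd G (Suc p)) ` finfam car (gens G (Suc (Suc p)))"
    using G[of "Suc (Suc p)"] unfolding exact_upto_def by auto
  then obtain g where g: "g \<in> finfam car (gens G (Suc q))" "y = matmap (*) (bd G q) g"
    unfolding q_def by blast
  have m\<theta>: "maps (gens G (Suc q)) (gens P q) \<theta>"
    unfolding \<theta>_def by (rule maps_comp[OF mG m\<phi>]) simp
  have \<theta>eq: "matmap (*) \<theta> f = matmap (*) (\<phi> q) (matmap (*) (bd G q) f)"
    if "f \<in> finfam car (gens G (Suc q))" for f
    unfolding \<theta>_def by (rule mat_comp[OF mG m\<phi> that, symmetric]) simp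
  have \<theta>Z': "matmap (*) \<theta> f \<in> Z" if f: "f \<in> finfam car (gens G (Suc q))" for f
  proof -
    have b: "matmap (*) (bd G q) f \<in> finfam car (gens G q)" by (rule mat_in[OF mG f])
    have "matmap (*) (bd P p) (matmap (*) \<theta> f) = matmap (*) (\<phi> p) (matmap (*) (bd G p) (matmap (*) (bd G q) f))"
      unfolding \<theta>eq[OF f] using self.tmap_chain_map[OF \<phi>(1) cG cP, of p] b by (simp add: q_def self_tmap)
    also have "matmap (*) (bd G p) (matmap (*) (bd G q) f) = 0"
    proof -
      have "matmap (*) (bd G p) (matmap (*) (bd G q) f) = matmap (*) (\<lambda>b. matmap (*) (bd G p) (bd G q b)) f"
        by (rule mat_comp[OF mG _ f]) (use mG[of p] in \<open>simp add: q_def\<close>)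
      also have "\<dots> = 0"
        by (rule mat_mat_zero[OF f]) (use cG[of "Suc q"] in \<open>simp add: complex_upto_def q_def\<close>)
      finally show ?thesis .
    qed
    finally have "matmap (*) (bd P p) (matmap (*) \<theta> f) = 0" unfolding mat_zero .
    then show ?thesis using mat_in[OF m\<theta> f] by (simp add: Zdef)
  qed
  have \<theta>Z: "\<theta> b \<in> Z" if "b \<in> gens G (Suc q)" for b
    using \<theta>Z'[OF unit_vec_finfam[OF that]] by (simp add: mat_unit_vec)
  have \<tau>Z: "\<tau> b \<in> Z" if b: "b \<in> gens P q" for b
  proof -
    have "matmap (*) (bd P p) (\<tau> b) = 0" using cyc b unfolding \<tau>_def q_def by blast
    moreover have "?\<chi> q b \<in> finfam car (gens P q)" using \<chi> b unfolding maps_def by blast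
    then have "\<tau> b \<in> finfam car (gens P q)"
      unfolding \<tau>_def using b mat_in[OF m\<sigma>] mP by (rule_tac self.finfam_diff) (auto simp: maps_def)
    ultimately show ?thesis by (simp add: Zdef)
  qed
  have "matmap (*) \<tau> z = matmap (*) (?\<chi> q) z - matmap (*) (\<lambda>b. matmap (*) (\<sigma> p) (bd P p b)) z"
    unfolding \<tau>_def by (rule mat_mat_diff[OF _ maps_comp[OF mP m\<sigma>] zf]) (use \<chi> in simp)
  also have "matmap (*) (\<lambda>b. matmap (*) (\<sigma> p) (bd P p b)) z = matmap (*) (\<sigma> p) (matmap (*) (bd P p) z)"
    by (rule mat_comp[OF mP m\<sigma> zf, symmetric])
  also have "\<dots> = 0" unfolding zb by (rule mat_zero)
  also have "matmap (*) (?\<chi> q) z = matmap (*) (\<lambda>b. matmap (*) (\<phi> q) (\<psi> q b)) z - matmap (*) unit_vec z"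
    by (rule mat_mat_diff[OF maps_comp[OF m\<psi> m\<phi>] maps_unit zf]) simp_all
  also have "matmap (*) unit_vec z = z" by (rule mat_unit_mat[OF zf])
  also have "matmap (*) (\<lambda>b. matmap (*) (\<phi> q) (\<psi> q b)) z = matmap (*) (\<phi> q) y"
    unfolding y_def by (rule mat_comp[OF m\<psi> m\<phi> zf, symmetric]) simp_all
  also have "\<dots> = matmap (*) \<theta> g" using \<theta>eq[OF g(1)] g(2) by simp
  finally have "matmap (*) \<tau> z = matmap (*) \<theta> g - z - 0" .
  then have "z = matmap (*) \<theta> g + - matmap (*) \<tau> z" by (simp add: fun_eq_iff)
  moreover have "- matmap (*) \<tau> z \<in> U"
  proof -
    have "- matmap (*) \<tau> z = matmap (*) \<tau> (- z)" using self.tmap_uminus[of \<tau> z] by (simp add: self_tmap)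
    moreover have "residue A ((- z) b) = 0" for b
      using res.rho_minus[of "z b"] zf min[OF z, of b] by (simp add: finfam_iff)
    ultimately show ?thesis using plus_sum[OF self.finfam_uminus[OF zf] _ \<tau>Z] by simp
  qed
  moreover have "matmap (*) \<theta> g \<in> U"
  proof -
    \<comment> \<open>The reduction of \<open>g\<close> modulo the augmentation ideal is a cycle
      over \<open>k\<close>: the boundary of \<open>g\<close> is the image of \<open>z\<close>,
      whose coordinates have residue 0. The differential respects degrees, so the homogeneous parts
      \<open>cj j\<close> are cycles as well.\<close>
    define c where "c = (\<lambda>b. residue A (g b))"
    have cf: "c \<in> finfam UNIV (gens G (Suc q))"
    proof -
      have "{b. c b \<noteq> 0} \<subseteq> {b. g b \<noteq> 0}" by (auto simp: c_def res.rho_zero)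
      then show ?thesis using g(1) by (auto simp: finfam_iff dest: finite_subset)
    qed
    have cc: "res.tmap (bd G q) c b' = 0" for b'
    proof -
      have "res.tmap (bd G q) c b' = residue A (y b')"
        unfolding c_def g(2) by (rule residue_matmap[OF mG g(1), symmetric])
      also have "\<dots> = res.tmap (\<psi> q) (\<lambda>b. residue A (z b)) b'"
        unfolding y_def by (rule residue_matmap[OF m\<psi> zf]) simp
      also have "\<dots> = 0" using min[OF z] by (simp add: res.tmap_def matmap_def)
      finally show ?thesis .
    qed
    define cj where "cj = (\<lambda>j b. if gdeg G (Suc q) b = j then c b else 0)"
    have cjf: "cj j \<in> finfam UNIV (gens G (Suc q))" for j
    proof -
      have "{b. cj j b \<noteq> 0} \<subseteq> {b. c b \<noteq> 0}" by (auto simp: cj_def)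
      then show ?thesis using cf by (auto simp: finfam_iff dest: finite_subset)
    qed
    have cjc: "res.tmap (bd G q) (cj j) = 0" for j
    proof
      fix b'
      have 1: "res.tmap (bd G q) (cj j) b' = (\<Sum>b | c b \<noteq> 0. residue A (bd G q b b') * cj j b)"
        using cf by (intro res.tmap_superset) (auto simp: finfam_iff cj_def split: if_splits)
      have r0: "residue A (bd G q b b') = 0" if "c b \<noteq> 0" "gdeg G (Suc q) b \<noteq> gdeg G q b'" for b
      proof -
        have "b \<in> gens G (Suc q)" using that cf by (simp add: finfam_iff)
        then have "bd G q b b' \<in> shift (gr A) (gdeg G q b') (gdeg G (Suc q) b)"
          using cG[of "Suc q"] by (simp add: complex_upto_def hom_gens_def)
        then show ?thesis
          using that residue_gr[of "bd G q b b'" "gdeg G (Suc q) b - gdeg G q b'"] res.rho_zero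
          by (auto simp: shift_def split: if_splits)
      qed
      show "res.tmap (bd G q) (cj j) b' = 0 b'"
      proof (cases "gdeg G q b' = j")
        case True
        have "res.tmap (bd G q) (cj j) b' = (\<Sum>b | c b \<noteq> 0. residue A (bd G q b b') * c b)"
          unfolding 1 by (intro sum.cong) (use True r0 in \<open>auto simp: cj_def\<close>)
        also have "\<dots> = res.tmap (bd G q) c b'"
          using cf by (intro res.tmap_superset[symmetric]) (auto simp: finfam_iff)
        finally show ?thesis using cc by simp
      next
        case False
        then show ?thesis unfolding 1 by (intro trans[OF sum.neutral]) (use r0 in \<open>auto simp: cj_def\<close>)
      qed
    qed
    have part: "matmap (*) \<theta> (const_vec (cj j)) \<in> U" for j
    proof (cases "j = Suc q")
      case True
      let ?f = "const_vec (cj j)"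
      have ff: "?f \<in> finfam car (gens G (Suc q))" by (rule const_vec_finfam[OF cjf])
      have fh: "\<forall>b. ?f b \<in> shift (gr A) (gdeg G (Suc q) b) j"
        using gr_smul_one gr_zero by (auto simp: const_vec_def cj_def shift_def)
      have h: "hom_gens (gens G q) (gdeg G q) (gens G (Suc q)) (gdeg G (Suc q)) (bd G q)"
        using cG[of "Suc q"] by (simp add: complex_upto_def)
      have "\<forall>b. matmap (*) (bd G q) ?f b \<in> shift (gr A) (gdeg G q b) j"
        using matmap_shift[OF h ff fh] by blast
      then have "\<forall>b. matmap (*) \<theta> ?f b \<in> shift (gr A) (gdeg P q b) j"
        unfolding \<theta>eq[OF ff] using matmap_shift[OF \<phi>(3)[rule_format, of q] mat_in[OF mG ff]] by blast
      then show ?thesis using base \<theta>Z'[OF ff] True by (simp add: q_def)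
    next
      case False
      \<comment> \<open>Outside degree \<open>Suc q\<close> the cycle \<open>cj j\<close> is a
        boundary over \<open>k\<close>. Lifting it to a boundary \<open>w\<close> of
        \<open>G\<close> alters it only by coordinates in the augmentation ideal, and
        \<open>\<theta>\<close> kills \<open>w\<close>.\<close>
      have "tor_component_zero A (residue_field A) (residue_field A) (Suc q) j"
        using K False unfolding koszul_def by metis
      moreover have "cj j \<in> tor_cycles A (residue_field A) (residue_field A) (Suc q)"
        using cjf cjc by (simp add: tor_chains_def gsum_residue_field act_residue_field G_def)
      moreover have "cj j \<in> tor_degree A (residue_field A) (residue_field A) (Suc q) j"
        using cjf by (simp add: tor_degree_def tor_chains_def gsum_residue_field G_def cj_def shift_def
            mgr_residue_field)
      ultimately have "cj j \<in> tor_boundaries A (residue_field A) (residue_field A) (Suc q)"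
        unfolding tor_component_zero_def by blast
      then obtain e where e: "e \<in> finfam UNIV (gens G (Suc (Suc q)))" "cj j = res.tmap (bd G (Suc q)) e"
        unfolding tor_boundaries_def tor_chains_def gsum_residue_field G_def act_residue_field by blast
      have ef: "const_vec e \<in> finfam car (gens G (Suc (Suc q)))" by (rule const_vec_finfam[OF e(1)])
      define w where "w = matmap (*) (bd G (Suc q)) (const_vec e)"
      have wf: "w \<in> finfam car (gens G (Suc q))" unfolding w_def by (rule mat_in[OF mG ef])
      have rw: "residue A (w b) = cj j b" for b
        unfolding w_def residue_matmap[OF mG ef] e(2) by (simp add: residue_const_vec)
      have "matmap (*) (bd G q) w = matmap (*) (\<lambda>b. matmap (*) (bd G q) (bd G (Suc q) b)) (const_vec e)"
        unfolding w_def by (rule mat_comp[OF mG mG ef])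
      also have "\<dots> = 0"
        by (rule mat_mat_zero[OF ef]) (use cG[of "Suc (Suc q)"] in \<open>simp add: complex_upto_def\<close>)
      finally have w0: "matmap (*) \<theta> w = 0" using \<theta>eq[OF wf] mat_zero by simp
      let ?f = "const_vec (cj j)"
      have ff: "?f \<in> finfam car (gens G (Suc q))" by (rule const_vec_finfam[OF cjf])
      have "residue A ((?f - w) b) = 0" for b
        using residue_add[of "?f b" "- w b"] res.rho_minus[of "w b"] car_minus ff wf rw[of b]
          residue_const_vec[of "cj j" b] by (simp add: finfam_iff)
      then have "matmap (*) \<theta> (?f - w) \<in> U"
        by (intro plus_sum[OF self.finfam_diff[OF ff wf]] \<theta>Z)
      then show ?thesis using mat_diff[OF ff wf, of \<theta>] w0 by simp
    qed
    have chf: "const_vec c \<in> finfam car (gens G (Suc q))" by (rule const_vec_finfam[OF cf])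
    have "residue A ((g - const_vec c) b) = 0" for b
      using residue_add[of "g b" "- const_vec c b"] res.rho_minus[of "const_vec c b"] car_minus chf g(1)
        residue_const_vec[of c b] by (simp add: finfam_iff c_def)
    then have 1: "matmap (*) \<theta> (g - const_vec c) \<in> U"
      by (intro plus_sum[OF self.finfam_diff[OF g(1) chf]] \<theta>Z)
    define J where "J = gdeg G (Suc q) ` {b. c b \<noteq> 0}"
    have J: "finite J" unfolding J_def using cf by (simp add: finfam_iff)
    have "matmap (*) \<theta> (const_vec c) b' = (\<Sum>j\<in>J. matmap (*) \<theta> (const_vec (cj j)) b')" for b'
    proof -
      have "matmap (*) \<theta> (const_vec (cj j)) b' = (\<Sum>b | c b \<noteq> 0. \<theta> b b' * const_vec (cj j) b)" for j
        using cf by (intro matmap_superset) (auto simp: finfam_iff const_vec_nonzero cj_def split: if_splits)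
      then have "(\<Sum>j\<in>J. matmap (*) \<theta> (const_vec (cj j)) b') =
          (\<Sum>b | c b \<noteq> 0. \<Sum>j\<in>J. \<theta> b b' * const_vec (cj j) b)"
        by (simp add: sum.swap[of _ J])
      also have "\<dots> = (\<Sum>b | c b \<noteq> 0. \<theta> b b' * const_vec c b)"
      proof (rule sum.cong[OF refl])
        fix b assume "b \<in> {b. c b \<noteq> 0}"
        then have bJ: "gdeg G (Suc q) b \<in> J" unfolding J_def by blast
        have "(\<Sum>j\<in>J. \<theta> b b' * const_vec (cj j) b) =
            (\<Sum>j\<in>J. if j = gdeg G (Suc q) b then \<theta> b b' * const_vec c b else 0)"
          by (intro sum.cong) (auto simp: const_vec_def cj_def)
        then show "(\<Sum>j\<in>J. \<theta> b b' * const_vec (cj j) b) = \<theta> b b' * const_vec c b"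
          using J bJ by simp
      qed
      also have "\<dots> = matmap (*) \<theta> (const_vec c) b'"
        using cf by (intro matmap_superset[symmetric]) (auto simp: finfam_iff const_vec_nonzero)
      finally show ?thesis ..
    qed
    then have "matmap (*) \<theta> (const_vec c) = (\<Sum>j\<in>J. matmap (*) \<theta> (const_vec (cj j)))"
      by (simp add: fun_eq_iff sum_fun_apply)
    then have 2: "matmap (*) \<theta> (const_vec c) \<in> U" using Usum[of J] part by simp
    have "matmap (*) \<theta> g = matmap (*) \<theta> (g - const_vec c) + matmap (*) \<theta> (const_vec c)"
      using mat_diff[OF g(1) chf, of \<theta>] by simp
    then show ?thesis using U(2)[OF 1 2] by simp
  qed
  ultimately show ?thesis using U(2) by metis
qed

lemma proj_add: "f \<in> finfam car B \<Longrightarrow> g \<in> finfam car B \<Longrightarrow> proj deg j (f + g) = proj deg j f + proj deg j g"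
  by (auto simp: proj_def fun_eq_iff finfam_iff hc_add)

lemma proj_zero: "proj deg j 0 = 0"
  by (auto simp: proj_def fun_eq_iff hc_zero)

lemma proj_homogeneous_other:
  assumes "\<forall>b. f b \<in> shift (gr A) (deg b) i" "i \<noteq> j"
  shows "proj deg j f = 0"
proof
  fix b
  show "proj deg j f b = 0 b"
    using assms(1)[rule_format, of b] hc_eq[OF decomp_gr, of "f b" "i - deg b"] assms(2)
    by (auto simp: proj_def shift_def hc_zero split: if_splits)
qed

lemma proj_mult:
  assumes f: "f \<in> finfam car B" and a: "a \<in> car"
  obtains n where "proj deg j (\<lambda>b. f b * a) = (\<Sum>i\<le>n. if i \<le> j then (\<lambda>b. proj deg (j - i) f b * hc a i) else 0)"
proof -
  obtain n where n: "a = (\<Sum>i\<le>n. hc a i)" using hc_decomp[OF a] by (auto simp: decomp_def)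
  have fC: "f b \<in> car" for b using f by (simp add: finfam_iff)
  have "proj deg j (\<lambda>b. f b * a) b = (\<Sum>i\<le>n. if i \<le> j then (\<lambda>b. proj deg (j - i) f b * hc a i) else 0) b" for b
  proof (cases "deg b \<le> j")
    case True
    have "f b * a = (\<Sum>i\<le>n. hc a i * f b)"
      by (subst n) (simp add: sum_distrib_left mult.commute)
    then have "proj deg j (\<lambda>b. f b * a) b = (\<Sum>i\<le>n. hc (hc a i * f b) (j - deg b))"
      using True hc_sum[of "{..n}" "\<lambda>i. hc a i * f b" "j - deg b"] fC gr_C[OF hc_gr[OF a]] mult_C
      by (simp add: proj_def)
    also have "\<dots> = (\<Sum>i\<le>n. (if i \<le> j then (\<lambda>b. proj deg (j - i) f b * hc a i) else 0) b)"
      using True hc_mult[OF hc_gr[OF a] fC] by (intro sum.cong) (auto simp: proj_def algebra_simps)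
    finally show ?thesis by (simp add: sum_fun_apply)
  next
    case False
    then show ?thesis by (auto simp: proj_def sum_fun_apply intro!: sum.neutral)
  qed
  then show ?thesis using that by blast
qed

text \<open>Graded Nakayama: the step lemma handles \<open>Z\<close> up to multiples with the
  augmentation ideal, and the degree \<open>j\<close> part of such a multiple involves only parts of
  \<open>Z\<close> of smaller degree.\<close>

theorem koszul_generation:
  assumes K: "koszul A" and P: "exact_upto (Suc p) P"
  defines "Z \<equiv> {z \<in> finfam car (gens P (Suc p)). matmap (*) (bd P p) z = 0}"
  assumes min: "\<And>z b. z \<in> Z \<Longrightarrow> residue A (z b) = 0"
    and U: "0 \<in> U" "\<And>u v. u \<in> U \<Longrightarrow> v \<in> U \<Longrightarrow> u + v \<in> U"
      "\<And>u a. u \<in> U \<Longrightarrow> a \<in> car \<Longrightarrow> (\<lambda>b. u b * a) \<in> U"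
    and base: "\<And>z. z \<in> Z \<Longrightarrow> \<forall>b. z b \<in> shift (gr A) (gdeg P (Suc p) b) (Suc (Suc p)) \<Longrightarrow> z \<in> U"
  shows "Z \<subseteq> U"
proof
  let ?deg = "gdeg P (Suc p)"
  have h: "hom_gens (gens P p) (gdeg P p) (gens P (Suc p)) ?deg (bd P p)"
    using P by (simp add: exact_upto_def complex_upto_def)
  have gZ: "graded_submodule (gens P (Suc p)) ?deg Z"
    unfolding Z_def by (rule graded_submodule_kernel[OF h])
  have Zf: "z \<in> finfam car (gens P (Suc p))" if "z \<in> Z" for z using that by (simp add: Z_def)
  have pZ: "proj ?deg j z \<in> Z" if "z \<in> Z" for z j using gZ that unfolding graded_submodule_def by blast
  have mZ: "(\<lambda>b. z b * a) \<in> Z" if "z \<in> Z" "a \<in> car" for z a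
    using gZ that unfolding graded_submodule_def by blast
  have Usum: "sum f I \<in> U" if "\<And>i. i \<in> I \<Longrightarrow> f i \<in> U" for I and f :: "'i \<Rightarrow> nat \<Rightarrow> 'a"
    using that by (induction I rule: infinite_finite_induct) (auto simp: U simp del: plus_fun_apply)
  have homog: "proj ?deg j z \<in> U" if "z \<in> Z" for j z
    using that
  proof (induction j arbitrary: z rule: less_induct)
    case (less j)
    \<comment> \<open>Only the component of degree \<open>j\<close> is tested, so the induction
      hypothesis for smaller degrees provides the condition on multiples in the step lemma.\<close>
    let ?U = "{u \<in> finfam car (gens P (Suc p)). proj ?deg j u \<in> U}"
    have "z \<in> ?U"
    proof (rule koszul_generation_step[OF K P])
      show "0 \<in> ?U" using self.finfam_zero U(1) proj_zero by simp
    next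
      fix u v assume uv: "u \<in> ?U" "v \<in> ?U"
      then have "proj ?deg j (u + v) = proj ?deg j u + proj ?deg j v"
        using proj_add[of u "gens P (Suc p)" v] by simp
      then show "u + v \<in> ?U" using uv self.finfam_add[of u "gens P (Suc p)" v] U(2) by simp
    next
      fix y assume "y \<in> {z \<in> finfam car (gens P (Suc p)). matmap (*) (bd P p) z = 0}"
        "\<forall>b. y b \<in> shift (gr A) (?deg b) (Suc (Suc p))"
      then show "y \<in> ?U"
        using proj_homogeneous[of y ?deg j] proj_homogeneous_other[of y ?deg "Suc (Suc p)" j] base U(1)
        by (cases "j = Suc (Suc p)") (auto simp: Z_def)
    next
      fix y a assume "y \<in> {z \<in> finfam car (gens P (Suc p)). matmap (*) (bd P p) z = 0}"
        and a: "a \<in> car" "residue A a = 0"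
      then have y: "y \<in> Z" by (simp add: Z_def)
      obtain n where n: "proj ?deg j (\<lambda>b. y b * a) =
          (\<Sum>i\<le>n. if i \<le> j then (\<lambda>b. proj ?deg (j - i) y b * hc a i) else 0)"
        by (rule proj_mult[OF Zf[OF y] a(1)])
      have a0: "hc a 0 = 0" using residue_0_iff a by simp
      have "(if i \<le> j then (\<lambda>b. proj ?deg (j - i) y b * hc a i) else 0) \<in> U" for i
      proof (cases "i = 0 \<or> i > j")
        case True
        have "(\<lambda>b. proj ?deg (j - i) y b * 0) = (0 :: nat \<Rightarrow> 'a)" by auto
        then show ?thesis using True a0 U(1) by auto
      next
        case False
        then have "j - i < j" by simp
        then have "(\<lambda>b. proj ?deg (j - i) y b * hc a i) \<in> U"
          using U(3)[OF less.IH[OF _ y] gr_C[OF hc_gr[OF a(1)]]] by blast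
        then show ?thesis using False by simp
      qed
      then have "proj ?deg j (\<lambda>b. y b * a) \<in> U" unfolding n by (rule Usum)
      then show "(\<lambda>b. y b * a) \<in> ?U" using Zf[OF mZ[OF y a(1)]] by simp
    qed (use min less.prems in \<open>simp_all add: Z_def\<close>)
    then show ?case by simp
  qed
  fix z assume z: "z \<in> Z"
  obtain n where "z = (\<Sum>j\<le>n. proj ?deg j z)" using proj_sum[OF Zf[OF z], of ?deg] by blast
  then show "z \<in> U" using Usum[of "{..n}" "\<lambda>j. proj ?deg j z"] homog[OF z] by simp
qed

end

section \<open>The Koszul complex on at most three elements\<close>

text \<open>Positions 1, 2, 3 have the bases \<open>e\<^sub>0, e\<^sub>1, e\<^sub>2\<close>, then \<open>e\<^sub>0\<^sub>1, e\<^sub>0\<^sub>2, e\<^sub>1\<^sub>2\<close>, then \<open>e\<^sub>0\<^sub>1\<^sub>2\<close>. In this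
  order the complex on \<open>n \<le> 3\<close> elements uses the first \<open>n choose i\<close> of them.\<close>

definition koszul_bd :: "(nat \<Rightarrow> 'a::comm_ring_1) \<Rightarrow> nat \<Rightarrow> nat \<Rightarrow> nat \<Rightarrow> 'a"
  where "koszul_bd v i b b' =
   (if i = 0 then (if b' = 0 then v b else 0)
    else if i = 1 then
      (if b = 0 then (if b' = 0 then - v 1 else if b' = 1 then v 0 else 0)
       else if b = 1 then (if b' = 0 then - v 2 else if b' = 2 then v 0 else 0)
       else if b = 2 then (if b' = 1 then - v 2 else if b' = 2 then v 1 else 0) else 0)
    else if i = 2 \<and> b = 0 then
      (if b' = 0 then v 2 else if b' = 1 then - v 1 else if b' = 2 then v 0 else 0)
    else 0)"

definition koszul_complex :: "nat \<Rightarrow> (nat \<Rightarrow> 'a::comm_ring_1) \<Rightarrow> ('a, 'k::one) gcomplex"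
  where "koszul_complex n v =
    \<lparr>gens = \<lambda>i. {..<n choose i}, gdeg = \<lambda>i b. i, bd = koszul_bd v, aug = \<lambda>_. 1\<rparr>"

text \<open>The sum always runs over three basis elements. With fewer variables the missing entries
  of \<open>v\<close> and coordinates of \<open>f\<close> are 0, so one formula serves every
  \<open>n \<le> 3\<close>.\<close>

definition koszul_map :: "(nat \<Rightarrow> 'a::comm_ring_1) \<Rightarrow> nat \<Rightarrow> (nat \<Rightarrow> 'a) \<Rightarrow> nat \<Rightarrow> 'a"
  where "koszul_map v i f b' = (\<Sum>b<3. koszul_bd v i b b' * f b)"

lemma sum_lessThan_3: "(\<Sum>b<3. f b) = f 0 + f 1 + (f (2::nat) :: 'a::comm_monoid_add)"
  by (simp add: numeral_3_eq_3 numeral_2_eq_2)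

lemma koszul_map_0: "koszul_map v 0 f = (\<lambda>b. if b = 0 then v 0 * f 0 + v 1 * f 1 + v 2 * f 2 else 0)"
  by (auto simp: koszul_map_def koszul_bd_def fun_eq_iff sum_lessThan_3)

lemma koszul_map_1: "koszul_map v 1 f =
    (\<lambda>b. if b = 0 then - (v 1 * f 0) - v 2 * f 1 else if b = 1 then v 0 * f 0 - v 2 * f 2
         else if b = 2 then v 0 * f 1 + v 1 * f 2 else 0)"
  by (auto simp: koszul_map_def koszul_bd_def fun_eq_iff sum_lessThan_3)

lemma koszul_map_2: "koszul_map v 2 f =
    (\<lambda>b. if b = 0 then v 2 * f 0 else if b = 1 then - (v 1 * f 0) else if b = 2 then v 0 * f 0 else 0)"
  by (auto simp: koszul_map_def koszul_bd_def fun_eq_iff sum_lessThan_3)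

lemma koszul_map_ge_3: "3 \<le> i \<Longrightarrow> koszul_map v i f = 0"
  by (auto simp: koszul_map_def koszul_bd_def fun_eq_iff)

lemma koszul_map_comp_1: "koszul_map v 0 (koszul_map v 1 f) = 0"
  unfolding koszul_map_0 koszul_map_1 by (auto simp: fun_eq_iff algebra_simps)

lemma koszul_map_comp_2: "koszul_map v 1 (koszul_map v 2 f) = 0"
  unfolding koszul_map_1 koszul_map_2 by (auto simp: fun_eq_iff algebra_simps)

lemmas koszul_map_simps = koszul_map_0 koszul_map_1 koszul_map_1[unfolded One_nat_def] koszul_map_2

lemma le_3_cases: "n \<le> 3 \<Longrightarrow> n = 0 \<or> n = 1 \<or> n = 2 \<or> n = (3::nat)"
  by linarith

lemma choose_le_3:
  assumes "n \<le> 3" shows "n choose i \<le> 3"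
proof -
  consider "i = 0" | "i = 1" | "i = 2" | "i = 3" | "i > 3" by linarith
  then show ?thesis
  proof cases
    case 5
    then have "n < i" using assms by simp
    then show ?thesis by (simp add: binomial_eq_0)
  qed (use le_3_cases[OF assms] in \<open>auto simp: numeral_3_eq_3 numeral_2_eq_2\<close>)
qed

lemma choose_2_values: "0 choose 2 = (0::nat)" "1 choose 2 = (0::nat)" "2 choose 2 = (1::nat)" "3 choose 2 = (3::nat)"
  by (simp_all add: numeral_2_eq_2 numeral_3_eq_3)

lemma choose_3_values: "0 choose 3 = (0::nat)" "1 choose 3 = (0::nat)" "2 choose 3 = (0::nat)" "3 choose 3 = (1::nat)"
  by (simp_all add: numeral_2_eq_2 numeral_3_eq_3)

lemma finfam_lessThan: "f \<in> finfam C {..<k} \<longleftrightarrow> (\<forall>b\<ge>k. f b = 0) \<and> (\<forall>b. f b \<in> C)"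
proof -
  have "finite {b. f b \<noteq> 0}" if "\<forall>b\<ge>k. f b = 0"
    by (rule finite_subset[of _ "{..<k}"]) (use that in \<open>auto simp: not_le[symmetric]\<close>)
  then show ?thesis unfolding finfam_iff by (metis lessThan_iff not_le)
qed

lemma finfam_empty: "f \<in> finfam C {} \<Longrightarrow> f = 0"
  by (auto simp: finfam_iff fun_eq_iff)

lemma (in base_change) tmap_koszul:
  assumes f: "f \<in> finfam C {..<k}" "k \<le> 3" and v: "\<And>j. v j \<in> gsum (gr A)"
  shows "tmap (koszul_bd v i) f = koszul_map (\<lambda>j. \<rho> (v j)) i f"
proof
  fix b'
  have "{b. f b \<noteq> 0} \<subseteq> {..<3}" using f by (auto simp: finfam_lessThan not_le[symmetric])
  then have "tmap (koszul_bd v i) f b' = (\<Sum>b<3. \<rho> (koszul_bd v i b b') * f b)"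
    by (intro tmap_superset) auto
  moreover have "\<rho> (koszul_bd v i b b') = koszul_bd (\<lambda>j. \<rho> (v j)) i b b'" for b
    unfolding koszul_bd_def using v by (auto simp: rho_zero rho_minus)
  ultimately show "tmap (koszul_bd v i) f b' = koszul_map (\<lambda>j. \<rho> (v j)) i f b'"
    unfolding koszul_map_def by simp
qed

context standard_graded_algebra
begin

lemma mat_koszul:
  assumes "f \<in> finfam car {..<k}" "k \<le> 3" "\<And>j. v j \<in> car"
  shows "matmap (*) (koszul_bd v i) f = koszul_map v i f"
  using self.tmap_koszul[OF assms] by (simp add: self_tmap)

text \<open>Every term of a coordinate beyond \<open>n choose i\<close> contains some
  \<open>v j\<close> with \<open>n \<le> j\<close> or a coordinate of \<open>f\<close> beyond
  \<open>n choose Suc i\<close>.\<close>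

lemma koszul_map_in:
  assumes n: "n \<le> 3" and v: "\<And>j. v j \<in> car" "\<And>j. n \<le> j \<Longrightarrow> v j = 0" and f: "f \<in> finfam car {..<n choose Suc i}"
  shows "koszul_map v i f \<in> finfam car {..<n choose i}"
proof -
  have fC: "\<And>b. f b \<in> car" and f0: "\<And>b. n choose Suc i \<le> b \<Longrightarrow> f b = 0" using f by (auto simp: finfam_lessThan)
  have a: "x + y \<in> car" "x - y \<in> car" "- x \<in> car" if "x \<in> car" "y \<in> car" for x y
    using that subspace_add[OF subspace_C] subspace_diff[OF subspace_C] car_minus by auto
  have c: "koszul_map v i f b \<in> car" for b
    unfolding koszul_map_def koszul_bd_def using fC v(1) zero_C
    by (intro sum_C mult_C) (auto simp: car_minus)
  have "koszul_map v i f b = 0" if "n choose i \<le> b" for b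
  proof (cases "i \<ge> 3")
    case True
    then show ?thesis by (simp add: koszul_map_ge_3)
  next
    case False
    then have i: "i = 0 \<or> i = 1 \<or> i = 2" by linarith
    have "f 0 = 0" if "n \<le> i" using f0[of 0] that by simp
    then show ?thesis
      using i le_3_cases[OF n] \<open>n choose i \<le> b\<close> v(2) f0
      by (elim disjE) (auto simp: koszul_map_simps koszul_map_2[unfolded numeral_2_eq_2] eval_nat_numeral)
  qed
  with c show ?thesis by (auto simp: finfam_lessThan)
qed

lemma koszul_hom_gens:
  assumes n: "n \<le> 3" and v: "\<And>j. v j \<in> gr A 1" "\<And>j. n \<le> j \<Longrightarrow> v j = 0"
  shows "hom_gens {..<n choose i} (\<lambda>_. i) {..<n choose Suc i} (\<lambda>_. Suc i) (koszul_bd v i)"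
  unfolding hom_gens_def
proof (intro ballI conjI allI)
  have vC: "v j \<in> car" for j using gr_C[OF v(1)] .
  fix b assume b: "b \<in> {..<n choose Suc i}"
  have "koszul_bd v i b = matmap (*) (koszul_bd v i) (unit_vec b)" by (simp add: mat_unit_vec)
  also have "\<dots> = koszul_map v i (unit_vec b)"
    by (rule mat_koszul[OF unit_vec_finfam[OF b] choose_le_3[OF n] vC])
  finally show "koszul_bd v i b \<in> finfam car {..<n choose i}"
    using koszul_map_in[OF n vC v(2) unit_vec_finfam[OF b]] by simp
  fix b'
  show "koszul_bd v i b b' \<in> shift (gr A) i (Suc i)"
    using v(1) gr_zero subspace_neg[OF subspace_gr v(1)] by (auto simp: koszul_bd_def shift_def)
qed

lemma koszul_aug:
  "f \<in> finfam car {0} \<Longrightarrow> aug_map (koszul_complex n v) f = residue A (f 0)"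
  unfolding aug_map_def koszul_complex_def using augmap_residue by simp

text \<open>\<open>reg\<close> says that the \<open>v j\<close> form a regular sequence on the
  carrier, \<open>aug\<close> that they generate the augmentation ideal. With three elements at
  most, exactness can be shown by solving the equations of a cycle one coordinate at a time.\<close>

theorem koszul_complex_resolution:
  assumes n: "n \<le> 3" and v: "\<And>j. v j \<in> gr A 1" "\<And>j. n \<le> j \<Longrightarrow> v j = 0"
    and reg: "\<And>j p r. j < n \<Longrightarrow> p \<in> car \<Longrightarrow> (\<forall>i. r i \<in> car) \<Longrightarrow> v j * p = (\<Sum>i<j. v i * r i) \<Longrightarrow>
      \<exists>s. (\<forall>i. s i \<in> car) \<and> p = (\<Sum>i<j. v i * s i)"
    and aug: "\<And>a. a \<in> car \<Longrightarrow> residue A a = 0 \<Longrightarrow> \<exists>s. (\<forall>i. s i \<in> car) \<and> a = (\<Sum>i<n. v i * s i)"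
  shows "graded_free_resolution A (residue_field A) (koszul_complex n v)"
proof -
  let ?F = "koszul_complex n v :: ('a, 'k) gcomplex"
  have vC: "v j \<in> car" for j using gr_C[OF v(1)] .
  have g: "gens ?F i = {..<n choose i}" "gdeg ?F i b = i" "bd ?F i = koszul_bd v i" "aug ?F b = 1" for i b
    by (simp_all add: koszul_complex_def)
  have M: "matmap (*) (koszul_bd v i) f = koszul_map v i f" if "f \<in> finfam car {..<n choose k}" for i k f
    by (rule mat_koszul[OF that choose_le_3[OF n] vC])
  have in1: "koszul_map v i f \<in> finfam car {..<n choose i}" if "f \<in> finfam car {..<n choose Suc i}" for i f
    by (rule koszul_map_in[OF n vC v(2) that])
  have h: "hom_gens {..<n choose i} (\<lambda>_. i) {..<n choose Suc i} (\<lambda>_. Suc i) (koszul_bd v i)" for i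
    by (rule koszul_hom_gens[OF n v])
  have c0: "{..<n choose 0} = {0}" "{..<Suc 0} = {0}" by auto
  have mC: "- x \<in> car" if "x \<in> car" for x using that by (rule car_minus)
  have aC: "x + y \<in> car" if "x \<in> car" "y \<in> car" for x y using that subspace_add[OF subspace_C] by blast
  have r0: "p = 0" if "0 < n" "p \<in> car" "v 0 * p = 0" for p
    using reg[OF that(1,2), of "\<lambda>_. 0"] zero_C that(3) by auto
  have r1: "\<exists>s\<in>car. p = v 0 * s" if "1 < n" "p \<in> car" "r \<in> car" "v 1 * p = v 0 * r" for p r
    using reg[OF that(1,2), of "\<lambda>_. r"] that(3,4) by auto
  have r2: "\<exists>s\<in>car. \<exists>t\<in>car. p = v 0 * s + v 1 * t"
    if 2: "2 < n" "p \<in> car" "r \<in> car" "q \<in> car" "v 2 * p = v 0 * r + v 1 * q" for p r q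
  proof -
    have "\<forall>i::nat. (if i = 0 then r else q) \<in> car" using that(3,4) by simp
    moreover have "v 2 * p = (\<Sum>i<2. v i * (if i = 0 then r else q))"
      using that(5) by (simp add: numeral_2_eq_2)
    ultimately have "\<exists>s. (\<forall>i. s i \<in> car) \<and> p = (\<Sum>i<2. v i * s i)"
      by (rule reg[OF 2(1,2)])
    then obtain s where s: "\<forall>i. s i \<in> car" "p = (\<Sum>i<2. v i * s i)" by blast
    have "p = v 0 * s 0 + v 1 * s 1" using s(2) by (simp add: numeral_2_eq_2)
    then show ?thesis using s(1) by blast
  qed
  \<comment> \<open>Relations between the first two elements: regularity of \<open>v 1\<close>
    modulo \<open>v 0\<close> gives \<open>b\<close>, and cancelling the nonzerodivisor
    \<open>v 0\<close> gives \<open>a\<close>.\<close>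
  have E2: "\<exists>s\<in>car. a = - (v 1 * s) \<and> b = v 0 * s"
    if ab: "1 < n" "a \<in> car" "b \<in> car" "v 0 * a + v 1 * b = 0" for a b
  proof -
    have "v 1 * b = v 0 * (- a)" using ab(4) by (simp add: eq_neg_iff_add_eq_0 add.commute)
    then obtain s where s: "s \<in> car" "b = v 0 * s" using r1[OF ab(1,3) mC[OF ab(2)]] by blast
    have "v 0 * (a + v 1 * s) = 0" using ab(4) s(2) by (simp add: algebra_simps)
    then have "a + v 1 * s = 0" by (rule r0[rotated -1, OF _ _ aC[OF ab(2) mult_C[OF vC s(1)]]]) (use ab(1) in simp)
    then show ?thesis using s by (auto simp: eq_neg_iff_add_eq_0)
  qed
  have E: "f \<in> koszul_map v 1 ` finfam car {..<n choose 2}"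
    if f: "f \<in> finfam car {..<n}" "koszul_map v 0 f = 0" for f
  proof -
    have fC: "f b \<in> car" and f0: "n \<le> b \<Longrightarrow> f b = 0" for b using f(1) by (auto simp: finfam_lessThan)
    have e: "v 0 * f 0 + v 1 * f 1 + v 2 * f 2 = 0" using fun_cong[OF f(2), of 0] by (simp add: koszul_map_0)
    consider "n = 0" | "n = 1" | "n = 2" | "n = 3" using le_3_cases[OF n] by blast
    then obtain w where w: "w \<in> finfam car {..<n choose 2}" "\<forall>b<3. f b = koszul_map v 1 w b"
    proof cases
      case 1
      show thesis by (rule that[of 0]) (use 1 f0 zero_C in \<open>auto simp: finfam_lessThan koszul_map_simps\<close>)
    next
      case 2
      have "f 0 = 0" using e r0[of "f 0"] fC f0 2 by simp
      then have "\<forall>b. f b = 0" using f0 2 by (metis One_nat_def less_one not_le)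
      then show thesis by (intro that[of 0]) (use zero_C in \<open>auto simp: finfam_lessThan koszul_map_simps\<close>)
    next
      case 3
      obtain s where s: "s \<in> car" "f 0 = - (v 1 * s)" "f 1 = v 0 * s"
        using E2[of "f 0" "f 1"] e fC f0 3 by auto
      show thesis
        by (rule that[of "\<lambda>b. if b = 0 then s else 0"])
          (use s f0 3 zero_C in \<open>auto simp: finfam_lessThan koszul_map_simps choose_2_values less_Suc_eq numeral_3_eq_3\<close>)
    next
      case 4
      \<comment> \<open>Regularity of \<open>v 2\<close> puts \<open>f 2\<close> into the ideal of
        \<open>v 0\<close> and \<open>v 1\<close>. Correcting \<open>f 0\<close> and
        \<open>f 1\<close> by multiples of \<open>v 2\<close> then leaves a relation between
        \<open>v 0\<close> and \<open>v 1\<close> only.\<close>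
      have "v 2 * f 2 = v 0 * (- f 0) + v 1 * (- f 1)" using e by (simp add: algebra_simps eq_neg_iff_add_eq_0)
      then obtain s t where st: "s \<in> car" "t \<in> car" "f 2 = v 0 * s + v 1 * t"
        using r2[of "f 2" "- f 0" "- f 1"] fC mC 4 by auto
      have "v 0 * (f 0 + v 2 * s) + v 1 * (f 1 + v 2 * t) = 0"
        using e st(3) by (simp add: algebra_simps)
      then obtain u where u: "u \<in> car" "f 0 + v 2 * s = - (v 1 * u)" "f 1 + v 2 * t = v 0 * u"
        using E2[of "f 0 + v 2 * s" "f 1 + v 2 * t"] fC st aC mult_C vC 4 by auto
      have "f 0 = - (v 1 * u) - v 2 * s" "f 1 = v 0 * u - v 2 * t"
        using u(2,3) by (simp_all add: algebra_simps eq_neg_iff_add_eq_0 eq_diff_eq)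
      then show thesis
        by (intro that[of "\<lambda>b. if b = 0 then u else if b = 1 then s else if b = 2 then t else 0"])
          (use st u zero_C 4 in \<open>auto simp: finfam_lessThan koszul_map_simps choose_2_values less_Suc_eq numeral_3_eq_3 numeral_2_eq_2\<close>)
    qed
    have "f = koszul_map v 1 w"
    proof
      fix b show "f b = koszul_map v 1 w b"
        using w(2) f0[of b] n by (cases "b < 3") (auto simp: koszul_map_simps)
    qed
    then show ?thesis using w(1) by blast
  qed
  have E': "f \<in> koszul_map v 2 ` finfam car {..<n choose 3}"
    if f: "f \<in> finfam car {..<n choose 2}" "koszul_map v 1 f = 0" for f
  proof -
    have fC: "f b \<in> car" and f0: "n choose 2 \<le> b \<Longrightarrow> f b = 0" for b using f(1) by (auto simp: finfam_lessThan)
    have "koszul_map v 1 f 0 = 0" "koszul_map v 1 f 1 = 0" "koszul_map v 1 f 2 = 0" using f(2) by simp_all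
    then have e: "- (v 1 * f 0) - v 2 * f 1 = 0" "v 0 * f 0 - v 2 * f 2 = 0" "v 0 * f 1 + v 1 * f 2 = 0"
      by (simp_all add: koszul_map_simps)
    have z: ?thesis if "f = 0"
      by (rule image_eqI[of _ _ 0]) (use that zero_C in \<open>auto simp: finfam_lessThan koszul_map_2\<close>)
    consider "n \<le> 1" | "n = 2" | "n = 3" using le_3_cases[OF n] by linarith
    then show ?thesis
    proof cases
      case 1
      then have "f b = 0" for b by (intro f0) (simp add: binomial_eq_0)
      then show ?thesis using z by (simp add: fun_eq_iff)
    next
      case 2
      have "v 2 = 0" using v(2) 2 by simp
      then have "f 0 = 0" using e r0[of "f 0"] fC 2 by simp
      then have "f b = 0" for b using f0[of b] 2 by (cases b) (auto simp: choose_2_values)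
      then show ?thesis using z by (simp add: fun_eq_iff)
    next
      case 3
      \<comment> \<open>The third equation is a relation between \<open>v 0\<close> and
        \<open>v 1\<close> and gives \<open>s\<close>; the second one then determines
        \<open>f 0\<close>, again by cancelling \<open>v 0\<close>.\<close>
      obtain s where s: "s \<in> car" "f 1 = - (v 1 * s)" "f 2 = v 0 * s"
        using E2[of "f 1" "f 2"] e fC 3 by auto
      have "v 0 * (f 0 + - (v 2 * s)) = 0" using e(2) s by (simp add: algebra_simps)
      then have "f 0 + - (v 2 * s) = 0"
        by (rule r0[rotated -1, OF _ _ aC[OF fC mC[OF mult_C[OF vC s(1)]]]]) (use 3 in simp)
      then have "f 0 = v 2 * s" by simp
      moreover have "f b = 0" if "b \<ge> 3" for b using f0 that 3 by (simp add: choose_2_values)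
      ultimately have "f b = koszul_map v 2 (\<lambda>b. if b = 0 then s else 0) b" for b
        unfolding koszul_map_2 using s
        by (cases "b \<ge> 3") (auto simp: not_le less_Suc_eq numeral_3_eq_3 numeral_2_eq_2)
      then have "f = koszul_map v 2 (\<lambda>b. if b = 0 then s else 0)" by blast
      moreover have "(\<lambda>b. if b = 0 then s else 0) \<in> finfam car {..<n choose 3}"
        using s(1) zero_C 3 by (auto simp: finfam_lessThan choose_3_values)
      ultimately show ?thesis by blast
    qed
  qed
  have E'': "f = 0" if f: "f \<in> finfam car {..<n choose 3}" "koszul_map v 2 f = 0" for f
  proof (cases "n = 3")
    case True
    have "koszul_map v 2 f 2 = 0" using f(2) by simp
    then have "f 0 = 0" using r0[of "f 0"] f(1) True by (simp add: koszul_map_2 finfam_lessThan)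
    then have "f b = 0" for b
      using f(1) True by (cases b) (auto simp: finfam_lessThan choose_3_values)
    then show ?thesis by (simp add: fun_eq_iff)
  next
    case False
    then have "n < 3" using n by simp
    then show ?thesis using f(1) by (simp add: finfam_empty binomial_eq_0)
  qed
  show ?thesis
    unfolding graded_free_resolution_def
  proof (intro conjI allI ballI)
    fix b show "aug ?F b \<in> mgr (residue_field A) (gdeg ?F 0 b)"
      by (simp add: g mgr_residue_field)
  next
    fix i b b' assume "b \<in> gens ?F (Suc i)"
    then show "bd ?F i b \<in> finfam car (gens ?F i)"
      "bd ?F i b b' \<in> shift (gr A) (gdeg ?F i b') (gdeg ?F (Suc i) b)"
      using h[of i] by (simp_all add: hom_gens_def g)
  next
    have "c \<in> augmap (act (residue_field A)) (aug ?F) ` finfam car (gens ?F 0)" for c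
    proof -
      let ?f = "const_vec (\<lambda>b. if b = 0 then c else 0)"
      have f: "?f \<in> finfam car {0}" by (rule const_vec_finfam) (auto simp: finfam_iff)
      then show ?thesis
        using koszul_aug[OF f] by (intro image_eqI[of _ _ ?f])
          (auto simp: aug_map_def residue_const_vec g c0)
    qed
    then show "augmap (act (residue_field A)) (aug ?F) ` finfam car (gens ?F 0) = gsum (mgr (residue_field A))"
      unfolding gsum_residue_field by blast
  next
    have A: "augmap (act (residue_field A)) (aug ?F) f = residue A (f 0)" if "f \<in> finfam car {0}" for f
      using koszul_aug[OF that] by (simp add: aug_map_def)
    show "matmap (*) (bd ?F 0) ` finfam car (gens ?F 1) =
        {f \<in> finfam car (gens ?F 0). augmap (act (residue_field A)) (aug ?F) f = 0}"
    proof (intro equalityI subsetI)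
      fix f assume "f \<in> matmap (*) (bd ?F 0) ` finfam car (gens ?F 1)"
      then obtain w where w: "w \<in> finfam car {..<n choose 1}" "f = matmap (*) (koszul_bd v 0) w"
        unfolding g by blast
      have w: "w \<in> finfam car {..<n choose 1}" "f = koszul_map v 0 w" using w M[OF w(1)] by simp_all
      have f: "f \<in> finfam car {0}" using in1[of w 0] w c0 by simp
      have "residue A (v j * w j) = 0" for j
        using residue_mult[OF vC, of "w j"] residue_gr[OF v(1)] w(1) by (simp add: finfam_lessThan)
      then have "residue A (f 0) = 0"
        using w vC by (simp add: koszul_map_0 residue_add mult_C finfam_lessThan aC)
      then show "f \<in> {f \<in> finfam car (gens ?F 0). augmap (act (residue_field A)) (aug ?F) f = 0}"
        using A[OF f] f by (simp add: g c0)
    next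
      fix f assume "f \<in> {f \<in> finfam car (gens ?F 0). augmap (act (residue_field A)) (aug ?F) f = 0}"
      then have f: "f \<in> finfam car {0}" "residue A (f 0) = 0" using A by (auto simp: g c0)
      then obtain s where s: "\<forall>i. s i \<in> car" "f 0 = (\<Sum>i<n. v i * s i)"
        using aug[of "f 0"] by (auto simp: finfam_iff)
      let ?w = "\<lambda>i. if i < n then s i else 0"
      have w: "?w \<in> finfam car {..<n choose 1}" using s zero_C by (simp add: finfam_lessThan)
      have "(\<Sum>i<n. v i * s i) = (\<Sum>i<3. v i * ?w i)"
        using n by (intro sum.mono_neutral_cong_left) auto
      then have "f 0 = v 0 * ?w 0 + v 1 * ?w 1 + v 2 * ?w 2" using s(2) by (simp add: sum_lessThan_3)
      moreover have "f b = 0" if "b \<noteq> 0" for b using f(1) that by (auto simp: finfam_iff)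
      ultimately have "f = koszul_map v 0 ?w" by (simp add: koszul_map_0 fun_eq_iff)
      then show "f \<in> matmap (*) (bd ?F 0) ` finfam car (gens ?F 1)"
        using M[OF w, of 0] w by (intro image_eqI[of _ _ ?w]) (auto simp: g)
    qed
  next
    fix i
    have I: "matmap (*) (bd ?F j) ` finfam car (gens ?F k) = koszul_map v j ` finfam car {..<n choose k}" for j k
      unfolding g using M by (intro image_cong) auto
    have K: "{f \<in> finfam car (gens ?F (Suc i)). matmap (*) (bd ?F i) f = 0} =
        {f \<in> finfam car {..<n choose Suc i}. koszul_map v i f = 0}"
      unfolding g using M by auto
    show "matmap (*) (bd ?F (Suc i)) ` finfam car (gens ?F (Suc (Suc i))) =
        {f \<in> finfam car (gens ?F (Suc i)). matmap (*) (bd ?F i) f = 0}"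
      unfolding I K
    proof (intro equalityI subsetI)
      fix f assume "f \<in> koszul_map v (Suc i) ` finfam car {..<n choose Suc (Suc i)}"
      then obtain w where w: "w \<in> finfam car {..<n choose Suc (Suc i)}" "f = koszul_map v (Suc i) w" by blast
      have "koszul_map v i f = 0"
      proof (cases "i < 2")
        case True
        then show ?thesis
          using w(2) koszul_map_comp_1 koszul_map_comp_2 by (auto simp: less_Suc_eq numeral_2_eq_2)
      next
        case False
        then show ?thesis using w(2) koszul_map_ge_3[of "Suc i" v w] by (simp add: koszul_map_def fun_eq_iff)
      qed
      then show "f \<in> {f \<in> finfam car {..<n choose Suc i}. koszul_map v i f = 0}" using in1[OF w(1)] w(2) by simp
    next
      fix f assume f: "f \<in> {f \<in> finfam car {..<n choose Suc i}. koszul_map v i f = 0}"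
      consider "i = 0" | "i = 1" | "i = 2" | "i \<ge> 3" by linarith
      then show "f \<in> koszul_map v (Suc i) ` finfam car {..<n choose Suc (Suc i)}"
      proof cases
        case 1 then show ?thesis using f E[of f] by (simp add: numeral_2_eq_2)
      next
        case 2 then show ?thesis using f E'[of f] by (simp add: numeral_2_eq_2 numeral_3_eq_3)
      next
        case 3
        then have "f = 0" using f E''[of f] by (simp add: numeral_3_eq_3)
        then show ?thesis
          by (intro image_eqI[of _ _ 0]) (auto simp: koszul_map_def fun_eq_iff finfam_lessThan zero_C)
      next
        case 4
        then have "n < Suc i" using n by simp
        then have "f = 0" using f finfam_empty[of f car] by (simp add: binomial_eq_0)
        then show ?thesis
          by (intro image_eqI[of _ _ 0]) (auto simp: koszul_map_def fun_eq_iff finfam_lessThan zero_C)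
      qed
    qed
  qed
qed

end

section \<open>Betti numbers as dimensions of Koszul homology\<close>

abbreviation sym_var :: "'r \<Rightarrow> ('r \<Rightarrow>\<^sub>0 nat) \<Rightarrow>\<^sub>0 'k::field"
  where "sym_var x \<equiv> Poly_Mapping.single (Poly_Mapping.single x 1) 1"

lemma single_mult_eq_sum:
  fixes p :: "('r \<Rightarrow>\<^sub>0 nat) \<Rightarrow>\<^sub>0 'k::field"
  shows "Poly_Mapping.single a 1 * p =
    (\<Sum>m\<in>Poly_Mapping.keys p. Poly_Mapping.single (a + m) (Poly_Mapping.lookup p m))"
  by (subst poly_mapping_sum_single[of p]) (simp add: sum_distrib_left mult_single)

lemma lookup_single_mult_add:
  fixes p :: "('r \<Rightarrow>\<^sub>0 nat) \<Rightarrow>\<^sub>0 'k::field"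
  shows "Poly_Mapping.lookup (Poly_Mapping.single a 1 * p) (a + m) = Poly_Mapping.lookup p m"
  unfolding single_mult_eq_sum
  by (auto simp: lookup_sum lookup_single when_def in_keys_iff)

lemma keys_sym_var_mult:
  fixes p :: "('r \<Rightarrow>\<^sub>0 nat) \<Rightarrow>\<^sub>0 'k::field"
  assumes "m \<in> Poly_Mapping.keys (sym_var x * p)"
  shows "x \<in> Poly_Mapping.keys m"
proof -
  obtain a b where "m = a + b" "a \<in> Poly_Mapping.keys (sym_var x :: ('r \<Rightarrow>\<^sub>0 nat) \<Rightarrow>\<^sub>0 'k)"
    using keys_mult[of "sym_var x" p] assms by blast
  then show ?thesis by (simp add: keys_add_nat)
qed

lemma sym_gr_degree:
  "p \<in> gr (sym_algebra X) d \<Longrightarrow> m \<in> Poly_Mapping.keys p \<Longrightarrow>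
    (\<Sum>x\<in>Poly_Mapping.keys m. Poly_Mapping.lookup m x) = d"
  by (simp add: sym_algebra_def)

lemma sym_car_iff:
  fixes X :: "'r set" and p :: "('r \<Rightarrow>\<^sub>0 nat) \<Rightarrow>\<^sub>0 'k::field"
  assumes "finite X"
  shows "p \<in> gsum (gr (sym_algebra X)) \<longleftrightarrow> (\<forall>m\<in>Poly_Mapping.keys p. Poly_Mapping.keys m \<subseteq> X)"
proof
  interpret Q: standard_graded_algebra "sym_algebra X :: ('k, _) galgebra"
    by (rule standard_graded_sym_algebra[OF assms])
  show "\<forall>m\<in>Poly_Mapping.keys p. Poly_Mapping.keys m \<subseteq> X" if p: "p \<in> gsum (gr (sym_algebra X))"
  proof
    fix m assume m: "m \<in> Poly_Mapping.keys p"
    obtain n f where f: "p = (\<Sum>i\<le>n. f i)" "\<forall>i. f i \<in> gr (sym_algebra X) i"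
      using p by (auto simp: gsum_def)
    obtain i where "m \<in> Poly_Mapping.keys (f i)"
      using m f(1) by (auto simp: in_keys_iff lookup_sum elim!: sum.not_neutral_contains_not_neutral)
    then show "Poly_Mapping.keys m \<subseteq> X" using f(2) by (simp add: sym_algebra_def)
  qed
  show "p \<in> gsum (gr (sym_algebra X))" if p: "\<forall>m\<in>Poly_Mapping.keys p. Poly_Mapping.keys m \<subseteq> X"
  proof -
    have "Poly_Mapping.single m (Poly_Mapping.lookup p m) \<in> gsum (gr (sym_algebra X))"
      if "m \<in> Poly_Mapping.keys p" for m
    proof (rule Q.gr_C)
      show "Poly_Mapping.single m (Poly_Mapping.lookup p m) \<in>
          gr (sym_algebra X) (\<Sum>x\<in>Poly_Mapping.keys m. Poly_Mapping.lookup m x)"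
        using p that by (auto simp: sym_algebra_def)
    qed
    then have "(\<Sum>m\<in>Poly_Mapping.keys p. Poly_Mapping.single m (Poly_Mapping.lookup p m)) \<in> gsum (gr (sym_algebra X))"
      by (rule Q.sum_C)
    then show ?thesis using poly_mapping_sum_single[of p] by simp
  qed
qed

text \<open>Distribute the monomials of \<open>p\<close> according to a variable that divides them:
  \<open>c m\<close> is the index chosen for \<open>m\<close>, and \<open>s i\<close> collects the
  quotients by \<open>x i\<close> of the terms assigned to \<open>i\<close>.\<close>

lemma sym_ideal_intro:
  fixes p :: "('r \<Rightarrow>\<^sub>0 nat) \<Rightarrow>\<^sub>0 'k::field" and x :: "nat \<Rightarrow> 'r"
  assumes X: "finite X" and p: "p \<in> gsum (gr (sym_algebra X))"
    and J: "\<And>m. m \<in> Poly_Mapping.keys p \<Longrightarrow> \<exists>i<j. x i \<in> Poly_Mapping.keys m"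
  shows "\<exists>s. (\<forall>i. s i \<in> gsum (gr (sym_algebra X))) \<and> p = (\<Sum>i<j. sym_var (x i) * s i)"
proof -
  obtain c where c: "\<And>m. m \<in> Poly_Mapping.keys p \<Longrightarrow> c m < j \<and> x (c m) \<in> Poly_Mapping.keys m"
    using J by metis
  define s where "s = (\<lambda>i. \<Sum>m\<in>{m \<in> Poly_Mapping.keys p. c m = i}.
    Poly_Mapping.single (m - Poly_Mapping.single (x i) 1) (Poly_Mapping.lookup p m))"
  have mm: "Poly_Mapping.single (x (c m)) 1 + (m - Poly_Mapping.single (x (c m)) 1) = m"
    if "m \<in> Poly_Mapping.keys p" for m
    using c[OF that] by (intro poly_mapping_eqI)
      (auto simp: lookup_add lookup_minus lookup_single when_def in_keys_iff)
  have "sym_var (x i) * s i = (\<Sum>m\<in>{m \<in> Poly_Mapping.keys p. c m = i}.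
      Poly_Mapping.single m (Poly_Mapping.lookup p m))" for i
    unfolding s_def sum_distrib_left mult_single using mm by (intro sum.cong) auto
  then have "(\<Sum>i<j. sym_var (x i) * s i) =
      (\<Sum>m\<in>Poly_Mapping.keys p. Poly_Mapping.single m (Poly_Mapping.lookup p m))"
    using sum.group[of "Poly_Mapping.keys p" "{..<j}" c] c by auto
  moreover have "s i \<in> gsum (gr (sym_algebra X))" for i
    unfolding sym_car_iff[OF X]
  proof
    fix m assume "m \<in> Poly_Mapping.keys (s i)"
    then obtain m' where m': "m' \<in> Poly_Mapping.keys p" "c m' = i" "m = m' - Poly_Mapping.single (x i) 1"
      unfolding s_def by (auto simp: in_keys_iff lookup_sum lookup_single when_def
        elim!: sum.not_neutral_contains_not_neutral split: if_splits)
    have "Poly_Mapping.keys m \<subseteq> Poly_Mapping.keys m'"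
      using keys_add_nat[of "Poly_Mapping.single (x i) 1" m] mm[OF m'(1)] m'(2,3) by (simp add: subset_insertI)
    also have "\<dots> \<subseteq> X" using p[unfolded sym_car_iff[OF X]] m'(1) by (rule bspec)
    finally show "Poly_Mapping.keys m \<subseteq> X" .
  qed
  ultimately show ?thesis
    using trans[OF poly_mapping_sum_single[of p], of "\<Sum>i<j. sym_var (x i) * s i"] by (intro exI[of _ s]) simp
qed

text \<open>Variables form a regular sequence because their ideals are monomial: if
  \<open>x j\<close> times a monomial contains some \<open>x i\<close> with \<open>i < j\<close>,
  the monomial itself does, as \<open>x i \<noteq> x j\<close>.\<close>

lemma sym_regular:
  fixes p :: "('r \<Rightarrow>\<^sub>0 nat) \<Rightarrow>\<^sub>0 'k::field" and x :: "nat \<Rightarrow> 'r"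
  assumes X: "finite X" and p: "p \<in> gsum (gr (sym_algebra X))" and x: "\<And>i. i < j \<Longrightarrow> x i \<noteq> x j"
    and e: "sym_var (x j) * p = (\<Sum>i<j. sym_var (x i) * r i)"
  shows "\<exists>s. (\<forall>i. s i \<in> gsum (gr (sym_algebra X))) \<and> p = (\<Sum>i<j. sym_var (x i) * s i)"
proof (rule sym_ideal_intro[OF X p])
  fix m assume "m \<in> Poly_Mapping.keys p"
  then have "Poly_Mapping.single (x j) 1 + m \<in> Poly_Mapping.keys (sym_var (x j) * p)"
    by (simp only: in_keys_iff lookup_single_mult_add simp_thms)
  then obtain i where i: "i < j" "Poly_Mapping.single (x j) 1 + m \<in> Poly_Mapping.keys (sym_var (x i) * r i)"
    unfolding e by (auto simp: in_keys_iff lookup_sum elim!: sum.not_neutral_contains_not_neutral)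
  then have "x i \<in> Poly_Mapping.keys (Poly_Mapping.single (x j) 1 + m)" by (intro keys_sym_var_mult)
  then show "\<exists>i<j. x i \<in> Poly_Mapping.keys m" using i x by (auto simp: keys_add_nat)
qed

section \<open>The presentation of \<open>R\<close> by the symmetric algebra\<close>

locale presented_algebra = standard_graded_algebra R
  for R :: "('k::field, 'r::comm_ring_1) galgebra" +
  fixes X :: "'r set" and n :: nat and x :: "nat \<Rightarrow> 'r"
  assumes independent_X: "\<not> module.dependent (smul R) X"
    and span_X: "module.span (smul R) X = gr R 1"
    and n_le: "n \<le> 3" and x_bij: "bij_betw x {..<n} X"
begin

abbreviation "Q \<equiv> sym_algebra X :: ('k, ('r \<Rightarrow>\<^sub>0 nat) \<Rightarrow>\<^sub>0 'k) galgebra"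

lemma finite_X: "finite X"
  using x_bij bij_betw_finite by blast

lemma X_gr: "y \<in> X \<Longrightarrow> y \<in> gr R 1"
  using span_X span_base by blast

sublocale Q: standard_graded_algebra Q
  by (rule standard_graded_sym_algebra[OF finite_X])

text \<open>\<open>xs\<close> and \<open>qs\<close> are the variables in \<open>R\<close> and in
  \<open>Q\<close>, continued by 0 beyond \<open>n\<close> so that the formulas for three elements
  apply whatever \<open>n\<close> is.\<close>

definition xs :: "nat \<Rightarrow> 'r" where "xs j = (if j < n then x j else 0)"

definition qs :: "nat \<Rightarrow> ('r \<Rightarrow>\<^sub>0 nat) \<Rightarrow>\<^sub>0 'k" where "qs j = (if j < n then sym_var (x j) else 0)"

lemma xs_gr: "xs j \<in> gr R 1"
  using X_gr bij_betwE[OF x_bij] gr_zero by (auto simp: xs_def)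

lemma xs_car: "xs j \<in> car"
  by (rule gr_C[OF xs_gr])

lemma xs_ge: "n \<le> j \<Longrightarrow> xs j = 0"
  by (simp add: xs_def)

lemma qs_gr: "qs j \<in> gr Q 1"
  using bij_betwE[OF x_bij] by (auto simp: qs_def sym_algebra_def)

lemma sym_koszul_resolution: "graded_free_resolution Q (residue_field Q) (koszul_complex n qs)"
proof (rule Q.koszul_complex_resolution[OF n_le qs_gr])
  show "qs j = 0" if "n \<le> j" for j using that by (simp add: qs_def)
next
  fix j p r
  assume j: "j < n" and p: "p \<in> gsum (gr Q)" and e: "qs j * p = (\<Sum>i<j. qs i * r i)"
  have "sym_var (x j) * p = (\<Sum>i<j. sym_var (x i) * r i)" using e j by (simp add: qs_def)
  moreover have "x i \<noteq> x j" if "i < j" for i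
    using x_bij that j unfolding bij_betw_def by (auto dest!: inj_onD[where x = i and y = j])
  ultimately have "\<exists>s. (\<forall>i. s i \<in> gsum (gr Q)) \<and> p = (\<Sum>i<j. sym_var (x i) * s i)"
    using sym_regular[OF finite_X p] by blast
  then show "\<exists>s. (\<forall>i. s i \<in> gsum (gr Q)) \<and> p = (\<Sum>i<j. qs i * s i)" using j by (simp add: qs_def)
next
  fix a assume a: "a \<in> gsum (gr Q)" "residue Q a = 0"
  have "\<exists>s. (\<forall>i. s i \<in> gsum (gr Q)) \<and> a = (\<Sum>i<n. sym_var (x i) * s i)"
  proof (rule sym_ideal_intro[OF finite_X a(1)])
    fix m assume m: "m \<in> Poly_Mapping.keys a"
    have "Poly_Mapping.lookup a 0 = 0"
    proof -
      obtain N where N: "a = (\<Sum>i\<le>N. Q.hc a i)" using Q.hc_decomp[OF a(1)] by (auto simp: Q.decomp_def)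
      have "Poly_Mapping.lookup (Q.hc a i) 0 = 0" for i
      proof (cases "i = 0")
        case True
        then show ?thesis using a Q.residue_0_iff by simp
      next
        case False
        have "0 \<notin> Poly_Mapping.keys (Q.hc a i)"
        proof
          assume "0 \<in> Poly_Mapping.keys (Q.hc a i)"
          from sym_gr_degree[OF Q.hc_gr[OF a(1), of i] this] False show False by simp
        qed
        then show ?thesis by (simp only: in_keys_iff not_not)
      qed
      then show ?thesis by (subst N) (simp add: lookup_sum)
    qed
    then have "m \<noteq> 0" using m by (auto simp: in_keys_iff)
    then obtain y where y: "y \<in> Poly_Mapping.keys m" by (metis keys_eq_empty all_not_in_conv)
    moreover have "Poly_Mapping.keys m \<subseteq> X"
      using a(1)[unfolded sym_car_iff[OF finite_X]] m by (rule bspec)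
    ultimately have "y \<in> X" by (rule subsetD[rotated])
    then obtain i where "i < n" "y = x i" using x_bij unfolding bij_betw_def by blast
    then show "\<exists>i<n. x i \<in> Poly_Mapping.keys m" using y by blast
  qed
  then show "\<exists>s. (\<forall>i. s i \<in> gsum (gr Q)) \<and> a = (\<Sum>i<n. qs i * s i)" by (simp add: qs_def)
qed

definition sym_monomial :: "('r \<Rightarrow>\<^sub>0 nat) \<Rightarrow> 'r"
  where "sym_monomial m = (\<Prod>y\<in>Poly_Mapping.keys m. y ^ Poly_Mapping.lookup m y)"

lemma sym_monomial_superset:
  assumes "finite S" "Poly_Mapping.keys m \<subseteq> S"
  shows "sym_monomial m = (\<Prod>y\<in>S. y ^ Poly_Mapping.lookup m y)"
  unfolding sym_monomial_def using assms
  by (intro prod.mono_neutral_left) (auto simp: in_keys_iff)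

lemma sym_monomial_add: "sym_monomial (a + b) = sym_monomial a * sym_monomial b"
  using sym_monomial_superset[of "Poly_Mapping.keys a \<union> Poly_Mapping.keys b" a]
    sym_monomial_superset[of "Poly_Mapping.keys a \<union> Poly_Mapping.keys b" b]
  by (simp add: sym_monomial_def[of "a + b"] keys_add_nat lookup_add power_add prod.distrib)

lemma sym_map_superset:
  assumes "finite S" "Poly_Mapping.keys p \<subseteq> S"
  shows "sym_map R p = (\<Sum>m\<in>S. smul R (Poly_Mapping.lookup p m) (sym_monomial m))"
  unfolding sym_map_def sym_monomial_def[symmetric] using assms
  by (intro sum.mono_neutral_left) (auto simp: in_keys_iff)

lemma sym_map_add: "sym_map R (p + q) = sym_map R p + sym_map R q"
  using sym_map_superset[of "Poly_Mapping.keys p \<union> Poly_Mapping.keys q" p]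
    sym_map_superset[of "Poly_Mapping.keys p \<union> Poly_Mapping.keys q" q]
    sym_map_superset[of "Poly_Mapping.keys p \<union> Poly_Mapping.keys q" "p + q"] keys_add[of p q]
  by (simp add: lookup_add scale_left_distrib sum.distrib)

lemma sym_map_sum: "sym_map R (sum f I) = (\<Sum>i\<in>I. sym_map R (f i))"
  by (induction I rule: infinite_finite_induct) (simp_all add: sym_map_add, simp_all add: sym_map_def)

lemma sym_map_single: "sym_map R (Poly_Mapping.single m c) = smul R c (sym_monomial m)"
  using sym_map_superset[of "{m}" "Poly_Mapping.single m c"] by simp

lemma sym_map_mult: "sym_map R (p * q) = sym_map R p * sym_map R q"
proof -
  let ?s = "\<lambda>p m. Poly_Mapping.single m (Poly_Mapping.lookup p m)"
  have "p * q = (\<Sum>a\<in>Poly_Mapping.keys p. ?s p a) * (\<Sum>b\<in>Poly_Mapping.keys q. ?s q b)"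
    using poly_mapping_sum_single[of p] poly_mapping_sum_single[of q] by simp
  also have "\<dots> = (\<Sum>a\<in>Poly_Mapping.keys p. \<Sum>b\<in>Poly_Mapping.keys q.
      Poly_Mapping.single (a + b) (Poly_Mapping.lookup p a * Poly_Mapping.lookup q b))"
    by (simp add: sum_product mult_single)
  finally have "sym_map R (p * q) = (\<Sum>a\<in>Poly_Mapping.keys p. \<Sum>b\<in>Poly_Mapping.keys q.
      smul R (Poly_Mapping.lookup p a) (sym_monomial a) * smul R (Poly_Mapping.lookup q b) (sym_monomial b))"
    by (simp add: sym_map_sum sym_map_single sym_monomial_add smul_comm smul_mult[symmetric] mult.commute)
  then show ?thesis
    by (simp add: sum_product sym_map_superset[of "Poly_Mapping.keys p" p] sym_map_superset[of "Poly_Mapping.keys q" q])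
qed

lemma sym_map_car:
  assumes "p \<in> gsum (gr Q)" shows "sym_map R p \<in> car"
proof -
  have p: "y \<in> car" "y ^ k \<in> car" if "y \<in> X" for y k
  proof -
    show y: "y \<in> car" using X_gr[OF that] by (rule gr_C)
    show "y ^ k \<in> car" by (induction k) (simp_all add: one_C mult_C y)
  qed
  have prodC: "finite S \<Longrightarrow> S \<subseteq> X \<Longrightarrow> (\<Prod>y\<in>S. y ^ k y) \<in> car" for S k
    by (induction S rule: finite_induct) (simp_all add: one_C mult_C p)
  show ?thesis
    unfolding sym_map_def using assms unfolding sym_car_iff[OF finite_X]
    by (intro sum_C subspace_scale[OF subspace_C] prodC) auto
qed

sublocale B: base_change Q "sym_map R" "gsum (gr R)"
proof
  show "sym_map R 1 = 1"
    using sym_map_single[of 0 1] by (simp add: sym_monomial_def)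
qed (auto simp: sym_map_add sym_map_mult sym_map_car zero_C mult_C intro: subspace_add[OF subspace_C])

lemma sym_map_const: "sym_map R (smul Q c 1) = smul R c 1"
  using sym_map_single[of 0 c] by (simp add: sym_algebra_def sym_monomial_def)

lemma vs_eq: "B.vs = vscale"
  by (simp add: B.vs_def fun_eq_iff sym_map_const smul_one_mult)

lemma sym_map_qs: "sym_map R (qs j) = xs j"
  using sym_map_single[of 0 0] by (simp add: qs_def xs_def sym_map_single sym_monomial_def)

definition koszul_cycles :: "nat \<Rightarrow> (nat \<Rightarrow> 'r) set"
  where "koszul_cycles i = {f \<in> finfam car {..<n choose i}. i \<noteq> 0 \<longrightarrow> koszul_map xs (i - 1) f = 0}"

definition koszul_boundaries :: "nat \<Rightarrow> (nat \<Rightarrow> 'r) set"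
  where "koszul_boundaries i = koszul_map xs i ` finfam car {..<n choose Suc i}"

lemma tmap_koszul_qs: "f \<in> finfam car {..<n choose k} \<Longrightarrow> B.tmap (koszul_bd qs i) f = koszul_map xs i f"
  using B.tmap_koszul[of f "n choose k" qs i] choose_le_3[OF n_le] Q.gr_C[OF qs_gr] by (simp add: sym_map_qs)

lemma homology_cycles_koszul: "B.homology_cycles (koszul_complex n qs :: (_, 'm::one) gcomplex) i = koszul_cycles i"
  unfolding B.homology_cycles_def koszul_cycles_def by (auto simp: koszul_complex_def tmap_koszul_qs)

lemma homology_boundaries_koszul: "B.homology_boundaries (koszul_complex n qs :: (_, 'm::one) gcomplex) i = koszul_boundaries i"
  unfolding B.homology_boundaries_def koszul_boundaries_def
  by (auto simp: koszul_complex_def tmap_koszul_qs intro!: image_cong)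

text \<open>Unfolded, \<open>betti\<close> is the homology of the chosen resolution of
  \<open>k\<close> over \<open>Q\<close> after base change to \<open>R\<close>; independence of the
  resolution replaces it by the Koszul complex on \<open>qs\<close>, which becomes the one on
  \<open>xs\<close>. From here on, a Betti number is found by exhibiting representatives
  \<open>S\<close> of a homology basis.\<close>

theorem betti_eq_koszul_homology:
  assumes "S \<subseteq> koszul_cycles i" "finite S" "\<not> module.dependent vscale S"
    "module.span vscale S \<inter> koszul_boundaries i = {0}"
    "koszul_cycles i \<subseteq> module.span vscale (S \<union> koszul_boundaries i)"
  shows "betti R X i = card S"
proof -
  let ?F = "resolution Q (residue_field Q)"
  have m: "matmap (act (sym_module R)) M f = B.tmap M f" for M f
    by (simp add: B.tmap_def sym_module_def)
  have g: "gsum (mgr (sym_module R)) = car" by (simp add: sym_module_def)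
  have cyc: "tor_cycles Q (residue_field Q) (sym_module R) i = B.homology_cycles ?F i"
    by (cases i) (auto simp: B.homology_cycles_def tor_chains_def m g)
  have bnd: "tor_boundaries Q (residue_field Q) (sym_module R) i = B.homology_boundaries ?F i"
    by (simp add: tor_boundaries_def B.homology_boundaries_def tor_chains_def m g)
  have sc: "(\<lambda>c f b. act (sym_module R) (smul Q c 1) (f b)) = B.vs"
    by (simp add: B.vs_def sym_module_def fun_eq_iff)
  have "betti R X i = quotient_dim B.vs (B.homology_cycles ?F i) (B.homology_boundaries ?F i)"
    unfolding betti_def tor_rank_def cyc bnd sc ..
  also have "\<dots> = card S"
    by (rule B.homology_independent_of_resolution[where F' = "koszul_complex n qs"])
      (use assms Q.resolution_exact_upto[OF Q.resolution_residue_field]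
        Q.resolution_exact_upto[OF sym_koszul_resolution]
        in \<open>simp_all add: homology_cycles_koszul homology_boundaries_koszul vs_eq\<close>)
  finally show ?thesis .
qed

end

section \<open>Koszul homology of a Koszul algebra\<close>

lemma lessThan_3_cases: "b < 3 \<Longrightarrow> b = 0 \<or> b = 1 \<or> b = (2::nat)"
  by linarith

text \<open>Exterior multiplication in the bases of the Koszul complex: \<open>wedge1\<close>
  multiplies two elements of position 1, \<open>wedge2\<close> an element of position 1 with one of
  position 2.\<close>

definition wedge1 :: "(nat \<Rightarrow> 'a::comm_ring_1) \<Rightarrow> (nat \<Rightarrow> 'a) \<Rightarrow> nat \<Rightarrow> 'a"
  where "wedge1 f g = (\<lambda>b. if b = 0 then f 0 * g 1 - f 1 * g 0 else if b = 1 then f 0 * g 2 - f 2 * g 0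
    else if b = 2 then f 1 * g 2 - f 2 * g 1 else 0)"

definition wedge2 :: "(nat \<Rightarrow> 'a::comm_ring_1) \<Rightarrow> (nat \<Rightarrow> 'a) \<Rightarrow> nat \<Rightarrow> 'a"
  where "wedge2 f w = (\<lambda>b. if b = 0 then f 0 * w 2 - f 1 * w 1 + f 2 * w 0 else 0)"

text \<open>The Leibniz rule for two factors of position 1; \<open>koszul_map_wedge2\<close> is the
  rule for factors of positions 1 and 2.\<close>

lemma koszul_map_wedge1:
  "koszul_map v 1 (wedge1 f g) =
    (\<lambda>b. if b < 3 then koszul_map v 0 f 0 * g b - koszul_map v 0 g 0 * f b else 0)"
  unfolding koszul_map_1 koszul_map_0 wedge1_def
  by (rule ext) (auto simp: algebra_simps dest!: lessThan_3_cases)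

lemma koszul_map_wedge2:
  "koszul_map v 2 (wedge2 f w) =
    (\<lambda>b. (if b < 3 then koszul_map v 0 f 0 * w b else 0) - wedge1 f (koszul_map v 1 w) b)"
  unfolding koszul_map_2 koszul_map_1 koszul_map_0 wedge1_def wedge2_def
  by (rule ext) (auto simp: algebra_simps dest!: lessThan_3_cases)

lemma wedge1_anticommute: "wedge1 f g = - wedge1 g f"
  by (auto simp: wedge1_def fun_eq_iff)

lemma wedge1_self: "wedge1 f f = 0"
  by (auto simp: wedge1_def fun_eq_iff)

lemma wedge1_add_left: "wedge1 (f + f') g = wedge1 f g + wedge1 f' g"
  by (auto simp: wedge1_def fun_eq_iff algebra_simps)

lemma wedge1_mult: "wedge1 (\<lambda>b. f b * a) g = (\<lambda>b. wedge1 f g b * a)"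
  by (auto simp: wedge1_def fun_eq_iff algebra_simps)

lemma koszul_map_add: "koszul_map v i (f + g) = koszul_map v i f + koszul_map v i g"
  by (simp add: koszul_map_def fun_eq_iff distrib_left sum.distrib)

lemma koszul_map_uminus: "koszul_map v i (- f) = - koszul_map v i f"
  by (simp add: koszul_map_def fun_eq_iff sum_negf)

lemma koszul_map_zero: "koszul_map v i 0 = 0"
  by (simp add: koszul_map_def fun_eq_iff)

lemma koszul_map_sum: "koszul_map v i (sum f I) = (\<Sum>t\<in>I. koszul_map v i (f t))"
  by (induction I rule: infinite_finite_induct) (simp_all only: koszul_map_add koszul_map_zero
    sum.infinite sum.empty sum.insert simp_thms)

lemma koszul_map_mult: "koszul_map v i (\<lambda>b. f b * a) = (\<lambda>b. koszul_map v i f b * a)"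
  by (simp add: koszul_map_def fun_eq_iff sum_distrib_right mult.assoc)

section \<open>Homogeneous pieces of the Koszul complex over \<open>R\<close> and cycles in position
  1\<close>

context presented_algebra
begin

sublocale V: vector_space vscale
  by unfold_locales (auto simp: fun_eq_iff algebra_simps)

lemma vscale_eq_mult: "vscale c f = (\<lambda>b. f b * smul R c 1)"
  by (simp add: fun_eq_iff smul_comm)

lemma koszul_map_vscale: "koszul_map v i (vscale c f) = vscale c (koszul_map v i f)"
  unfolding vscale_eq_mult by (rule koszul_map_mult)

text \<open>The elements of this shape form a subalgebra that contains the variables, hence all of
  the carrier by \<open>generated\<close>.\<close>

lemma generated_by_xs:
  assumes "a \<in> car"
  obtains c s where "\<forall>i. s i \<in> car" "a = smul R c 1 + (\<Sum>i<n. xs i * s i)"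
proof -
  define S where "S = {smul R c 1 + (\<Sum>i<n. xs i * s i) | c s. \<forall>i. s i \<in> car}"
  have I: "smul R c 1 + (\<Sum>i<n. xs i * s i) \<in> S" if "\<And>i. s i \<in> car" for c s
    unfolding S_def using that by blast
  have aC: "p + q \<in> car" if "p \<in> car" "q \<in> car" for p q using that subspace_add[OF subspace_C] by blast
  have sC: "smul R c p \<in> car" if "p \<in> car" for p c using that subspace_scale[OF subspace_C] by blast
  have S: "subspace S"
  proof (rule subspaceI)
    show "0 \<in> S" using I[of "\<lambda>_. 0" 0] zero_C by simp
  next
    fix p q assume "p \<in> S" "q \<in> S"
    then obtain c s d t where "\<forall>i. s i \<in> car" "p = smul R c 1 + (\<Sum>i<n. xs i * s i)"
      "\<forall>i. t i \<in> car" "q = smul R d 1 + (\<Sum>i<n. xs i * t i)" unfolding S_def by blast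
    then show "p + q \<in> S" using I[of "\<lambda>i. s i + t i" "c + d"] aC
      by (simp add: scale_left_distrib distrib_left sum.distrib algebra_simps)
  next
    fix d p assume "p \<in> S"
    then obtain c s where "\<forall>i. s i \<in> car" "p = smul R c 1 + (\<Sum>i<n. xs i * s i)" unfolding S_def by blast
    then show "smul R d p \<in> S" using I[of "\<lambda>i. smul R d (s i)" "d * c"] sC
      by (simp add: scale_right_distrib scale_sum_right smul_comm)
  qed
  have "gr R d \<subseteq> S" for d
  proof (rule generated[OF S])
    show "1 \<in> S" using I[of "\<lambda>_. 0" 1] zero_C by simp
  next
    fix p q assume "p \<in> S" "q \<in> S"
    then obtain c s d t where st: "\<forall>i. s i \<in> car" "p = smul R c 1 + (\<Sum>i<n. xs i * s i)"
      "\<forall>i. t i \<in> car" "q = smul R d 1 + (\<Sum>i<n. xs i * t i)" unfolding S_def by blast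
    have qC: "q \<in> car" using st aC sC one_C mult_C xs_car sum_C[of "{..<n}" "\<lambda>i. xs i * t i"] by simp
    have e: "(\<Sum>i<n. xs i * s i) * q = (\<Sum>i<n. xs i * (s i * q))"
      "smul R c 1 * (\<Sum>i<n. xs i * t i) = (\<Sum>i<n. xs i * smul R c (t i))"
      by (simp_all add: sum_distrib_right sum_distrib_left smul_one_mult smul_comm scale_sum_right mult.assoc)
    have "p * q = smul R c 1 * smul R d 1 + smul R c 1 * (\<Sum>i<n. xs i * t i) + (\<Sum>i<n. xs i * s i) * q"
      using st(2,4) by (simp add: algebra_simps)
    also have "\<dots> = smul R (c * d) 1 + (\<Sum>i<n. xs i * (smul R c (t i) + s i * q))"
      unfolding e by (simp add: smul_one_mult distrib_left sum.distrib)
    finally show "p * q \<in> S" using I[of "\<lambda>i. smul R c (t i) + s i * q" "c * d"] st aC sC mult_C qC by simp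
  next
    have "X \<subseteq> S"
    proof
      fix y assume "y \<in> X"
      then obtain j where j: "j < n" "y = x j" using x_bij unfolding bij_betw_def by blast
      have "(\<Sum>i<n. xs i * (if i = j then 1 else 0)) = (\<Sum>i<n. if i = j then xs i else 0)"
        by (intro sum.cong) auto
      also have "\<dots> = y" using j by (simp add: xs_def)
      finally show "y \<in> S" using I[of "\<lambda>i. if i = j then 1 else 0" 0] one_C zero_C by simp
    qed
    then show "gr R 1 \<subseteq> S" using span_X span_minimal[OF _ S] by blast
  qed
  then have "sum f {..N} \<in> S" if "\<forall>i. f i \<in> gr R i" for f N
    using that by (intro subspace_sum[OF S]) blast
  then have "a \<in> S" using assms unfolding gsum_def by auto
  then show ?thesis using that unfolding S_def by blast
qed

lemma residue_xs_mult: "p \<in> car \<Longrightarrow> residue R (xs i * p) = 0"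
  using residue_mult[OF xs_car] residue_gr[OF xs_gr] by simp

text \<open>Multiples of the variables have residue 0, so comparing residues removes the constant
  term. The conclusion is phrased with \<open>koszul_map\<close> so that \<open>s\<close> can enter
  the Leibniz rule.\<close>

lemma augmentation_ideal:
  assumes "a \<in> car" "residue R a = 0"
  obtains s where "s \<in> finfam car {..<n}" "a = koszul_map xs 0 s 0"
proof -
  obtain c s where s: "\<forall>i. s i \<in> car" "a = smul R c 1 + (\<Sum>i<n. xs i * s i)"
    by (rule generated_by_xs[OF assms(1)])
  have "residue R (\<Sum>i<n. xs i * s i) = 0"
    using res.rho_sum[of "{..<n}" "\<lambda>i. xs i * s i"] s(1) mult_C xs_car residue_xs_mult by simp
  then have "residue R a = c"
    using s residue_add[of "smul R c 1" "\<Sum>i<n. xs i * s i"] gr_C[OF gr_smul_one]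
      sum_C[of "{..<n}" "\<lambda>i. xs i * s i"] mult_C xs_car residue_smul_one by simp
  then have a: "a = (\<Sum>i<n. xs i * s i)" using assms(2) s(2) by simp
  let ?s = "\<lambda>i. if i < n then s i else 0"
  have "(\<Sum>i<n. xs i * s i) = (\<Sum>i<3. xs i * ?s i)"
    using n_le by (intro sum.mono_neutral_cong_left) auto
  then have "a = koszul_map xs 0 ?s 0" using a by (simp add: koszul_map_0 sum_lessThan_3)
  then show ?thesis using s(1) zero_C by (intro that[of ?s]) (auto simp: finfam_lessThan)
qed

text \<open>\<open>e\<close> is the degree of the coefficients; in position \<open>i\<close> the
  internal degree is \<open>i + e\<close>. Thus \<open>Z 1 1\<close> has internal degree 2, while
  \<open>Z 2 1\<close> and \<open>Z 2 2\<close> have internal degrees 3 and 4.\<close>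

definition H :: "nat \<Rightarrow> nat \<Rightarrow> (nat \<Rightarrow> 'r) set"
  where "H k e = {f. (\<forall>b\<ge>k. f b = 0) \<and> (\<forall>b. f b \<in> gr R e)}"

definition Z :: "nat \<Rightarrow> nat \<Rightarrow> (nat \<Rightarrow> 'r) set"
  where "Z i e = {f \<in> H (n choose i) e. i \<noteq> 0 \<longrightarrow> koszul_map xs (i - 1) f = 0}"

definition component :: "nat \<Rightarrow> (nat \<Rightarrow> 'r) \<Rightarrow> nat \<Rightarrow> 'r"
  where "component e f = (\<lambda>b. hc (f b) e)"

lemma H_finfam: "f \<in> H k e \<Longrightarrow> f \<in> finfam car {..<k}"
  using gr_C by (auto simp: H_def finfam_lessThan)

lemma Z_cycles: "f \<in> Z i e \<Longrightarrow> f \<in> koszul_cycles i"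
  using H_finfam by (auto simp: Z_def koszul_cycles_def)

lemma component_H: "f \<in> finfam car {..<k} \<Longrightarrow> component e f \<in> H k e"
  using hc_gr by (auto simp: H_def component_def finfam_lessThan hc_zero)

lemma hc_homogeneous: "a \<in> gr R e \<Longrightarrow> hc a d = (if d = e then a else 0)"
  by (simp add: hc_eq[OF decomp_gr])

lemma component_eq: "f \<in> H k e \<Longrightarrow> component d f = (if d = e then f else 0)"
  by (auto simp: H_def component_def fun_eq_iff hc_homogeneous[of _ e])

lemma component_add:
  "f \<in> finfam car B \<Longrightarrow> g \<in> finfam car B \<Longrightarrow> component e (f + g) = component e f + component e g"
  by (auto simp: component_def fun_eq_iff finfam_iff hc_add)

lemma component_sum: "f \<in> finfam car B \<Longrightarrow> \<exists>N. f = (\<Sum>e\<le>N. component e f)"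
proof -
  assume f: "f \<in> finfam car B"
  have "proj (\<lambda>_. 0) e f = component e f" for e by (simp add: proj_def component_def)
  then show ?thesis using proj_sum[OF f, of "\<lambda>_. 0"] by simp
qed

lemma koszul_bd_gr: "koszul_bd xs i b b' \<in> gr R 1"
  using xs_gr gr_zero subspace_neg[OF subspace_gr xs_gr] by (auto simp: koszul_bd_def)

lemma component_koszul_map:
  assumes "f \<in> finfam car B"
  shows "component e (koszul_map xs i f) = (if e = 0 then 0 else koszul_map xs i (component (e - 1) f))"
proof
  fix b'
  have fC: "f b \<in> car" for b using assms by (simp add: finfam_iff)
  have "component e (koszul_map xs i f) b' = (\<Sum>b<3. hc (koszul_bd xs i b b' * f b) e)"
    unfolding component_def koszul_map_def
    using hc_sum[of "{..<3}" "\<lambda>b. koszul_bd xs i b b' * f b" e] mult_C[OF gr_C[OF koszul_bd_gr] fC] by simp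
  also have "\<dots> = (\<Sum>b<3. if 1 \<le> e then koszul_bd xs i b b' * hc (f b) (e - 1) else 0)"
    using hc_mult[OF koszul_bd_gr fC] by simp
  also have "\<dots> = (if e = 0 then 0 else koszul_map xs i (component (e - 1) f)) b'"
    by (simp add: koszul_map_def component_def)
  finally show "component e (koszul_map xs i f) b' =
      (if e = 0 then 0 else koszul_map xs i (component (e - 1) f)) b'" .
qed

lemma koszul_map_H: "f \<in> H (n choose Suc i) e \<Longrightarrow> koszul_map xs i f \<in> H (n choose i) (Suc e)"
proof -
  assume f: "f \<in> H (n choose Suc i) e"
  have "koszul_map xs i f \<in> finfam car {..<n choose i}"
    by (rule koszul_map_in[OF n_le xs_car xs_ge H_finfam[OF f]])
  moreover have "koszul_map xs i f b \<in> gr R (Suc e)" for b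
    unfolding koszul_map_def using gr_mult[OF koszul_bd_gr, of _ e] f by (intro gr_sum) (auto simp: H_def)
  ultimately show ?thesis by (auto simp: H_def finfam_lessThan)
qed

lemma boundary_finfam: "g \<in> finfam car {..<n choose Suc i} \<Longrightarrow> koszul_map xs i g \<in> finfam car {..<n choose i}"
  by (rule koszul_map_in[OF n_le xs_car xs_ge])

lemma boundaries_finfam: "g \<in> koszul_boundaries i \<Longrightarrow> g \<in> finfam car {..<n choose i}"
  unfolding koszul_boundaries_def using boundary_finfam by blast

lemma boundaries_iff:
  "f \<in> koszul_boundaries i \<longleftrightarrow> (\<exists>g. g \<in> finfam car {..<n choose Suc i} \<and> f = koszul_map xs i g)"
  unfolding koszul_boundaries_def by blast

lemma boundaries_add:
  assumes "f \<in> koszul_boundaries i" "g \<in> koszul_boundaries i"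
  shows "f + g \<in> koszul_boundaries i"
proof -
  obtain p q where pq: "p \<in> finfam car {..<n choose Suc i}" "f = koszul_map xs i p"
    "q \<in> finfam car {..<n choose Suc i}" "g = koszul_map xs i q"
    using assms unfolding boundaries_iff by iprover
  then show ?thesis
    unfolding boundaries_iff using self.finfam_add[OF pq(1,3)]
    by (intro exI[of _ "p + q"] conjI) (simp_all only: koszul_map_add)
qed

lemma boundaries_mult:
  assumes "f \<in> koszul_boundaries i" "a \<in> car"
  shows "(\<lambda>b. f b * a) \<in> koszul_boundaries i"
proof -
  obtain p where p: "p \<in> finfam car {..<n choose Suc i}" "f = koszul_map xs i p"
    using assms unfolding boundaries_iff by iprover
  then show ?thesis
    unfolding boundaries_iff using finfam_mult[OF p(1) assms(2)]
    by (intro exI[of _ "\<lambda>b. p b * a"] conjI) (simp_all only: koszul_map_mult)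
qed

lemma boundaries_zero: "0 \<in> koszul_boundaries i"
  unfolding boundaries_iff using self.finfam_zero koszul_map_zero
  by (intro exI[of _ 0] conjI) (simp_all only: koszul_map_zero self.finfam_zero)

lemma boundaries_component:
  assumes "g \<in> koszul_boundaries i" "component e g \<noteq> 0"
  shows "component e g \<in> koszul_map xs i ` H (n choose Suc i) (e - 1)"
proof -
  obtain q where q: "q \<in> finfam car {..<n choose Suc i}" "g = koszul_map xs i q"
    using assms(1) unfolding koszul_boundaries_def by blast
  have "e \<noteq> 0" using component_koszul_map[OF q(1), of e i] assms(2) q(2) by auto
  then show ?thesis using component_koszul_map[OF q(1), of e i] q component_H[OF q(1)] by simp
qed

lemma wedge1_finfam:
  assumes "f \<in> finfam car {..<n}" "g \<in> finfam car {..<n}"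
  shows "wedge1 f g \<in> finfam car {..<n choose 2}"
proof -
  have 0: "f b = 0" "g b = 0" if "n \<le> b" for b using assms that by (simp_all add: finfam_lessThan)
  have "wedge1 f g b = 0" if "n choose 2 \<le> b" for b
    using le_3_cases[OF n_le] that 0[of 0] 0[of 1] 0[of 2]
    by (elim disjE) (auto simp: wedge1_def choose_2_values choose_2_values[unfolded One_nat_def])
  moreover have "wedge1 f g b \<in> car" for b
    using assms by (auto simp: wedge1_def finfam_lessThan zero_C intro!: mult_C subspace_diff[OF subspace_C])
  ultimately show ?thesis by (simp add: finfam_lessThan)
qed

lemma wedge1_H:
  assumes "f \<in> H n d" "g \<in> H n e"
  shows "wedge1 f g \<in> H (n choose 2) (d + e)"
proof -
  have "wedge1 f g b \<in> gr R (d + e)" for b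
    using assms gr_mult[of _ d _ e] by (auto simp: wedge1_def H_def gr_zero intro!: subspace_diff[OF subspace_gr])
  then show ?thesis
    using wedge1_finfam[OF H_finfam[OF assms(1)] H_finfam[OF assms(2)]] by (simp add: H_def finfam_lessThan)
qed

lemma wedge2_finfam:
  assumes "f \<in> finfam car {..<n}" "w \<in> finfam car {..<n choose 2}"
  shows "wedge2 f w \<in> finfam car {..<n choose 3}"
proof -
  have 0: "n \<le> b \<Longrightarrow> f b = 0" "n choose 2 \<le> b \<Longrightarrow> w b = 0" for b
    using assms by (simp_all add: finfam_lessThan)
  have "wedge2 f w b = 0" if "n choose 3 \<le> b" for b
    using le_3_cases[OF n_le] that 0[of 0] 0[of 1] 0[of 2]
    by (elim disjE) (auto simp: wedge2_def choose_2_values choose_3_values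
      choose_2_values[unfolded One_nat_def] choose_3_values[unfolded One_nat_def])
  moreover have "wedge2 f w b \<in> car" for b
    using assms by (auto simp: wedge2_def finfam_lessThan zero_C
      intro!: mult_C subspace_diff[OF subspace_C] subspace_add[OF subspace_C])
  ultimately show ?thesis by (simp add: finfam_lessThan)
qed

text \<open>Multiplication by an element of the augmentation ideal is null-homotopic: if
  \<open>a\<close> is the image of \<open>s\<close>, then by the Leibniz rule the product of
  \<open>s\<close> with a cycle \<open>z\<close> has boundary \<open>a\<close> times
  \<open>z\<close>.\<close>

lemma cycle_mult_boundary:
  assumes z: "z \<in> koszul_cycles i" "i = 1 \<or> i = 2" and a: "a \<in> car" "residue R a = 0"
  shows "(\<lambda>b. z b * a) \<in> koszul_boundaries i"
proof -
  obtain s where s: "s \<in> finfam car {..<n}" "a = koszul_map xs 0 s 0"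
    by (rule augmentation_ideal[OF a])
  have "n choose i \<le> 3" using choose_le_3[OF n_le] .
  then have z3: "z b = 0" if "\<not> b < 3" for b using z(1) that by (auto simp: koszul_cycles_def finfam_lessThan)
  from z(2) show ?thesis
  proof
    assume i: "i = 1"
    have zf: "z \<in> finfam car {..<n}" and z0: "koszul_map xs 0 z = 0"
      using z(1) i by (auto simp: koszul_cycles_def)
    have "koszul_map xs 1 (wedge1 s z) = (\<lambda>b. z b * a)"
      unfolding koszul_map_wedge1 using z3 z0 s(2) by (auto simp: fun_eq_iff mult.commute)
    then show ?thesis
      unfolding koszul_boundaries_def i using wedge1_finfam[OF s(1) zf]
      by (intro image_eqI[of _ _ "wedge1 s z"]) (simp_all add: numeral_2_eq_2)
  next
    assume i: "i = 2"
    have zf: "z \<in> finfam car {..<n choose 2}" and z0: "koszul_map xs 1 z = 0"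
      using z(1) i by (auto simp: koszul_cycles_def)
    have "koszul_map xs 2 (wedge2 s z) = (\<lambda>b. z b * a)"
      unfolding koszul_map_wedge2 z0 using z3 s(2) by (auto simp: fun_eq_iff mult.commute wedge1_def)
    then show ?thesis
      unfolding koszul_boundaries_def i using wedge2_finfam[OF s(1) zf]
      by (intro image_eqI[of _ _ "wedge2 s z"]) (simp_all add: numeral_3_eq_3 numeral_2_eq_2)
  qed
qed

text \<open>In positions 1 and 2 this is a submodule, as the augmentation ideal maps cycles to boundaries.\<close>

definition lin :: "nat \<Rightarrow> (nat \<Rightarrow> 'r) set"
  where "lin i = {u + g | u g. u \<in> Z i 1 \<and> g \<in> koszul_boundaries i}"

lemma Z_add: "f \<in> Z i e \<Longrightarrow> g \<in> Z i e \<Longrightarrow> f + g \<in> Z i e"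
  by (auto simp: Z_def H_def koszul_map_add intro: subspace_add[OF subspace_gr])

lemma Z_zero: "0 \<in> Z i e"
  by (auto simp: Z_def H_def koszul_map_zero gr_zero)

lemma Z_vscale: "f \<in> Z i e \<Longrightarrow> vscale c f \<in> Z i e"
  by (auto simp: Z_def H_def koszul_map_vscale intro: subspace_scale[OF subspace_gr])

lemma lin_zero: "0 \<in> lin i"
  unfolding lin_def using Z_zero boundaries_zero by (metis (mono_tags, lifting) add.right_neutral mem_Collect_eq)

lemma lin_add: assumes "f \<in> lin i" "g \<in> lin i" shows "f + g \<in> lin i"
proof -
  obtain u p v q where "f = u + p" "u \<in> Z i 1" "p \<in> koszul_boundaries i"
    "g = v + q" "v \<in> Z i 1" "q \<in> koszul_boundaries i"
    using assms unfolding lin_def by blast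
  moreover have "u + p + (v + q) = (u + v) + (p + q)" for u p v q :: "nat \<Rightarrow> 'r" by (simp add: algebra_simps)
  ultimately show ?thesis unfolding lin_def using Z_add boundaries_add by blast
qed

lemma lin_mult:
  assumes "f \<in> lin i" "i = 1 \<or> i = 2" "a \<in> car"
  shows "(\<lambda>b. f b * a) \<in> lin i"
proof -
  obtain u p where f: "f = u + p" "u \<in> Z i 1" "p \<in> koszul_boundaries i"
    using assms(1) unfolding lin_def by blast
  define c where "c = residue R a"
  define a' where "a' = a + - smul R c 1"
  have sC: "smul R c 1 \<in> car" using gr_C[OF gr_smul_one] .
  have a': "a' \<in> car" "residue R a' = 0"
    unfolding a'_def using subspace_add[OF subspace_C assms(3) car_minus[OF sC]]
      residue_add[OF assms(3) car_minus[OF sC]] res.rho_minus[OF sC] residue_smul_one c_def by simp_all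
  have "f b * a = vscale c u b + (u b * a' + p b * a)" for b
    using f(1) by (simp add: a'_def algebra_simps smul_comm)
  then have "(\<lambda>b. f b * a) = vscale c u + ((\<lambda>b. u b * a') + (\<lambda>b. p b * a))" by (simp add: fun_eq_iff)
  moreover have "(\<lambda>b. u b * a') \<in> koszul_boundaries i"
    using cycle_mult_boundary[OF Z_cycles[OF f(2)] assms(2) a'] .
  ultimately show ?thesis
    unfolding lin_def using Z_vscale[OF f(2)] boundaries_add boundaries_mult[OF f(3) assms(3)] by blast
qed

lemma xs_independent:
  assumes "(\<Sum>b<n. smul R (c b) (xs b)) = 0" "b < n"
  shows "c b = 0"
proof -
  have inj: "inj_on x {..<n}" and im: "x ` {..<n} = X" using x_bij by (auto simp: bij_betw_def)
  let ?u = "c \<circ> the_inv_into {..<n} x"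
  have "(\<Sum>y\<in>X. smul R (?u y) y) = (\<Sum>b<n. smul R (?u (x b)) (x b))"
    unfolding im[symmetric] by (simp add: sum.reindex[OF inj])
  also have "\<dots> = (\<Sum>b<n. smul R (c b) (xs b))"
    by (intro sum.cong) (auto simp: the_inv_into_f_f[OF inj] xs_def)
  finally have s: "(\<Sum>y\<in>X. smul R (?u y) y) = 0" using assms(1) by simp
  have "x b \<in> X" using im assms(2) by blast
  then have "?u (x b) = 0" using independentD[OF independent_X finite_X order_refl s] by blast
  then show ?thesis using the_inv_into_f_f[OF inj] assms(2) by simp
qed

lemma xs_independent_3:
  assumes "smul R p (xs 0) + smul R q (xs 1) + smul R r (xs 2) = 0"
  shows "0 < n \<longrightarrow> p = 0" "1 < n \<longrightarrow> q = 0" "2 < n \<longrightarrow> r = 0"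
proof -
  let ?c = "\<lambda>b::nat. if b = 0 then p else if b = 1 then q else r"
  have "(\<Sum>b<n. smul R (?c b) (xs b)) = (\<Sum>b<3. smul R (?c b) (xs b))"
    using n_le xs_ge by (intro sum.mono_neutral_left) auto
  also have "\<dots> = 0" using assms by (simp add: sum_lessThan_3)
  finally show "0 < n \<longrightarrow> p = 0" "1 < n \<longrightarrow> q = 0" "2 < n \<longrightarrow> r = 0"
    using xs_independent[of ?c 0] xs_independent[of ?c 1] xs_independent[of ?c 2] by auto
qed

text \<open>Constant terms would give a linear relation among the variables, which form a basis of
  \<open>gr R 1\<close>. This is the minimality that \<open>koszul_generation\<close> asks
  for.\<close>

lemma cycles_1_residue:
  assumes "z \<in> koszul_cycles 1" shows "residue R (z b) = 0"
proof -
  have zf: "z \<in> finfam car {..<n}" and z0: "koszul_map xs 0 z = 0" using assms by (auto simp: koszul_cycles_def)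
  have "component 1 (koszul_map xs 0 z) = koszul_map xs 0 (component 0 z)"
    using component_koszul_map[OF zf, of 1 0] by simp
  moreover have "component 1 (0 :: nat \<Rightarrow> 'r) = 0" by (simp add: component_def hc_zero fun_eq_iff)
  ultimately have "koszul_map xs 0 (component 0 z) 0 = 0" using z0 by simp
  moreover have "component 0 z b = smul R (residue R (z b)) 1" for b
    unfolding component_def using zf by (intro residue_C) (simp add: finfam_lessThan)
  ultimately have "smul R (residue R (z 0)) (xs 0) + smul R (residue R (z 1)) (xs 1) +
      smul R (residue R (z 2)) (xs 2) = 0"
    by (simp add: koszul_map_0 smul_comm)
  from xs_independent_3[OF this] have r: "b < n \<Longrightarrow> residue R (z b) = 0" for b
    using n_le lessThan_3_cases[of b] by auto
  show ?thesis
  proof (cases "b < n")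
    case False
    then have "z b = 0" using zf by (simp add: finfam_lessThan)
    then show ?thesis using res.rho_zero by simp
  qed (rule r)
qed

text \<open>The beginning, free of rank \<open>n\<close> over free of rank 1 over \<open>k\<close>,
  is common to the Koszul complex and the Tate complex; hence only the data of \<open>P\<close> in
  positions 0 and 1 are prescribed, besides degrees and augmentation.\<close>

lemma exact_upto_1:
  assumes P: "gens P 0 = {0}" "gens P 1 = {..<n}" "gdeg P = (\<lambda>i b. i)" "bd P 0 = koszul_bd xs 0" "aug P = (\<lambda>_. 1)"
  shows "exact_upto 1 P"
proof -
  have aug: "aug_map P f = residue R (f 0)" if "f \<in> finfam car {0}" for f
    using augmap_residue[OF that] by (simp add: aug_map_def P(5))
  have M: "matmap (*) (bd P 0) f = koszul_map xs 0 f" if "f \<in> finfam car {..<n}" for f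
    unfolding P(4) by (rule mat_koszul[OF that n_le xs_car])
  have h: "hom_gens {0} (\<lambda>_. 0) {..<n} (\<lambda>_. Suc 0) (koszul_bd xs 0)"
    using koszul_hom_gens[of n xs 0, OF n_le xs_gr xs_ge] by (simp add: lessThan_Suc)
  have c: "complex_upto 1 P"
    unfolding complex_upto_def
  proof (intro conjI allI impI ballI)
    fix i :: nat assume "i < 1"
    then show "hom_gens (gens P i) (gdeg P i) (gens P (Suc i)) (gdeg P (Suc i)) (bd P i)"
      using h P by simp
  next
    fix b assume "b \<in> gens P 1"
    then have b: "b \<in> {..<n}" using P by simp
    then have "bd P 0 b \<in> finfam car {0}" using h P by (simp add: hom_gens_def)
    from aug[OF this] show "aug_map P (bd P 0 b) = 0" using residue_gr[OF xs_gr] P(4) by (simp add: koszul_bd_def)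
  qed (use P in simp_all)
  have "k \<in> aug_map P ` finfam car (gens P 0)" for k
  proof -
    let ?f = "const_vec (\<lambda>b. if b = 0 then k else 0)"
    have f: "?f \<in> finfam car {0}" by (rule const_vec_finfam) (auto simp: finfam_iff)
    then show ?thesis using aug[OF f] by (intro image_eqI[of _ _ ?f]) (auto simp: residue_const_vec P)
  qed
  moreover have "{f \<in> finfam car (gens P 0). aug_map P f = 0} \<subseteq> matmap (*) (bd P 0) ` finfam car (gens P 1)"
  proof
    fix f assume "f \<in> {f \<in> finfam car (gens P 0). aug_map P f = 0}"
    then have f: "f \<in> finfam car {0}" "residue R (f 0) = 0" using aug P by auto
    have "f 0 \<in> car" using f(1) by (simp add: finfam_iff)
    then obtain s where s: "s \<in> finfam car {..<n}" "f 0 = koszul_map xs 0 s 0"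
      using augmentation_ideal f(2) by blast
    have "f b = koszul_map xs 0 s b" for b
      using s(2) f(1) by (cases "b = 0") (auto simp: finfam_iff koszul_map_0)
    then have "f = koszul_map xs 0 s" by (rule ext)
    then have "f = matmap (*) (bd P 0) s" using M[OF s(1)] by metis
    then show "f \<in> matmap (*) (bd P 0) ` finfam car (gens P 1)" using s(1) unfolding P(2) by (rule image_eqI)
  qed
  ultimately show ?thesis unfolding exact_upto_def using c by auto
qed

text \<open>\<open>koszul_generation\<close> with \<open>p = 0\<close> on the Koszul complex: the
  submodule \<open>lin 1\<close> contains the cycles of internal degree 2, hence all cycles of
  position 1.\<close>

lemma koszul_cycles_1:
  assumes "koszul R"
  shows "koszul_cycles 1 \<subseteq> lin 1"
proof -
  let ?P = "koszul_complex n xs :: ('r, 'k) gcomplex"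
  have g: "gens ?P i = {..<n choose i}" "gdeg ?P i b = i" "bd ?P i = koszul_bd xs i" for i b
    by (simp_all add: koszul_complex_def)
  have P: "exact_upto (Suc 0) ?P"
    using exact_upto_1[of ?P] by (simp add: koszul_complex_def lessThan_Suc)
  have Zeq: "{z \<in> finfam car (gens ?P (Suc 0)). matmap (*) (bd ?P 0) z = 0} = koszul_cycles 1"
    unfolding koszul_cycles_def g using mat_koszul[OF _ n_le xs_car] by auto
  have "{z \<in> finfam car (gens ?P (Suc 0)). matmap (*) (bd ?P 0) z = 0} \<subseteq> lin 1"
  proof (rule koszul_generation[OF assms P])
    show "0 \<in> lin 1" by (rule lin_zero)
    show "u + v \<in> lin 1" if "u \<in> lin 1" "v \<in> lin 1" for u v using that by (rule lin_add)
    show "(\<lambda>b. u b * a) \<in> lin 1" if "u \<in> lin 1" "a \<in> car" for u a using that by (intro lin_mult) auto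
    show "residue R (z b) = 0" if "z \<in> {z \<in> finfam car (gens ?P (Suc 0)). matmap (*) (bd ?P 0) z = 0}" for z b
      using that unfolding Zeq by (rule cycles_1_residue)
    show "z \<in> lin 1" if z: "z \<in> {z \<in> finfam car (gens ?P (Suc 0)). matmap (*) (bd ?P 0) z = 0}"
      "\<forall>b. z b \<in> shift (gr R) (gdeg ?P (Suc 0) b) (Suc (Suc 0))" for z
    proof -
      have "z \<in> koszul_cycles 1" using z(1) unfolding Zeq .
      then have "z \<in> Z 1 1" using z(2) by (auto simp: Z_def H_def koszul_cycles_def finfam_lessThan g shift_def)
      then show ?thesis
        unfolding lin_def using boundaries_zero[of 1] by (metis (mono_tags, lifting) add.right_neutral mem_Collect_eq)
    qed
  qed
  then show ?thesis unfolding Zeq .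
qed

end

section \<open>Cycles in position 2 by Tate's construction\<close>

lemma sum_lessThan_add: "(\<Sum>b<k + m. g b) = (\<Sum>b<k. g b) + (\<Sum>t<m. g (k + t))"
  for g :: "nat \<Rightarrow> 'a::comm_monoid_add"
  by (induction m) (simp_all add: add.assoc)

lemma koszul_map_comp: "koszul_map v i (koszul_map v (Suc i) f) = 0"
proof -
  consider "i = 0" | "i = 1" | "i \<ge> 2" by linarith
  then show ?thesis
  proof cases
    case 3
    then have "koszul_map v (Suc i) f = 0" by (intro koszul_map_ge_3) simp
    then show ?thesis by (simp only: koszul_map_zero)
  qed (use koszul_map_comp_1 koszul_map_comp_2 in \<open>auto simp: numeral_2_eq_2\<close>)
qed

lemma koszul_map_cong: "(\<And>b. b < 3 \<Longrightarrow> f b = g b) \<Longrightarrow> koszul_map v i f = koszul_map v i g"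
  by (auto simp: koszul_map_def fun_eq_iff intro!: sum.cong)

lemma wedge1_zero: "wedge1 0 g = 0"
  by (auto simp: wedge1_def fun_eq_iff)

context presented_algebra
begin

lemma H_add: "f \<in> H k e \<Longrightarrow> g \<in> H k e \<Longrightarrow> f + g \<in> H k e"
  by (auto simp: H_def intro: subspace_add[OF subspace_gr])

lemma boundaries_cycles: "g \<in> koszul_boundaries i \<Longrightarrow> g \<in> koszul_cycles i"
  using boundaries_finfam[of g i] unfolding koszul_cycles_def
  by (cases i) (auto simp: koszul_map_comp boundaries_iff)

lemma boundaries_uminus: "f \<in> koszul_boundaries i \<Longrightarrow> - f \<in> koszul_boundaries i"
  using boundaries_mult[of f i "- 1"] car_minus[OF one_C] by (simp add: fun_Compl_def)

lemma boundaries_sum: "(\<And>t. t \<in> I \<Longrightarrow> f t \<in> koszul_boundaries i) \<Longrightarrow> sum f I \<in> koszul_boundaries i"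
  by (induction I rule: infinite_finite_induct) (simp_all add: boundaries_zero boundaries_add del: plus_fun_apply)

lemma boundaries_lin: "g \<in> koszul_boundaries i \<Longrightarrow> g \<in> lin i"
  unfolding lin_def using Z_zero by (metis (mono_tags, lifting) add.left_neutral mem_Collect_eq)

lemma Z_lin: "u \<in> Z i 1 \<Longrightarrow> u \<in> lin i"
  unfolding lin_def using boundaries_zero by (metis (mono_tags, lifting) add.right_neutral mem_Collect_eq)

text \<open>With \<open>g\<close> the image of \<open>q\<close> and \<open>z\<close> a cycle, the
  Leibniz rule for \<open>wedge2 z q\<close> leaves only \<open>- wedge1 z g\<close>, which is
  \<open>wedge1 g z\<close>.\<close>

lemma wedge1_boundary:
  assumes "g \<in> koszul_boundaries 1" "z \<in> koszul_cycles 1"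
  shows "wedge1 g z \<in> koszul_boundaries 2"
proof -
  obtain q where q: "q \<in> finfam car {..<n choose 2}" "g = koszul_map xs 1 q"
    using assms(1) unfolding boundaries_iff by (auto simp: numeral_2_eq_2)
  have z: "z \<in> finfam car {..<n}" "koszul_map xs 0 z = 0" using assms(2) by (auto simp: koszul_cycles_def)
  have "koszul_map xs 2 (wedge2 z q) = wedge1 g z"
    unfolding koszul_map_wedge2 z(2) q(2)[symmetric] wedge1_anticommute[of g z] by (simp add: fun_eq_iff)
  then show ?thesis
    unfolding boundaries_iff using wedge2_finfam[OF z(1) q(1)]
    by (intro exI[of _ "wedge2 z q"]) (simp add: numeral_3_eq_3 numeral_2_eq_2)
qed

lemma residue_component: "f \<in> finfam car B \<Longrightarrow> component 0 f b = smul R (residue R (f b)) 1"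
  unfolding component_def by (intro residue_C) (simp add: finfam_iff)

text \<open>For constant coefficients the equations of a cycle are linear relations among the
  variables.\<close>

lemma Z_2_0: assumes "u \<in> Z 2 0" shows "u = 0"
proof -
  have u: "u \<in> H (n choose 2) 0" and d: "koszul_map xs 1 u = 0" using assms by (auto simp: Z_def)
  have "\<exists>c. u b = smul R c 1" for b using u gr_0 by (auto simp: H_def)
  then obtain c where c: "\<And>b. u b = smul R (c b) 1" by metis
  have e: "koszul_map xs 1 u 0 = 0" "koszul_map xs 1 u 1 = 0" using d by simp_all
  have 0: "smul R 0 (xs 0) + smul R (- c 0) (xs 1) + smul R (- c 1) (xs 2) = 0"
    "smul R (c 0) (xs 0) + smul R 0 (xs 1) + smul R (- c 2) (xs 2) = 0"
    using e unfolding koszul_map_1 c by (simp_all add: smul_comm)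
  have "u b = 0" for b
  proof (cases "b < n choose 2")
    case True
    then have "n = 2 \<and> b = 0 \<or> n = 3 \<and> b < 3"
      using le_3_cases[OF n_le] by (auto simp: choose_2_values choose_2_values[unfolded One_nat_def])
    then have "c b = 0"
      using xs_independent_3[OF 0(1)] xs_independent_3[OF 0(2)] lessThan_3_cases[of b] by auto
    then show ?thesis using c by simp
  next
    case False
    then show ?thesis using u by (simp add: H_def)
  qed
  then show ?thesis by (simp add: fun_eq_iff)
qed

text \<open>The first steps of the minimal resolution of \<open>k\<close> over \<open>R\<close>: variables killing a basis
  \<open>z 0, \<dots>, z (m - 1)\<close> of the first Koszul homology are added to the Koszul complex in position 2,
  as the basis elements \<open>3, \<dots>, m + 2\<close>.\<close>

definition tate_complex :: "nat \<Rightarrow> (nat \<Rightarrow> nat \<Rightarrow> 'r) \<Rightarrow> ('r, 'k) gcomplex"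
  where "tate_complex m z =
    \<lparr>gens = \<lambda>i. if i = 0 then {0} else if i = 1 then {..<n} else {..<n choose 2} \<union> {3..<3 + m},
     gdeg = \<lambda>i b. i,
     bd = \<lambda>i b. if i = 0 then koszul_bd xs 0 b else if b < 3 then koszul_bd xs 1 b else z (b - 3),
     aug = \<lambda>_. 1\<rparr>"

text \<open>\<open>koszul_generation\<close> with \<open>p = 1\<close> on the Tate complex, which is
  exact in position 1 because the added variables kill the first homology. It describes all cycles
  of the Tate complex in position 2; a Koszul cycle is one whose coordinates at the added variables
  are 0.\<close>

theorem koszul_cycles_2:
  fixes m :: nat and z :: "nat \<Rightarrow> nat \<Rightarrow> 'r"
  assumes K: "koszul R"
    and z: "\<And>t. t < m \<Longrightarrow> z t \<in> Z 1 1"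
    and indep: "\<And>c t. (\<Sum>t<m. vscale (c t) (z t)) \<in> koszul_boundaries 1 \<Longrightarrow> t < m \<Longrightarrow> c t = 0"
    and gen: "\<And>u. u \<in> Z 1 1 \<Longrightarrow> \<exists>c. \<exists>g\<in>koszul_boundaries 1. u = (\<Sum>t<m. vscale (c t) (z t)) + g"
    and y: "y \<in> koszul_cycles 2"
  obtains \<sigma> w where "\<sigma> \<in> V.span {wedge1 (z s) (z t) | s t. s < t \<and> t < m}" "w \<in> lin 2" "y = \<sigma> + w"
proof -
  let ?P = "tate_complex m z"
  let ?G = "{..<n choose 2} \<union> {3..<3 + m}"
  let ?z = "\<lambda>f. \<Sum>t<m. (\<lambda>b. z t b * f (3 + t))"
  have g: "gens ?P 0 = {0}" "gens ?P (Suc 0) = {..<n}" "gens ?P (Suc (Suc 0)) = ?G" "gdeg ?P = (\<lambda>i b. i)"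
    "bd ?P 0 = koszul_bd xs 0" "aug ?P = (\<lambda>_. 1)"
    "bd ?P (Suc 0) = (\<lambda>b. if b < 3 then koszul_bd xs 1 b else z (b - 3))"
    by (simp_all add: tate_complex_def fun_eq_iff)
  have c3: "n choose 2 \<le> 3" using choose_le_3[OF n_le] .
  have zf: "z t \<in> finfam car {..<n}" if "t < m" for t using H_finfam[of "z t" n 1] z[OF that] by (simp add: Z_def)
  have zc: "z t \<in> koszul_cycles 1" if "t < m" for t using Z_cycles[OF z[OF that]] .
  have M0: "matmap (*) (bd ?P 0) f = koszul_map xs 0 f" if "f \<in> finfam car {..<n}" for f
    unfolding g by (rule mat_koszul[OF that n_le xs_car])
  have M1: "matmap (*) (bd ?P (Suc 0)) f = koszul_map xs 1 f + ?z f" if f: "f \<in> finfam car ?G" for f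
  proof
    fix b'
    have "{b. f b \<noteq> 0} \<subseteq> {..<3 + m}"
      using self.finfam_support[OF f] c3 by fastforce
    then have "matmap (*) (bd ?P (Suc 0)) f b' = (\<Sum>b<3 + m. bd ?P (Suc 0) b b' * f b)"
      by (intro matmap_superset) auto
    then show "matmap (*) (bd ?P (Suc 0)) f b' = (koszul_map xs 1 f + ?z f) b'"
      by (simp add: sum_lessThan_add g koszul_map_def sum_fun_apply)
  qed
  have hom1: "hom_gens {..<n} (\<lambda>_. 1) ?G (\<lambda>_. 2) (bd ?P (Suc 0))"
    unfolding hom_gens_def
  proof (intro ballI)
    fix b assume b: "b \<in> ?G"
    show "bd ?P (Suc 0) b \<in> finfam car {..<n} \<and> (\<forall>b'. bd ?P (Suc 0) b b' \<in> shift (gr R) 1 2)"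
    proof (cases "b < 3")
      case True
      then have "b \<in> {..<n choose Suc 1}" using b by (auto simp: numeral_2_eq_2)
      then show ?thesis
        using koszul_hom_gens[of n xs 1, OF n_le xs_gr xs_ge] True unfolding hom_gens_def g
        by (simp add: numeral_2_eq_2)
    next
      case False
      then have t: "b - 3 < m" using b c3 by auto
      then have "z (b - 3) b' \<in> gr R 1" for b' using z[OF t] by (simp add: Z_def H_def)
      then show ?thesis using zf[OF t] False by (simp add: g shift_def)
    qed
  qed
  have e1: "exact_upto 1 ?P" by (rule exact_upto_1) (simp_all add: g)
  have bd_cycles: "matmap (*) (bd ?P 0) (bd ?P (Suc 0) b) = 0" if b: "b \<in> ?G" for b
  proof (cases "b < 3")
    case True
    have bf: "bd ?P (Suc 0) b \<in> finfam car {..<n}" using hom1 b by (simp add: hom_gens_def)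
    have "bd ?P (Suc 0) b = koszul_map xs 1 (unit_vec b)"
      using True by (auto simp: g koszul_map_def unit_vec_def fun_eq_iff intro!: sum.remove[symmetric, THEN trans]
        simp: sum.remove[of "{..<3}" b])
    then show ?thesis using M0[OF bf] koszul_map_comp[of xs 0 "unit_vec b"] by simp
  next
    case False
    then have "b - 3 < m" using b c3 by auto
    then show ?thesis using M0[OF zf] zc False by (simp add: g koszul_cycles_def)
  qed
  have exact: "exact_upto (Suc (Suc 0)) ?P"
  proof -
    have "complex_upto (Suc (Suc 0)) ?P"
      using e1 hom1 bd_cycles unfolding exact_upto_def complex_upto_def by (auto simp: less_Suc_eq g numeral_2_eq_2)
    moreover have "{f \<in> finfam car {..<n}. matmap (*) (bd ?P 0) f = 0} \<subseteq>
        matmap (*) (bd ?P (Suc 0)) ` finfam car ?G"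
    proof
      fix f assume "f \<in> {f \<in> finfam car {..<n}. matmap (*) (bd ?P 0) f = 0}"
      then have "f \<in> koszul_cycles 1" using M0 by (auto simp: koszul_cycles_def)
      then have "f \<in> lin 1" using koszul_cycles_1[OF K] by blast
      then obtain u p where u: "f = u + p" "u \<in> Z 1 1" "p \<in> koszul_boundaries 1" unfolding lin_def by blast
      obtain c p' where c: "p' \<in> koszul_boundaries 1" "u = (\<Sum>t<m. vscale (c t) (z t)) + p'"
        using gen[OF u(2)] by blast
      obtain q where q: "q \<in> finfam car {..<n choose 2}" "p' + p = koszul_map xs 1 q"
        using boundaries_add[OF c(1) u(3)] unfolding boundaries_iff by (auto simp: numeral_2_eq_2)
      \<comment> \<open>The coefficients of the \<open>z t\<close> are placed at the added
        variables, and the remaining boundary is covered by \<open>q\<close>.\<close>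
      define h where "h = (\<lambda>b. if b < 3 then q b else if b < 3 + m then smul R (c (b - 3)) 1 else 0)"
      have hf: "h \<in> finfam car ?G"
      proof -
        have "b < n choose 2" if "q b \<noteq> 0" for b
          using q(1) that by (meson finfam_lessThan not_le)
        then have "{b. h b \<noteq> 0} \<subseteq> ?G" by (auto simp: h_def not_less split: if_splits)
        moreover from this have "finite {b. h b \<noteq> 0}" by (rule finite_subset) simp
        ultimately show ?thesis
          using q(1) zero_C gr_C[OF gr_smul_one] by (auto simp: finfam_iff h_def)
      qed
      have "koszul_map xs 1 h = koszul_map xs 1 q" by (rule koszul_map_cong) (simp add: h_def)
      moreover have "?z h = (\<Sum>t<m. vscale (c t) (z t))"
        by (intro sum.cong) (auto simp: h_def smul_comm)
      ultimately have "matmap (*) (bd ?P (Suc 0)) h = f"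
        unfolding M1[OF hf] q(2)[symmetric] u(1) c(2) by (simp add: algebra_simps)
      then show "f \<in> matmap (*) (bd ?P (Suc 0)) ` finfam car ?G" using hf by blast
    qed
    ultimately show ?thesis using e1 unfolding exact_upto_def by (auto simp: less_Suc_eq g)
  qed
  let ?Z = "{f \<in> finfam car (gens ?P (Suc (Suc 0))). matmap (*) (bd ?P (Suc 0)) f = 0}"
  have Ziff: "f \<in> ?Z \<longleftrightarrow> f \<in> finfam car ?G \<and> koszul_map xs 1 f + ?z f = 0" for f
    using M1 unfolding g by auto
  have low: "(\<lambda>b. if b < 3 then f b else 0) \<in> finfam car {..<n choose 2}" if f: "f \<in> finfam car ?G" for f
  proof -
    have "f b = 0" if "n choose 2 \<le> b" "b < 3" for b
      using self.finfam_support[OF f, of b] that by auto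
    then show ?thesis using f zero_C by (auto simp: finfam_lessThan finfam_iff)
  qed
  \<comment> \<open>Minimality in position 2. The constant terms at the added variables give a
    combination of the \<open>z t\<close> that is a boundary, so they vanish by
    \<open>indep\<close>; those at the other basis elements then form a cycle with constant
    coefficients, which is 0 by \<open>Z_2_0\<close>.\<close>
  have min: "residue R (f b) = 0" if f: "f \<in> ?Z" for f b
  proof -
    have ff: "f \<in> finfam car ?G" and f0: "koszul_map xs 1 f + ?z f = 0" using f Ziff by auto
    have fC: "f b \<in> car" for b using ff by (simp add: finfam_iff)
    define f' where "f' = (\<lambda>b. if b < 3 then f b else 0)"
    have f': "f' \<in> finfam car {..<n choose 2}" unfolding f'_def by (rule low[OF ff])
    have k: "koszul_map xs 1 f = koszul_map xs 1 f'" by (rule koszul_map_cong) (simp add: f'_def)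
    have kf: "koszul_map xs 1 f' \<in> finfam car {..<n}"
      using boundary_finfam[of f' 1] f' by (simp add: numeral_2_eq_2)
    have zt: "(\<lambda>b. z t b * f (3 + t)) \<in> finfam car {..<n}" if "t < m" for t
      using finfam_mult[OF zf[OF that] fC] .
    have "component 1 (?z f) = (\<Sum>t<m. component 1 (\<lambda>b. z t b * f (3 + t)))"
      using zt by (auto simp: component_def fun_eq_iff sum_fun_apply finfam_iff intro!: hc_sum)
    also have "\<dots> = (\<Sum>t<m. vscale (residue R (f (3 + t))) (z t))"
    proof (intro sum.cong refl ext)
      fix t b assume "t \<in> {..<m}"
      then have "z t b \<in> gr R 1" using z[of t] by (simp add: Z_def H_def)
      from hc_mult[OF this fC, of "3 + t" 1] show "component 1 (\<lambda>b. z t b * f (3 + t)) b =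
          vscale (residue R (f (3 + t))) (z t) b"
        by (simp add: component_def residue_C[OF fC] smul_comm)
    qed
    finally have cz: "component 1 (?z f) = (\<Sum>t<m. vscale (residue R (f (3 + t))) (z t))" .
    have zff: "?z f \<in> finfam car {..<n}"
    proof -
      have "?z f = - koszul_map xs 1 f'" using f0 unfolding k by (rule minus_unique[symmetric])
      then show ?thesis using self.finfam_uminus[OF kf] by (simp only:)
    qed
    have "component 1 (koszul_map xs 1 f' + ?z f) = 0"
      using f0 unfolding k by (simp only:) (simp add: component_def hc_zero fun_eq_iff)
    then have e: "koszul_map xs 1 (component 0 f') + (\<Sum>t<m. vscale (residue R (f (3 + t))) (z t)) = 0"
      unfolding component_add[OF kf zff] cz component_koszul_map[OF f'] by simp
    have "(\<Sum>t<m. vscale (residue R (f (3 + t))) (z t)) = koszul_map xs 1 (- component 0 f')"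
      unfolding koszul_map_uminus using e by (rule minus_unique[symmetric])
    moreover have "- component 0 f' \<in> finfam car {..<n choose Suc 1}"
      using self.finfam_uminus[OF H_finfam[OF component_H[OF f', of 0]]] by (simp add: numeral_2_eq_2)
    ultimately have "(\<Sum>t<m. vscale (residue R (f (3 + t))) (z t)) \<in> koszul_boundaries 1"
      unfolding boundaries_iff by blast
    then have r: "residue R (f (3 + t)) = 0" if "t < m" for t
      using indep[of "\<lambda>t. residue R (f (3 + t))"] that by blast
    have "(\<Sum>t<m. vscale (residue R (f (3 + t))) (z t)) = 0"
      by (rule sum.neutral) (use r in \<open>auto simp: fun_eq_iff\<close>)
    then have "koszul_map xs 1 (component 0 f') = 0" using e by (simp only: add_0_right)
    then have "component 0 f' \<in> Z 2 0" using component_H[OF f', of 0] by (simp add: Z_def)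
    from Z_2_0[OF this] have "component 0 f' b = 0" for b by (simp only: zero_fun_apply)
    then have r': "residue R (f' b) = 0" for b
      using residue_component[OF f'] by (metis scale_eq_0_iff zero_neq_one)
    show "residue R (f b) = 0"
    proof (cases "b < 3")
      case True
      then show ?thesis using r'[of b] by (simp add: f'_def)
    next
      case False
      show ?thesis
      proof (cases "b < 3 + m")
        case True
        then show ?thesis using r[of "b - 3"] False by simp
      next
        case F: False
        then have "f b = 0" using self.finfam_support[OF ff, of b] False c3 by auto
        then show ?thesis using res.rho_zero by simp
      qed
    qed
  qed
  \<comment> \<open>The general shape of a cycle: the added variable with index \<open>t\<close>
    gets the image of \<open>L t\<close> as coefficient, and by the Leibniz rule subtracting
    \<open>wedge1 (L t) (z t)\<close> in the Koszul part cancels its contribution to the boundary.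
    What remains free is the element \<open>w\<close> of \<open>lin 2\<close>.\<close>
  define comb where "comb = (\<lambda>L w b. if b < 3 then w b - (\<Sum>t<m. wedge1 (L t) (z t) b)
    else if b < 3 + m then koszul_map xs 0 (L (b - 3)) 0 else 0)"
  define U where "U = {comb L w | L w. (\<forall>t. L t \<in> finfam car {..<n}) \<and> w \<in> lin 2}"
  have UI: "comb L w \<in> U" if "\<And>t. L t \<in> finfam car {..<n}" "w \<in> lin 2" for L w
    unfolding U_def using that by blast
  have "?Z \<subseteq> U"
  proof (rule koszul_generation[OF K exact])
    show "residue R (z b) = 0" if "z \<in> ?Z" for z b using that by (rule min)
    have "comb (\<lambda>_. 0) 0 = 0"
      by (auto simp: comb_def fun_eq_iff wedge1_zero koszul_map_zero)
    then show "0 \<in> U" using UI[of "\<lambda>_. 0" 0] self.finfam_zero lin_zero by simp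
  next
    fix u v assume "u \<in> U" "v \<in> U"
    then obtain L w L' w' where *: "u = comb L w" "\<forall>t. L t \<in> finfam car {..<n}" "w \<in> lin 2"
      "v = comb L' w'" "\<forall>t. L' t \<in> finfam car {..<n}" "w' \<in> lin 2" unfolding U_def by blast
    have "u + v = comb (\<lambda>t. L t + L' t) (w + w')"
      unfolding *(1,4) comb_def wedge1_add_left koszul_map_add by (auto simp: fun_eq_iff sum.distrib)
    then show "u + v \<in> U"
      using UI[of "\<lambda>t. L t + L' t" "w + w'"] * self.finfam_add lin_add by simp
  next
    fix u a assume "u \<in> U" and a: "a \<in> car"
    then obtain L w where *: "u = comb L w" "\<forall>t. L t \<in> finfam car {..<n}" "w \<in> lin 2" unfolding U_def by blast
    have "(\<lambda>b. u b * a) = comb (\<lambda>t b. L t b * a) (\<lambda>b. w b * a)"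
      unfolding *(1) comb_def wedge1_mult koszul_map_mult
      by (auto simp: fun_eq_iff sum_distrib_right left_diff_distrib)
    then show "(\<lambda>b. u b * a) \<in> U"
      using UI[of "\<lambda>t b. L t b * a" "\<lambda>b. w b * a"] * finfam_mult a lin_mult by simp
  next
    fix f assume f: "f \<in> ?Z" and deg: "\<forall>b. f b \<in> shift (gr R) (gdeg ?P (Suc (Suc 0)) b) (Suc (Suc (Suc 0)))"
    have ff: "f \<in> finfam car ?G" and f0: "koszul_map xs 1 f + ?z f = 0" using f Ziff by auto
    have f1: "f b \<in> gr R 1" for b using deg by (simp add: g shift_def)
    \<comment> \<open>Degree 3 in position 2 means linear coefficients, and a linear form is the
      image of a vector of constants.\<close>
    have "\<exists>s. s \<in> H n 0 \<and> f b = koszul_map xs 0 s 0" for b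
    proof -
      obtain s where s: "s \<in> finfam car {..<n}" "f b = koszul_map xs 0 s 0"
        using augmentation_ideal[OF gr_C[OF f1] residue_gr[OF f1]] by auto
      have "f b = component 1 (koszul_map xs 0 s) 0"
        using hc_homogeneous[OF f1, of b 1] s(2) by (simp add: component_def)
      also have "\<dots> = koszul_map xs 0 (component 0 s) 0" using component_koszul_map[OF s(1), of 1 0] by simp
      finally show ?thesis using component_H[OF s(1)] by blast
    qed
    then obtain L' where L': "\<And>b. L' b \<in> H n 0 \<and> f b = koszul_map xs 0 (L' b) 0" by metis
    define L where "L = (\<lambda>t. L' (3 + t))"
    have L: "L t \<in> H n 0" "f (3 + t) = koszul_map xs 0 (L t) 0" for t using L' by (auto simp: L_def)
    define w where "w = (\<lambda>b. if b < 3 then f b else 0) + (\<Sum>t<m. wedge1 (L t) (z t))"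
    have wH: "w \<in> H (n choose 2) 1"
    proof -
      have w1: "wedge1 (L t) (z t) \<in> H (n choose 2) 1" if "t < m" for t
        using wedge1_H[OF L(1), of "z t" 1] z[OF that] by (simp add: Z_def)
      have "(\<lambda>b. if b < 3 then f b else 0) \<in> H (n choose 2) 1"
        using low[OF ff] f1 gr_zero by (auto simp: H_def finfam_lessThan)
      moreover have "(\<Sum>t<m. wedge1 (L t) (z t)) \<in> H (n choose 2) 1"
        using w1 by (auto simp: H_def sum_fun_apply intro!: gr_sum sum.neutral)
      ultimately show ?thesis
        unfolding w_def by (rule H_add)
    qed
    have "koszul_map xs 1 (wedge1 (L t) (z t)) = (\<lambda>b. z t b * f (3 + t))" if "t < m" for t
    proof -
      have "koszul_map xs 0 (z t) = 0" using zc[OF that] by (simp add: koszul_cycles_def)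
      moreover have "z t b = 0" if "\<not> b < 3" for b using zf[OF \<open>t < m\<close>] that n_le by (simp add: finfam_lessThan)
      ultimately show ?thesis unfolding koszul_map_wedge1 by (auto simp: fun_eq_iff L(2) mult.commute)
    qed
    moreover have "koszul_map xs 1 (\<lambda>b. if b < 3 then f b else 0) = koszul_map xs 1 f"
      by (rule koszul_map_cong) simp
    ultimately have "koszul_map xs 1 w = koszul_map xs 1 f + ?z f"
      unfolding w_def koszul_map_add koszul_map_sum by simp
    then have "w \<in> Z 2 1" using wH f0 by (simp add: Z_def)
    then have "w \<in> lin 2" by (rule Z_lin)
    moreover have "f = comb L w"
    proof
      fix b
      show "f b = comb L w b"
      proof (cases "b < 3")
        case True
        then show ?thesis by (simp add: comb_def w_def sum_fun_apply)
      next
        case False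
        show ?thesis
        proof (cases "b < 3 + m")
          case True
          then show ?thesis using L(2)[of "b - 3"] False by (simp add: comb_def)
        next
          case F: False
          then have "f b = 0" using self.finfam_support[OF ff, of b] False c3 by auto
          then show ?thesis using F False by (simp add: comb_def)
        qed
      qed
    qed
    ultimately show "f \<in> U" using UI[of L w] H_finfam[OF L(1)] by simp
  qed
  moreover have "y \<in> ?Z"
  proof -
    have yf: "y \<in> finfam car {..<n choose 2}" and y0: "koszul_map xs 1 y = 0"
      using y by (auto simp: koszul_cycles_def)
    have "y (3 + t) = 0" for t using yf c3 by (simp add: finfam_lessThan)
    then have "?z y = 0" by (simp add: fun_eq_iff sum_fun_apply)
    moreover have "y \<in> finfam car ?G" using yf by (auto simp: finfam_iff)
    ultimately show ?thesis using y0 Ziff by simp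
  qed
  ultimately obtain L w where L: "y = comb L w" "\<And>t. L t \<in> finfam car {..<n}" "w \<in> lin 2"
    unfolding U_def by blast
  have y3: "y b = 0" if "3 \<le> b" for b using y c3 that by (simp add: koszul_cycles_def finfam_lessThan)
  let ?W = "{wedge1 (z s) (z t) | s t. s < t \<and> t < m}"
  \<comment> \<open>Squares vanish and exchanging the factors costs a sign, so pairs with
    \<open>s < t\<close> suffice.\<close>
  have W: "wedge1 (z s) (z t) \<in> V.span ?W" if "s < m" "t < m" for s t
  proof (rule linorder_cases[of s t])
    assume "s < t"
    then show ?thesis using that by (intro V.span_base) blast
  next
    assume "s = t"
    then show ?thesis using V.span_zero[of ?W] by (simp only: wedge1_self)
  next
    assume "t < s"
    then have "wedge1 (z t) (z s) \<in> V.span ?W" using that by (intro V.span_base) blast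
    then show ?thesis unfolding wedge1_anticommute[of "z s" "z t"] by (rule V.span_neg)
  qed
  have "\<exists>\<sigma>\<in>V.span ?W. \<exists>p\<in>koszul_boundaries 2. wedge1 (L t) (z t) = \<sigma> + p" if t: "t < m" for t
  proof -
    \<comment> \<open>\<open>y\<close> has coordinate 0 at the added variables, so each
      \<open>L t\<close> is itself a cycle, and its product with \<open>z t\<close> is a product of
      two classes of the first homology.\<close>
    have "koszul_map xs 0 (L t) 0 = 0" using fun_cong[OF L(1), of "3 + t"] y3[of "3 + t"] t by (simp add: comb_def)
    then have "koszul_map xs 0 (L t) = 0" by (simp add: koszul_map_0 fun_eq_iff)
    then have "L t \<in> koszul_cycles 1" using L(2)[of t] by (simp add: koszul_cycles_def)
    then have "L t \<in> lin 1" using koszul_cycles_1[OF K] by blast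
    then obtain u p where u: "L t = u + p" "u \<in> Z 1 1" "p \<in> koszul_boundaries 1" unfolding lin_def by blast
    obtain c p' where c: "p' \<in> koszul_boundaries 1" "u = (\<Sum>s<m. vscale (c s) (z s)) + p'"
      using gen[OF u(2)] by blast
    have "wedge1 (\<Sum>s\<in>I. vscale (c s) (z s)) (z t) = (\<Sum>s\<in>I. vscale (c s) (wedge1 (z s) (z t)))" for I
    proof (induction I rule: infinite_finite_induct)
      case (insert s I)
      have "wedge1 (vscale (c s) (z s)) (z t) = vscale (c s) (wedge1 (z s) (z t))"
        unfolding vscale_eq_mult by (rule wedge1_mult)
      then show ?case using insert by (simp only: sum.insert[OF insert(1,2)] wedge1_add_left)
    qed (simp_all only: sum.infinite sum.empty wedge1_zero simp_thms)
    then have "wedge1 (L t) (z t) = (\<Sum>s<m. vscale (c s) (wedge1 (z s) (z t))) + wedge1 (p' + p) (z t)"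
      unfolding u(1) c(2) wedge1_add_left by (simp add: add.assoc)
    moreover have "(\<Sum>s<m. vscale (c s) (wedge1 (z s) (z t))) \<in> V.span ?W"
      using W t by (intro V.span_sum V.span_scale) auto
    moreover have "wedge1 (p' + p) (z t) \<in> koszul_boundaries 2"
      by (rule wedge1_boundary[OF boundaries_add[OF c(1) u(3)] zc[OF t]])
    ultimately show ?thesis by blast
  qed
  then have "\<forall>t\<in>{..<m}. \<exists>q. fst q \<in> V.span ?W \<and> snd q \<in> koszul_boundaries 2 \<and>
      wedge1 (L t) (z t) = fst q + snd q"
    by (simp add: Bex_def)
  from bchoice[OF this] obtain q where q: "\<forall>t\<in>{..<m}. fst (q t) \<in> V.span ?W \<and>
      snd (q t) \<in> koszul_boundaries 2 \<and> wedge1 (L t) (z t) = fst (q t) + snd (q t)"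
    by (elim exE)
  define \<sigma> p where "\<sigma> = fst \<circ> q" and "p = snd \<circ> q"
  have \<sigma>p: "\<sigma> t \<in> V.span ?W \<and> p t \<in> koszul_boundaries 2 \<and> wedge1 (L t) (z t) = \<sigma> t + p t"
    if "t < m" for t
    using bspec[OF q, of t] that by (simp add: \<sigma>_def p_def)
  have wf: "w b = 0" if "3 \<le> b" for b
  proof -
    obtain u p where "w = u + p" "u \<in> Z 2 1" "p \<in> koszul_boundaries 2" using L(3) unfolding lin_def by blast
    then show ?thesis using boundaries_finfam[of p 2] c3 that by (simp add: Z_def H_def finfam_lessThan)
  qed
  have "y = w - (\<Sum>t<m. wedge1 (L t) (z t))"
  proof
    fix b show "y b = (w - (\<Sum>t<m. wedge1 (L t) (z t))) b"
      using fun_cong[OF L(1), of b] y3[of b] wf[of b]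
      by (cases "b < 3") (auto simp: comb_def sum_fun_apply wedge1_def)
  qed
  also have "(\<Sum>t<m. wedge1 (L t) (z t)) = (\<Sum>t<m. \<sigma> t + p t)" using \<sigma>p by (intro sum.cong) auto
  also have "\<dots> = (\<Sum>t<m. \<sigma> t) + (\<Sum>t<m. p t)" by (rule sum.distrib)
  finally have "y = - (\<Sum>t<m. \<sigma> t) + (w + - (\<Sum>t<m. p t))" by (simp add: fun_eq_iff)
  moreover have "- (\<Sum>t<m. \<sigma> t) \<in> V.span ?W" using \<sigma>p by (intro V.span_neg V.span_sum) auto
  moreover have "w + - (\<Sum>t<m. p t) \<in> lin 2"
    using \<sigma>p by (intro lin_add L(3) boundaries_lin boundaries_uminus boundaries_sum) auto
  ultimately show ?thesis using that by blast
qed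

end

section \<open>Hilbert function and Betti numbers\<close>

context presented_algebra
begin

sublocale VV: vector_space_pair vscale vscale ..
sublocale VR: vector_space_pair vscale "smul R" ..

definition hilb :: "nat \<Rightarrow> nat" where "hilb d = dim (gr R d)"

definition mon :: "nat \<times> nat \<times> nat \<Rightarrow> 'r"
  where "mon t = (case t of (a, b, c) \<Rightarrow> xs 0 ^ a * xs 1 ^ b * xs 2 ^ c)"

definition mon_deg :: "nat \<Rightarrow> (nat \<times> nat \<times> nat) set"
  where "mon_deg d = {(a, b, c). a + b + c = d}"

lemma finite_mon_deg: "finite (mon_deg d)"
  by (rule finite_subset[of _ "{..d} \<times> {..d} \<times> {..d}"]) (auto simp: mon_deg_def)

lemma gr_Suc:
  assumes "a \<in> gr R (Suc d)"
  obtains s where "s \<in> H n d" "a = koszul_map xs 0 s 0"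
proof -
  obtain s where s: "s \<in> finfam car {..<n}" "a = koszul_map xs 0 s 0"
    using augmentation_ideal[OF gr_C[OF assms] residue_gr[OF assms]] by auto
  have "a = component (Suc d) (koszul_map xs 0 s) 0"
    using hc_homogeneous[OF assms, of "Suc d"] s(2) by (simp add: component_def)
  also have "\<dots> = koszul_map xs 0 (component d s) 0" using component_koszul_map[OF s(1), of "Suc d" 0] by simp
  finally show ?thesis using that component_H[OF s(1)] by blast
qed

lemma mon_gr: "t \<in> mon_deg d \<Longrightarrow> mon t \<in> gr R d"
proof -
  have p: "xs j ^ k \<in> gr R k" for j k
  proof (induction k)
    case (Suc k)
    then show ?case using gr_mult[OF xs_gr Suc, of j] by simp
  qed (simp add: one_gr)
  show "t \<in> mon_deg d \<Longrightarrow> mon t \<in> gr R d"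
    unfolding mon_def mon_deg_def using gr_mult[OF gr_mult[OF p p] p] by auto
qed

lemma mult_span:
  assumes "a \<in> span (g ` T)" "\<And>t. t \<in> T \<Longrightarrow> y * g t \<in> span S"
  shows "y * a \<in> span S"
  using assms(1)
proof (induction rule: span_induct_alt)
  case base
  then show ?case by (simp add: span_zero)
next
  case (step c v w)
  then have "y * v \<in> span S" using assms(2) by blast
  then have "smul R c (y * v) + y * w \<in> span S" using step by (intro span_add span_scale)
  then show ?case by (simp add: distrib_left smul_comm)
qed

lemma xs_mon:
  "xs 0 * mon (a, b, c) = mon (Suc a, b, c)" "xs 1 * mon (a, b, c) = mon (a, Suc b, c)"
  "xs 2 * mon (a, b, c) = mon (a, b, Suc c)"
  by (simp_all add: mon_def algebra_simps)

lemma gr_span: "gr R d = span (mon ` mon_deg d)"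
proof
  show "span (mon ` mon_deg d) \<subseteq> gr R d"
    using mon_gr by (intro span_minimal subspace_gr) blast
  show "gr R d \<subseteq> span (mon ` mon_deg d)"
  proof (induction d)
    case 0
    have "mon_deg 0 = {(0, 0, 0)}" by (auto simp: mon_deg_def)
    then show ?case using gr_0 span_scale[OF span_base, of 1 "{1}"] by (auto simp: mon_def)
  next
    case (Suc d)
    show ?case
    proof
      fix a assume "a \<in> gr R (Suc d)"
      then obtain s where s: "s \<in> H n d" "a = koszul_map xs 0 s 0" by (rule gr_Suc)
      have "xs j * s j \<in> span (mon ` mon_deg (Suc d))" if j: "j < 3" for j
      proof (rule mult_span)
        show "s j \<in> span (mon ` mon_deg d)" using s(1) Suc by (auto simp: H_def)
        fix t assume "t \<in> mon_deg d"
        moreover obtain p q r where "t = (p, q, r)" by (metis prod.exhaust)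
        ultimately show "xs j * mon t \<in> span (mon ` mon_deg (Suc d))"
          using lessThan_3_cases[OF j] xs_mon by (intro span_base) (auto simp: mon_deg_def)
      qed
      from this[of 0] this[of 1] this[of 2] show "a \<in> span (mon ` mon_deg (Suc d))"
        unfolding s(2) koszul_map_0 by (auto intro!: span_add)
    qed
  qed
qed

lemma gr_finite_span: "\<exists>F. finite F \<and> gr R d \<subseteq> span F"
  using gr_span finite_mon_deg by (metis finite_imageI order_refl)

lemma H_subspace: "V.subspace (H k e)"
  by (rule V.subspaceI)
    (auto simp: H_def gr_zero intro: subspace_add[OF subspace_gr] subspace_scale[OF subspace_gr])

lemma H_finite_span: "\<exists>F. finite F \<and> H k e \<subseteq> V.span F"
proof (induction k)
  case 0
  have "H 0 e \<subseteq> V.span {}" by (auto simp: H_def fun_eq_iff)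
  then show ?case by blast
next
  case (Suc k)
  then obtain F where F: "finite F" "H k e \<subseteq> V.span F" by blast
  obtain B where B: "finite B" "gr R e \<subseteq> span B" using gr_finite_span by blast
  let ?E = "\<lambda>x b. if b = k then x else (0::'r)"
  have E: "?E x \<in> V.span (F \<union> ?E ` B)" if "x \<in> span B" for x
    using that
  proof (induction rule: span_induct_alt)
    case base
    have "?E 0 = 0" by auto
    then show ?case using V.span_zero by metis
  next
    case (step c u w)
    have "?E u \<in> V.span (F \<union> ?E ` B)" using step(1) by (intro V.span_base) blast
    then have "vscale c (?E u) + ?E w \<in> V.span (F \<union> ?E ` B)"
      using step(2) by (rule V.span_add[OF V.span_scale])
    moreover have "vscale c (?E u) + ?E w = ?E (smul R c u + w)" by auto
    ultimately show ?case by metis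
  qed
  have "H (Suc k) e \<subseteq> V.span (F \<union> ?E ` B)"
  proof
    fix f assume f: "f \<in> H (Suc k) e"
    have "(\<lambda>b. if b = k then 0 else f b) \<in> H k e" using f gr_zero by (auto simp: H_def)
    then have 1: "(\<lambda>b. if b = k then 0 else f b) \<in> V.span (F \<union> ?E ` B)"
      using F(2) V.span_mono[of F "F \<union> ?E ` B"] by blast
    have "f k \<in> gr R e" using f by (simp add: H_def)
    then have 2: "?E (f k) \<in> V.span (F \<union> ?E ` B)" using E B(2) by blast
    have "f = (\<lambda>b. if b = k then 0 else f b) + ?E (f k)" by auto
    then show "f \<in> V.span (F \<union> ?E ` B)" using V.span_add[OF 1 2] by simp
  qed
  then show ?case using F(1) B(1) by (intro exI[of _ "F \<union> ?E ` B"]) auto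
qed

lemma subspace_finite_span: "W \<subseteq> H k e \<Longrightarrow> \<exists>F. finite F \<and> W \<subseteq> V.span F"
  using H_finite_span[of k e] by blast

text \<open>The last coordinate maps the vectors of length \<open>Suc k\<close> onto
  \<open>W\<close>, with the vectors of length \<open>k\<close> as kernel.\<close>

lemma dim_product:
  assumes W: "subspace W" "W \<subseteq> gr R e"
  shows "V.dim {f. (\<forall>b\<ge>k. f b = 0) \<and> (\<forall>b. f b \<in> W)} = k * dim W"
proof (induction k)
  case 0
  have "{f. (\<forall>b\<ge>0. f b = 0) \<and> (\<forall>b. f b \<in> W)} = {0 :: nat \<Rightarrow> 'r}"
    using subspace_0[OF W(1)] by (auto simp: fun_eq_iff)
  then show ?case using V.dim_le_card[of "{0}" "{}"] by simp
next
  case (Suc k)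
  let ?P = "\<lambda>k. {f. (\<forall>b\<ge>k. f b = 0) \<and> (\<forall>b. f b \<in> W)}"
  have "?P (Suc k) \<subseteq> H (Suc k) e" using W(2) by (auto simp: H_def)
  from subspace_finite_span[OF this] obtain F where F: "finite F" "?P (Suc k) \<subseteq> V.span F"
    by (elim exE conjE)
  have sub: "V.subspace (?P (Suc k))"
    by (rule V.subspaceI) (auto intro: subspace_0[OF W(1)] subspace_add[OF W(1)] subspace_scale[OF W(1)])
  have lin: "Vector_Spaces.linear vscale (smul R) (\<lambda>f. f k)"
    by unfold_locales (auto simp: algebra_simps)
  have "{f \<in> ?P (Suc k). f k = 0} = ?P k"
    by (auto simp: le_Suc_eq not_less_eq_eq) (metis Suc_leI le_neq_implies_less)
  moreover have "(\<lambda>f. f k) ` ?P (Suc k) = W"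
  proof (intro equalityI subsetI)
    fix x assume "x \<in> W"
    then have "(\<lambda>b. if b = k then x else 0) \<in> ?P (Suc k)" using subspace_0[OF W(1)] by auto
    then show "x \<in> (\<lambda>f. f k) ` ?P (Suc k)" by (intro image_eqI[of _ _ "\<lambda>b. if b = k then x else 0"]) auto
  qed auto
  ultimately show ?case
    using VR.dim_kernel_plus_image[OF lin sub F] Suc by simp
qed

lemma dim_H: "V.dim (H k e) = k * hilb e"
  unfolding H_def hilb_def by (rule dim_product[OF subspace_gr order_refl])

text \<open>Indexed by the coefficient degree of the preimages: \<open>Bd i e\<close> consists of
  cycles of coefficient degree \<open>Suc e\<close>.\<close>

definition Bd :: "nat \<Rightarrow> nat \<Rightarrow> (nat \<Rightarrow> 'r) set"
  where "Bd i e = koszul_map xs i ` H (n choose Suc i) e"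

lemma koszul_map_linear: "Vector_Spaces.linear vscale vscale (koszul_map xs i)"
  by unfold_locales (auto simp: koszul_map_add koszul_map_vscale)

lemma rank_nullity: "(n choose Suc i) * hilb e = V.dim (Z (Suc i) e) + V.dim (Bd i e)"
proof -
  obtain F where F: "finite F" "H (n choose Suc i) e \<subseteq> V.span F" using H_finite_span by blast
  have "{f \<in> H (n choose Suc i) e. koszul_map xs i f = 0} = Z (Suc i) e" by (simp add: Z_def)
  then show ?thesis
    using VV.dim_kernel_plus_image[OF koszul_map_linear H_subspace F, of i] by (simp add: dim_H Bd_def)
qed

lemma Z_subspace: "V.subspace (Z i e)"
  by (rule V.subspaceI) (auto simp: Z_zero Z_add Z_vscale)

lemma Bd_subspace: "V.subspace (Bd i e)"
proof -
  interpret L: Vector_Spaces.linear vscale vscale "koszul_map xs i" by (rule koszul_map_linear)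
  show ?thesis unfolding Bd_def by (rule L.subspace_image[OF H_subspace])
qed

lemma boundaries_subspace: "V.subspace (koszul_boundaries i)"
proof (rule V.subspaceI)
  fix c g assume "g \<in> koszul_boundaries i"
  then show "vscale c g \<in> koszul_boundaries i"
    unfolding vscale_eq_mult using boundaries_mult gr_C[OF gr_smul_one] by blast
qed (use boundaries_zero boundaries_add in auto)

lemma Bd_boundaries: "g \<in> Bd i e \<Longrightarrow> g \<in> koszul_boundaries i"
  unfolding Bd_def boundaries_iff using H_finfam by blast

lemma Bd_Z: "Bd i e \<subseteq> Z i (Suc e)"
proof
  fix g assume g: "g \<in> Bd i e"
  then have "g \<in> H (n choose i) (Suc e)" unfolding Bd_def using koszul_map_H by blast
  moreover have "g \<in> koszul_cycles i" using Bd_boundaries[OF g] by (rule boundaries_cycles)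
  ultimately show "g \<in> Z i (Suc e)" by (simp add: Z_def koszul_cycles_def)
qed

lemma component_boundaries: "g \<in> koszul_boundaries i \<Longrightarrow> component e g \<in> koszul_boundaries i"
  using boundaries_component[of g i e] Bd_boundaries[of "component e g" i "e - 1"] boundaries_zero
  unfolding Bd_def by metis

lemma component_boundaries_Bd: "g \<in> koszul_boundaries i \<Longrightarrow> component (Suc e) g \<in> Bd i e"
  using boundaries_component[of g i "Suc e"] V.subspace_0[OF Bd_subspace] unfolding Bd_def
  by (metis diff_Suc_1)

lemma homogeneous_boundary: "g \<in> koszul_boundaries i \<Longrightarrow> g \<in> H k (Suc e) \<Longrightarrow> g \<in> Bd i e"
  using component_boundaries_Bd[of g i e] component_eq[of g k "Suc e" "Suc e"] by simp

lemma component_cycles: "f \<in> koszul_cycles i \<Longrightarrow> component e f \<in> Z i e"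
proof -
  assume f: "f \<in> koszul_cycles i"
  then have ff: "f \<in> finfam car {..<n choose i}" by (simp add: koszul_cycles_def)
  have "koszul_map xs (i - 1) (component e f) = 0" if "i \<noteq> 0"
  proof -
    have "component (Suc e) (koszul_map xs (i - 1) f) = koszul_map xs (i - 1) (component e f)"
      using component_koszul_map[OF ff, of "Suc e" "i - 1"] by simp
    moreover have "koszul_map xs (i - 1) f = 0" using f that by (simp add: koszul_cycles_def)
    moreover have "component (Suc e) 0 = (0 :: nat \<Rightarrow> 'r)" by (simp add: component_def hc_zero fun_eq_iff)
    ultimately show ?thesis by simp
  qed
  then show ?thesis using component_H[OF ff] by (simp add: Z_def)
qed

text \<open>A complement of \<open>Bd i e\<close> in the cycles of this degree is independent even
  modulo all boundaries, because a homogeneous boundary is the image of a homogeneous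
  element.\<close>

lemma homology_basis:
  obtains S where "S \<subseteq> Z i (Suc e)" "finite S" "V.independent S"
    "V.span S \<inter> koszul_boundaries i = {0}" "Z i (Suc e) \<subseteq> V.span (S \<union> Bd i e)"
    "V.dim (Z i (Suc e)) = card S + V.dim (Bd i e)"
proof -
  have "Z i (Suc e) \<subseteq> H (n choose i) (Suc e)" by (auto simp: Z_def)
  from subspace_finite_span[OF this] obtain F where F: "finite F" "Z i (Suc e) \<subseteq> V.span F"
    by (elim exE conjE)
  obtain S where S: "S \<subseteq> Z i (Suc e)" "finite S" "V.independent S" "V.span S \<inter> Bd i e = {0}"
    "Z i (Suc e) \<subseteq> V.span (S \<union> Bd i e)" "V.dim (Z i (Suc e)) = card S + V.dim (Bd i e)"
    by (rule V.complement_exists[OF Z_subspace Bd_subspace Bd_Z F])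
  have sp: "V.span S \<subseteq> Z i (Suc e)" using S(1) V.span_minimal[OF _ Z_subspace] by blast
  have "x = 0" if "x \<in> V.span S" "x \<in> koszul_boundaries i" for x
  proof -
    have "x \<in> Z i (Suc e)" using that(1) sp by blast
    then have "x \<in> Bd i e" using homogeneous_boundary[OF that(2), of "n choose i" e] by (simp add: Z_def)
    then show ?thesis using S(4) that(1) by blast
  qed
  then have "V.span S \<inter> koszul_boundaries i = {0}" using V.span_zero boundaries_zero by blast
  then show ?thesis using that S by blast
qed

lemma Z_in_span: "Z i (Suc e) \<subseteq> V.span (S \<union> Bd i e) \<Longrightarrow> u \<in> Z i (Suc e) \<Longrightarrow> u \<in> V.span (S \<union> koszul_boundaries i)"
  using V.span_mono[of "S \<union> Bd i e" "S \<union> koszul_boundaries i"] Bd_boundaries by blast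

text \<open>The homology in position 0 is concentrated in degree 0: an element of positive degree is
  a combination of the variables.\<close>

lemma hilb_Suc: "V.dim (Bd 0 e) = hilb (Suc e)"
proof -
  have "Bd 0 e = H 1 (Suc e)"
  proof
    show "Bd 0 e \<subseteq> H 1 (Suc e)" using Bd_Z[of 0 e] by (auto simp: Z_def)
    show "H 1 (Suc e) \<subseteq> Bd 0 e"
    proof
      fix f assume f: "f \<in> H 1 (Suc e)"
      then have "f 0 \<in> gr R (Suc e)" by (simp add: H_def)
      then obtain s where s: "s \<in> H n e" "f 0 = koszul_map xs 0 s 0" by (rule gr_Suc)
      have "f b = koszul_map xs 0 s b" for b
        using s(2) f by (cases "b = 0") (auto simp: H_def koszul_map_0)
      then have "f = koszul_map xs 0 s" by (rule ext)
      then show "f \<in> Bd 0 e" unfolding Bd_def using s(1) by simp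
    qed
  qed
  then show ?thesis using dim_H[of 1 "Suc e"] by simp
qed

section \<open>Betti numbers in terms of graded dimensions\<close>

lemma dim_zero_space: "V.dim {0} = 0"
  using V.dim_le_card[of "{0}" "{}"] by simp

lemma betti_gt: assumes "n < i" shows "betti R X i = 0"
proof -
  have "koszul_cycles i \<subseteq> {0}"
    unfolding koszul_cycles_def using assms finfam_empty by (auto simp: binomial_eq_0)
  then have "betti R X i = card ({} :: (nat \<Rightarrow> 'r) set)"
    by (intro betti_eq_koszul_homology) (use boundaries_zero V.span_zero in \<open>auto simp: V.independent_empty\<close>)
  then show ?thesis by simp
qed

text \<open>Position 0 has as homology \<open>R\<close> modulo the ideal of the variables, with the
  class of 1 as basis.\<close>

lemma betti_0: "betti R X 0 = 1"
proof -
  let ?u = "unit_vec 0 :: nat \<Rightarrow> 'r"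
  have u: "?u \<in> H 1 0" using one_gr gr_zero by (auto simp: H_def unit_vec_def)
  have u0: "?u \<noteq> 0" by (auto simp: unit_vec_def fun_eq_iff)
  have "betti R X 0 = card {?u}"
  proof (rule betti_eq_koszul_homology)
    show "{?u} \<subseteq> koszul_cycles 0" using Z_cycles[of ?u 0 0] u by (simp add: Z_def)
    show "V.independent {?u}" using u0 by simp
    have "x = 0" if x: "x \<in> V.span {?u}" "x \<in> koszul_boundaries 0" for x
    proof -
      have "x \<in> H 1 0" using x(1) V.span_minimal[OF _ H_subspace, of "{?u}" 1 0] u by blast
      then have "x = component 0 x" by (simp add: component_eq)
      also have "\<dots> = 0" using boundaries_component[OF x(2), of 0] component_koszul_map x(2)
        unfolding boundaries_iff by auto
      finally show ?thesis .
    qed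
    then show "V.span {?u} \<inter> koszul_boundaries 0 = {0}" using V.span_zero boundaries_zero by blast
    show "koszul_cycles 0 \<subseteq> V.span ({?u} \<union> koszul_boundaries 0)"
    proof
      fix f assume "f \<in> koszul_cycles 0"
      then have f: "f \<in> finfam car {..<1}" by (simp add: koszul_cycles_def)
      then have fC: "f 0 \<in> car" by (simp add: finfam_lessThan)
      define c where "c = residue R (f 0)"
      have cC: "smul R c 1 \<in> car" by (rule gr_C[OF gr_smul_one])
      have "f 0 + - smul R c 1 \<in> car" using subspace_add[OF subspace_C fC car_minus[OF cC]] .
      moreover have "residue R (f 0 + - smul R c 1) = 0"
        using residue_add[OF fC car_minus[OF cC]] res.rho_minus[OF cC] residue_smul_one[of c] c_def by simp
      ultimately obtain s where s: "s \<in> finfam car {..<n}" "f 0 + - smul R c 1 = koszul_map xs 0 s 0"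
        by (rule augmentation_ideal)
      have "f b = (vscale c ?u + koszul_map xs 0 s) b" for b
      proof (cases "b = 0")
        case True
        then show ?thesis using s(2)[symmetric] by (simp add: unit_vec_def)
      next
        case False
        then show ?thesis using f by (simp add: unit_vec_def koszul_map_0 finfam_lessThan)
      qed
      then have "f = vscale c ?u + koszul_map xs 0 s" by (rule ext)
      moreover have "koszul_map xs 0 s \<in> koszul_boundaries 0" unfolding boundaries_iff using s(1) by auto
      then have "koszul_map xs 0 s \<in> V.span ({?u} \<union> koszul_boundaries 0)" by (intro V.span_base) blast
      moreover have "vscale c ?u \<in> V.span ({?u} \<union> koszul_boundaries 0)"
        by (intro V.span_scale V.span_base) blast
      ultimately show "f \<in> V.span ({?u} \<union> koszul_boundaries 0)" by (simp only: V.span_add)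
    qed
  qed simp
  then show ?thesis by simp
qed

text \<open>The differential into position 3 is 0, so the third Betti number is the sum of the
  dimensions of all \<open>Z 3 e\<close>. A uniform bound on the partial sums both makes this sum
  finite and bounds it.\<close>

lemma betti_3_le:
  assumes bound: "\<And>N. (\<Sum>e<N. V.dim (Z 3 e)) \<le> c"
  shows "betti R X 3 \<le> c"
proof -
  let ?s = "\<lambda>N. \<Sum>e<N. V.dim (Z 3 e)"
  have fin: "finite (range ?s)" using bound by (intro finite_subset[of "range ?s" "{..c}"]) auto
  \<comment> \<open>Beyond an index at which the partial sums attain their maximum, all
    \<open>Z 3 e\<close> are 0.\<close>
  obtain N where N: "?s N = Max (range ?s)" using Max_in[OF fin] by auto
  have zero: "Z 3 e = {0}" if "N \<le> e" for e
  proof -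
    have "?s N \<le> ?s e" using that by (intro sum_mono2) auto
    moreover have "?s (Suc e) \<le> ?s N" unfolding N by (rule Max_ge[OF fin rangeI])
    ultimately have d: "V.dim (Z 3 e) = 0" by simp
    obtain F where F: "finite F" "Z 3 e \<subseteq> V.span F"
      using subspace_finite_span[of "Z 3 e" "n choose 3" e] by (auto simp: Z_def)
    obtain C where C: "C \<subseteq> Z 3 e" "V.independent C" "Z 3 e \<subseteq> V.span C" "card C = V.dim (Z 3 e)"
      using V.basis_exists[of "Z 3 e"] by blast
    have "finite C" using V.independent_finite_of_span[OF F C(1,2)] by blast
    then have "C = {}" using C(4) d by simp
    then show ?thesis using C(3) Z_zero by auto
  qed
  have "\<exists>S. S \<subseteq> Z 3 e \<and> finite S \<and> V.independent S \<and> Z 3 e \<subseteq> V.span S \<and> card S = V.dim (Z 3 e)" for e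
  proof -
    obtain F where F: "finite F" "Z 3 e \<subseteq> V.span F"
      using subspace_finite_span[of "Z 3 e" "n choose 3" e] by (auto simp: Z_def)
    obtain C where C: "C \<subseteq> Z 3 e" "V.independent C" "Z 3 e \<subseteq> V.span C" "card C = V.dim (Z 3 e)"
      using V.basis_exists[of "Z 3 e"] by blast
    have "finite C" using V.independent_finite_of_span[OF F C(1,2)] by blast
    then show ?thesis using C by blast
  qed
  then obtain S where S: "\<And>e. S e \<subseteq> Z 3 e \<and> finite (S e) \<and> V.independent (S e) \<and>
      Z 3 e \<subseteq> V.span (S e) \<and> card (S e) = V.dim (Z 3 e)" by metis
  have b0: "koszul_boundaries 3 = {0}"
    using boundaries_zero[of 3] unfolding koszul_boundaries_def by (auto simp: koszul_map_ge_3)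
  have I: "V.independent (\<Union>e\<in>{..<N}. S e) \<and> V.span (\<Union>e\<in>{..<N}. S e) \<inter> {0} = {0} \<and>
    card (\<Union>e\<in>{..<N}. S e) = (\<Sum>e\<in>{..<N}. card (S e))"
  proof (rule V.graded_union_independent[where G = "H (n choose 3)"])
    show "S e \<subseteq> H (n choose 3) e \<and> finite (S e) \<and> V.independent (S e) \<and> V.span (S e) \<inter> {0} = {0}" for e
      using S[of e] V.span_zero by (auto simp: Z_def)
    show "V.subspace (H (n choose 3) e)" for e by (rule H_subspace)
    show "V.subspace {0}" by simp
  next
    fix u e assume u: "\<And>e. e \<in> {..<N} \<Longrightarrow> u e \<in> H (n choose 3) e" "sum u {..<N} \<in> {0}" and e: "e \<in> {..<N}"
    have uC: "u d b \<in> car" if "d < N" for d b using u(1)[of d] gr_C[of "u d b" d] that by (simp add: H_def)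
    have "component e (sum u {..<N}) = (\<Sum>d<N. component e (u d))"
      using uC by (auto simp: component_def fun_eq_iff sum_fun_apply intro!: hc_sum)
    also have "\<dots> = (\<Sum>d<N. if d = e then u e else 0)"
      by (intro sum.cong) (use component_eq[OF u(1)] in auto)
    also have "\<dots> = u e" using e by simp
    finally show "u e \<in> {0}" using u(2) by (simp add: component_def hc_zero fun_eq_iff)
  qed simp
  have "betti R X 3 = card (\<Union>e\<in>{..<N}. S e)"
  proof (rule betti_eq_koszul_homology)
    show "(\<Union>e\<in>{..<N}. S e) \<subseteq> koszul_cycles 3" using S Z_cycles by blast
    show "finite (\<Union>e\<in>{..<N}. S e)" using S by blast
    show "V.independent (\<Union>e\<in>{..<N}. S e)" using I by (rule conjunct1)
    show "V.span (\<Union>e\<in>{..<N}. S e) \<inter> koszul_boundaries 3 = {0}" unfolding b0 using I by (elim conjE)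
    show "koszul_cycles 3 \<subseteq> V.span ((\<Union>e\<in>{..<N}. S e) \<union> koszul_boundaries 3)"
    proof
      fix f assume f: "f \<in> koszul_cycles 3"
      have "component e f \<in> V.span ((\<Union>e\<in>{..<N}. S e) \<union> koszul_boundaries 3)" for e
      proof (cases "e < N")
        case True
        then have "S e \<subseteq> (\<Union>e\<in>{..<N}. S e) \<union> koszul_boundaries 3" by blast
        from V.span_mono[OF this] show ?thesis using component_cycles[OF f, of e] S[of e] by blast
      next
        case False
        then have "component e f = 0" using component_cycles[OF f, of e] zero[of e] by simp
        then show ?thesis by (simp only: V.span_zero)
      qed
      moreover obtain M where "f = (\<Sum>e\<le>M. component e f)"
        using component_sum f unfolding koszul_cycles_def by blast
      ultimately show "f \<in> V.span ((\<Union>e\<in>{..<N}. S e) \<union> koszul_boundaries 3)"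
        using V.span_sum[of "{..M}" "\<lambda>e. component e f"] by simp
    qed
  qed
  also have "\<dots> = (\<Sum>e<N. V.dim (Z 3 e))" using I S by simp
  finally show ?thesis using bound by simp
qed

lemma sum_lessThan_eq_choose_2: "(\<Sum>t<m. t) = m choose 2"
  by (induction m) (simp_all add: numeral_2_eq_2)

text \<open>\<open>b3\<close> and \<open>b4\<close> are the dimensions of the second homology in
  internal degrees 3 and 4, that is, in coefficient degrees 1 and 2. Equal dimensions of cycles and
  boundaries record the degrees without homology.\<close>

theorem koszul_betti:
  assumes K: "koszul R"
  obtains b3 b4 where
    "V.dim (Z 1 1) = betti R X 1 + V.dim (Bd 1 0)"
    "\<forall>e\<ge>1. V.dim (Z 1 (Suc e)) = V.dim (Bd 1 e)"
    "betti R X 2 = b3 + b4" "b4 \<le> betti R X 1 choose 2"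
    "V.dim (Z 2 0) = 0" "V.dim (Z 2 1) = b3 + V.dim (Bd 2 0)" "V.dim (Z 2 2) = b4 + V.dim (Bd 2 1)"
    "\<forall>e\<ge>2. V.dim (Z 2 (Suc e)) = V.dim (Bd 2 e)"
    "betti R X 1 = 0 \<longrightarrow> koszul_cycles 1 = koszul_boundaries 1"
proof -
  obtain M where M: "M \<subseteq> Z 1 (Suc 0)" "finite M" "V.independent M"
    "V.span M \<inter> koszul_boundaries 1 = {0}" "Z 1 (Suc 0) \<subseteq> V.span (M \<union> Bd 1 0)"
    "V.dim (Z 1 (Suc 0)) = card M + V.dim (Bd 1 0)"
    by (rule homology_basis[of 1 0])
  have cyc1: "koszul_cycles 1 \<subseteq> V.span (M \<union> koszul_boundaries 1)"
  proof
    fix f assume "f \<in> koszul_cycles 1"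
    then have "f \<in> lin 1" using koszul_cycles_1[OF K] by blast
    then obtain u g where u: "f = u + g" "u \<in> Z 1 1" "g \<in> koszul_boundaries 1" unfolding lin_def by blast
    have "u \<in> V.span (M \<union> koszul_boundaries 1)" using Z_in_span[OF M(5)] u(2) by simp
    moreover have "g \<in> V.span (M \<union> koszul_boundaries 1)" using u(3) by (intro V.span_base) blast
    ultimately show "f \<in> V.span (M \<union> koszul_boundaries 1)" unfolding u(1) by (rule V.span_add)
  qed
  have b1: "betti R X 1 = card M"
    by (rule betti_eq_koszul_homology[OF _ M(2,3,4) cyc1]) (use M(1) Z_cycles in blast)
  have z1: "V.dim (Z 1 (Suc e)) = V.dim (Bd 1 e)" if "1 \<le> e" for e
  proof -
    \<comment> \<open>The linear summand \<open>u\<close> has coefficient degree 1, which is below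
      \<open>Suc e\<close>, so in this degree only the boundary contributes.\<close>
    have "Z 1 (Suc e) \<subseteq> Bd 1 e"
    proof
      fix f assume f: "f \<in> Z 1 (Suc e)"
      then have "f \<in> lin 1" using koszul_cycles_1[OF K] Z_cycles by blast
      then obtain u g where u: "f = u + g" "u \<in> Z 1 1" "g \<in> koszul_boundaries 1" unfolding lin_def by blast
      have uH: "u \<in> H n 1" "f \<in> H n (Suc e)" using u(2) f by (simp_all add: Z_def)
      have "f = component (Suc e) f" using component_eq[OF uH(2)] by simp
      also have "\<dots> = component (Suc e) u + component (Suc e) g"
        unfolding u(1) using H_finfam[OF uH(1)] boundaries_finfam[OF u(3)] by (intro component_add) auto
      also have "component (Suc e) u = 0" using component_eq[OF uH(1)] that by simp
      finally show "f \<in> Bd 1 e" using component_boundaries_Bd[OF u(3), of e] by simp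
    qed
    then show ?thesis using Bd_Z[of 1 e] by (simp add: subset_antisym)
  qed
  define m where "m = card M"
  obtain z where "bij_betw z {0..<card M} M" using ex_bij_betw_nat_finite[OF M(2)] by blast
  then have z: "bij_betw z {..<m} M" by (simp add: m_def atLeast0LessThan)
  have injz: "inj_on z {..<m}" and imz: "z ` {..<m} = M" using z by (auto simp: bij_betw_def)
  have zZ: "z t \<in> Z 1 1" if "t < m" for t using that imz M(1) by auto
  have zsum: "(\<Sum>y\<in>M. vscale (r y) y) = (\<Sum>t<m. vscale (r (z t)) (z t))" for r
    unfolding imz[symmetric] by (simp add: sum.reindex[OF injz])
  have indep: "c t = 0" if s: "(\<Sum>t<m. vscale (c t) (z t)) \<in> koszul_boundaries 1" and t: "t < m" for c t
  proof -
    let ?r = "c \<circ> the_inv_into {..<m} z"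
    have e: "(\<Sum>y\<in>M. vscale (?r y) y) = (\<Sum>t<m. vscale (c t) (z t))"
      unfolding zsum by (intro sum.cong) (auto simp: the_inv_into_f_f[OF injz])
    have "(\<Sum>y\<in>M. vscale (?r y) y) \<in> V.span M" by (intro V.span_sum V.span_scale V.span_base)
    then have "(\<Sum>y\<in>M. vscale (?r y) y) \<in> V.span M \<inter> koszul_boundaries 1" using s by (simp only: e Int_iff)
    then have y0: "(\<Sum>y\<in>M. vscale (?r y) y) = 0" by (simp only: M(4) singleton_iff)
    have "z t \<in> M" using imz t by blast
    then have "?r (z t) = 0" by (rule V.independentD[OF M(3,2) order_refl y0])
    then show ?thesis using the_inv_into_f_f[OF injz] t by simp
  qed
  have gen: "\<exists>c. \<exists>g\<in>koszul_boundaries 1. u = (\<Sum>t<m. vscale (c t) (z t)) + g" if u: "u \<in> Z 1 1" for u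
  proof -
    have "u \<in> V.span (M \<union> koszul_boundaries 1)" using Z_in_span[OF M(5)] u by simp
    then obtain a g where a: "u = a + g" "a \<in> V.span M" "g \<in> V.span (koszul_boundaries 1)"
      unfolding V.span_Un by blast
    have g: "g \<in> koszul_boundaries 1" using a(3) V.span_eq_iff[THEN iffD2, OF boundaries_subspace] by blast
    obtain r where "a = (\<Sum>y\<in>M. vscale (r y) y)" using a(2) unfolding V.span_finite[OF M(2)] by blast
    then have "u = (\<Sum>t<m. vscale (r (z t)) (z t)) + g" using a(1) zsum[of r] by simp
    then show ?thesis using g by (intro exI[of _ "\<lambda>t. r (z t)"] bexI[of _ g])
  qed
  let ?W = "{wedge1 (z s) (z t) | s t. s < t \<and> t < m}"
  have WZ: "?W \<subseteq> Z 2 2"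
  proof
    fix y assume "y \<in> ?W"
    then obtain s t where st: "y = wedge1 (z s) (z t)" "s < t" "t < m" by blast
    have k: "koszul_map xs 0 (z r) = 0" if "r < m" for r using zZ[OF that] by (simp add: Z_def)
    have "koszul_map xs 1 y = 0"
      unfolding st(1) koszul_map_wedge1 using k[of s] k[of t] st by (simp add: fun_eq_iff)
    moreover have "y \<in> H (n choose 2) (1 + 1)"
      unfolding st(1) using zZ[of s] zZ[of t] st by (intro wedge1_H) (auto simp: Z_def)
    ultimately show "y \<in> Z 2 2" by (simp add: Z_def numeral_2_eq_2)
  qed
  have spW: "V.span ?W \<subseteq> Z 2 2" using V.span_minimal[OF WZ Z_subspace] .
  have cyc2: "\<exists>\<sigma>\<in>V.span ?W. \<exists>u\<in>Z 2 1. \<exists>g\<in>koszul_boundaries 2. y = \<sigma> + (u + g)" if y: "y \<in> koszul_cycles 2" for y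
  proof -
    have "\<exists>\<sigma> w. \<sigma> \<in> V.span ?W \<and> w \<in> lin 2 \<and> y = \<sigma> + w"
      by (rule koszul_cycles_2[of m z y])
        (fact K, erule zZ, erule (1) indep, erule gen, fact y, intro exI conjI, assumption+)
    then show ?thesis unfolding lin_def by blast
  qed
  \<comment> \<open>In coefficient degree \<open>Suc e \<ge> 2\<close> the summand \<open>u\<close>
    disappears, and the products \<open>\<sigma>\<close>, of coefficient degree 2, survive only for
    \<open>e = 1\<close>.\<close>
  have comp2: "\<exists>\<sigma>\<in>V.span ?W. \<exists>g\<in>koszul_boundaries 2. y = (if e = 1 then \<sigma> else 0) + component (Suc e) g"
    if y: "y \<in> Z 2 (Suc e)" and e: "1 \<le> e" for y e
  proof -
    obtain \<sigma> u g where c: "\<sigma> \<in> V.span ?W" "u \<in> Z 2 1" "g \<in> koszul_boundaries 2" "y = \<sigma> + (u + g)"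
      using cyc2[OF Z_cycles[OF y]] by blast
    have h: "\<sigma> \<in> H (n choose 2) 2" "u \<in> H (n choose 2) 1" "y \<in> H (n choose 2) (Suc e)"
      using c(1) spW c(2) y by (auto simp: Z_def)
    have uf: "u \<in> finfam car {..<n choose 2}" and gf: "g \<in> finfam car {..<n choose 2}"
      using H_finfam[OF h(2)] boundaries_finfam[OF c(3)] by auto
    have "y = component (Suc e) y" using component_eq[OF h(3)] by simp
    also have "\<dots> = component (Suc e) \<sigma> + (component (Suc e) u + component (Suc e) g)"
      unfolding c(4) component_add[OF H_finfam[OF h(1)] self.finfam_add[OF uf gf]] component_add[OF uf gf] ..
    also have "component (Suc e) u = 0" using component_eq[OF h(2)] e by simp
    also have "component (Suc e) \<sigma> = (if e = 1 then \<sigma> else 0)" using component_eq[OF h(1)] by simp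
    finally have "y = (if e = 1 then \<sigma> else 0) + component (Suc e) g" unfolding add_0_left .
    then show ?thesis using c(1,3) by blast
  qed
  obtain S3 where S3: "S3 \<subseteq> Z 2 (Suc 0)" "finite S3" "V.independent S3"
    "V.span S3 \<inter> koszul_boundaries 2 = {0}" "Z 2 (Suc 0) \<subseteq> V.span (S3 \<union> Bd 2 0)"
    "V.dim (Z 2 (Suc 0)) = card S3 + V.dim (Bd 2 0)"
    by (rule homology_basis[of 2 0])
  obtain S4 where S4: "S4 \<subseteq> Z 2 (Suc 1)" "finite S4" "V.independent S4"
    "V.span S4 \<inter> koszul_boundaries 2 = {0}" "Z 2 (Suc 1) \<subseteq> V.span (S4 \<union> Bd 2 1)"
    "V.dim (Z 2 (Suc 1)) = card S4 + V.dim (Bd 2 1)"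
    by (rule homology_basis[of 2 1])
  define S where "S = (\<lambda>e::nat. if e = 1 then S3 else S4)"
  have US: "(\<Union>e\<in>{1,2}. S e) = S3 \<union> S4" by (auto simp: S_def)
  have I: "V.independent (\<Union>e\<in>{1,2}. S e) \<and> V.span (\<Union>e\<in>{1,2}. S e) \<inter> koszul_boundaries 2 = {0} \<and>
    card (\<Union>e\<in>{1,2}. S e) = (\<Sum>e\<in>{1,2}. card (S e))"
  proof (rule V.graded_union_independent[where G = "Z 2"])
    show "S e \<subseteq> Z 2 e \<and> finite (S e) \<and> V.independent (S e) \<and> V.span (S e) \<inter> koszul_boundaries 2 = {0}"
      if "e \<in> {1,2}" for e
      using that S3(1-4) S4(1-4) by (auto simp: S_def numeral_2_eq_2)
    show "V.subspace (Z 2 e)" for e by (rule Z_subspace)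
    show "V.subspace (koszul_boundaries 2)" by (rule boundaries_subspace)
  next
    fix u e assume u: "\<And>e. e \<in> {1,2} \<Longrightarrow> u e \<in> Z 2 e" "sum u {1,2} \<in> koszul_boundaries 2" and e: "e \<in> {1,2::nat}"
    have h: "u 1 \<in> H (n choose 2) 1" "u 2 \<in> H (n choose 2) 2" using u(1) by (auto simp: Z_def)
    have s: "sum u {1,2} = u 1 + u 2" by simp
    have "component e (u 1 + u 2) = component e (u 1) + component e (u 2)"
      by (rule component_add[OF H_finfam[OF h(1)] H_finfam[OF h(2)]])
    also have "\<dots> = u e" using e component_eq[OF h(1)] component_eq[OF h(2)] by auto
    finally show "u e \<in> koszul_boundaries 2" using component_boundaries[OF u(2), of e] s by simp
  qed simp
  have b2: "betti R X 2 = card (S3 \<union> S4)"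
  proof (rule betti_eq_koszul_homology)
    show "S3 \<union> S4 \<subseteq> koszul_cycles 2" using S3(1) S4(1) Z_cycles by blast
    show "finite (S3 \<union> S4)" using S3(2) S4(2) by simp
    show "V.independent (S3 \<union> S4)" using I unfolding US by (elim conjE)
    show "V.span (S3 \<union> S4) \<inter> koszul_boundaries 2 = {0}" using I unfolding US by (elim conjE)
    let ?T = "S3 \<union> S4 \<union> koszul_boundaries 2"
    show "koszul_cycles 2 \<subseteq> V.span ?T"
    proof
      fix y assume "y \<in> koszul_cycles 2"
      from cyc2[OF this] obtain \<sigma> u g where c: "\<sigma> \<in> V.span ?W" "u \<in> Z 2 1" "g \<in> koszul_boundaries 2"
        "y = \<sigma> + (u + g)" by blast
      have "\<sigma> \<in> Z 2 (Suc 1)" using c(1) spW by (auto simp: numeral_2_eq_2)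
      then have "\<sigma> \<in> V.span (S4 \<union> koszul_boundaries 2)" using Z_in_span[OF S4(5)] by blast
      then have 1: "\<sigma> \<in> V.span ?T" using V.span_mono[of "S4 \<union> koszul_boundaries 2" ?T] by blast
      have "u \<in> V.span (S3 \<union> koszul_boundaries 2)" using Z_in_span[OF S3(5)] c(2) by simp
      then have 2: "u \<in> V.span ?T" using V.span_mono[of "S3 \<union> koszul_boundaries 2" ?T] by blast
      have 3: "g \<in> V.span ?T" using c(3) by (intro V.span_base) blast
      show "y \<in> V.span ?T" unfolding c(4) using 1 2 3 by (intro V.span_add)
    qed
  qed
  have b2': "betti R X 2 = card S3 + card S4"
    unfolding b2 using I unfolding US by (simp add: S_def)
  \<comment> \<open>Cycles of coefficient degree 2 are combinations of the products of the
    \<open>z t\<close> modulo \<open>Bd 2 1\<close>, so the pairs of indices bound the number of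
    classes.\<close>
  have "card S4 \<le> m choose 2"
  proof -
    obtain C where C: "C \<subseteq> Bd 2 1" "V.independent C" "Bd 2 1 \<subseteq> V.span C" "card C = V.dim (Bd 2 1)"
      using V.basis_exists[of "Bd 2 1"] by blast
    obtain F where F: "finite F" "Bd 2 1 \<subseteq> V.span F"
      using subspace_finite_span[of "Bd 2 1" "n choose 2" "Suc 1"] Bd_Z[of 2 1] by (auto simp: Z_def)
    have fC: "finite C" using V.independent_finite_of_span[OF F C(1,2)] by blast
    have W': "?W = (\<lambda>(t, s). wedge1 (z s) (z t)) ` (SIGMA t:{..<m}. {..<t})" by auto
    have fW: "finite ?W" unfolding W' by (intro finite_imageI finite_SigmaI) auto
    have cW: "card ?W \<le> m choose 2"
    proof -
      have "card ?W \<le> card (SIGMA t:{..<m}. {..<t})" unfolding W' by (intro card_image_le finite_SigmaI) auto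
      then show ?thesis by (simp add: sum_lessThan_eq_choose_2)
    qed
    have "Z 2 (Suc 1) \<subseteq> V.span (?W \<union> C)"
    proof
      fix y assume "y \<in> Z 2 (Suc 1)"
      from comp2[OF this] obtain \<sigma> g where c: "\<sigma> \<in> V.span ?W" "g \<in> koszul_boundaries 2"
        "y = \<sigma> + component (Suc 1) g" by auto
      have "component (Suc 1) g \<in> V.span C" using component_boundaries_Bd[OF c(2), of 1] C(3) by blast
      then have "component (Suc 1) g \<in> V.span (?W \<union> C)" using V.span_mono[of C "?W \<union> C"] by blast
      moreover have "\<sigma> \<in> V.span (?W \<union> C)" using c(1) V.span_mono[of ?W "?W \<union> C"] by blast
      ultimately show "y \<in> V.span (?W \<union> C)" unfolding c(3) by (intro V.span_add)
    qed
    then have "V.dim (Z 2 (Suc 1)) \<le> card (?W \<union> C)" using fW fC by (intro V.dim_le_card) auto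
    also have "\<dots> \<le> card ?W + card C" by (rule card_Un_le)
    finally show ?thesis using cW C(4) S4(6) by simp
  qed
  moreover have "V.dim (Z 2 (Suc e)) = V.dim (Bd 2 e)" if e: "2 \<le> e" for e
  proof -
    have "Z 2 (Suc e) \<subseteq> Bd 2 e"
    proof
      fix y assume "y \<in> Z 2 (Suc e)"
      from comp2[OF this] e obtain \<sigma> g where g: "g \<in> koszul_boundaries 2"
        "y = (if e = 1 then \<sigma> else 0) + component (Suc e) g" by (metis One_nat_def Suc_1 Suc_leD)
      have "y = component (Suc e) g" using g(2) e by simp
      with g(1) have "g \<in> koszul_boundaries 2" "y = component (Suc e) g" by simp_all
      then show "y \<in> Bd 2 e" using component_boundaries_Bd by blast
    qed
    then show ?thesis using Bd_Z[of 2 e] by (simp add: subset_antisym)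
  qed
  moreover have "V.dim (Z 2 0) = 0"
  proof -
    have "Z 2 0 = {0}" using Z_2_0 Z_zero by blast
    then show ?thesis by (simp only: dim_zero_space)
  qed
  moreover have "koszul_cycles 1 = koszul_boundaries 1" if "betti R X 1 = 0"
  proof -
    have "M = {}" using that b1 M(2) by simp
    then have "koszul_cycles 1 \<subseteq> V.span (koszul_boundaries 1)" using cyc1 by simp
    then show ?thesis
      using V.span_eq_iff[THEN iffD2, OF boundaries_subspace, of 1] boundaries_cycles by blast
  qed
  ultimately show ?thesis
    using that[of "card S3" "card S4"] M(6) S3(6) S4(6) z1 b1 b2' by (simp add: m_def numeral_2_eq_2)
qed

end

section \<open>Growth of the Hilbert function\<close>

text \<open>The flags tell which monomials in three variables are standard; divisors of standard
  monomials are standard. The numbers are Macaulay's bounds from degree 2 to degree 3: for example 5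
  = (3 choose 2) + (2 choose 1) grows to at most (4 choose 3) + (3 choose 2) = 7.\<close>

lemma macaulay_2_3:
  fixes xx xy xz yy yz zz xxx xxy xxz xyy xyz xzz yyy yyz yzz zzz :: bool
  assumes "xxx \<longrightarrow> xx" "xxy \<longrightarrow> xx \<and> xy" "xxz \<longrightarrow> xx \<and> xz" "xyy \<longrightarrow> xy \<and> yy" "xyz \<longrightarrow> xy \<and> xz \<and> yz"
    "xzz \<longrightarrow> xz \<and> zz" "yyy \<longrightarrow> yy" "yyz \<longrightarrow> yy \<and> yz" "yzz \<longrightarrow> yz \<and> zz" "zzz \<longrightarrow> zz"
  defines "p \<equiv> of_bool xx + of_bool xy + of_bool xz + of_bool yy + of_bool yz + (of_bool zz :: nat)"
  defines "q \<equiv> of_bool xxx + of_bool xxy + of_bool xxz + of_bool xyy + of_bool xyz + of_bool xzz +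
    of_bool yyy + of_bool yyz + of_bool yzz + (of_bool zzz :: nat)"
  shows "q \<le> 10 \<and> (p \<le> 5 \<longrightarrow> q \<le> 7) \<and> (p \<le> 4 \<longrightarrow> q \<le> 5) \<and> (p \<le> 3 \<longrightarrow> q \<le> 4) \<and>
    (p \<le> 2 \<longrightarrow> q \<le> 2) \<and> (p \<le> 1 \<longrightarrow> q \<le> 1) \<and> (p = 0 \<longrightarrow> q = 0)"
proof -
  \<comment> \<open>The largest choice of flags in degree 3 that the hypotheses permit. It is a
    function of the six flags in degree 2, so a finite check remains.\<close>
  define q' where "q' = of_bool xx + of_bool (xx \<and> xy) + of_bool (xx \<and> xz) + of_bool (xy \<and> yy) +
    of_bool (xy \<and> xz \<and> yz) + of_bool (xz \<and> zz) + of_bool yy + of_bool (yy \<and> yz) + of_bool (yz \<and> zz) +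
    (of_bool zz :: nat)"
  have "q \<le> q'" unfolding q_def q'_def using assms(1-10) by (intro add_mono) auto
  moreover have "q' \<le> 10 \<and> (p \<le> 5 \<longrightarrow> q' \<le> 7) \<and> (p \<le> 4 \<longrightarrow> q' \<le> 5) \<and> (p \<le> 3 \<longrightarrow> q' \<le> 4) \<and>
      (p \<le> 2 \<longrightarrow> q' \<le> 2) \<and> (p \<le> 1 \<longrightarrow> q' \<le> 1) \<and> (p = 0 \<longrightarrow> q' = 0)"
    unfolding p_def q'_def by (cases xx; cases xy; cases xz; cases yy; cases yz; cases zz; simp)
  ultimately show ?thesis by linarith
qed

text \<open>The bounds from degree 3 to degree 4, for the values that occur below: for example 5 =
  (4 choose 3) + (2 choose 2) grows to at most (5 choose 4) + (3 choose 3) = 6.\<close>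

lemma macaulay_3_4:
  fixes xxx xxy xxz xyy xyz xzz yyy yyz yzz zzz xxxx xxxy xxxz xxyy xxyz xxzz xyyy xyyz xyzz xzzz
    yyyy yyyz yyzz yzzz zzzz :: bool
  assumes "xxxx \<longrightarrow> xxx" "xxxy \<longrightarrow> xxx \<and> xxy" "xxxz \<longrightarrow> xxx \<and> xxz" "xxyy \<longrightarrow> xxy \<and> xyy"
    "xxyz \<longrightarrow> xxy \<and> xxz \<and> xyz" "xxzz \<longrightarrow> xxz \<and> xzz" "xyyy \<longrightarrow> xyy \<and> yyy" "xyyz \<longrightarrow> xyy \<and> xyz \<and> yyz"
    "xyzz \<longrightarrow> xyz \<and> xzz \<and> yzz" "xzzz \<longrightarrow> xzz \<and> zzz" "yyyy \<longrightarrow> yyy" "yyyz \<longrightarrow> yyy \<and> yyz"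
    "yyzz \<longrightarrow> yyz \<and> yzz" "yzzz \<longrightarrow> yzz \<and> zzz" "zzzz \<longrightarrow> zzz"
  defines "p \<equiv> of_bool xxx + of_bool xxy + of_bool xxz + of_bool xyy + of_bool xyz + of_bool xzz +
    of_bool yyy + of_bool yyz + of_bool yzz + (of_bool zzz :: nat)"
  defines "q \<equiv> of_bool xxxx + of_bool xxxy + of_bool xxxz + of_bool xxyy + of_bool xxyz + of_bool xxzz +
    of_bool xyyy + of_bool xyyz + of_bool xyzz + of_bool xzzz + of_bool yyyy + of_bool yyyz +
    of_bool yyzz + of_bool yzzz + (of_bool zzzz :: nat)"
  shows "(p \<le> 5 \<longrightarrow> q \<le> 6) \<and> (p \<le> 4 \<longrightarrow> q \<le> 5) \<and> (p \<le> 3 \<longrightarrow> q \<le> 3) \<and>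
    (p \<le> 2 \<longrightarrow> q \<le> 2) \<and> (p \<le> 1 \<longrightarrow> q \<le> 1) \<and> (p = 0 \<longrightarrow> q = 0)"
proof -
  define q' where "q' = of_bool xxx + of_bool (xxx \<and> xxy) + of_bool (xxx \<and> xxz) + of_bool (xxy \<and> xyy) +
    of_bool (xxy \<and> xxz \<and> xyz) + of_bool (xxz \<and> xzz) + of_bool (xyy \<and> yyy) + of_bool (xyy \<and> xyz \<and> yyz) +
    of_bool (xyz \<and> xzz \<and> yzz) + of_bool (xzz \<and> zzz) + of_bool yyy + of_bool (yyy \<and> yyz) +
    of_bool (yyz \<and> yzz) + of_bool (yzz \<and> zzz) + (of_bool zzz :: nat)"
  have "q \<le> q'" unfolding q_def q'_def using assms(1-15) by (intro add_mono) auto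
  moreover have "(p \<le> 5 \<longrightarrow> q' \<le> 6) \<and> (p \<le> 4 \<longrightarrow> q' \<le> 5) \<and> (p \<le> 3 \<longrightarrow> q' \<le> 3) \<and>
      (p \<le> 2 \<longrightarrow> q' \<le> 2) \<and> (p \<le> 1 \<longrightarrow> q' \<le> 1) \<and> (p = 0 \<longrightarrow> q' = 0)"
    unfolding p_def q'_def
    by (cases xxx; cases xxy; cases xxz; cases xyy; cases xyz; cases xzz; cases yyy; cases yyz;
        cases yzz; cases zzz; simp)
  ultimately show ?thesis by linarith
qed

section \<open>Standard monomials and cycles in top position\<close>

context presented_algebra
begin

text \<open>Monomials that are not combinations of smaller ones of the same degree. The key orders the
  monomials of degree at most \<open>4\<close> lexicographically and is additive.\<close>

definition mon_key :: "nat \<times> nat \<times> nat \<Rightarrow> nat"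
  where "mon_key t = (case t of (a, b, c) \<Rightarrow> 10 * a + b)"

definition std :: "nat \<Rightarrow> nat \<Rightarrow> nat \<Rightarrow> bool"
  where "std a b c \<longleftrightarrow>
    mon (a, b, c) \<notin> span (mon ` {t \<in> mon_deg (a + b + c). mon_key t < mon_key (a, b, c)})"

lemma hilb_eq_std: "d \<le> 4 \<Longrightarrow> hilb d = (\<Sum>(a, b, c)\<in>mon_deg d. of_bool (std a b c))"
proof -
  assume d: "d \<le> 4"
  have inj: "inj_on mon_key (mon_deg d)"
  proof (rule inj_onI)
    fix s t assume st: "s \<in> mon_deg d" "t \<in> mon_deg d" "mon_key s = mon_key t"
    obtain a b c a' b' c' where e: "s = (a, b, c)" "t = (a', b', c')"
      by (cases s, cases t) blast
    have k: "10 * a + b = 10 * a' + b'" "a + b + c = d" "a' + b' + c' = d"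
      using st by (simp_all add: e mon_key_def mon_deg_def)
    \<comment> \<open>Exponents are at most 4, so the factor 10 in the key keeps \<open>a\<close>
      and \<open>b\<close> apart.\<close>
    then have "b \<le> 4" "b' \<le> 4" using d by linarith+
    then have "\<not> a < a'" "\<not> a' < a" using k(1) by linarith+
    then have "a = a'" by simp
    then show "s = t" using k by (simp add: e)
  qed
  have "hilb d = card {t \<in> mon_deg d. mon t \<notin> span (mon ` {t' \<in> mon_deg d. mon_key t' < mon_key t})}"
    unfolding hilb_def gr_span by (rule standard_basis[OF finite_mon_deg inj])
  also have "\<dots> = card {t \<in> mon_deg d. case t of (a, b, c) \<Rightarrow> std a b c}"
    by (rule arg_cong[of _ _ card]) (auto simp: std_def mon_deg_def)
  also have "\<dots> = (\<Sum>t\<in>mon_deg d. of_bool (case t of (a, b, c) \<Rightarrow> std a b c))"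
    by (simp only: card_eq_sum sum.inter_filter[OF finite_mon_deg] of_bool_def)
  also have "\<dots> = (\<Sum>(a, b, c)\<in>mon_deg d. of_bool (std a b c))" by (intro sum.cong) auto
  finally show ?thesis .
qed

text \<open>By additivity of the key, a monomial factor \<open>y\<close> turns a combination of
  smaller monomials into a combination of smaller monomials again.\<close>

lemma std_divisor:
  assumes e: "\<And>a b c. y * mon (a, b, c) = mon (a + p, b + q, c + r)" and s: "std (a + p) (b + q) (c + r)"
  shows "std a b c"
proof (rule ccontr)
  assume "\<not> std a b c"
  then have "mon (a, b, c) \<in> span (mon ` {t \<in> mon_deg (a + b + c). mon_key t < mon_key (a, b, c)})"
    by (simp add: std_def)
  then have "y * mon (a, b, c) \<in> span (mon ` {t \<in> mon_deg (a + p + (b + q) + (c + r)).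
      mon_key t < mon_key (a + p, b + q, c + r)})"
  proof (rule mult_span)
    fix t assume t: "t \<in> {t \<in> mon_deg (a + b + c). mon_key t < mon_key (a, b, c)}"
    obtain i j k where "t = (i, j, k)" by (metis prod.exhaust)
    then show "y * mon t \<in> span (mon ` {t \<in> mon_deg (a + p + (b + q) + (c + r)).
        mon_key t < mon_key (a + p, b + q, c + r)})"
      using t e by (intro span_base) (auto simp: mon_deg_def mon_key_def)
  qed
  then show False using s e by (simp add: std_def)
qed

lemma std_dvd: "std (Suc a) b c \<Longrightarrow> std a b c" "std a (Suc b) c \<Longrightarrow> std a b c" "std a b (Suc c) \<Longrightarrow> std a b c"
  using std_divisor[of "xs 0" 1 0 0 a b c] std_divisor[of "xs 1" 0 1 0 a b c]
    std_divisor[of "xs 2" 0 0 1 a b c] xs_mon by auto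

lemma mon_deg_explicit:
  "mon_deg 2 = {(2,0,0), (1,1,0), (1,0,1), (0,2,0), (0,1,1), (0,0,2)}"
  "mon_deg 3 = {(3,0,0), (2,1,0), (2,0,1), (1,2,0), (1,1,1), (1,0,2), (0,3,0), (0,2,1), (0,1,2), (0,0,3)}"
  "mon_deg 4 = {(4,0,0), (3,1,0), (3,0,1), (2,2,0), (2,1,1), (2,0,2), (1,3,0), (1,2,1), (1,1,2), (1,0,3),
    (0,4,0), (0,3,1), (0,2,2), (0,1,3), (0,0,4)}"
proof -
  have "mon_deg d = (\<Union>a\<in>{..d}. (\<lambda>b. (a, b, d - a - b)) ` {..d - a})" for d
    by (auto simp: mon_deg_def image_iff)
  then show "mon_deg 2 = {(2,0,0), (1,1,0), (1,0,1), (0,2,0), (0,1,1), (0,0,2)}"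
    "mon_deg 3 = {(3,0,0), (2,1,0), (2,0,1), (1,2,0), (1,1,1), (1,0,2), (0,3,0), (0,2,1), (0,1,2), (0,0,3)}"
    "mon_deg 4 = {(4,0,0), (3,1,0), (3,0,1), (2,2,0), (2,1,1), (2,0,2), (1,3,0), (1,2,1), (1,1,2), (1,0,3),
      (0,4,0), (0,3,1), (0,2,2), (0,1,3), (0,0,4)}"
    by (auto simp: numeral_2_eq_2 numeral_3_eq_3 numeral_eq_Suc atMost_Suc)
qed

lemma hilb_2: "hilb 2 = of_bool (std 2 0 0) + of_bool (std 1 1 0) + of_bool (std 1 0 1) +
    of_bool (std 0 2 0) + of_bool (std 0 1 1) + of_bool (std 0 0 2)"
  by (simp add: hilb_eq_std mon_deg_explicit)

lemma hilb_3: "hilb 3 = of_bool (std 3 0 0) + of_bool (std 2 1 0) + of_bool (std 2 0 1) +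
    of_bool (std 1 2 0) + of_bool (std 1 1 1) + of_bool (std 1 0 2) + of_bool (std 0 3 0) +
    of_bool (std 0 2 1) + of_bool (std 0 1 2) + of_bool (std 0 0 3)"
  by (simp add: hilb_eq_std mon_deg_explicit)

lemma hilb_4: "hilb 4 = of_bool (std 4 0 0) + of_bool (std 3 1 0) + of_bool (std 3 0 1) +
    of_bool (std 2 2 0) + of_bool (std 2 1 1) + of_bool (std 2 0 2) + of_bool (std 1 3 0) +
    of_bool (std 1 2 1) + of_bool (std 1 1 2) + of_bool (std 1 0 3) + of_bool (std 0 4 0) +
    of_bool (std 0 3 1) + of_bool (std 0 2 2) + of_bool (std 0 1 3) + of_bool (std 0 0 4)"
  by (simp add: hilb_eq_std mon_deg_explicit)

lemma hilb_2_3: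
  "hilb 3 \<le> 10 \<and> (hilb 2 \<le> 5 \<longrightarrow> hilb 3 \<le> 7) \<and> (hilb 2 \<le> 4 \<longrightarrow> hilb 3 \<le> 5) \<and> (hilb 2 \<le> 3 \<longrightarrow> hilb 3 \<le> 4) \<and>
    (hilb 2 \<le> 2 \<longrightarrow> hilb 3 \<le> 2) \<and> (hilb 2 \<le> 1 \<longrightarrow> hilb 3 \<le> 1) \<and> (hilb 2 = 0 \<longrightarrow> hilb 3 = 0)"
  unfolding hilb_2 hilb_3
  by (rule macaulay_2_3) (auto simp: numeral_eq_Suc dest: std_dvd)

lemma hilb_3_4:
  "(hilb 3 \<le> 5 \<longrightarrow> hilb 4 \<le> 6) \<and> (hilb 3 \<le> 4 \<longrightarrow> hilb 4 \<le> 5) \<and> (hilb 3 \<le> 3 \<longrightarrow> hilb 4 \<le> 3) \<and>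
    (hilb 3 \<le> 2 \<longrightarrow> hilb 4 \<le> 2) \<and> (hilb 3 \<le> 1 \<longrightarrow> hilb 4 \<le> 1) \<and> (hilb 3 = 0 \<longrightarrow> hilb 4 = 0)"
  unfolding hilb_3 hilb_4
  by (rule macaulay_3_4) (auto simp: numeral_eq_Suc dest: std_dvd)

lemma hilb_0: "hilb 0 = 1"
proof -
  have "gr R 0 = span {1}" unfolding gr_0 span_singleton ..
  moreover have "independent {1}" by simp
  ultimately show ?thesis unfolding hilb_def using dim_span_eq_card_independent[of "{1}"] by simp
qed

lemma hilb_1: "hilb 1 = n"
  unfolding hilb_def span_X[symmetric] dim_span_eq_card_independent[OF independent_X]
  using bij_betw_same_card[OF x_bij] by simp

lemma Z_3_0: "n = 3 \<Longrightarrow> V.dim (Z 3 0) = 0"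
proof -
  assume n: "n = 3"
  have ch: "n choose 3 = 1" using n by (simp add: choose_3_values)
  have "f = 0" if "f \<in> Z 3 0" for f
  proof -
    have f: "\<forall>b\<ge>1. f b = 0" "f 0 \<in> gr R 0" "koszul_map xs 2 f = 0"
      using that by (auto simp: Z_def H_def ch)
    obtain c where c: "f 0 = smul R c 1" using f(2) gr_0 by auto
    have "koszul_map xs 2 f 2 = 0" using f(3) by simp
    then have "smul R c (xs 0) + smul R 0 (xs 1) + smul R 0 (xs 2) = 0"
      using c by (simp add: koszul_map_2 smul_comm)
    then have "f 0 = 0" using xs_independent_3(1)[of c 0 0] n c by simp
    then show ?thesis using f(1) by (auto simp: fun_eq_iff) (metis One_nat_def Suc_leI neq0_conv)
  qed
  then have "Z 3 0 = {0}" using Z_zero by blast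
  then show ?thesis by (simp only: dim_zero_space)
qed

text \<open>A socle element \<open>s\<close> of degree 1 gives the cycles \<open>s e\<^sub>0\<^sub>1\<close>, \<open>s e\<^sub>0\<^sub>2\<close>, \<open>s e\<^sub>1\<^sub>2\<close>.\<close>

lemma three_socle_le: "n = 3 \<Longrightarrow> 3 * V.dim (Z 3 1) \<le> V.dim (Z 2 1)"
proof -
  assume n: "n = 3"
  have ch: "n choose 3 = 1" "n choose 2 = 3" using n by (simp_all add: choose_3_values choose_2_values)
  define W where "W = {s \<in> gr R 1. xs 0 * s = 0 \<and> xs 1 * s = 0 \<and> xs 2 * s = 0}"
  have W: "subspace W"
    unfolding W_def by (rule subspaceI)
      (auto simp: gr_zero distrib_left smul_comm intro: subspace_add[OF subspace_gr] subspace_scale[OF subspace_gr])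
  have W1: "W \<subseteq> gr R 1" by (auto simp: W_def)
  have "Z 3 1 = {f. (\<forall>b\<ge>1. f b = 0) \<and> (\<forall>b. f b \<in> W)}"
  proof (intro equalityI subsetI)
    fix f assume f: "f \<in> Z 3 1"
    then have k: "koszul_map xs 2 f = 0" and f1: "\<forall>b\<ge>1. f b = 0" "\<forall>b. f b \<in> gr R 1"
      by (auto simp: Z_def H_def ch)
    have "koszul_map xs 2 f 0 = 0" "koszul_map xs 2 f 1 = 0" "koszul_map xs 2 f 2 = 0" using k by simp_all
    then have "f 0 \<in> W" using f1 by (simp add: koszul_map_2 W_def)
    moreover have "f b = 0" if "b \<noteq> 0" for b using f1(1) that by simp
    ultimately have "f b \<in> W" for b using subspace_0[OF W] by (cases "b = 0") auto
    then show "f \<in> {f. (\<forall>b\<ge>1. f b = 0) \<and> (\<forall>b. f b \<in> W)}" using f1 by blast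
  next
    fix f :: "nat \<Rightarrow> 'r" assume "f \<in> {f. (\<forall>b\<ge>1. f b = 0) \<and> (\<forall>b. f b \<in> W)}"
    then show "f \<in> Z 3 1" by (auto simp: Z_def H_def ch W_def koszul_map_2 fun_eq_iff)
  qed
  then have d: "V.dim (Z 3 1) = dim W" using dim_product[OF W W1, of 1] by simp
  have "{f. (\<forall>b\<ge>3. f b = 0) \<and> (\<forall>b. f b \<in> W)} \<subseteq> Z 2 1"
    by (auto simp: Z_def H_def ch W_def koszul_map_simps fun_eq_iff)
  moreover obtain F where "finite F" "Z 2 1 \<subseteq> V.span F"
    using subspace_finite_span[of "Z 2 1" "n choose 2" 1] by (auto simp: Z_def)
  ultimately have "V.dim {f. (\<forall>b\<ge>3. f b = 0) \<and> (\<forall>b. f b \<in> W)} \<le> V.dim (Z 2 1)"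
    using V.dim_mono_finite by blast
  then show ?thesis using dim_product[OF W W1, of 3] d by simp
qed

text \<open>If the first Koszul homology vanishes, so does that of \<open>x\<^sub>0, x\<^sub>1\<close> and of \<open>x\<^sub>0\<close>.\<close>

lemma socle_zero:
  assumes n: "n = 3" and H1: "koszul_cycles 1 = koszul_boundaries 1"
  shows "V.dim (Z 3 e) = 0"
proof -
  have ch: "n choose 3 = 1" and n2: "2 \<le> n" using n by (simp_all add: choose_3_values)
  have bnd: "(\<lambda>b. if b = 0 then a else if b = 1 then b' else 0) \<in> koszul_boundaries 1"
    if "a \<in> gr R e" "b' \<in> gr R e" "xs 0 * a + xs 1 * b' = 0" for a b' e
  proof -
    let ?f = "\<lambda>b::nat. if b = 0 then a else if b = 1 then b' else 0"
    have "?f \<in> Z 1 e" using that n2 gr_zero by (auto simp: Z_def H_def koszul_map_0 fun_eq_iff)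
    then show ?thesis using Z_cycles H1 by blast
  qed
  have A0: "a = 0 \<and> b' = 0" if h: "a \<in> gr R 0" "b' \<in> gr R 0" "xs 0 * a + xs 1 * b' = 0" for a b'
  proof -
    let ?f = "\<lambda>b::nat. if b = 0 then a else if b = 1 then b' else (0::'r)"
    have f: "?f \<in> H n 0" using h n2 gr_zero by (auto simp: H_def)
    have "?f = component 0 ?f" using component_eq[OF f] by simp
    also have "\<dots> = 0" using bnd[OF h] component_koszul_map unfolding boundaries_iff by auto
    finally have f0: "?f = 0" .
    show ?thesis using fun_cong[OF f0, of 0] fun_cong[OF f0, of 1] by simp
  qed
  \<comment> \<open>Relations between \<open>xs 0\<close> and \<open>xs 1\<close> are multiples of
    the Koszul relation. Such a relation is the boundary of some \<open>q\<close>, and the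
    coordinate at index 2 makes \<open>q 1\<close> and \<open>q 2\<close> a relation of one degree
    less. A solution \<open>p\<close> of that relation is absorbed by passing to
    \<open>q 0 - xs 2 * p\<close>.\<close>
  have A: "\<exists>p\<in>gr R e. a = - (xs 1 * p) \<and> b' = xs 0 * p"
    if "a \<in> gr R (Suc e)" "b' \<in> gr R (Suc e)" "xs 0 * a + xs 1 * b' = 0" for e a b'
    using that
  proof (induction e arbitrary: a b' rule: less_induct)
    case (less e)
    let ?f = "\<lambda>b::nat. if b = 0 then a else if b = 1 then b' else (0::'r)"
    have f: "?f \<in> H n (Suc e)" using less.prems n2 gr_zero by (auto simp: H_def)
    have "?f \<in> Bd 1 e" by (rule homogeneous_boundary[OF bnd[OF less.prems] f])
    then obtain q where q: "q \<in> H (n choose 2) e" "?f = koszul_map xs 1 q"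
      unfolding Bd_def by (auto simp: numeral_2_eq_2)
    have qe: "q b \<in> gr R e" for b using q(1) by (simp add: H_def)
    have k: "a = - (xs 1 * q 0) - xs 2 * q 1" "b' = xs 0 * q 0 - xs 2 * q 2" "xs 0 * q 1 + xs 1 * q 2 = 0"
      using fun_cong[OF q(2), of 0] fun_cong[OF q(2), of 1] fun_cong[OF q(2), of 2]
      unfolding koszul_map_1 by simp_all
    show ?case
    proof (cases e)
      case 0
      then have "q 1 = 0 \<and> q 2 = 0" using A0[of "q 1" "q 2"] qe k(3) by simp
      then show ?thesis using k(1,2) qe by (intro bexI[of _ "q 0"]) auto
    next
      case (Suc d)
      then obtain p where p: "p \<in> gr R d" "q 1 = - (xs 1 * p)" "q 2 = xs 0 * p"
        using less.IH[of d "q 1" "q 2"] qe k(3) by auto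
      have "xs 2 * p \<in> gr R e" using gr_mult[OF xs_gr p(1), of 2] Suc by simp
      then have "q 0 - xs 2 * p \<in> gr R e" using qe subspace_diff[OF subspace_gr] by blast
      moreover have "a = - (xs 1 * (q 0 - xs 2 * p))" "b' = xs 0 * (q 0 - xs 2 * p)"
        using k(1,2) p(2,3) by (simp_all add: algebra_simps)
      ultimately show ?thesis by blast
    qed
  qed
  \<comment> \<open>Applied to the relation with coefficients \<open>r\<close> and 0, fact
    \<open>A\<close> gives \<open>r = - (xs 1 * p)\<close> with \<open>xs 0 * p = 0\<close>, where
    \<open>p\<close> has smaller degree.\<close>
  have B: "r = 0" if "r \<in> gr R e" "xs 0 * r = 0" for e r
    using that
  proof (induction e arbitrary: r)
    case 0
    then show ?case using A0[of r 0] gr_zero by simp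
  next
    case (Suc e)
    then obtain p where "p \<in> gr R e" "r = - (xs 1 * p)" "0 = xs 0 * p"
      using A[of r e 0] gr_zero by auto
    then show ?case using Suc.IH[of p] by simp
  qed
  have "f = 0" if "f \<in> Z 3 e" for f
  proof -
    have k: "koszul_map xs 2 f = 0" and f1: "\<forall>b\<ge>1. f b = 0" "\<forall>b. f b \<in> gr R e"
      using that by (auto simp: Z_def H_def ch)
    have "koszul_map xs 2 f 2 = 0" using k by simp
    then have "f 0 = 0" using B[of "f 0" e] f1 by (simp add: koszul_map_2)
    moreover have "f b = 0" if "b \<noteq> 0" for b using f1(1) that by simp
    ultimately have "f b = 0" for b by (cases "b = 0") auto
    then show ?thesis by (simp add: fun_eq_iff)
  qed
  then have "Z 3 e = {0}" using Z_zero by blast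
  then show ?thesis by (simp only: dim_zero_space)
qed

end

section \<open>The bounds\<close>

text \<open>From \<open>N0\<close> on, first differences fall by at least 1 at every step and become
  negative; then the sequence itself falls by at least 1 at every step.\<close>

lemma second_difference_bound:
  fixes f :: "nat \<Rightarrow> int"
  assumes "\<And>N. N0 \<le> N \<Longrightarrow> f (N + 2) - 2 * f (N + 1) + f N \<le> - 1"
  shows "\<exists>N. f N < 0"
proof -
  define g where "g = (\<lambda>k. f (N0 + k + 1) - f (N0 + k))"
  have g: "g k \<le> g 0 - int k" for k
  proof (induction k)
    case (Suc k)
    have "g (Suc k) \<le> g k - 1" using assms[of "N0 + k"] by (simp add: g_def)
    then show ?case using Suc by simp
  qed simp
  define K where "K = nat \<bar>g 0\<bar> + 1"
  have neg: "g (K + k) \<le> - 1" for k using g[of "K + k"] by (simp add: K_def)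
  have "f (N0 + K + k) \<le> f (N0 + K) - int k" for k
  proof (induction k)
    case (Suc k)
    then show ?case using neg[of k] by (simp add: g_def add.assoc)
  qed simp
  from this[of "nat \<bar>f (N0 + K)\<bar> + 1"] have "f (N0 + K + (nat \<bar>f (N0 + K)\<bar> + 1)) < 0" by simp
  then show ?thesis ..
qed

lemma choose_2_upto_6:
  "0 choose 2 = (0::nat)" "Suc 0 choose 2 = 0" "2 choose 2 = (1::nat)" "3 choose 2 = (3::nat)" "4 choose 2 = (6::nat)"
  "5 choose 2 = (10::nat)" "6 choose 2 = (15::nat)"
  by (simp_all add: numeral_eq_Suc)

lemma choose_3_upto_6:
  "0 choose 3 = (0::nat)" "Suc 0 choose 3 = 0" "2 choose 3 = (0::nat)" "3 choose 3 = (1::nat)" "4 choose 3 = (4::nat)"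
  "5 choose 3 = (10::nat)" "6 choose 3 = (20::nat)"
  by (simp_all add: numeral_eq_Suc)

text \<open>Two variables: \<open>h2\<close>, \<open>h3\<close>, \<open>h4\<close> are values of the
  Hilbert function, 3 is the dimension of the quadratic part of \<open>Q\<close>, and
  \<open>a\<close> and \<open>b\<close> are the parts of the second Betti number in internal degrees
  3 and 4. Since \<open>a + b = h4 - h3 - h2 + 2\<close>, the growth bounds settle every
  \<open>m > 0\<close>.\<close>

lemma second_betti_bound_2:
  fixes m h2 h3 h4 a b :: int
  assumes "0 \<le> m" "0 \<le> h2" "0 \<le> h3" "h2 = 3 - m" "a = h3 - 2 * h2 + 2" "b = h4 - 2 * h3 + h2"
    and "m = 0 \<longrightarrow> b \<le> 0"
    and "h2 \<le> 3 \<longrightarrow> h3 \<le> 4" "h2 \<le> 2 \<longrightarrow> h3 \<le> 2" "h2 \<le> 1 \<longrightarrow> h3 \<le> 1" "h2 \<le> 0 \<longrightarrow> h3 \<le> 0"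
    and "h3 \<le> 2 \<longrightarrow> h4 \<le> 2" "h3 \<le> 1 \<longrightarrow> h4 \<le> 1" "h3 \<le> 0 \<longrightarrow> h4 \<le> 0"
  shows "(m = 0 \<longrightarrow> a + b \<le> 0) \<and> (m = 1 \<longrightarrow> a + b \<le> 0) \<and> (m = 2 \<longrightarrow> a + b \<le> 1) \<and> (m = 3 \<longrightarrow> a + b \<le> 3)"
  using assms by (smt (verit))

text \<open>Three variables, with \<open>s\<close> the dimension of the socle in degree 1. If
  \<open>m \<le> 3\<close> and \<open>a \<le> 0\<close>, the product bound on \<open>b\<close>
  suffices. Otherwise \<open>a + b = h4 - 2 * h3 + 5 + s\<close> is estimated by the growth of the
  Hilbert function and \<open>3 * s \<le> a + 1\<close>.\<close>

lemma second_betti_bound_3: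
  fixes m h2 h3 h4 a b s :: int
  assumes "0 \<le> m" "0 \<le> h2" "0 \<le> h3" "h2 = 6 - m" "a = h3 - 3 * h2 + 8" "b = h4 - 3 * h3 + 3 * h2 - 3 + s"
    and "3 * s \<le> a + 1" "m = 0 \<longrightarrow> b \<le> 0" "m = 1 \<longrightarrow> b \<le> 0" "m = 2 \<longrightarrow> b \<le> 1" "m = 3 \<longrightarrow> b \<le> 3"
    and "h3 \<le> 10" "h2 \<le> 5 \<longrightarrow> h3 \<le> 7" "h2 \<le> 4 \<longrightarrow> h3 \<le> 5" "h2 \<le> 3 \<longrightarrow> h3 \<le> 4" "h2 \<le> 2 \<longrightarrow> h3 \<le> 2"
      "h2 \<le> 1 \<longrightarrow> h3 \<le> 1" "h2 \<le> 0 \<longrightarrow> h3 \<le> 0"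
    and "h3 \<le> 5 \<longrightarrow> h4 \<le> 6" "h3 \<le> 4 \<longrightarrow> h4 \<le> 5" "h3 \<le> 3 \<longrightarrow> h4 \<le> 3" "h3 \<le> 2 \<longrightarrow> h4 \<le> 2"
      "h3 \<le> 1 \<longrightarrow> h4 \<le> 1" "h3 \<le> 0 \<longrightarrow> h4 \<le> 0"
  shows "(m = 0 \<longrightarrow> a + b \<le> 0) \<and> (m = 1 \<longrightarrow> a + b \<le> 0) \<and> (m = 2 \<longrightarrow> a + b \<le> 1) \<and> (m = 3 \<longrightarrow> a + b \<le> 3) \<and>
    (m = 4 \<longrightarrow> a + b \<le> 6) \<and> (m = 5 \<longrightarrow> a + b \<le> 10) \<and> (m = 6 \<longrightarrow> a + b \<le> 15)"
  using assms by (smt (verit))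

lemma le_6_cases: "m \<le> 6 \<Longrightarrow> m = 0 \<or> m = 1 \<or> m = 2 \<or> m = 3 \<or> m = 4 \<or> m = 5 \<or> m = (6::nat)"
  by linarith

section \<open>Assembling the inequalities\<close>

context presented_algebra
begin

theorem betti_le_choose:
  assumes K: "koszul R"
  shows "betti R X i \<le> betti R X 1 choose i"
proof -
  define m where "m = betti R X 1"
  obtain b3 b4 where
    kz: "V.dim (Z 1 1) = betti R X 1 + V.dim (Bd 1 0)" "\<forall>e\<ge>1. V.dim (Z 1 (Suc e)) = V.dim (Bd 1 e)"
    and b2: "betti R X 2 = b3 + b4" "b4 \<le> betti R X 1 choose 2"
    and kz2: "V.dim (Z 2 0) = 0" "V.dim (Z 2 1) = b3 + V.dim (Bd 2 0)" "V.dim (Z 2 2) = b4 + V.dim (Bd 2 1)"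
      "\<forall>e\<ge>2. V.dim (Z 2 (Suc e)) = V.dim (Bd 2 e)"
    and m0: "betti R X 1 = 0 \<longrightarrow> koszul_cycles 1 = koszul_boundaries 1"
    by (rule koszul_betti[OF K])
  note kz = kz[folded m_def] and b2 = b2[folded m_def] and m0 = m0[folded m_def]
  define h z1 z2 z3 r1 r2 where "h = (\<lambda>e. int (hilb e))" and "z1 = (\<lambda>e. int (V.dim (Z 1 e)))"
    and "z2 = (\<lambda>e. int (V.dim (Z 2 e)))" and "z3 = (\<lambda>e. int (V.dim (Z 3 e)))"
    and "r1 = (\<lambda>e. int (V.dim (Bd 1 e)))" and "r2 = (\<lambda>e. int (V.dim (Bd 2 e)))"
  note int_defs = h_def z1_def z2_def z3_def r1_def r2_def
  have E0: "int n * h e = z1 e + h (Suc e)" for e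
    using arg_cong[OF rank_nullity[of 0 e], of int] by (simp add: int_defs hilb_Suc)
  have E1: "int (n choose 2) * h e = z2 e + r1 e" for e
    using arg_cong[OF rank_nullity[of 1 e], of int] by (simp add: int_defs numeral_2_eq_2)
  have E2: "int (n choose 3) * h e = z3 e + r2 e" for e
    using arg_cong[OF rank_nullity[of 2 e], of int] by (simp add: int_defs numeral_2_eq_2 numeral_3_eq_3)
  have h01: "h 0 = 1" "h 1 = int n" using hilb_0 hilb_1 by (simp_all add: h_def)
  have F: "z1 1 = int m + r1 0" "z2 0 = 0" "z2 1 = int b3 + r2 0" "z2 2 = int b4 + r2 1"
    using kz(1) kz2(1-3) by (simp_all add: int_defs)
  have F1: "z1 (Suc e) = r1 e" if "1 \<le> e" for e using kz(2) that by (simp add: int_defs)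
  have F2: "z2 (Suc e) = r2 e" if "2 \<le> e" for e using kz2(4) that by (simp add: int_defs)
  \<comment> \<open>\<open>\<beta> e\<close> is the dimension of the second homology in coefficient
    degree \<open>Suc e\<close>, that is, in internal degree \<open>e + 3\<close>.\<close>
  define \<beta> where "\<beta> = (\<lambda>e::nat. if e = 0 then int b3 else if e = 1 then int b4 else 0)"
  have G: "z2 (Suc e) = \<beta> e + r2 e" for e
    using F(3,4) F2[of e] by (auto simp: \<beta>_def numeral_2_eq_2 not_less_eq_eq)
  have h2: "h 2 = int n * int n - int (n choose 2) - int m"
    using E0[of 1] E1[of 0] F(1,2) h01 by (simp add: numeral_2_eq_2)
  \<comment> \<open>The Euler characteristic of the Koszul complex over \<open>R\<close> in internal
    degree \<open>e + 3\<close>, where positions 0 and 1 have no homology and position 3 contributes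
    its cycles.\<close>
  have rec: "h (Suc (Suc (Suc e))) = int n * h (Suc (Suc e)) - int (n choose 2) * h (Suc e) +
      int (n choose 3) * h e + \<beta> e - z3 e" for e
    using E0[of "Suc (Suc e)"] E1[of "Suc e"] E2[of e] F1[of "Suc e"] G[of e] by simp
  have h3: "h 3 = int n * h 2 - int (n choose 2) * h 1 + int (n choose 3) * h 0 + int b3 - z3 0"
    using rec[of 0] by (simp add: \<beta>_def numeral_2_eq_2 numeral_3_eq_3)
  have h4: "h 4 = int n * h 3 - int (n choose 2) * h 2 + int (n choose 3) * h 1 + int b4 - z3 1"
    using rec[of 1] by (simp add: \<beta>_def numeral_eq_Suc)
  have pos: "0 \<le> h e" "0 \<le> z3 e" for e by (simp_all add: int_defs)
  have M3: "h 3 \<le> 10" "h 2 \<le> 5 \<longrightarrow> h 3 \<le> 7" "h 2 \<le> 4 \<longrightarrow> h 3 \<le> 5" "h 2 \<le> 3 \<longrightarrow> h 3 \<le> 4"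
    "h 2 \<le> 2 \<longrightarrow> h 3 \<le> 2" "h 2 \<le> 1 \<longrightarrow> h 3 \<le> 1" "h 2 \<le> 0 \<longrightarrow> h 3 \<le> 0"
    using hilb_2_3 by (auto simp: h_def)
  have M4: "h 3 \<le> 5 \<longrightarrow> h 4 \<le> 6" "h 3 \<le> 4 \<longrightarrow> h 4 \<le> 5" "h 3 \<le> 3 \<longrightarrow> h 4 \<le> 3" "h 3 \<le> 2 \<longrightarrow> h 4 \<le> 2"
    "h 3 \<le> 1 \<longrightarrow> h 4 \<le> 1" "h 3 \<le> 0 \<longrightarrow> h 4 \<le> 0"
    using hilb_3_4 by (auto simp: h_def)
  have b4: "m = 0 \<longrightarrow> b4 \<le> 0" "m = 1 \<longrightarrow> b4 \<le> 0" "m = 2 \<longrightarrow> b4 \<le> 1" "m = 3 \<longrightarrow> b4 \<le> 3"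
    using b2(2) by (auto simp: choose_2_upto_6)
  have case2: "betti R X 2 \<le> m choose 2"
  proof -
    consider "n \<le> 1" | "n = 2" | "n = 3" using le_3_cases[OF n_le] by linarith
    then show ?thesis
    proof cases
      case 1
      then show ?thesis using betti_gt[of 2] by simp
    next
      case 2
      have z: "z3 e = 0" for e using E2[of e] pos(2)[of e] 2 by (simp add: int_defs choose_3_values)
      have e: "h 2 = 3 - int m" "int b3 = h 3 - 2 * h 2 + 2" "int b4 = h 4 - 2 * h 3 + h 2"
        using h2 h3 h4 h01 z 2 by (simp_all add: choose_2_values choose_3_values)
      have "(int m = 0 \<longrightarrow> int b3 + int b4 \<le> 0) \<and> (int m = 1 \<longrightarrow> int b3 + int b4 \<le> 0) \<and>
          (int m = 2 \<longrightarrow> int b3 + int b4 \<le> 1) \<and> (int m = 3 \<longrightarrow> int b3 + int b4 \<le> 3)"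
        by (rule second_betti_bound_2[OF _ pos(1) pos(1) e _ M3(4-7) M4(4-6)]) (use b4(1) in simp_all)
      moreover have "m \<le> 3" using e(1) pos(1)[of 2] by simp
      then have "m = 0 \<or> m = 1 \<or> m = 2 \<or> m = 3" by linarith
      ultimately have "b3 + b4 \<le> m choose 2" by (auto simp: choose_2_upto_6)
      then show ?thesis using b2(1) by simp
    next
      case 3
      have z0: "z3 0 = 0" using Z_3_0[OF 3] by (simp add: z3_def)
      have e: "h 2 = 6 - int m" "int b3 = h 3 - 3 * h 2 + 8" "int b4 = h 4 - 3 * h 3 + 3 * h 2 - 3 + z3 1"
        using h2 h3 h4 h01 z0 3 by (simp_all add: choose_2_values choose_3_values)
      have "3 * z3 1 \<le> z2 1" using three_socle_le[OF 3] by (simp add: int_defs)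
      \<comment> \<open>In coefficient degree 0 the last differential is injective on a space of
        dimension 1. This is the origin of the 1 in the socle estimate.\<close>
      moreover have "r2 0 = 1" using E2[of 0] z0 h01 3 by (simp add: choose_3_values)
      ultimately have s: "3 * z3 1 \<le> int b3 + 1" using F(3) by simp
      have L: "(int m = 0 \<longrightarrow> int b3 + int b4 \<le> 0) \<and> (int m = 1 \<longrightarrow> int b3 + int b4 \<le> 0) \<and>
          (int m = 2 \<longrightarrow> int b3 + int b4 \<le> 1) \<and> (int m = 3 \<longrightarrow> int b3 + int b4 \<le> 3) \<and>
          (int m = 4 \<longrightarrow> int b3 + int b4 \<le> 6) \<and> (int m = 5 \<longrightarrow> int b3 + int b4 \<le> 10) \<and>
          (int m = 6 \<longrightarrow> int b3 + int b4 \<le> 15)"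
        by (rule second_betti_bound_3[OF _ pos(1) pos(1) e s _ _ _ _ M3 M4]) (use b4 in simp_all)
      have "m \<le> 6" using e(1) pos(1)[of 2] by simp
      from le_6_cases[OF this] have "b3 + b4 \<le> m choose 2"
        by (elim disjE) (use L in \<open>simp_all add: choose_2_upto_6\<close>)
      then show ?thesis using b2(1) by simp
    qed
  qed
  have case3: "betti R X 3 \<le> m choose 3"
  proof (cases "n = 3")
    case False
    then show ?thesis using betti_gt[of 3] n_le by simp
  next
    case n: True
    have e: "h 2 = 6 - int m" using h2 n by (simp add: choose_2_values)
    have m6: "m \<le> 6" using e pos(1)[of 2] by simp
    show ?thesis
    proof (cases "m = 0")
      case True
      then have "V.dim (Z 3 e) = 0" for e using socle_zero[OF n] m0 by simp
      then show ?thesis by (intro betti_3_le) simp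
    next
      case False
      \<comment> \<open>For three variables \<open>rec\<close> computes the third difference of
        \<open>h\<close>; it is summed starting from the second difference \<open>1 - int m\<close>
        at 0.\<close>
      have A: "h (N + 2) - 2 * h (N + 1) + h N = 1 - int m + (\<Sum>e<N. \<beta> e - z3 e)" for N
      proof (induction N)
        case 0
        then show ?case using e h01 n by (simp add: numeral_2_eq_2)
      next
        case (Suc N)
        then show ?case using rec[of N] n by (simp add: choose_2_values choose_3_values)
      qed
      have \<beta>sum: "(\<Sum>e<N. \<beta> e) = int b3 + int b4" if "2 \<le> N" for N
      proof -
        have "(\<Sum>e<N. \<beta> e) = (\<Sum>e<2. \<beta> e)"
          using that by (intro sum.mono_neutral_right) (auto simp: \<beta>_def)
        then show ?thesis by (simp add: \<beta>_def numeral_2_eq_2)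
      qed
      \<comment> \<open>All of \<open>\<beta>\<close> has been summed from 2 on, so a violation at
        \<open>N\<close> keeps the second difference at most -1 from \<open>max N 2\<close>
        on.\<close>
      have S: "(\<Sum>e<N. z3 e) \<le> 1 - int m + (int b3 + int b4)" for N
      proof (rule ccontr)
        assume c: "\<not> (\<Sum>e<N. z3 e) \<le> 1 - int m + (int b3 + int b4)"
        have "h (N' + 2) - 2 * h (N' + 1) + h N' \<le> - 1" if "max N 2 \<le> N'" for N'
        proof -
          have "(\<Sum>e<N. z3 e) \<le> (\<Sum>e<N'. z3 e)" using that pos(2) by (intro sum_mono2) auto
          then show ?thesis using A[of N'] c \<beta>sum[of N'] that by (simp add: sum_subtractf)
        qed
        then have "\<exists>N. h N < 0" by (rule second_difference_bound)
        then show False using pos(1) by (meson not_less)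
      qed
      \<comment> \<open>By the bound on the second Betti number the left side is at most 1 - m + (m
        choose 2), which for m > 0 equals (m - 1 choose 2) and by Pascal's rule is at most (m choose
        3). For m = 0 it would be 1, whence the separate case.\<close>
      have "1 - int m + (int b3 + int b4) \<le> int (m choose 3)"
        using le_6_cases[OF m6] False case2 b2(1) by (auto simp: choose_2_upto_6 choose_3_upto_6)
      then have "int (\<Sum>e<N. V.dim (Z 3 e)) \<le> int (m choose 3)" for N
        using S[of N] by (simp add: z3_def)
      then show ?thesis by (intro betti_3_le) (simp only: of_nat_le_iff)
    qed
  qed
  consider "i = 0" | "i = 1" | "i = 2" | "i = 3" | "3 < i" by linarith
  then show ?thesis
  proof cases
    case 1 then show ?thesis using betti_0 by simp
  next
    case 5 then show ?thesis using betti_gt[of i] n_le by simp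
  qed (use case2 case3 in \<open>simp_all add: m_def\<close>)
qed

end

theorem mainTheorem5:
  fixes R :: "('k::field, 'r::comm_ring_1) galgebra" and X :: "'r set" and i :: nat
  assumes "standard_graded_algebra R"
    and "\<not> module.dependent (smul R) X" and "module.span (smul R) X = gr R 1"
    and "koszul R"
    and "vector_space.dim (smul R) (gr R 1) \<le> 3"
  shows "betti R X i \<le> (betti R X 1) choose i"
proof -
  interpret R: standard_graded_algebra R by fact
  obtain B where B: "finite B" "gr R 1 = R.span B" using R.gr_1_finite by blast
  have "X \<subseteq> R.span B" using assms(3) B(2) R.span_superset[of X] by blast
  then have fX: "finite X" using R.independent_span_bound[OF B(1) assms(2)] by blast
  have "card X \<le> 3"
    using R.dim_span_eq_card_independent[OF assms(2)] assms(3,5) by simp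
  moreover obtain x where "bij_betw x {0..<card X} X" using ex_bij_betw_nat_finite[OF fX] by blast
  ultimately interpret presented_algebra R X "card X" x
    using assms(2,3) by unfold_locales (simp_all add: atLeast0LessThan)
  show ?thesis using assms(4) by (rule betti_le_choose)
qed

end
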